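(* Let $E$ be an ordered basis of $\mathbf R^d$. Then the following is true: (1) the operator $Z_E$ is a homeomorphism from $\mathscr S(\mathbf R^d)$ to $C^\infty_{Z,E}(\mathbf R^{2d})$; (2) the operator $Z_E$ from $\mathscr S(\mathbf R^d)$ to $C^\infty(\mathbf R^{2d})$ is uniquely extendable to a homeomorphism from $\mathscr S'(\mathbf R^d)$ to $\mathscr S'_{Z,E}(\mathbf R^{2d})$.
   Context: For an ordered basis $E=\{e_1,\dots,e_d\}$ of $\mathbf R^d$, the dual basis $E'=\{e_1',\dots,e_d'\}$ is defined by $\langle e_j,e_k'\rangle=2\pi\delta_{jk}$. Lattices: $\Lambda_E=\{n_1e_1+\cdots+n_de_d : n\in\mathbf Z^d\}$ and $\Lambda_E'=\Lambda_{E'}$. Zak transform: for $f\in\mathscr S(\mathbf R^d)$, $(Z_Ef)(x,\xi)=\sum_{j\in\Lambda_E}f(x-j)e^{i\langle j,\xi\rangle}$, $x,\xi\in\mathbf R^d$. A function or distribution $F$ on $\mathbf R^{2d}$ is called quasi-periodic of order $E$ (with respect to $E$) if $F(x+k,\xi)=e^{i\langle k,\xi\rangle}F(x,\xi)$ and $F(x,\xi+\kappa)=F(x,\xi)$ for all $k\in\Lambda_E$, $\kappa\in\Lambda_E'$. $C^\infty_{Z,E}(\mathbf R^{2d})$ and $\mathscr S'_{Z,E}(\mathbf R^{2d})$ are the sets of quasi-periodic elements of order $E$ in $C^\infty(\mathbf R^{2d})$ and $\mathscr S'(\mathbf R^{2d})$, respectively, with the subspace topologies. *)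

theory Defs
  imports "HOL-Analysis.Analysis"
begin

section \<open>Bases and lattices\<close>

text \<open>An ordered basis of \<open>R\<^sup>d\<close> is a family of vectors indexed by the type \<open>'d\<close>, with
  \<open>d = CARD('d)\<close>.\<close>

definition ordered_basis :: "('d::finite \<Rightarrow> real^'d) \<Rightarrow> bool" where
  "ordered_basis e \<longleftrightarrow> inj e \<and> independent (range e) \<and> span (range e) = UNIV"

definition dual_basis :: "('d::finite \<Rightarrow> real^'d) \<Rightarrow> 'd \<Rightarrow> real^'d" where
  "dual_basis e = (THE e'. \<forall>j k. e j \<bullet> e' k = (if j = k then 2 * pi else 0))"

lemma dual_basis_ex1:
  fixes e :: "'d::finite \<Rightarrow> real^'d"
  assumes "ordered_basis e"
  shows "\<exists>!e'. \<forall>j k. e j \<bullet> e' k = (if j = k then 2 * pi else 0)"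
proof (rule ex_ex1I)
  have inj: "inj e" and ind: "independent (range e)"
    using assms by (auto simp: ordered_basis_def)
  have "\<exists>v. \<forall>j. e j \<bullet> v = (if j = k then 2 * pi else 0)" for k
  proof -
    obtain g :: "real^'d \<Rightarrow> real" where g: "linear g"
      and ge: "\<forall>x\<in>range e. g x = (if x = e k then 2 * pi else 0)"
      using linear_independent_extend[OF ind, of "\<lambda>x. if x = e k then 2 * pi else 0"]
      by (elim exE conjE)
    let ?v = "\<Sum>b\<in>Basis. g b *\<^sub>R b"
    have "x \<bullet> ?v = g x" for x
    proof -
      have "g x = g (\<Sum>b\<in>Basis. (x \<bullet> b) *\<^sub>R b)"
        by (simp only: euclidean_representation)
      also have "\<dots> = (\<Sum>b\<in>Basis. (x \<bullet> b) * g b)"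
        by (simp add: linear_sum[OF g] linear_scale[OF g])
      also have "\<dots> = x \<bullet> ?v"
        by (simp only: inner_sum_right inner_scaleR_right mult.commute)
      finally show ?thesis by simp
    qed
    moreover have "g (e j) = (if j = k then 2 * pi else 0)" for j
      using ge inj by (simp add: inj_eq)
    ultimately show ?thesis by (intro exI[of _ ?v]) (simp only: simp_thms)
  qed
  then show "\<exists>e'. \<forall>j k. e j \<bullet> e' k = (if j = k then 2 * pi else 0)"
    by metis
next
  fix u v :: "'d \<Rightarrow> real^'d"
  assume u: "\<forall>j k. e j \<bullet> u k = (if j = k then 2 * pi else 0)"
    and v: "\<forall>j k. e j \<bullet> v k = (if j = k then 2 * pi else 0)"
  have "u k = v k" for k
  proof -
    have "orthogonal (u k - v k) (u k - v k)"
    proof (rule orthogonal_to_span)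
      show "u k - v k \<in> span (range e)"
        using assms by (simp add: ordered_basis_def)
      show "orthogonal (u k - v k) y" if y: "y \<in> range e" for y
      proof -
        obtain j where "y = e j" using y by blast
        then have "y \<bullet> (u k - v k) = 0" by (simp add: inner_diff_right u v)
        then show ?thesis by (simp add: orthogonal_def inner_commute)
      qed
    qed
    then show ?thesis by (simp add: orthogonal_self)
  qed
  then show "u = v" by blast
qed

definition lattice :: "('d::finite \<Rightarrow> real^'d) \<Rightarrow> (real^'d) set" where
  "lattice e = range (\<lambda>n :: 'd \<Rightarrow> int. \<Sum>j\<in>UNIV. of_int (n j) *\<^sub>R e j)"

abbreviation dual_lattice :: "('d::finite \<Rightarrow> real^'d) \<Rightarrow> (real^'d) set" where
  "dual_lattice e \<equiv> lattice (dual_basis e)"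


section \<open>Topologies given by seminorms\<close>

text \<open>The coarsest topology on the carrier \<open>V\<close> containing all open balls of the seminorms in
  \<open>P\<close>; for a vector space \<open>V\<close> and nonempty \<open>P\<close> this is the usual locally convex topology.\<close>

definition seminorm_topology :: "'v::minus set \<Rightarrow> ('v \<Rightarrow> real) set \<Rightarrow> 'v topology" where
  "seminorm_topology V P =
     topology_generated_by {{g \<in> V. p (g - f) < r} | f p r. f \<in> V \<and> p \<in> P \<and> 0 < r}"


section \<open>Smooth functions\<close>

definition partial_deriv ::
    "'a::euclidean_space \<Rightarrow> ('a \<Rightarrow> complex) \<Rightarrow> 'a \<Rightarrow> complex" where
  "partial_deriv b f x = frechet_derivative f (at x) b"

text \<open>Iterated partial derivatives are indexed by lists of standard basis vectors, with
  repetitions; on smooth functions these are the derivatives given by multi-indices.\<close>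

definition partial_derivs ::
    "'a::euclidean_space list \<Rightarrow> ('a \<Rightarrow> complex) \<Rightarrow> 'a \<Rightarrow> complex" where
  "partial_derivs bs f = foldr partial_deriv bs f"

definition smooth_space :: "('a::euclidean_space \<Rightarrow> complex) set" where
  "smooth_space = {f. \<forall>bs\<in>lists Basis. \<forall>x. partial_derivs bs f differentiable (at x)}"

definition smooth_seminorm ::
    "'a::euclidean_space set \<Rightarrow> 'a list \<Rightarrow> ('a \<Rightarrow> complex) \<Rightarrow> real" where
  "smooth_seminorm K bs f = (SUP x\<in>K. cmod (partial_derivs bs f x))"

definition smooth_topology :: "('a::euclidean_space \<Rightarrow> complex) topology" where
  "smooth_topology = seminorm_topology smooth_space
     {smooth_seminorm K bs | K bs. compact K \<and> K \<noteq> {} \<and> bs \<in> lists Basis}"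


section \<open>Schwartz functions\<close>

definition schwartz_space :: "('a::euclidean_space \<Rightarrow> complex) set" where
  "schwartz_space = {f \<in> smooth_space. \<forall>N :: nat. \<forall>bs\<in>lists Basis.
     bdd_above (range (\<lambda>x. (1 + norm x) ^ N * cmod (partial_derivs bs f x)))}"

definition schwartz_seminorm ::
    "nat \<Rightarrow> 'a::euclidean_space list \<Rightarrow> ('a \<Rightarrow> complex) \<Rightarrow> real" where
  "schwartz_seminorm N bs f = (SUP x. (1 + norm x) ^ N * cmod (partial_derivs bs f x))"

definition schwartz_topology :: "('a::euclidean_space \<Rightarrow> complex) topology" where
  "schwartz_topology = seminorm_topology schwartz_space
     {schwartz_seminorm N bs | N bs. bs \<in> lists Basis}"

definition schwartz_bounded :: "('a::euclidean_space \<Rightarrow> complex) set \<Rightarrow> bool" where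
  "schwartz_bounded B \<longleftrightarrow> B \<subseteq> schwartz_space \<and>
     (\<forall>N. \<forall>bs\<in>lists Basis. \<exists>C. \<forall>f\<in>B. schwartz_seminorm N bs f \<le> C)"


section \<open>Tempered distributions\<close>

text \<open>Tempered distributions are complex linear (not antilinear) functionals.  As they are total
  functions on the type of all functions, they are made equal to \<^const>\<open>undefined\<close> outside the
  Schwartz space, so that equal functionals on the Schwartz space are equal objects.\<close>

definition tempered :: "(('a::euclidean_space \<Rightarrow> complex) \<Rightarrow> complex) set" where
  "tempered = {u \<in> extensional schwartz_space.
     (\<forall>f\<in>schwartz_space. \<forall>g\<in>schwartz_space. u (\<lambda>x. f x + g x) = u f + u g) \<and>
     (\<forall>c. \<forall>f\<in>schwartz_space. u (\<lambda>x. c * f x) = c * u f) \<and>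
     continuous_map schwartz_topology euclidean u}"

text \<open>The two standard topologies of the dual space: uniform convergence on finite sets of test
  functions (equivalently, pointwise convergence) and uniform convergence on bounded sets.\<close>

definition weak_topology :: "(('a::euclidean_space \<Rightarrow> complex) \<Rightarrow> complex) topology" where
  "weak_topology = seminorm_topology tempered {\<lambda>u. cmod (u \<phi>) | \<phi>. \<phi> \<in> schwartz_space}"

definition strong_topology :: "(('a::euclidean_space \<Rightarrow> complex) \<Rightarrow> complex) topology" where
  "strong_topology = seminorm_topology tempered
     {\<lambda>u. SUP \<phi>\<in>B. cmod (u \<phi>) | B. schwartz_bounded B \<and> B \<noteq> {}}"

text \<open>The distribution defined by a function.\<close>

definition distr_of ::
    "('a::euclidean_space \<Rightarrow> complex) \<Rightarrow> ('a \<Rightarrow> complex) \<Rightarrow> complex" where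
  "distr_of f = (\<lambda>\<phi>\<in>schwartz_space. LINT x|lborel. f x * \<phi> x)"

text \<open>The distribution \<open>u(\<cdot> + h)\<close>.\<close>

definition distr_shift :: "'a::euclidean_space \<Rightarrow>
    (('a \<Rightarrow> complex) \<Rightarrow> complex) \<Rightarrow> ('a \<Rightarrow> complex) \<Rightarrow> complex" where
  "distr_shift h u = (\<lambda>\<phi>\<in>schwartz_space. u (\<lambda>z. \<phi> (z - h)))"

definition distr_mult :: "('a::euclidean_space \<Rightarrow> complex) \<Rightarrow>
    (('a \<Rightarrow> complex) \<Rightarrow> complex) \<Rightarrow> ('a \<Rightarrow> complex) \<Rightarrow> complex" where
  "distr_mult m u = (\<lambda>\<phi>\<in>schwartz_space. u (\<lambda>z. m z * \<phi> z))"


section \<open>Quasi-periodicity and the Zak transform\<close>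

definition quasi_periodic ::
    "('d::finite \<Rightarrow> real^'d) \<Rightarrow> ((real^'d) \<times> (real^'d) \<Rightarrow> complex) \<Rightarrow> bool" where
  "quasi_periodic e F \<longleftrightarrow> (\<forall>k\<in>lattice e. \<forall>\<kappa>\<in>dual_lattice e. \<forall>x \<xi>.
     F (x + k, \<xi>) = exp (\<i> * of_real (k \<bullet> \<xi>)) * F (x, \<xi>) \<and> F (x, \<xi> + \<kappa>) = F (x, \<xi>))"

definition quasi_periodic_distr ::
    "('d::finite \<Rightarrow> real^'d) \<Rightarrow> (((real^'d) \<times> (real^'d) \<Rightarrow> complex) \<Rightarrow> complex) \<Rightarrow> bool" where
  "quasi_periodic_distr e u \<longleftrightarrow> (\<forall>k\<in>lattice e. \<forall>\<kappa>\<in>dual_lattice e.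
     distr_shift (k, 0) u = distr_mult (\<lambda>(x, \<xi>). exp (\<i> * of_real (k \<bullet> \<xi>))) u \<and>
     distr_shift (0, \<kappa>) u = u)"

definition smooth_Z :: "('d::finite \<Rightarrow> real^'d) \<Rightarrow> ((real^'d) \<times> (real^'d) \<Rightarrow> complex) set" where
  "smooth_Z e = {F \<in> smooth_space. quasi_periodic e F}"

definition tempered_Z ::
    "('d::finite \<Rightarrow> real^'d) \<Rightarrow> (((real^'d) \<times> (real^'d) \<Rightarrow> complex) \<Rightarrow> complex) set" where
  "tempered_Z e = {u \<in> tempered. quasi_periodic_distr e u}"

definition zak :: "('d::finite \<Rightarrow> real^'d) \<Rightarrow> (real^'d \<Rightarrow> complex) \<Rightarrow>
    (real^'d) \<times> (real^'d) \<Rightarrow> complex" where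
  "zak e f = (\<lambda>(x, \<xi>). \<Sum>\<^sub>\<infinity>j\<in>lattice e. f (x - j) * exp (\<i> * of_real (j \<bullet> \<xi>)))"

end

theory Submission
  imports Defs
begin

text \<open>
  The inverse of the Zak transform is the mean \<open>f(x) = \<integral> F (x, \<xi>) d\<xi>\<close> over a cell of the dual lattice.
  On quasi-periodic functions, \<open>x_b F + \<i> \<partial>F/\<partial>\<xi>_b\<close> is again quasi-periodic with mean \<open>x_b f\<close>, so the decay of
  \<open>f\<close> follows from the smoothness of \<open>F\<close>.

  For distributions, \<open>adj\<close> sums a test function on phase space over the phase lattice, with phases, into a
  quasi-periodic function and applies the inverse Zak transform. It is a continuous operator onto the
  Schwartz space; a right inverse \<open>lift\<close> multiplies \<open>(x, \<xi>) \<mapsto> (Z f)(x, - \<xi>)\<close> by a partition of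
  unity over the phase lattice. A quasi-periodic distribution does not see the
  difference between \<open>\<Phi>\<close> and \<open>lift (adj \<Phi>)\<close>. Hence the transpose of \<open>adj\<close> is a homeomorphism onto
  the quasi-periodic distributions, with inverse the transpose of \<open>lift\<close>, in the weak as well as in the
  strong topology; by Parseval's formula for Fourier series, a constant multiple of it extends the Zak
  transform. Uniqueness needs that Schwartz functions are dense for the strong topology: a
  distribution applied to a mollified test function is approximated by Riemann sums, uniformly on
  bounded sets, and the point values of the test function in these sums by integrals against narrow
  Gaussians.
\<close>

section \<open>Smooth functions\<close>

text \<open>The pairing of functions and distributions is bilinear, so phases have to cancel without
  complex conjugation; this forces the reflection of \<xi> in \<open>periodize\<close>,
  \<open>zak_conj\<close> and \<open>lift\<close>. Surjectivity on smooth functions rests on one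
  fact: a continuous periodic function whose Fourier coefficients all vanish is zero. By
  quasi-periodicity, the coefficient of \<open>F\<close> in \<xi> against
  \<open>torus_char n\<close> is the mean of \<open>F\<close> at \<open>x + lin n\<close>, so
  \<open>F\<close> and the Zak transform of its mean share all coefficients. The partition of unity
  is a Gaussian averaged over a phase cell; it is Schwartz, and its lattice sum is a full Gaussian
  integral, hence constant. Lattices are handled in coordinates that turn them into integer points.
  The Jacobians of these coordinates survive only in the constant of
  \<open>integral_zak_adj\<close>, which is the volume of a cell of the dual lattice. Estimates use
  the increasing norms \<open>schwartz_norm M\<close>. Their constants have to be explicit in the
  lattice point, for lattice sums to converge, and uniform in the test function, for density in the
  strong topology.\<close>

lemma partial_derivs_Nil [simp]: "partial_derivs [] f = f"
  by (simp add: partial_derivs_def)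

lemma partial_derivs_Cons [simp]:
  "partial_derivs (b # bs) f = partial_deriv b (partial_derivs bs f)"
  by (simp add: partial_derivs_def)

lemma partial_derivs_append:
  "partial_derivs (bs @ cs) f = partial_derivs bs (partial_derivs cs f)"
  by (simp add: partial_derivs_def)

text \<open>\<open>smooth_space\<close> is the largest set of differentiable functions closed under
  partial derivatives along the basis. Closure proofs below therefore only have to name a set with
  these two properties.\<close>

lemma smooth_space_coinduct:
  assumes "f \<in> X" and "\<And>g x. g \<in> X \<Longrightarrow> g differentiable (at x)"
    and "\<And>g b. g \<in> X \<Longrightarrow> b \<in> Basis \<Longrightarrow> partial_deriv b g \<in> X"
  shows "f \<in> smooth_space"
proof -
  have "partial_derivs bs f \<in> X" if "bs \<in> lists Basis" for bs
    using that by (induction bs) (auto intro: assms)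
  with assms(2) show ?thesis by (auto simp: smooth_space_def)
qed

lemma partial_derivs_smooth:
  "f \<in> smooth_space \<Longrightarrow> bs \<in> lists Basis \<Longrightarrow> partial_derivs bs f \<in> smooth_space"
  by (auto simp: smooth_space_def partial_derivs_append [symmetric])

lemma partial_deriv_smooth:
  "f \<in> smooth_space \<Longrightarrow> b \<in> Basis \<Longrightarrow> partial_deriv b f \<in> smooth_space"
  using partial_derivs_smooth [of f "[b]"] by simp

lemma smooth_differentiable: "f \<in> smooth_space \<Longrightarrow> f differentiable (at x)"
  unfolding smooth_space_def by (force dest: bspec [of _ _ "[]"])

lemma smooth_has_frechet:
  "f \<in> smooth_space \<Longrightarrow> (f has_derivative frechet_derivative f (at x)) (at x)"
  using smooth_differentiable frechet_derivative_works by blast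

lemma partial_derivI: "(f has_derivative D) (at x) \<Longrightarrow> partial_deriv b f x = D b"
  unfolding partial_deriv_def using frechet_derivative_at by metis

lemma smooth_has_derivative:
  fixes f :: "'a::euclidean_space \<Rightarrow> complex"
  assumes "f \<in> smooth_space"
  shows "(f has_derivative (\<lambda>h. \<Sum>b\<in>Basis. (h \<bullet> b) *\<^sub>R partial_deriv b f x)) (at x)"
proof -
  let ?D = "frechet_derivative f (at x)"
  have D: "(f has_derivative ?D) (at x)" by (rule smooth_has_frechet [OF assms])
  then have lin: "linear ?D" by (rule has_derivative_linear)
  have "?D h = (\<Sum>b\<in>Basis. (h \<bullet> b) *\<^sub>R partial_deriv b f x)" for h
  proof -
    have "?D h = ?D (\<Sum>b\<in>Basis. (h \<bullet> b) *\<^sub>R b)" by (simp add: euclidean_representation)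
    also have "\<dots> = (\<Sum>b\<in>Basis. (h \<bullet> b) *\<^sub>R ?D b)"
      by (simp add: linear_sum [OF lin] linear_scale [OF lin])
    finally show ?thesis by (simp add: partial_deriv_def)
  qed
  then have "?D = (\<lambda>h. \<Sum>b\<in>Basis. (h \<bullet> b) *\<^sub>R partial_deriv b f x)" by blast
  with D show ?thesis by simp
qed

lemma smooth_continuous: "f \<in> smooth_space \<Longrightarrow> continuous_on S f"
  by (meson continuous_at_imp_continuous_on differentiable_imp_continuous_within smooth_differentiable)

lemma partial_derivs_continuous:
  "f \<in> smooth_space \<Longrightarrow> bs \<in> lists Basis \<Longrightarrow> continuous_on S (partial_derivs bs f)"
  by (simp add: partial_derivs_smooth smooth_continuous)

lemma partial_deriv_add:
  assumes "f \<in> smooth_space" "g \<in> smooth_space"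
  shows "partial_deriv b (\<lambda>x. f x + g x) = (\<lambda>x. partial_deriv b f x + partial_deriv b g x)"
  using partial_derivI [OF has_derivative_add [OF smooth_has_frechet [OF assms(1)] smooth_has_frechet [OF assms(2)]]]
  by (auto simp: partial_deriv_def)

lemma partial_deriv_cmult:
  assumes "f \<in> smooth_space"
  shows "partial_deriv b (\<lambda>x. c * f x) = (\<lambda>x. c * partial_deriv b f x)"
  using partial_derivI [OF has_derivative_mult_right [OF smooth_has_frechet [OF assms(1)]]]
  by (auto simp: partial_deriv_def)

lemma partial_deriv_const [simp]: "partial_deriv b (\<lambda>x. c) = (\<lambda>x. 0)"
  using partial_derivI [OF has_derivative_const] by auto

lemma smooth_const [simp]: "(\<lambda>x. c) \<in> smooth_space"
  by (rule smooth_space_coinduct [of _ "range (\<lambda>c x. c)"]) auto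

lemma smooth_add:
  assumes "f \<in> smooth_space" "g \<in> smooth_space"
  shows "(\<lambda>x. f x + g x) \<in> smooth_space"
proof (rule smooth_space_coinduct [of _ "{\<lambda>x. f x + g x | f g. f \<in> smooth_space \<and> g \<in> smooth_space}"])
  show "h differentiable at x" if "h \<in> {\<lambda>x. f x + g x | f g. f \<in> smooth_space \<and> g \<in> smooth_space}" for h :: "'a \<Rightarrow> complex" and x
    using that by (elim CollectE exE conjE) (simp add: differentiable_add smooth_differentiable)
  show "partial_deriv b h \<in> {\<lambda>x. f x + g x | f g. f \<in> smooth_space \<and> g \<in> smooth_space}"
    if "h \<in> {\<lambda>x. f x + g x | f g. f \<in> smooth_space \<and> g \<in> smooth_space}" "b \<in> Basis" for h :: "'a \<Rightarrow> complex" and b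
    using that partial_deriv_add partial_deriv_smooth by fastforce
qed (use assms in auto)

lemma smooth_sum:
  "(\<And>i. i \<in> I \<Longrightarrow> f i \<in> smooth_space) \<Longrightarrow> (\<lambda>x. \<Sum>i\<in>I. f i x) \<in> smooth_space"
  by (induction I rule: infinite_finite_induct) (auto intro: smooth_add)

text \<open>Products are not closed under differentiation, but finite sums of products are.\<close>

lemma smooth_mult:
  fixes f g :: "'a::euclidean_space \<Rightarrow> complex"
  assumes "f \<in> smooth_space" "g \<in> smooth_space"
  shows "(\<lambda>x. f x * g x) \<in> smooth_space"
proof -
  let ?X = "{\<lambda>x. \<Sum>p\<leftarrow>ps. fst p x * snd p x | ps. set ps \<subseteq> smooth_space \<times> (smooth_space :: ('a \<Rightarrow> complex) set)}"
  have has: "((\<lambda>x. \<Sum>p\<leftarrow>ps. fst p x * snd p x) has_derivative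
     (\<lambda>h. \<Sum>p\<leftarrow>ps. fst p x * frechet_derivative (snd p) (at x) h + frechet_derivative (fst p) (at x) h * snd p x)) (at x)"
    if "set ps \<subseteq> smooth_space \<times> smooth_space" for ps :: "(('a \<Rightarrow> complex) \<times> ('a \<Rightarrow> complex)) list" and x
    using that
  proof (induction ps)
    case (Cons p ps)
    have "((\<lambda>x. fst p x * snd p x) has_derivative
      (\<lambda>h. fst p x * frechet_derivative (snd p) (at x) h + frechet_derivative (fst p) (at x) h * snd p x)) (at x)"
      by (rule has_derivative_mult) (use Cons.prems smooth_has_frechet in fastforce)+
    from has_derivative_add [OF this Cons.IH] Cons.prems show ?case by simp
  qed simp
  show ?thesis
  proof (rule smooth_space_coinduct [of _ ?X])
    show "(\<lambda>x. f x * g x) \<in> ?X"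
      by (rule CollectI, rule exI [of _ "[(f, g)]"]) (use assms in auto)
  next
    fix h :: "'a \<Rightarrow> complex" and x assume "h \<in> ?X"
    then show "h differentiable at x" using has unfolding differentiable_def by blast
  next
    fix h :: "'a \<Rightarrow> complex" and b :: 'a assume "h \<in> ?X" and b: "b \<in> Basis"
    then obtain ps where h: "h = (\<lambda>x. \<Sum>p\<leftarrow>ps. fst p x * snd p x)" and ps: "set ps \<subseteq> smooth_space \<times> smooth_space"
      by blast
    define qs where "qs = concat (map (\<lambda>p. [(fst p, partial_deriv b (snd p)), (partial_deriv b (fst p), snd p)]) ps)"
    have "partial_deriv b h x = (\<Sum>p\<leftarrow>ps. fst p x * frechet_derivative (snd p) (at x) b + frechet_derivative (fst p) (at x) b * snd p x)" for x
      using partial_derivI [OF has [OF ps]] unfolding h by blast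
    also have "\<dots> x = (\<Sum>p\<leftarrow>qs. fst p x * snd p x)" for x
      unfolding qs_def by (induction ps) (auto simp: partial_deriv_def)
    finally have "partial_deriv b h = (\<lambda>x. \<Sum>p\<leftarrow>qs. fst p x * snd p x)" by blast
    moreover have "set qs \<subseteq> smooth_space \<times> smooth_space"
      using ps b by (fastforce simp: qs_def intro: partial_deriv_smooth)
    ultimately show "partial_deriv b h \<in> ?X" by blast
  qed
qed

lemma smooth_cmult: "f \<in> smooth_space \<Longrightarrow> (\<lambda>x. c * f x) \<in> smooth_space"
  by (rule smooth_mult) auto

lemma smooth_diff:
  assumes "f \<in> smooth_space" "g \<in> smooth_space"
  shows "(\<lambda>x. f x - g x) \<in> smooth_space"
  using smooth_add [OF assms(1) smooth_cmult [OF assms(2), of "-1"]] by simp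

lemma partial_derivs_add:
  assumes "f \<in> smooth_space" "g \<in> smooth_space" "bs \<in> lists Basis"
  shows "partial_derivs bs (\<lambda>x. f x + g x) = (\<lambda>x. partial_derivs bs f x + partial_derivs bs g x)"
  using assms(3) by (induction bs) (auto simp: partial_deriv_add partial_derivs_smooth assms)

lemma partial_derivs_cmult:
  assumes "f \<in> smooth_space" "bs \<in> lists Basis"
  shows "partial_derivs bs (\<lambda>x. c * f x) = (\<lambda>x. c * partial_derivs bs f x)"
  using assms(2) by (induction bs) (auto simp: partial_deriv_cmult partial_derivs_smooth assms)

lemma partial_derivs_diff:
  assumes "f \<in> smooth_space" "g \<in> smooth_space" "bs \<in> lists Basis"
  shows "partial_derivs bs (\<lambda>x. f x - g x) = (\<lambda>x. partial_derivs bs f x - partial_derivs bs g x)"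
  using partial_derivs_add [OF assms(1) smooth_cmult [OF assms(2), of "-1"] assms(3)]
    partial_derivs_cmult [OF assms(2,3), of "-1"] by simp

lemma partial_derivs_zero: "partial_derivs bs (\<lambda>x. 0) = (\<lambda>x. 0)"
  by (induction bs) auto

lemma partial_derivs_sum:
  assumes "\<And>i. i \<in> I \<Longrightarrow> f i \<in> smooth_space" "bs \<in> lists Basis"
  shows "partial_derivs bs (\<lambda>x. \<Sum>i\<in>I. f i x) = (\<lambda>x. \<Sum>i\<in>I. partial_derivs bs (f i) x)"
  using assms(1)
  by (induction I rule: infinite_finite_induct)
     (auto simp: partial_derivs_zero partial_derivs_add smooth_sum assms(2))

text \<open>All ways to hand each derivative of a list to one of two factors. The result is a list
  and not a set: repeated pairs carry the binomial coefficients of the product rule for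
  multi-indices.\<close>

fun splits :: "'a list \<Rightarrow> ('a list \<times> 'a list) list" where
  "splits [] = [([], [])]"
| "splits (b # bs) = concat (map (\<lambda>(c, d). [(b # c, d), (c, b # d)]) (splits bs))"

lemma splits_props:
  "(c, d) \<in> set (splits bs) \<Longrightarrow>
    set c \<subseteq> set bs \<and> set d \<subseteq> set bs \<and> length c \<le> length bs \<and> length d \<le> length bs"
  by (induction bs arbitrary: c d) (fastforce split: prod.splits)+

lemma length_splits: "length (splits bs) = 2 ^ length bs"
proof (induction bs)
  case (Cons b bs)
  have "length (concat (map (\<lambda>(c, d). [(b # c, d), (c, b # d)]) xs)) = 2 * length xs" for xs :: "('a list \<times> 'a list) list"
    by (induction xs) auto
  with Cons show ?case by simp
qed simp

text \<open>The product rule applied to the term of \<open>(c, d)\<close> yields exactly the two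
  terms in which \<open>splits\<close> puts the new direction \<open>b\<close> in front of
  \<open>c\<close> or of \<open>d\<close>.\<close>

lemma leibniz:
  fixes f g :: "'a::euclidean_space \<Rightarrow> complex"
  assumes f: "f \<in> smooth_space" and g: "g \<in> smooth_space" and "bs \<in> lists Basis"
  shows "partial_derivs bs (\<lambda>x. f x * g x) =
    (\<lambda>x. \<Sum>(c, d)\<leftarrow>splits bs. partial_derivs c f x * partial_derivs d g x)"
  using assms(3)
proof (induction bs)
  case (Cons b bs)
  have has: "((\<lambda>x. \<Sum>(c, d)\<leftarrow>ps. partial_derivs c f x * partial_derivs d g x) has_derivative
     (\<lambda>h. \<Sum>(c, d)\<leftarrow>ps. partial_derivs c f x * frechet_derivative (partial_derivs d g) (at x) h
        + frechet_derivative (partial_derivs c f) (at x) h * partial_derivs d g x)) (at x)"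
    if "set ps \<subseteq> lists Basis \<times> lists Basis" for ps x
    using that
  proof (induction ps)
    case (Cons p ps)
    obtain c d where p: "p = (c, d)" by fastforce
    have "((\<lambda>x. partial_derivs c f x * partial_derivs d g x) has_derivative
      (\<lambda>h. partial_derivs c f x * frechet_derivative (partial_derivs d g) (at x) h
        + frechet_derivative (partial_derivs c f) (at x) h * partial_derivs d g x)) (at x)"
      by (rule has_derivative_mult)
        (use Cons.prems p in \<open>auto intro!: smooth_has_frechet partial_derivs_smooth f g\<close>)
    from has_derivative_add [OF this Cons.IH] Cons.prems p show ?case by simp
  qed simp
  have sub: "set (splits bs) \<subseteq> lists Basis \<times> lists Basis"
    using splits_props [of _ _ bs] Cons.hyps by (fastforce simp: lists_eq_set)
  have eq: "(\<Sum>(c, d)\<leftarrow>ps. partial_derivs c f x * frechet_derivative (partial_derivs d g) (at x) b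
        + frechet_derivative (partial_derivs c f) (at x) b * partial_derivs d g x) =
      (\<Sum>(c, d)\<leftarrow>concat (map (\<lambda>(c, d). [(b # c, d), (c, b # d)]) ps). partial_derivs c f x * partial_derivs d g x)" for ps x
    by (induction ps) (auto simp: partial_deriv_def)
  have "partial_deriv b (\<lambda>x. \<Sum>(c, d)\<leftarrow>splits bs. partial_derivs c f x * partial_derivs d g x) x
      = (\<Sum>(c, d)\<leftarrow>splits (b # bs). partial_derivs c f x * partial_derivs d g x)" for x
    unfolding splits.simps using trans [OF partial_derivI [OF has [OF sub]] eq] .
  moreover have "partial_derivs bs (\<lambda>x. f x * g x) =
      (\<lambda>x. \<Sum>(c, d)\<leftarrow>splits bs. partial_derivs c f x * partial_derivs d g x)"
    using Cons by simp
  ultimately show ?case by (simp only: partial_derivs_Cons)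
qed auto

text \<open>A plane wave times the pullback of \<open>\<Phi>\<close> by an affine map. Translations,
  modulations, the terms of the Zak transform and those of the periodization all have this form, so
  derivatives and bounds are computed only once.\<close>

definition exp_twist ::
  "'a::euclidean_space \<Rightarrow> ('a \<Rightarrow> 'b::euclidean_space) \<Rightarrow> 'b \<Rightarrow> ('b \<Rightarrow> complex) \<Rightarrow> 'a \<Rightarrow> complex" where
  "exp_twist v B l \<Phi> = (\<lambda>z. exp (\<i> * of_real (z \<bullet> v)) * \<Phi> (B z + l))"

text \<open>The derivative along \<open>b\<close>, moved past the twist so that it acts on
  \<open>\<Phi>\<close> first. Its coefficients are constant, so iterating it describes all
  derivatives of a twisted function as twists again.\<close>

definition twist_deriv ::
  "'a::euclidean_space \<Rightarrow> ('a \<Rightarrow> 'b::euclidean_space) \<Rightarrow> 'a \<Rightarrow> ('b \<Rightarrow> complex) \<Rightarrow> 'b \<Rightarrow> complex" where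
  "twist_deriv v B b \<Phi> = (\<lambda>y. \<i> * of_real (b \<bullet> v) * \<Phi> y +
      (\<Sum>c\<in>Basis. of_real (B b \<bullet> c) * partial_deriv c \<Phi> y))"

lemma twist_deriv_smooth: "\<Phi> \<in> smooth_space \<Longrightarrow> twist_deriv v B b \<Phi> \<in> smooth_space"
  unfolding twist_deriv_def
  by (intro smooth_add smooth_cmult smooth_sum partial_deriv_smooth)

lemma exp_twist_has_derivative:
  fixes \<Phi> :: "'b::euclidean_space \<Rightarrow> complex" and B :: "'a::euclidean_space \<Rightarrow> 'b"
  assumes \<Phi>: "\<Phi> \<in> smooth_space" and B: "bounded_linear B"
  shows "(exp_twist v B l \<Phi> has_derivative
    (\<lambda>h. exp_twist v B l (twist_deriv v B h \<Phi>) z)) (at z)"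
proof -
  have aff: "((\<lambda>z. B z + l) has_derivative B) (at z)"
    using has_derivative_add [OF bounded_linear_imp_has_derivative [OF B] has_derivative_const] by auto
  have 1: "((\<lambda>z. \<Phi> (B z + l)) has_derivative
      (\<lambda>h. \<Sum>b\<in>Basis. (B h \<bullet> b) *\<^sub>R partial_deriv b \<Phi> (B z + l))) (at z)"
    using has_derivative_compose [OF aff smooth_has_derivative [OF \<Phi>]] .
  have 2: "((\<lambda>z. exp (\<i> * of_real (z \<bullet> v))) has_derivative
      (\<lambda>h. exp (\<i> * of_real (z \<bullet> v)) * (\<i> * of_real (h \<bullet> v)))) (at z)"
  proof -
    have "((\<lambda>z. \<i> * of_real (z \<bullet> v) :: complex) has_derivative (\<lambda>h. \<i> * of_real (h \<bullet> v))) (at z)"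
      by (intro bounded_linear_imp_has_derivative bounded_linear_const_mult
          bounded_linear_compose [OF bounded_linear_of_real] bounded_linear_inner_left)
    from has_derivative_compose [OF this DERIV_exp [unfolded has_field_derivative_def]]
    show ?thesis by simp
  qed
  show ?thesis unfolding exp_twist_def
    by (rule has_derivative_eq_rhs [OF has_derivative_mult [OF 2 1]])
       (simp add: twist_deriv_def scaleR_conv_of_real algebra_simps)
qed

lemma partial_deriv_exp_twist:
  assumes "\<Phi> \<in> smooth_space" "bounded_linear B"
  shows "partial_deriv b (exp_twist v B l \<Phi>) = exp_twist v B l (twist_deriv v B b \<Phi>)"
  using partial_derivI [OF exp_twist_has_derivative [OF assms]] by blast

lemma exp_twist_smooth:
  assumes "\<Phi> \<in> smooth_space" "bounded_linear B"
  shows "exp_twist v B l \<Phi> \<in> smooth_space"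
proof (rule smooth_space_coinduct [of _ "exp_twist v B l ` smooth_space"])
  show "g differentiable at x" if "g \<in> exp_twist v B l ` smooth_space" for g x
    using that exp_twist_has_derivative assms(2) unfolding differentiable_def by blast
qed (use assms in \<open>auto simp: partial_deriv_exp_twist intro: twist_deriv_smooth\<close>)

lemma twist_derivs_smooth:
  "\<Phi> \<in> smooth_space \<Longrightarrow> foldr (twist_deriv v B) bs \<Phi> \<in> smooth_space"
  by (induction bs) (auto intro: twist_deriv_smooth)

lemma partial_derivs_exp_twist:
  assumes "\<Phi> \<in> smooth_space" "bounded_linear B"
  shows "partial_derivs bs (exp_twist v B l \<Phi>) = exp_twist v B l (foldr (twist_deriv v B) bs \<Phi>)"
  by (induction bs) (auto simp: partial_deriv_exp_twist twist_derivs_smooth assms)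

lemma smooth_affine:
  assumes "\<Phi> \<in> smooth_space" "bounded_linear B"
  shows "(\<lambda>z. \<Phi> (B z + l)) \<in> smooth_space"
  using exp_twist_smooth [OF assms, of 0 l] by (simp add: exp_twist_def)

lemma partial_deriv_affine:
  assumes "\<Phi> \<in> smooth_space" "bounded_linear B"
  shows "partial_deriv b (\<lambda>z. \<Phi> (B z + l)) = (\<lambda>z. \<Sum>c\<in>Basis. of_real (B b \<bullet> c) * partial_deriv c \<Phi> (B z + l))"
  using partial_deriv_exp_twist [OF assms, of b 0 l] by (simp add: exp_twist_def twist_deriv_def)

lemma partial_derivs_translate:
  assumes "\<Phi> \<in> smooth_space" "bs \<in> lists Basis"
  shows "partial_derivs bs (\<lambda>z. \<Phi> (z + l)) = (\<lambda>z. partial_derivs bs \<Phi> (z + l))"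
  using assms(2)
proof (induction bs)
  case (Cons b bs)
  then show ?case
    using partial_deriv_affine [OF partial_derivs_smooth [OF assms(1)] bounded_linear_ident, of bs b l]
    by (simp add: inner_Basis if_distrib if_distribR cong: if_cong)
qed simp

lemma smooth_translate: "\<Phi> \<in> smooth_space \<Longrightarrow> (\<lambda>z. \<Phi> (z + l)) \<in> smooth_space"
  using smooth_affine [OF _ bounded_linear_ident] by auto

lemma smooth_lipschitz:
  fixes f :: "'a::euclidean_space \<Rightarrow> complex" and A :: real
  assumes f: "f \<in> smooth_space" and S: "convex S" "x \<in> S" "y \<in> S"
    and A: "\<And>z b. z \<in> S \<Longrightarrow> b \<in> Basis \<Longrightarrow> cmod (partial_deriv b f z) \<le> A"
  shows "cmod (f y - f x) \<le> DIM('a) * A * norm (y - x)"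
proof (rule differentiable_bound [OF S(1) _ _ S(3,2)])
  show "(f has_derivative (\<lambda>h. \<Sum>b\<in>Basis. (h \<bullet> b) *\<^sub>R partial_deriv b f z)) (at z within S)" for z
    by (rule has_derivative_at_withinI [OF smooth_has_derivative [OF f]])
  show "onorm (\<lambda>h. \<Sum>b\<in>Basis. (h \<bullet> b) *\<^sub>R partial_deriv b f z) \<le> DIM('a) * A" if "z \<in> S" for z
  proof (rule onorm_le)
    fix h :: 'a
    have "norm (\<Sum>b\<in>Basis. (h \<bullet> b) *\<^sub>R partial_deriv b f z) \<le> (\<Sum>b\<in>(Basis::'a set). norm h * A)"
      by (rule sum_norm_le) (simp add: mult_mono Basis_le_norm A that)
    then show "norm (\<Sum>b\<in>Basis. (h \<bullet> b) *\<^sub>R partial_deriv b f z) \<le> DIM('a) * A * norm h"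
      by (simp add: algebra_simps)
  qed
qed

text \<open>The remainder \<open>h\<close> has as gradient at \<open>z\<close> the gradient of
  \<open>f\<close> at \<open>z\<close> minus that at \<open>x\<close>, which is small by the
  Lipschitz bound for first derivatives. The mean value inequality for \<open>h\<close> then gives
  the quadratic estimate.\<close>

lemma smooth_taylor1:
  fixes f :: "'a::euclidean_space \<Rightarrow> complex" and A :: real
  assumes f: "f \<in> smooth_space" and S: "convex S" "x \<in> S" "y \<in> S"
    and A: "\<And>z b c. z \<in> S \<Longrightarrow> b \<in> Basis \<Longrightarrow> c \<in> Basis \<Longrightarrow> cmod (partial_deriv c (partial_deriv b f) z) \<le> A"
  shows "cmod (f y - f x - (\<Sum>b\<in>Basis. ((y - x) \<bullet> b) *\<^sub>R partial_deriv b f x))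
    \<le> (real DIM('a))\<^sup>2 * A * (norm (y - x))\<^sup>2"
proof -
  \<comment> \<open>Inside this ball every \<open>z\<close> is at most \<open>norm (y - x)\<close>
    away from \<open>x\<close>, so the Lipschitz bound for the gradient is expressed by the
    increment alone.\<close>
  let ?S = "S \<inter> cball x (norm (y - x))"
  define h where "h = (\<lambda>z. f z - (\<Sum>b\<in>Basis. ((z - x) \<bullet> b) *\<^sub>R partial_deriv b f x))"
  have lip: "cmod (partial_deriv b f z - partial_deriv b f x) \<le> DIM('a) * A * norm (y - x)"
    if z: "z \<in> ?S" and b: "b \<in> Basis" for z b
  proof -
    have "0 \<le> A" using A [OF S(2) b b] norm_ge_zero order_trans by blast
    have "cmod (partial_deriv b f z - partial_deriv b f x) \<le> DIM('a) * A * norm (z - x)"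
      using smooth_lipschitz [OF partial_deriv_smooth [OF f b] S(1,2), of z A] z b A by auto
    also have "\<dots> \<le> DIM('a) * A * norm (y - x)"
      using z \<open>0 \<le> A\<close> by (intro mult_left_mono) (auto simp: dist_norm norm_minus_commute)
    finally show ?thesis .
  qed
  have "cmod (h y - h x) \<le> (DIM('a) * (DIM('a) * A * norm (y - x))) * norm (y - x)"
  proof (rule differentiable_bound)
    show "convex ?S" using S by (simp add: convex_Int)
    show "y \<in> ?S" "x \<in> ?S" using S by (auto simp: dist_norm norm_minus_commute)
    show "(h has_derivative (\<lambda>v. \<Sum>b\<in>Basis. (v \<bullet> b) *\<^sub>R (partial_deriv b f z - partial_deriv b f x))) (at z within ?S)" for z
    proof -
      have "(h has_derivative (\<lambda>v. (\<Sum>b\<in>Basis. (v \<bullet> b) *\<^sub>R partial_deriv b f z)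
           - (\<Sum>b\<in>Basis. (v \<bullet> b) *\<^sub>R partial_deriv b f x))) (at z within ?S)"
        unfolding h_def
        by (intro has_derivative_diff has_derivative_at_withinI [OF smooth_has_derivative [OF f]])
           (auto intro!: derivative_eq_intros)
      then show ?thesis by (simp add: sum_subtractf scaleR_diff_right)
    qed
    show "onorm (\<lambda>v. \<Sum>b\<in>Basis. (v \<bullet> b) *\<^sub>R (partial_deriv b f z - partial_deriv b f x)) \<le> DIM('a) * (DIM('a) * A * norm (y - x))"
      if "z \<in> ?S" for z
    proof (rule onorm_le)
      fix v :: 'a
      have "norm (\<Sum>b\<in>Basis. (v \<bullet> b) *\<^sub>R (partial_deriv b f z - partial_deriv b f x))
          \<le> (\<Sum>b\<in>(Basis::'a set). norm v * (DIM('a) * A * norm (y - x)))"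
      proof (rule sum_norm_le)
        fix b :: 'a assume b: "b \<in> Basis"
        have "\<bar>v \<bullet> b\<bar> * cmod (partial_deriv b f z - partial_deriv b f x) \<le> norm v * (DIM('a) * A * norm (y - x))"
          by (rule mult_mono [OF Basis_le_norm [OF b] lip [OF that b]]) simp_all
        then show "norm ((v \<bullet> b) *\<^sub>R (partial_deriv b f z - partial_deriv b f x)) \<le> norm v * (DIM('a) * A * norm (y - x))"
          by simp
      qed
      then show "norm (\<Sum>b\<in>Basis. (v \<bullet> b) *\<^sub>R (partial_deriv b f z - partial_deriv b f x)) \<le> DIM('a) * (DIM('a) * A * norm (y - x)) * norm v"
        by (simp add: algebra_simps)
    qed
  qed
  then show ?thesis by (simp add: h_def power2_eq_square algebra_simps)
qed

lemma sum_inner_Basis: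
  fixes h :: "'a::euclidean_space \<Rightarrow> 'b::real_vector"
  shows "b \<in> Basis \<Longrightarrow> (\<Sum>c\<in>Basis. (b \<bullet> c) *\<^sub>R h c) = h b"
  by (simp add: inner_Basis if_distrib if_distribR cong: if_cong)

text \<open>If \<open>f\<close> is not integrable, its Bochner integral is 0 by convention, and the
  bound then follows from \<open>g\<close> being nonnegative on the space.\<close>

lemma norm_integral_le:
  fixes f :: "'t \<Rightarrow> 'b::{banach, second_countable_topology}"
  assumes g: "integrable M g" and le: "\<And>t. t \<in> space M \<Longrightarrow> norm (f t) \<le> g t"
  shows "norm (\<integral>t. f t \<partial>M) \<le> (\<integral>t. g t \<partial>M)"
proof (cases "integrable M f")
  case True
  have "norm (\<integral>t. f t \<partial>M) \<le> (\<integral>t. norm (f t) \<partial>M)" by (rule integral_norm_bound)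
  also have "\<dots> \<le> (\<integral>t. g t \<partial>M)" using True g le by (intro integral_mono) auto
  finally show ?thesis .
next
  case False
  have "0 \<le> (\<integral>t. g t \<partial>M)"
    by (intro Bochner_Integration.integral_nonneg) (use le norm_ge_zero order_trans in blast)
  then show ?thesis using False by (simp add: not_integrable_integral_eq)
qed

text \<open>Differentiation under the integral sign.  Applied to counting measures, this is also the
  termwise differentiation of series.\<close>

lemma integral_has_derivative:
  fixes g :: "'t \<Rightarrow> 'a::euclidean_space \<Rightarrow> complex"
  assumes smooth: "\<And>t. t \<in> space M \<Longrightarrow> g t \<in> smooth_space"
    and int0: "\<And>x. integrable M (\<lambda>t. g t x)"
    and int1: "\<And>b x. b \<in> Basis \<Longrightarrow> integrable M (\<lambda>t. partial_deriv b (g t) x)"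
    and dom: "\<And>b c r. b \<in> Basis \<Longrightarrow> c \<in> Basis \<Longrightarrow> \<exists>a. integrable M a \<and>
       (\<forall>t\<in>space M. \<forall>x. norm x \<le> r \<longrightarrow> cmod (partial_deriv c (partial_deriv b (g t)) x) \<le> a t)"
  shows "((\<lambda>x. \<integral>t. g t x \<partial>M) has_derivative
     (\<lambda>h. \<Sum>b\<in>Basis. (h \<bullet> b) *\<^sub>R (\<integral>t. partial_deriv b (g t) x \<partial>M))) (at x)"
proof -
  \<comment> \<open>Only increments shorter than 1 are considered, so \<open>x\<close> and
    \<open>y\<close> both stay in the ball of this radius, where the second derivatives are
    dominated.\<close>
  define r where "r = norm x + 1"
  obtain a where a: "\<And>b c. b \<in> Basis \<Longrightarrow> c \<in> Basis \<Longrightarrow> integrable M (a b c)"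
    and a': "\<And>b c t x. b \<in> Basis \<Longrightarrow> c \<in> Basis \<Longrightarrow> t \<in> space M \<Longrightarrow> norm x \<le> r \<Longrightarrow>
       cmod (partial_deriv c (partial_deriv b (g t)) x) \<le> a b c t"
    using dom [of _ _ r] by metis
  \<comment> \<open>One integrable bound for all pairs of directions; the absolute values allow a
    single summand to be compared with the double sum.\<close>
  define A where "A = (\<lambda>t. \<Sum>b\<in>Basis. \<Sum>c\<in>Basis. \<bar>a b c t\<bar>)"
  have A: "integrable M A" unfolding A_def by (intro Bochner_Integration.integrable_sum integrable_abs a)
  have A': "cmod (partial_deriv c (partial_deriv b (g t)) x) \<le> A t"
    if "b \<in> Basis" "c \<in> Basis" "t \<in> space M" "norm x \<le> r" for b c t x
  proof -
    have "a b c t \<le> \<bar>a b c t\<bar>" by simp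
    also have "\<dots> \<le> (\<Sum>c\<in>Basis. \<bar>a b c t\<bar>)" by (rule member_le_sum) (use that in auto)
    also have "\<dots> \<le> A t" unfolding A_def
      by (rule member_le_sum [of b _ "\<lambda>b. \<Sum>c\<in>Basis. \<bar>a b c t\<bar>"]) (use that in \<open>auto intro: sum_nonneg\<close>)
    finally show ?thesis using a' [OF that] by linarith
  qed
  let ?D = "\<lambda>h. \<Sum>b\<in>Basis. (h \<bullet> b) *\<^sub>R (\<integral>t. partial_deriv b (g t) x \<partial>M)"
  define C where "C = (real DIM('a))\<^sup>2 * (\<integral>t. A t \<partial>M)"
  have C0: "0 \<le> C" unfolding C_def
    by (intro mult_nonneg_nonneg Bochner_Integration.integral_nonneg) (auto simp: A_def intro!: sum_nonneg)
  have est: "cmod ((\<integral>t. g t y \<partial>M) - (\<integral>t. g t x \<partial>M) - ?D (y - x)) \<le> C * (norm (y - x))\<^sup>2"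
    if "norm (y - x) < 1" for y
  proof -
    have i3: "integrable M (\<lambda>t. \<Sum>b\<in>Basis. ((y - x) \<bullet> b) *\<^sub>R partial_deriv b (g t) x)"
      by (intro Bochner_Integration.integrable_sum integrable_scaleR_right int1)
    have "(\<integral>t. g t y \<partial>M) - (\<integral>t. g t x \<partial>M) - ?D (y - x)
        = (\<integral>t. g t y - g t x - (\<Sum>b\<in>Basis. ((y - x) \<bullet> b) *\<^sub>R partial_deriv b (g t) x) \<partial>M)"
      using int0 int1 i3 by (simp add: Bochner_Integration.integral_diff Bochner_Integration.integral_sum)
    also have "cmod \<dots> \<le> (\<integral>t. (real DIM('a))\<^sup>2 * A t * (norm (y - x))\<^sup>2 \<partial>M)"
    proof (rule norm_integral_le)
      show "integrable M (\<lambda>t. (real DIM('a))\<^sup>2 * A t * (norm (y - x))\<^sup>2)" using A by auto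
      fix t assume t: "t \<in> space M"
      show "cmod (g t y - g t x - (\<Sum>b\<in>Basis. ((y - x) \<bullet> b) *\<^sub>R partial_deriv b (g t) x)) \<le> (real DIM('a))\<^sup>2 * A t * (norm (y - x))\<^sup>2"
      proof (rule smooth_taylor1 [OF smooth [OF t], of "cball 0 r"])
        have "norm y \<le> norm x + norm (y - x)" using norm_triangle_sub by blast
        then show "y \<in> cball 0 r" using that by (simp add: r_def)
      qed (use A' t in \<open>auto simp: r_def\<close>)
    qed
    also have "\<dots> = C * (norm (y - x))\<^sup>2" by (simp add: C_def)
    finally show ?thesis .
  qed
  show ?thesis
    unfolding has_derivative_at_alt
  proof (intro conjI allI impI)
    show "bounded_linear ?D"
      by (intro bounded_linear_sum bounded_linear_scaleR_const bounded_linear_inner_left)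
    fix e :: real assume e: "0 < e"
    show "\<exists>d>0. \<forall>y. norm (y - x) < d \<longrightarrow>
      norm ((\<integral>t. g t y \<partial>M) - (\<integral>t. g t x \<partial>M) - ?D (y - x)) \<le> e * norm (y - x)"
    proof (intro exI [of _ "min 1 (e / (C + 1))"] conjI allI impI)
      show "0 < min 1 (e / (C + 1))" using e C0 by auto
      fix y assume y: "norm (y - x) < min 1 (e / (C + 1))"
      have "C * (norm (y - x))\<^sup>2 \<le> (C + 1) * (e / (C + 1)) * norm (y - x)"
        unfolding power2_eq_square mult.assoc [symmetric]
        using y C0 by (intro mult_right_mono mult_mono) auto
      also have "\<dots> = e * norm (y - x)" using C0 by simp
      finally show "norm ((\<integral>t. g t y \<partial>M) - (\<integral>t. g t x \<partial>M) - ?D (y - x)) \<le> e * norm (y - x)"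
        using est [of y] y by auto
    qed
  qed
qed

text \<open>The integrals of \<open>partial_derivs bs (g t)\<close>, over all lists
  \<open>bs\<close>, form a set closed under partial derivatives:
  \<open>integral_has_derivative\<close> differentiates once, and its second order bounds are
  instances of the domination assumed here. Coinduction then gives smoothness.\<close>

lemma smooth_integral:
  fixes g :: "'t \<Rightarrow> 'a::euclidean_space \<Rightarrow> complex"
  assumes smooth: "\<And>t. t \<in> space M \<Longrightarrow> g t \<in> smooth_space"
    and meas: "\<And>bs x. bs \<in> lists Basis \<Longrightarrow> (\<lambda>t. partial_derivs bs (g t) x) \<in> borel_measurable M"
    and dom: "\<And>bs r. bs \<in> lists Basis \<Longrightarrow> \<exists>a. integrable M a \<and>
       (\<forall>t\<in>space M. \<forall>x. norm x \<le> r \<longrightarrow> cmod (partial_derivs bs (g t) x) \<le> a t)"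
  shows "(\<lambda>x. \<integral>t. g t x \<partial>M) \<in> smooth_space"
    and "bs \<in> lists Basis \<Longrightarrow> partial_derivs bs (\<lambda>x. \<integral>t. g t x \<partial>M) = (\<lambda>x. \<integral>t. partial_derivs bs (g t) x \<partial>M)"
proof -
  have int: "integrable M (\<lambda>t. partial_derivs bs (g t) x)" if bs: "bs \<in> lists Basis" for bs x
  proof -
    obtain a where a: "integrable M a" and le: "\<forall>t\<in>space M. cmod (partial_derivs bs (g t) x) \<le> a t"
      using dom [OF bs, of "norm x"] by auto
    have "AE t in M. norm (partial_derivs bs (g t) x) \<le> norm (a t)"
      using le by (intro AE_I2) (metis abs_of_nonneg norm_ge_zero order_trans real_norm_def)
    then show ?thesis
      by (rule Bochner_Integration.integrable_bound [OF a meas [OF bs]])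
  qed
  let ?F = "\<lambda>bs x. \<integral>t. partial_derivs bs (g t) x \<partial>M"
  have deriv: "(?F bs has_derivative (\<lambda>h. \<Sum>b\<in>Basis. (h \<bullet> b) *\<^sub>R ?F (b # bs) x)) (at x)"
    if bs: "bs \<in> lists Basis" for bs x
    unfolding partial_derivs_Cons
  proof (rule integral_has_derivative)
    fix b c :: 'a and r assume b: "b \<in> Basis" "c \<in> Basis"
    show "\<exists>a. integrable M a \<and>
       (\<forall>t\<in>space M. \<forall>x. norm x \<le> r \<longrightarrow> cmod (partial_deriv c (partial_deriv b (partial_derivs bs (g t))) x) \<le> a t)"
      using dom [of "c # b # bs"] b bs by simp
  next
    show "partial_derivs bs (g t) \<in> smooth_space" if "t \<in> space M" for t
      using that bs by (intro partial_derivs_smooth smooth)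
    show "integrable M (\<lambda>t. partial_derivs bs (g t) x)" for x using bs by (rule int)
    show "integrable M (\<lambda>t. partial_deriv b (partial_derivs bs (g t)) x)" if "b \<in> Basis" for b x
      using int [of "b # bs"] bs that by simp
  qed
  have pd: "partial_deriv b (?F bs) = ?F (b # bs)" if "bs \<in> lists Basis" "b \<in> Basis" for bs b
  proof
    fix x
    have "partial_deriv b (?F bs) x = (\<Sum>c\<in>Basis. (b \<bullet> c) *\<^sub>R ?F (c # bs) x)"
      by (rule partial_derivI [OF deriv [OF that(1)]])
    then show "partial_deriv b (?F bs) x = ?F (b # bs) x"
      by (simp only: sum_inner_Basis [OF that(2)])
  qed
  have "?F [] \<in> smooth_space"
  proof (rule smooth_space_coinduct [of _ "?F ` lists Basis"])
    fix h x assume "h \<in> ?F ` lists Basis"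
    then obtain bs where bs: "bs \<in> lists Basis" and h: "h = ?F bs" by blast
    show "h differentiable at x" unfolding h differentiable_def by (rule exI, rule deriv [OF bs])
  next
    fix h and b :: 'a assume "h \<in> ?F ` lists Basis" and b: "b \<in> Basis"
    then obtain bs where bs: "bs \<in> lists Basis" and h: "h = ?F bs" by blast
    show "partial_deriv b h \<in> ?F ` lists Basis"
      unfolding h pd [OF bs b] by (rule imageI) (use bs b in auto)
  qed (rule imageI, simp)
  then show "(\<lambda>x. \<integral>t. g t x \<partial>M) \<in> smooth_space" by simp
  show "partial_derivs bs (\<lambda>x. \<integral>t. g t x \<partial>M) = ?F bs" if "bs \<in> lists Basis"
    using that
  proof (induction bs)
    case (Cons b bs)
    then have "partial_derivs bs (\<lambda>x. \<integral>t. g t x \<partial>M) = ?F bs" by auto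
    with pd [of bs b] Cons.hyps show ?case by simp
  qed simp
qed

section \<open>Schwartz functions\<close>

text \<open>One index limits both the weight and the order of differentiation. These norms increase
  with \<open>M\<close> and eventually dominate each \<open>schwartz_seminorm\<close>, so continuity
  of a linear map becomes a bound by a single norm.\<close>

definition schwartz_norm :: "nat \<Rightarrow> ('a::euclidean_space \<Rightarrow> complex) \<Rightarrow> real" where
  "schwartz_norm M f = (\<Sum>bs | set bs \<subseteq> Basis \<and> length bs \<le> M. schwartz_seminorm M bs f)"

abbreviation multi_indices :: "'a::euclidean_space itself \<Rightarrow> nat \<Rightarrow> 'a list set" where
  "multi_indices _ M \<equiv> {bs. set bs \<subseteq> Basis \<and> length bs \<le> M}"

lemma finite_multi_indices [simp]: "finite (multi_indices TYPE('a::euclidean_space) M)"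
  by (rule finite_lists_length_le) simp

text \<open>The factor \<open>2 ^ length bs\<close> is the number of terms in
  \<open>splits bs\<close>.\<close>

lemma leibniz_bound:
  fixes f g :: "'a::euclidean_space \<Rightarrow> complex"
  assumes f: "f \<in> smooth_space" and g: "g \<in> smooth_space" and bs: "bs \<in> lists Basis"
    and F: "\<And>c. c \<in> lists Basis \<Longrightarrow> length c \<le> length bs \<Longrightarrow> cmod (partial_derivs c f z) \<le> F"
    and G: "\<And>c. c \<in> lists Basis \<Longrightarrow> length c \<le> length bs \<Longrightarrow> cmod (partial_derivs c g z) \<le> G"
  shows "cmod (partial_derivs bs (\<lambda>x. f x * g x) z) \<le> 2 ^ length bs * (F * G)"
proof -
  have F0: "0 \<le> F" by (rule order_trans [OF norm_ge_zero F [of "[]"]]) auto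
  have "cmod (\<Sum>(c, d)\<leftarrow>ps. partial_derivs c f z * partial_derivs d g z) \<le> length ps * (F * G)"
    if "\<forall>(c, d)\<in>set ps. c \<in> lists Basis \<and> d \<in> lists Basis \<and> length c \<le> length bs \<and> length d \<le> length bs" for ps
    using that
  proof (induction ps)
    case (Cons p ps)
    obtain c d where p: "p = (c, d)" by fastforce
    have "cmod (partial_derivs c f z * partial_derivs d g z) \<le> F * G"
      unfolding norm_mult by (rule mult_mono) (use Cons.prems p F0 in \<open>simp_all add: F G\<close>)
    moreover have "cmod (\<Sum>(c, d)\<leftarrow>ps. partial_derivs c f z * partial_derivs d g z) \<le> length ps * (F * G)"
      using Cons by simp
    ultimately have "cmod (partial_derivs c f z * partial_derivs d g z + (\<Sum>(c, d)\<leftarrow>ps. partial_derivs c f z * partial_derivs d g z))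
        \<le> F * G + length ps * (F * G)"
      by (intro order_trans [OF norm_triangle_ineq] add_mono)
    then show ?case by (simp add: p algebra_simps)
  qed simp
  moreover have "\<forall>(c, d)\<in>set (splits bs). c \<in> lists Basis \<and> d \<in> lists Basis \<and> length c \<le> length bs \<and> length d \<le> length bs"
  proof clarify
    fix c d assume "(c, d) \<in> set (splits bs)"
    from splits_props [OF this] bs
    show "c \<in> lists Basis \<and> d \<in> lists Basis \<and> length c \<le> length bs \<and> length d \<le> length bs"
      unfolding lists_eq_set by blast
  qed
  ultimately have "cmod (\<Sum>(c, d)\<leftarrow>splits bs. partial_derivs c f z * partial_derivs d g z) \<le> length (splits bs) * (F * G)"
    by blast
  then show ?thesis by (simp only: leibniz [OF f g bs] length_splits of_nat_power of_nat_numeral)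
qed

lemma schwartz_smooth: "f \<in> schwartz_space \<Longrightarrow> f \<in> smooth_space"
  by (simp add: schwartz_space_def)

lemma schwartz_bdd:
  "f \<in> schwartz_space \<Longrightarrow> bs \<in> lists Basis \<Longrightarrow>
    bdd_above (range (\<lambda>x. (1 + norm x) ^ N * cmod (partial_derivs bs f x)))"
  by (simp add: schwartz_space_def)

lemma schwartz_seminorm_upper:
  "f \<in> schwartz_space \<Longrightarrow> bs \<in> lists Basis \<Longrightarrow>
    (1 + norm x) ^ N * cmod (partial_derivs bs f x) \<le> schwartz_seminorm N bs f"
  unfolding schwartz_seminorm_def by (rule cSUP_upper [OF _ schwartz_bdd]) auto

lemma schwartz_seminorm_least:
  "(\<And>x. (1 + norm x) ^ N * cmod (partial_derivs bs f x) \<le> C) \<Longrightarrow> schwartz_seminorm N bs f \<le> C"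
  unfolding schwartz_seminorm_def by (rule cSUP_least) auto

lemma schwartz_seminorm_nonneg:
  assumes "f \<in> schwartz_space" "bs \<in> lists Basis"
  shows "0 \<le> schwartz_seminorm N bs f"
proof -
  have "0 \<le> (1 + norm 0) ^ N * cmod (partial_derivs bs f 0)" by simp
  also note schwartz_seminorm_upper [OF assms]
  finally show ?thesis .
qed

lemma schwartz_spaceI:
  assumes "f \<in> smooth_space"
    and "\<And>bs N. bs \<in> lists Basis \<Longrightarrow> \<exists>C. \<forall>x. (1 + norm x) ^ N * cmod (partial_derivs bs f x) \<le> C"
  shows "f \<in> schwartz_space"
  using assms unfolding schwartz_space_def bdd_above_def by fastforce

lemma schwartz_norm_nonneg: "f \<in> schwartz_space \<Longrightarrow> 0 \<le> schwartz_norm M f"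
  unfolding schwartz_norm_def by (intro sum_nonneg schwartz_seminorm_nonneg) (auto simp: lists_eq_set)

lemma schwartz_seminorm_le_norm:
  assumes "f \<in> schwartz_space" "bs \<in> lists Basis" "N \<le> M" "length bs \<le> M"
  shows "schwartz_seminorm N bs f \<le> schwartz_norm M f"
proof -
  have "schwartz_seminorm N bs f \<le> schwartz_seminorm M bs f"
  proof (rule schwartz_seminorm_least)
    fix x
    have "(1 + norm x) ^ N * cmod (partial_derivs bs f x) \<le> (1 + norm x) ^ M * cmod (partial_derivs bs f x)"
      using assms(3) by (intro mult_right_mono power_increasing) auto
    also have "\<dots> \<le> schwartz_seminorm M bs f" by (rule schwartz_seminorm_upper [OF assms(1,2)])
    finally show "(1 + norm x) ^ N * cmod (partial_derivs bs f x) \<le> schwartz_seminorm M bs f" .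
  qed
  also have "\<dots> \<le> schwartz_norm M f"
    unfolding schwartz_norm_def using assms
    by (intro member_le_sum schwartz_seminorm_nonneg) (auto simp: lists_eq_set)
  finally show ?thesis .
qed

lemma schwartz_norm_upper:
  assumes "f \<in> schwartz_space" "bs \<in> lists Basis" "length bs \<le> M" "N \<le> M"
  shows "(1 + norm x) ^ N * cmod (partial_derivs bs f x) \<le> schwartz_norm M f"
  using schwartz_seminorm_upper [OF assms(1,2)] schwartz_seminorm_le_norm [OF assms(1,2,4,3)]
  by (rule order_trans)

lemma schwartz_norm_least:
  fixes f :: "'a::euclidean_space \<Rightarrow> complex"
  assumes "\<And>bs x. bs \<in> lists Basis \<Longrightarrow> length bs \<le> M \<Longrightarrow> (1 + norm x) ^ M * cmod (partial_derivs bs f x) \<le> C"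
  shows "schwartz_norm M f \<le> real (card (multi_indices TYPE('a) M)) * C"
  unfolding schwartz_norm_def
  by (rule order_trans [OF sum_bounded_above [where K = C]])
     (auto intro!: schwartz_seminorm_least assms simp: lists_eq_set)

lemma schwartz_norm_mono:
  fixes f :: "'a::euclidean_space \<Rightarrow> complex"
  assumes f: "f \<in> schwartz_space" and "M \<le> M'"
  shows "schwartz_norm M f \<le> schwartz_norm M' f"
  unfolding schwartz_norm_def
proof (rule order_trans [OF sum_mono sum_mono2])
  fix bs :: "'a list" assume "bs \<in> {bs. set bs \<subseteq> Basis \<and> length bs \<le> M}"
  then have bs: "bs \<in> lists Basis" by auto
  show "schwartz_seminorm M bs f \<le> schwartz_seminorm M' bs f"
  proof (rule schwartz_seminorm_least)
    fix x
    have "(1 + norm x) ^ M * cmod (partial_derivs bs f x) \<le> (1 + norm x) ^ M' * cmod (partial_derivs bs f x)"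
      using assms(2) by (intro mult_right_mono power_increasing) auto
    also have "\<dots> \<le> schwartz_seminorm M' bs f" by (rule schwartz_seminorm_upper [OF f bs])
    finally show "(1 + norm x) ^ M * cmod (partial_derivs bs f x) \<le> schwartz_seminorm M' bs f" .
  qed
qed (use assms in \<open>auto intro!: schwartz_seminorm_nonneg\<close>)

lemma schwartz_add:
  assumes f: "f \<in> schwartz_space" and g: "g \<in> schwartz_space"
  shows "(\<lambda>x. f x + g x) \<in> schwartz_space"
    and "schwartz_norm M (\<lambda>x. f x + g x) \<le> schwartz_norm M f + schwartz_norm M g"
proof -
  note fs = schwartz_smooth [OF f] and gs = schwartz_smooth [OF g]
  have le: "(1 + norm x) ^ N * cmod (partial_derivs bs (\<lambda>x. f x + g x) x) \<le> schwartz_seminorm N bs f + schwartz_seminorm N bs g"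
    if bs: "bs \<in> lists Basis" for bs N x
  proof -
    have "(1 + norm x) ^ N * cmod (partial_derivs bs (\<lambda>x. f x + g x) x)
      \<le> (1 + norm x) ^ N * (cmod (partial_derivs bs f x) + cmod (partial_derivs bs g x))"
      unfolding partial_derivs_add [OF fs gs bs] by (intro mult_left_mono norm_triangle_ineq) auto
    then show ?thesis
      using schwartz_seminorm_upper [OF f bs, of x N] schwartz_seminorm_upper [OF g bs, of x N]
      by (simp add: distrib_left)
  qed
  show "(\<lambda>x. f x + g x) \<in> schwartz_space"
    using le by (intro schwartz_spaceI smooth_add fs gs) blast
  show "schwartz_norm M (\<lambda>x. f x + g x) \<le> schwartz_norm M f + schwartz_norm M g"
    unfolding schwartz_norm_def sum.distrib [symmetric]
    by (intro sum_mono schwartz_seminorm_least le) auto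
qed

lemma schwartz_cmult:
  assumes f: "f \<in> schwartz_space"
  shows "(\<lambda>x. c * f x) \<in> schwartz_space"
    and "schwartz_norm M (\<lambda>x. c * f x) \<le> cmod c * schwartz_norm M f"
proof -
  note fs = schwartz_smooth [OF f]
  have le: "(1 + norm x) ^ N * cmod (partial_derivs bs (\<lambda>x. c * f x) x) \<le> cmod c * schwartz_seminorm N bs f"
    if bs: "bs \<in> lists Basis" for bs N x
    using mult_left_mono [OF schwartz_seminorm_upper [OF f bs, of x N], of "cmod c"]
    by (simp add: partial_derivs_cmult [OF fs bs] norm_mult mult_ac)
  show "(\<lambda>x. c * f x) \<in> schwartz_space"
    using le by (intro schwartz_spaceI smooth_cmult fs) blast
  show "schwartz_norm M (\<lambda>x. c * f x) \<le> cmod c * schwartz_norm M f"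
    unfolding schwartz_norm_def sum_distrib_left
    by (intro sum_mono schwartz_seminorm_least le) auto
qed

lemma schwartz_zero [simp]: "(\<lambda>x. 0) \<in> schwartz_space"
  by (rule schwartz_spaceI) (auto simp: partial_derivs_zero)

lemma schwartz_norm_zero [simp]: "schwartz_norm M (\<lambda>x. 0) = 0"
  by (simp add: schwartz_norm_def schwartz_seminorm_def partial_derivs_zero)

lemma schwartz_diff:
  assumes f: "f \<in> schwartz_space" and g: "g \<in> schwartz_space"
  shows "(\<lambda>x. f x - g x) \<in> schwartz_space"
    and "schwartz_norm M (\<lambda>x. f x - g x) \<le> schwartz_norm M f + schwartz_norm M g"
  using schwartz_add [OF f schwartz_cmult(1) [OF g, of "-1"]] schwartz_cmult(2) [OF g, of M "-1"]
    by (auto intro: order_trans add_left_mono)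

lemma schwartz_sum:
  "(\<And>i. i \<in> I \<Longrightarrow> f i \<in> schwartz_space) \<Longrightarrow> (\<lambda>x. \<Sum>i\<in>I. f i x) \<in> schwartz_space"
  by (induction I rule: infinite_finite_induct) (auto intro: schwartz_add)

lemma schwartz_partial_deriv:
  fixes f :: "'a::euclidean_space \<Rightarrow> complex"
  assumes f: "f \<in> schwartz_space" and b: "b \<in> Basis"
  shows "partial_deriv b f \<in> schwartz_space"
    and "schwartz_norm M (partial_deriv b f) \<le> real (card (multi_indices TYPE('a) M)) * schwartz_norm (Suc M) f"
proof -
  have eq: "partial_derivs bs (partial_deriv b f) = partial_derivs (bs @ [b]) f" for bs
    by (simp add: partial_derivs_append)
  have "\<exists>C. \<forall>x. (1 + norm x) ^ N * cmod (partial_derivs bs (partial_deriv b f) x) \<le> C"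
    if "bs \<in> lists Basis" for bs N
    unfolding eq by (intro exI allI, rule schwartz_seminorm_upper [OF f]) (use that b in auto)
  then show "partial_deriv b f \<in> schwartz_space"
    by (rule schwartz_spaceI [OF partial_deriv_smooth [OF schwartz_smooth [OF f] b]])
  show "schwartz_norm M (partial_deriv b f) \<le> real (card (multi_indices TYPE('a) M)) * schwartz_norm (Suc M) f"
    by (rule schwartz_norm_least, unfold eq, rule schwartz_norm_upper) (use f b in auto)
qed

text \<open>Peetre's inequality in its elementary form, the source of all weight estimates under
  translation.\<close>

lemma norm_weight_mult: "1 + norm (x + y :: 'a::real_normed_vector) \<le> (1 + norm x) * (1 + norm y)"
proof -
  have "(1 + norm x) * (1 + norm y) = 1 + norm x + norm y + norm x * norm y" by (simp add: algebra_simps)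
  with norm_triangle_ineq [of x y] mult_nonneg_nonneg [OF norm_ge_zero [of x] norm_ge_zero [of y]]
  show ?thesis by linarith
qed

lemma norm_weight_power_mult:
  "(1 + norm (x + y :: 'a::real_normed_vector)) ^ N \<le> (1 + norm x) ^ N * (1 + norm y) ^ N"
  using power_mono [OF norm_weight_mult [of x y], of N] by (simp add: power_mult_distrib)

text \<open>The dependence on the frequency is kept explicit, one factor \<open>1 + norm v\<close>
  per derivative: \<open>v\<close> will run through a lattice and the bounds will have to be
  summed.\<close>

lemma schwartz_twist_deriv:
  fixes B :: "'a::euclidean_space \<Rightarrow> 'b::euclidean_space"
  assumes B: "bounded_linear B"
  shows "\<exists>K\<ge>0. \<forall>v. \<forall>b\<in>Basis. \<forall>\<Phi>\<in>schwartz_space. twist_deriv v B b \<Phi> \<in> schwartz_space \<and>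
     schwartz_norm M (twist_deriv v B b \<Phi>) \<le> K * (1 + norm v) * schwartz_norm (Suc M) \<Phi>"
proof -
  define k where "k = real (card (multi_indices TYPE('b) M))"
  define K where "K = 1 + DIM('b) * onorm B * k"
  have sum_le: "(\<lambda>y. \<Sum>c\<in>C. complex_of_real (B b \<bullet> c) * partial_deriv c \<Phi> y) \<in> schwartz_space \<and>
    schwartz_norm M (\<lambda>y. \<Sum>c\<in>C. complex_of_real (B b \<bullet> c) * partial_deriv c \<Phi> y) \<le> real (card C) * (onorm B * (k * schwartz_norm (Suc M) \<Phi>))"
    if "finite C" "C \<subseteq> Basis" and b: "b \<in> Basis" and \<Phi>: "\<Phi> \<in> schwartz_space" for C b \<Phi>
    using that(1,2)
  proof (induction C)
    case (insert c C)
    have c: "c \<in> Basis" using insert by auto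
    note S = schwartz_partial_deriv [OF \<Phi> c]
    note T = schwartz_cmult [OF S(1), where c = "complex_of_real (B b \<bullet> c)"]
    have "\<bar>B b \<bullet> c\<bar> \<le> onorm B"
      using Basis_le_norm [OF c, of "B b"] onorm [OF B, of b] b by simp
    then have 1: "schwartz_norm M (\<lambda>y. complex_of_real (B b \<bullet> c) * partial_deriv c \<Phi> y) \<le> onorm B * (k * schwartz_norm (Suc M) \<Phi>)"
      using S(2) [of M] unfolding k_def
      by (intro order_trans [OF T(2)] mult_mono) (auto simp: schwartz_norm_nonneg S onorm_pos_le B)
    let ?g = "\<lambda>y. \<Sum>c\<in>C. complex_of_real (B b \<bullet> c) * partial_deriv c \<Phi> y"
    have IH: "?g \<in> schwartz_space" "schwartz_norm M ?g \<le> real (card C) * (onorm B * (k * schwartz_norm (Suc M) \<Phi>))"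
      using insert by auto
    have "schwartz_norm M (\<lambda>y. complex_of_real (B b \<bullet> c) * partial_deriv c \<Phi> y + ?g y)
        \<le> onorm B * (k * schwartz_norm (Suc M) \<Phi>) + real (card C) * (onorm B * (k * schwartz_norm (Suc M) \<Phi>))"
      by (rule order_trans [OF schwartz_add(2) [OF T(1) IH(1)] add_mono [OF 1 IH(2)]])
    then show ?case
      using insert.hyps schwartz_add(1) [OF T(1) IH(1)] by (simp add: distrib_right)
  qed auto
  have "twist_deriv v B b \<Phi> \<in> schwartz_space \<and>
     schwartz_norm M (twist_deriv v B b \<Phi>) \<le> K * (1 + norm v) * schwartz_norm (Suc M) \<Phi>"
    if b: "b \<in> Basis" and \<Phi>: "\<Phi> \<in> schwartz_space" for v b \<Phi>
  proof
    note S = sum_le [OF finite_Basis subset_refl b \<Phi>]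
    note T = schwartz_cmult [OF \<Phi>, where c = "\<i> * of_real (b \<bullet> v)"]
    show "twist_deriv v B b \<Phi> \<in> schwartz_space"
      unfolding twist_deriv_def using S T by (intro schwartz_add) auto
    let ?q = "schwartz_norm (Suc M) \<Phi>"
    have q: "0 \<le> ?q" by (rule schwartz_norm_nonneg [OF \<Phi>])
    have "schwartz_norm M (\<lambda>y. \<i> * of_real (b \<bullet> v) * \<Phi> y) \<le> norm v * ?q"
      using Basis_le_norm [OF b, of v] schwartz_norm_mono [OF \<Phi>, of M "Suc M"]
      by (intro order_trans [OF T(2)] mult_mono) (auto simp: norm_mult inner_commute schwartz_norm_nonneg \<Phi>)
    then have "schwartz_norm M (twist_deriv v B b \<Phi>) \<le> norm v * ?q + DIM('b) * (onorm B * (k * ?q))"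
      unfolding twist_deriv_def using S by (intro order_trans [OF schwartz_add(2)] add_mono T) auto
    also have "\<dots> \<le> K * (1 + norm v) * ?q"
    proof -
      have "0 \<le> DIM('b) * (onorm B * k) * norm v" "0 \<le> (1::real)"
        by (auto simp: onorm_pos_le [OF B] k_def)
      from mult_right_mono [OF this(1) q] show ?thesis
        using q by (simp add: K_def algebra_simps)
    qed
    finally show "schwartz_norm M (twist_deriv v B b \<Phi>) \<le> K * (1 + norm v) * ?q" .
  qed
  moreover have "0 \<le> K" by (simp add: K_def k_def onorm_pos_le [OF B])
  ultimately show ?thesis by blast
qed

text \<open>Each derivative raises the order of the norm by one. The induction hypothesis is
  therefore used at \<open>Suc M\<close>, which is why \<open>M\<close> is generalized.\<close>

lemma schwartz_twist_derivs:
  fixes B :: "'a::euclidean_space \<Rightarrow> 'b::euclidean_space"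
  assumes B: "bounded_linear B"
  shows "\<exists>K\<ge>0. \<forall>v bs. \<forall>\<Phi>\<in>schwartz_space. bs \<in> lists Basis \<longrightarrow> length bs = n \<longrightarrow>
     foldr (twist_deriv v B) bs \<Phi> \<in> schwartz_space \<and>
     schwartz_norm M (foldr (twist_deriv v B) bs \<Phi>) \<le> K * (1 + norm v) ^ n * schwartz_norm (M + n) \<Phi>"
proof (induction n arbitrary: M)
  case 0
  show ?case by (rule exI [of _ 1]) auto
next
  case (Suc n)
  obtain K1 where K1: "0 \<le> K1" and K1': "\<And>v b \<Phi>. b \<in> Basis \<Longrightarrow> \<Phi> \<in> schwartz_space \<Longrightarrow> twist_deriv v B b \<Phi> \<in> schwartz_space \<and>
     schwartz_norm M (twist_deriv v B b \<Phi>) \<le> K1 * (1 + norm v) * schwartz_norm (Suc M) \<Phi>"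
    using schwartz_twist_deriv [OF B, of M] by blast
  obtain K2 where K2: "0 \<le> K2" and K2': "\<And>v bs \<Phi>. \<Phi> \<in> schwartz_space \<Longrightarrow> bs \<in> lists Basis \<Longrightarrow> length bs = n \<Longrightarrow>
     foldr (twist_deriv v B) bs \<Phi> \<in> schwartz_space \<and>
     schwartz_norm (Suc M) (foldr (twist_deriv v B) bs \<Phi>) \<le> K2 * (1 + norm v) ^ n * schwartz_norm (Suc M + n) \<Phi>"
    using Suc.IH [of "Suc M"] by blast
  have "foldr (twist_deriv v B) bs \<Phi> \<in> schwartz_space \<and>
     schwartz_norm M (foldr (twist_deriv v B) bs \<Phi>) \<le> K1 * K2 * (1 + norm v) ^ Suc n * schwartz_norm (M + Suc n) \<Phi>"
    if \<Phi>: "\<Phi> \<in> schwartz_space" and bs: "bs \<in> lists Basis" "length bs = Suc n" for v bs \<Phi>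
  proof -
    obtain b cs where bs': "bs = b # cs" "b \<in> Basis" "cs \<in> lists Basis" "length cs = n"
      using bs by (cases bs) auto
    let ?\<Psi> = "foldr (twist_deriv v B) cs \<Phi>"
    have "schwartz_norm M (twist_deriv v B b ?\<Psi>) \<le> K1 * (1 + norm v) * schwartz_norm (Suc M) ?\<Psi>"
      using K1' K2' \<Phi> bs' by blast
    also have "\<dots> \<le> K1 * (1 + norm v) * (K2 * (1 + norm v) ^ n * schwartz_norm (Suc M + n) \<Phi>)"
      using K2' [OF \<Phi> bs'(3,4)] K1 by (intro mult_left_mono) auto
    finally show ?thesis using K1' [OF bs'(2)] K2' [OF \<Phi> bs'(3,4)] bs'(1) by (simp add: mult_ac)
  qed
  moreover have "0 \<le> K1 * K2" using K1 K2 by simp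
  ultimately show ?case by blast
qed

text \<open>The exponential has modulus 1, so only the values of the iterated
  \<open>twist_deriv\<close> at \<open>B z + l\<close> matter. The weight is taken at that point and
  not at \<open>z\<close> because \<open>B\<close> may have a kernel, as \<open>fst\<close>
  does.\<close>

lemma exp_twist_bound:
  fixes B :: "'a::euclidean_space \<Rightarrow> 'b::euclidean_space"
  assumes B: "bounded_linear B"
  shows "\<exists>K\<ge>0. \<forall>v l bs z. \<forall>\<Phi>\<in>schwartz_space. bs \<in> lists Basis \<longrightarrow> length bs \<le> n \<longrightarrow>
     (1 + norm (B z + l)) ^ M * cmod (partial_derivs bs (exp_twist v B l \<Phi>) z)
       \<le> K * (1 + norm v) ^ n * schwartz_norm (M + n) \<Phi>"
proof -
  define P where "P = (\<lambda>K k. \<forall>v bs. \<forall>\<Phi>\<in>schwartz_space. bs \<in> lists Basis \<longrightarrow> length bs = k \<longrightarrow>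
     foldr (twist_deriv v B) bs \<Phi> \<in> schwartz_space \<and>
     schwartz_norm M (foldr (twist_deriv v B) bs \<Phi>) \<le> K * (1 + norm v) ^ k * schwartz_norm (M + k) \<Phi>)"
  have "\<forall>k. \<exists>K\<ge>0. P K k" unfolding P_def using schwartz_twist_derivs [OF B] by blast
  then obtain K where K: "\<And>k. 0 \<le> K k" and "\<And>k. P (K k) k" by metis
  then have K': "foldr (twist_deriv v B) bs \<Phi> \<in> schwartz_space \<and>
     schwartz_norm M (foldr (twist_deriv v B) bs \<Phi>) \<le> K k * (1 + norm v) ^ k * schwartz_norm (M + k) \<Phi>"
    if "\<Phi> \<in> schwartz_space" "bs \<in> lists Basis" "length bs = k" for k v bs \<Phi>
    using that unfolding P_def by blast
  have "(1 + norm (B z + l)) ^ M * cmod (partial_derivs bs (exp_twist v B l \<Phi>) z)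
       \<le> (\<Sum>k\<le>n. K k) * (1 + norm v) ^ n * schwartz_norm (M + n) \<Phi>"
    if \<Phi>: "\<Phi> \<in> schwartz_space" and bs: "bs \<in> lists Basis" "length bs \<le> n" for v l bs z \<Phi>
  proof -
    let ?\<Psi> = "foldr (twist_deriv v B) bs \<Phi>"
    note D = K' [OF \<Phi> bs(1) refl, of v]
    have "cmod (partial_derivs bs (exp_twist v B l \<Phi>) z) = cmod (?\<Psi> (B z + l))"
      unfolding partial_derivs_exp_twist [OF schwartz_smooth [OF \<Phi>] B] by (simp add: exp_twist_def norm_mult)
    then have "(1 + norm (B z + l)) ^ M * cmod (partial_derivs bs (exp_twist v B l \<Phi>) z) \<le> schwartz_norm M ?\<Psi>"
      using schwartz_norm_upper [of ?\<Psi> "[]" M M "B z + l"] D by simp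
    also have "\<dots> \<le> K (length bs) * (1 + norm v) ^ length bs * schwartz_norm (M + length bs) \<Phi>"
      using D by blast
    also have "\<dots> \<le> (\<Sum>k\<le>n. K k) * (1 + norm v) ^ n * schwartz_norm (M + n) \<Phi>"
      using bs(2) K
      by (intro mult_mono power_increasing schwartz_norm_mono \<Phi> member_le_sum)
         (auto intro!: mult_nonneg_nonneg sum_nonneg schwartz_norm_nonneg \<Phi>)
    finally show ?thesis .
  qed
  moreover have "0 \<le> (\<Sum>k\<le>n. K k)" using K by (simp add: sum_nonneg)
  ultimately show ?thesis by blast
qed

text \<open>Peetre's inequality for \<open>x + l\<close> and \<open>- l\<close>: weight is moved
  back from a shifted point at a cost depending on the shift only.\<close>

lemma norm_weight_divide:
  fixes x l :: "'a::real_normed_vector"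
  shows "(1 + norm x) ^ N \<le> (1 + norm l) ^ N * (1 + norm (x + l)) ^ N"
  using norm_weight_power_mult [of "x + l" "- l" N] by (simp add: mult.commute)

text \<open>In each term of the product rule, the surplus weight \<open>m\<close> demanded of
  \<open>f\<close> absorbs the polynomial growth of the derivatives of \<open>g\<close>.\<close>

lemma schwartz_mult_bound:
  assumes f: "f \<in> schwartz_space" and g: "g \<in> smooth_space" and bs: "bs \<in> lists Basis" "length bs \<le> M"
    and G: "\<And>c. c \<in> lists Basis \<Longrightarrow> length c \<le> M \<Longrightarrow> cmod (partial_derivs c g z) \<le> A * (1 + norm z) ^ m"
  shows "(1 + norm z) ^ M * cmod (partial_derivs bs (\<lambda>z. f z * g z) z) \<le> 2 ^ M * A * schwartz_norm (M + m) f"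
proof -
  let ?q = "schwartz_norm (M + m) f" and ?w = "1 + norm z"
  have w: "?w > 0" by (simp add: add_pos_nonneg)
  have A0: "0 \<le> A" 
  proof -
    have "0 \<le> A * ?w ^ m" by (rule order_trans [OF norm_ge_zero G [of "[]"]]) auto
    then show ?thesis using zero_less_power [OF w, of m] by (auto simp: zero_le_mult_iff)
  qed
  have "cmod (partial_derivs bs (\<lambda>z. f z * g z) z) \<le> 2 ^ length bs * (?q / ?w ^ (M + m) * (A * ?w ^ m))"
  proof (rule leibniz_bound [OF schwartz_smooth [OF f] g bs(1)])
    fix c :: "'a list" assume c: "c \<in> lists Basis" "length c \<le> length bs"
    then show "cmod (partial_derivs c g z) \<le> A * ?w ^ m" using bs by (intro G) auto
    have "?w ^ (M + m) * cmod (partial_derivs c f z) \<le> ?q"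
      by (rule schwartz_norm_upper [OF f]) (use c bs in auto)
    then show "cmod (partial_derivs c f z) \<le> ?q / ?w ^ (M + m)"
      using w by (simp add: pos_le_divide_eq mult.commute)
  qed
  also have "\<dots> \<le> 2 ^ M * (?q / ?w ^ (M + m) * (A * ?w ^ m))"
    using bs(2) A0 w schwartz_norm_nonneg [OF f, of "M + m"]
    by (intro mult_right_mono power_increasing mult_nonneg_nonneg divide_nonneg_nonneg) auto
  also have "\<dots> = 2 ^ M * A * ?q / ?w ^ M" using w by (simp add: power_add field_simps)
  finally show ?thesis using w by (simp add: pos_le_divide_eq mult.commute)
qed

lemma schwartz_mult:
  assumes f: "f \<in> schwartz_space" and g: "g \<in> smooth_space"
    and G: "\<And>M. \<exists>A m. \<forall>z. \<forall>c\<in>lists Basis. length c \<le> M \<longrightarrow> cmod (partial_derivs c g z) \<le> A * (1 + norm z) ^ m"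
  shows "(\<lambda>z. f z * g z) \<in> schwartz_space"
proof (rule schwartz_spaceI [OF smooth_mult [OF schwartz_smooth [OF f] g]])
  fix bs :: "'a list" and N assume bs: "bs \<in> lists Basis"
  define M where "M = max N (length bs)"
  obtain A m where Am: "\<And>z c. c \<in> lists Basis \<Longrightarrow> length c \<le> M \<Longrightarrow> cmod (partial_derivs c g z) \<le> A * (1 + norm z) ^ m"
    using G [of M] by blast
  have "(1 + norm z) ^ N * cmod (partial_derivs bs (\<lambda>z. f z * g z) z) \<le> 2 ^ M * A * schwartz_norm (M + m) f" for z
  proof (rule order_trans [OF mult_right_mono schwartz_mult_bound [OF f g bs]])
    show "(1 + norm z) ^ N \<le> (1 + norm z) ^ M" by (rule power_increasing) (auto simp: M_def)
  qed (use Am in \<open>auto simp: M_def\<close>)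
  then show "\<exists>C. \<forall>z. (1 + norm z) ^ N * cmod (partial_derivs bs (\<lambda>z. f z * g z) z) \<le> C" by blast
qed

text \<open>For \<open>B\<close> the identity the weight can be moved from \<open>z + l\<close> to
  \<open>z\<close>. The cost is polynomial in the shift as well as in the frequency.\<close>

lemma schwartz_exp_twist:
  fixes M :: nat
  shows "\<exists>K\<ge>0. \<forall>v l. \<forall>\<Phi>\<in>(schwartz_space :: ('a::euclidean_space \<Rightarrow> complex) set).
     exp_twist v (\<lambda>z. z) l \<Phi> \<in> schwartz_space \<and>
     schwartz_norm M (exp_twist v (\<lambda>z. z) l \<Phi>) \<le> K * (1 + norm v) ^ M * (1 + norm l) ^ M * schwartz_norm (M + M) \<Phi>"
proof -
  have B: "bounded_linear (\<lambda>z::'a. z)" by (rule bounded_linear_ident)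
  have est: "(1 + norm z) ^ M * cmod (partial_derivs bs (exp_twist v (\<lambda>z. z) l \<Phi>) z)
       \<le> (1 + norm l) ^ M * (K * (1 + norm v) ^ n * schwartz_norm (M + n) \<Phi>)"
    if "(1 + norm (z + l)) ^ M * cmod (partial_derivs bs (exp_twist v (\<lambda>z. z) l \<Phi>) z)
       \<le> K * (1 + norm v) ^ n * schwartz_norm (M + n) \<Phi>" for bs M n K v l z and \<Phi> :: "'a \<Rightarrow> complex"
  proof -
    have "(1 + norm z) ^ M * cmod (partial_derivs bs (exp_twist v (\<lambda>z. z) l \<Phi>) z)
      \<le> ((1 + norm l) ^ M * (1 + norm (z + l)) ^ M) * cmod (partial_derivs bs (exp_twist v (\<lambda>z. z) l \<Phi>) z)"
      by (intro mult_right_mono norm_weight_divide) auto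
    also have "\<dots> \<le> (1 + norm l) ^ M * (K * (1 + norm v) ^ n * schwartz_norm (M + n) \<Phi>)"
      unfolding mult.assoc using that by (intro mult_left_mono) (auto simp: mult_ac)
    finally show ?thesis .
  qed
  have S: "exp_twist v (\<lambda>z. z) l \<Phi> \<in> schwartz_space" if \<Phi>: "\<Phi> \<in> schwartz_space" for v l and \<Phi> :: "'a \<Rightarrow> complex"
  proof (rule schwartz_spaceI [OF exp_twist_smooth [OF schwartz_smooth [OF \<Phi>] B]])
    fix bs :: "'a list" and N assume bs: "bs \<in> lists Basis"
    obtain K where "\<And>z. (1 + norm (z + l)) ^ N * cmod (partial_derivs bs (exp_twist v (\<lambda>z. z) l \<Phi>) z)
       \<le> K * (1 + norm v) ^ length bs * schwartz_norm (N + length bs) \<Phi>"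
      using exp_twist_bound [OF B, of "length bs" N] \<Phi> bs by blast
    from est [OF this] show "\<exists>C. \<forall>z. (1 + norm z) ^ N * cmod (partial_derivs bs (exp_twist v (\<lambda>z. z) l \<Phi>) z) \<le> C"
      by blast
  qed
  obtain K where K: "0 \<le> K" and K': "\<And>v l bs z \<Phi>. \<Phi> \<in> schwartz_space \<Longrightarrow> bs \<in> lists Basis \<Longrightarrow> length bs \<le> M \<Longrightarrow>
     (1 + norm (z + l)) ^ M * cmod (partial_derivs bs (exp_twist v (\<lambda>z. z) l \<Phi>) z)
       \<le> K * (1 + norm (v::'a)) ^ M * schwartz_norm (M + M) \<Phi>"
    using exp_twist_bound [OF B, of M M] by blast
  have "schwartz_norm M (exp_twist v (\<lambda>z. z) l \<Phi>)
      \<le> real (card (multi_indices TYPE('a) M)) * ((1 + norm l) ^ M * (K * (1 + norm v) ^ M * schwartz_norm (M + M) \<Phi>))"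
    if \<Phi>: "\<Phi> \<in> schwartz_space" for v l and \<Phi> :: "'a \<Rightarrow> complex"
    by (rule schwartz_norm_least, rule est, rule K' [OF \<Phi>])
  then show ?thesis
    using S K by (intro exI [of _ "real (card (multi_indices TYPE('a) M)) * K"]) (simp add: mult_ac)
qed

lemma exp_twist_in_schwartz: "\<Phi> \<in> schwartz_space \<Longrightarrow> exp_twist v (\<lambda>z. z) l \<Phi> \<in> schwartz_space"
  using schwartz_exp_twist by blast

lemma schwartz_translate: "\<Phi> \<in> schwartz_space \<Longrightarrow> (\<lambda>z. \<Phi> (z + l)) \<in> schwartz_space"
  using exp_twist_in_schwartz [of \<Phi> 0 l] by (simp add: exp_twist_def)

section \<open>Series of smooth and of Schwartz functions\<close>

lemma abs_summable_dominated:
  fixes f :: "'i \<Rightarrow> 'b::banach"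
  assumes "a summable_on I" "\<And>i. i \<in> I \<Longrightarrow> norm (f i) \<le> a i"
  shows "(\<lambda>i. norm (f i)) summable_on I" "f summable_on I" "norm (infsum f I) \<le> infsum a I"
proof -
  show 1: "(\<lambda>i. norm (f i)) summable_on I"
    by (rule summable_on_comparison_test [OF assms(1)]) (use assms(2) in auto)
  then show "f summable_on I" by (rule abs_summable_summable)
  have "norm (infsum f I) \<le> infsum (\<lambda>i. norm (f i)) I" by (rule norm_infsum_bound [OF 1])
  also have "\<dots> \<le> infsum a I" by (rule infsum_mono [OF 1 assms])
  finally show "norm (infsum f I) \<le> infsum a I" .
qed

text \<open>The sum is an integral over the counting measure, so \<open>smooth_integral\<close>
  differentiates it term by term. The work lies in passing between summability and integrability for
  that measure.\<close>

lemma smooth_infsum: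
  fixes g :: "'i \<Rightarrow> 'a::euclidean_space \<Rightarrow> complex"
  assumes smooth: "\<And>i. i \<in> I \<Longrightarrow> g i \<in> smooth_space"
    and dom: "\<And>bs r. bs \<in> lists Basis \<Longrightarrow> \<exists>a. a summable_on I \<and>
       (\<forall>i\<in>I. \<forall>x. norm x \<le> r \<longrightarrow> cmod (partial_derivs bs (g i) x) \<le> a i)"
  shows "(\<lambda>x. \<Sum>\<^sub>\<infinity>i\<in>I. g i x) \<in> smooth_space"
    and "bs \<in> lists Basis \<Longrightarrow> partial_derivs bs (\<lambda>x. \<Sum>\<^sub>\<infinity>i\<in>I. g i x) = (\<lambda>x. \<Sum>\<^sub>\<infinity>i\<in>I. partial_derivs bs (g i) x)"
proof -
  have eq: "(\<integral>i. partial_derivs bs (g i) x \<partial>count_space I) = (\<Sum>\<^sub>\<infinity>i\<in>I. partial_derivs bs (g i) x)"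
    if bs: "bs \<in> lists Basis" for bs x
  proof -
    obtain a where "a summable_on I" "\<forall>i\<in>I. cmod (partial_derivs bs (g i) x) \<le> a i"
      using dom [OF bs, of "norm x"] by auto
    then have "(\<lambda>i. cmod (partial_derivs bs (g i) x)) summable_on I"
      using abs_summable_dominated(1) [of a I "\<lambda>i. partial_derivs bs (g i) x"] by blast
    then have "Infinite_Set_Sum.abs_summable_on (\<lambda>i. partial_derivs bs (g i) x) I"
      by (simp add: abs_summable_equivalent)
    then show ?thesis using infsetsum_infsum by (metis infsetsum_def)
  qed
  have dom': "\<exists>a. integrable (count_space I) a \<and>
       (\<forall>i\<in>space (count_space I). \<forall>x. norm x \<le> r \<longrightarrow> cmod (partial_derivs bs (g i) x) \<le> a i)"
    if bs: "bs \<in> lists Basis" for bs r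
  \<comment> \<open>For negative \<open>r\<close> there is nothing to dominate and 0 serves.
    Otherwise the origin lies in the ball, which forces the given bounds to be nonnegative and hence
    absolutely summable.\<close>
  proof (cases "r < 0")
    case True
    then show ?thesis by (intro exI [of _ "\<lambda>_. 0"]) (auto simp: not_le [symmetric] dest: order_trans [OF norm_ge_zero])
  next
    case False
    obtain a where a: "a summable_on I" "\<forall>i\<in>I. \<forall>x. norm x \<le> r \<longrightarrow> cmod (partial_derivs bs (g i) x) \<le> a i"
      using dom [OF bs, of r] by auto
    have "0 \<le> a i" if "i \<in> I" for i
    proof -
      have "cmod (partial_derivs bs (g i) 0) \<le> a i" using a(2) that False by auto
      then show ?thesis by (rule order_trans [OF norm_ge_zero])
    qed
    then have "(\<lambda>i. norm (a i)) summable_on I" using a(1) summable_on_cong [of I "\<lambda>i. norm (a i)" a] by simp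
    then have "Infinite_Set_Sum.abs_summable_on a I" by (simp only: abs_summable_equivalent [symmetric])
    then show ?thesis using a(2) by (auto simp: Infinite_Set_Sum.abs_summable_on_def)
  qed
  have meas: "(\<lambda>t. partial_derivs bs (g t) x) \<in> borel_measurable (count_space I)" for bs x by simp
  have smooth': "g t \<in> smooth_space" if "t \<in> space (count_space I)" for t using that smooth by simp
  note R = smooth_integral [of "count_space I" g, OF smooth' meas dom']
  show "(\<lambda>x. \<Sum>\<^sub>\<infinity>i\<in>I. g i x) \<in> smooth_space"
    using R(1) eq [of "[]"] by simp
  show "partial_derivs bs (\<lambda>x. \<Sum>\<^sub>\<infinity>i\<in>I. g i x) = (\<lambda>x. \<Sum>\<^sub>\<infinity>i\<in>I. partial_derivs bs (g i) x)"
    if bs: "bs \<in> lists Basis"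
    using R(2) [OF _ _ bs] eq [of "[]"] eq [OF bs] by simp
qed

text \<open>Derivatives and weights pass through the sum, so the terms are compared with the
  summable bounds one by one. The cardinality counts the lists of directions that enter the
  norm.\<close>

lemma schwartz_infsum:
  fixes h :: "'i \<Rightarrow> 'a::euclidean_space \<Rightarrow> complex"
  assumes h: "\<And>i. i \<in> I \<Longrightarrow> h i \<in> schwartz_space"
    and dom: "\<And>M. \<exists>a. a summable_on I \<and> (\<forall>i\<in>I. schwartz_norm M (h i) \<le> a i)"
  shows "(\<lambda>x. \<Sum>\<^sub>\<infinity>i\<in>I. h i x) \<in> schwartz_space"
    and "\<And>M a. a summable_on I \<Longrightarrow> \<forall>i\<in>I. schwartz_norm M (h i) \<le> a i \<Longrightarrow>
      schwartz_norm M (\<lambda>x. \<Sum>\<^sub>\<infinity>i\<in>I. h i x) \<le> real (card (multi_indices TYPE('a) M)) * (\<Sum>\<^sub>\<infinity>i\<in>I. a i)"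
    and "\<And>x. (\<lambda>i. cmod (h i x)) summable_on I"
proof -
  have pw: "cmod (partial_derivs bs (h i) x) \<le> a i" 
    if "bs \<in> lists Basis" "length bs \<le> M" "\<forall>i\<in>I. schwartz_norm M (h i) \<le> a i" "i \<in> I" for bs x i M a
    using schwartz_norm_upper [OF h [OF that(4)] that(1,2), of 0 x] that(3,4) by fastforce
  have dom': "\<exists>a. a summable_on I \<and> (\<forall>i\<in>I. \<forall>x. norm x \<le> r \<longrightarrow> cmod (partial_derivs bs (h i) x) \<le> a i)"
    if bs: "bs \<in> lists Basis" for bs r
    using dom [of "length bs"] pw [OF bs order_refl] by blast
  note S = smooth_infsum [OF schwartz_smooth [OF h] dom']
  have le: "(1 + norm x) ^ M * cmod (partial_derivs bs (\<lambda>x. \<Sum>\<^sub>\<infinity>i\<in>I. h i x) x) \<le> (\<Sum>\<^sub>\<infinity>i\<in>I. a i)"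
    if bs: "bs \<in> lists Basis" "length bs \<le> M" and a: "a summable_on I" "\<forall>i\<in>I. schwartz_norm M (h i) \<le> a i" for bs M a x
  proof -
    define W where "W = (1 + norm x) ^ M"
    have w: "W > 0" by (simp add: W_def add_pos_nonneg)
    have "norm (\<Sum>\<^sub>\<infinity>i\<in>I. of_real W * partial_derivs bs (h i) x) \<le> (\<Sum>\<^sub>\<infinity>i\<in>I. a i)"
    proof (rule abs_summable_dominated(3) [OF a(1)])
      fix i assume i: "i \<in> I"
      have "W * cmod (partial_derivs bs (h i) x) \<le> a i"
        using schwartz_norm_upper [OF h [OF i] bs order_refl, of x] a(2) i unfolding W_def by fastforce
      then show "norm (of_real W * partial_derivs bs (h i) x) \<le> a i"
        using w by (simp add: norm_mult)
    qed
    then show ?thesis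
      using w unfolding W_def [symmetric] by (simp add: S(2) [OF _ _ bs(1)] infsum_cmult_right' norm_mult)
  qed
  show "(\<lambda>x. \<Sum>\<^sub>\<infinity>i\<in>I. h i x) \<in> schwartz_space"
  proof (rule schwartz_spaceI)
    show "(\<lambda>x. \<Sum>\<^sub>\<infinity>i\<in>I. h i x) \<in> smooth_space" by (rule S(1))
    fix bs :: "'a list" and N assume bs: "bs \<in> lists Basis"
    define M where "M = max N (length bs)"
    obtain a where a: "a summable_on I" "\<forall>i\<in>I. schwartz_norm M (h i) \<le> a i" using dom by blast
    have "(1 + norm x) ^ N * cmod (partial_derivs bs (\<lambda>x. \<Sum>\<^sub>\<infinity>i\<in>I. h i x) x) \<le> (\<Sum>\<^sub>\<infinity>i\<in>I. a i)" for x
      by (rule order_trans [OF mult_right_mono le [OF bs _ a]]) (auto simp: M_def intro!: power_increasing)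
    then show "\<exists>C. \<forall>x. (1 + norm x) ^ N * cmod (partial_derivs bs (\<lambda>x. \<Sum>\<^sub>\<infinity>i\<in>I. h i x) x) \<le> C" by blast
  qed
  show "schwartz_norm M (\<lambda>x. \<Sum>\<^sub>\<infinity>i\<in>I. h i x) \<le> real (card (multi_indices TYPE('a) M)) * (\<Sum>\<^sub>\<infinity>i\<in>I. a i)"
    if "a summable_on I" "\<forall>i\<in>I. schwartz_norm M (h i) \<le> a i" for M a
    by (rule schwartz_norm_least, rule le) (use that in auto)
  show "(\<lambda>i. cmod (h i x)) summable_on I" for x
  proof -
    obtain a where a: "a summable_on I" "\<forall>i\<in>I. schwartz_norm 0 (h i) \<le> a i" using dom by blast
    show ?thesis using pw [of "[]" 0 a] a(2) by (intro abs_summable_dominated(1) [OF a(1)]) auto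
  qed
qed

section \<open>Topologies given by seminorms\<close>

text \<open>Everything is phrased through \<open>p (g - f)\<close> with \<open>f\<close> and
  \<open>g\<close> in \<open>V\<close>, without asking that \<open>g - f\<close> lie in
  \<open>V\<close>. For \<open>tempered\<close> this matters: a difference of two extensional
  functionals need not be extensional.\<close>

definition pseudometric_family :: "'v::minus set \<Rightarrow> ('v \<Rightarrow> real) set \<Rightarrow> bool" where
  "pseudometric_family V P \<longleftrightarrow> P \<noteq> {} \<and> (\<forall>p\<in>P. \<forall>f\<in>V. p (f - f) = 0) \<and>
     (\<forall>p\<in>P. \<forall>f\<in>V. \<forall>g\<in>V. p (g - f) = p (f - g)) \<and>
     (\<forall>p\<in>P. \<forall>f\<in>V. \<forall>g\<in>V. \<forall>h\<in>V. p (h - f) \<le> p (h - g) + p (g - f))"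

lemma pseudometric_familyD:
  assumes "pseudometric_family V P"
  shows "P \<noteq> {}" "\<And>p f. p \<in> P \<Longrightarrow> f \<in> V \<Longrightarrow> p (f - f) = 0"
    "\<And>p f g. p \<in> P \<Longrightarrow> f \<in> V \<Longrightarrow> g \<in> V \<Longrightarrow> p (g - f) = p (f - g)"
    "\<And>p f g h. p \<in> P \<Longrightarrow> f \<in> V \<Longrightarrow> g \<in> V \<Longrightarrow> h \<in> V \<Longrightarrow> p (h - f) \<le> p (h - g) + p (g - f)"
  using assms unfolding pseudometric_family_def by blast+

lemma topspace_seminorm_topology:
  assumes "pseudometric_family V P"
  shows "topspace (seminorm_topology V P) = V"
proof -
  obtain p where "p \<in> P" using pseudometric_familyD [OF assms] by blast
  have "f \<in> \<Union> {{g \<in> V. p (g - f) < r} | f p r. f \<in> V \<and> p \<in> P \<and> 0 < r}" if "f \<in> V" for f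
    using that \<open>p \<in> P\<close> pseudometric_familyD(2) [OF assms]
    by (intro UnionI [of "{g \<in> V. p (g - f) < 1}"]) force+
  then show ?thesis unfolding seminorm_topology_def topology_generated_by_topspace by blast
qed

lemma openin_seminorm_ball:
  "f \<in> V \<Longrightarrow> p \<in> P \<Longrightarrow> 0 < r \<Longrightarrow> openin (seminorm_topology V P) {g \<in> V. p (g - f) < r}"
  unfolding seminorm_topology_def by (rule topology_generated_by_Basis) blast

text \<open>From a subbasis to neighbourhoods: by induction on the generation of the topology, where
  a ball around \<open>h\<close> contains a ball around each of its points \<open>f\<close>, with
  radius \<open>r - p (f - h)\<close>, by the triangle inequality.\<close>

lemma openin_seminorm_topology:
  assumes pm: "pseudometric_family V P"
  shows "openin (seminorm_topology V P) U \<longleftrightarrow> U \<subseteq> V \<and>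
    (\<forall>f\<in>U. \<exists>Q r. finite Q \<and> Q \<subseteq> P \<and> 0 < r \<and> (\<forall>g\<in>V. (\<forall>p\<in>Q. p (g - f) < r) \<longrightarrow> g \<in> U))"
proof
  assume U: "openin (seminorm_topology V P) U"
  then have "U \<subseteq> V" using openin_subset topspace_seminorm_topology [OF pm] by metis
  moreover
  define N where "N = (\<lambda>f A. \<exists>Q r. finite Q \<and> Q \<subseteq> P \<and> 0 < r \<and> (\<forall>g\<in>V. (\<forall>p\<in>Q. p (g - f) < r) \<longrightarrow> g \<in> A))"
  have "N f U" if "f \<in> U" for f
  proof -
    have "generate_topology_on {{g \<in> V. p (g - f) < r} | f p r. f \<in> V \<and> p \<in> P \<and> 0 < r} U"
      using U unfolding seminorm_topology_def openin_topology_generated_by_iff .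
    then show ?thesis using that
    proof (induction arbitrary: f)
      case (Int A B)
      have "N f A" by (rule Int.IH(1)) (use Int.prems in simp)
      then obtain Q r where 1: "finite Q" "Q \<subseteq> P" "0 < r" "\<forall>g\<in>V. (\<forall>p\<in>Q. p (g - f) < r) \<longrightarrow> g \<in> A"
        unfolding N_def by (elim exE conjE) (rule that)
      have "N f B" by (rule Int.IH(2)) (use Int.prems in simp)
      then obtain Q' r' where 2: "finite Q'" "Q' \<subseteq> P" "0 < r'" "\<forall>g\<in>V. (\<forall>p\<in>Q'. p (g - f) < r') \<longrightarrow> g \<in> B"
        unfolding N_def by (elim exE conjE) (rule that)
      show ?case unfolding N_def
        by (rule exI [of _ "Q \<union> Q'"], rule exI [of _ "min r r'"]) (use 1 2 in auto)
    next
      case (UN K)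
      then obtain A where A: "A \<in> K" "f \<in> A" by blast
      then have "N f A" by (rule UN.IH)
      with A(1) show ?case unfolding N_def by (meson UnionI)
    next
      case (Basis A)
      then obtain h p r where A: "A = {g \<in> V. p (g - h) < r}" "h \<in> V" "p \<in> P" by blast
      then have f: "f \<in> V" "p (f - h) < r" using Basis by auto
      have "p (g - h) < r" if "g \<in> V" "p (g - f) < r - p (f - h)" for g
        using pseudometric_familyD(4) [OF pm A(3,2) f(1) that(1)] that by linarith
      then show ?case using A f unfolding N_def
        by (intro exI [of _ "{p}"] exI [of _ "r - p (f - h)"]) auto
    qed auto
  qed
  ultimately show "U \<subseteq> V \<and> (\<forall>f\<in>U. \<exists>Q r. finite Q \<and> Q \<subseteq> P \<and> 0 < r \<and> (\<forall>g\<in>V. (\<forall>p\<in>Q. p (g - f) < r) \<longrightarrow> g \<in> U))"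
    unfolding N_def by simp
next
  assume *: "U \<subseteq> V \<and> (\<forall>f\<in>U. \<exists>Q r. finite Q \<and> Q \<subseteq> P \<and> 0 < r \<and> (\<forall>g\<in>V. (\<forall>p\<in>Q. p (g - f) < r) \<longrightarrow> g \<in> U))"
  show "openin (seminorm_topology V P) U"
  proof (subst openin_subopen, intro ballI)
    fix f assume f: "f \<in> U"
    then have fV: "f \<in> V" using * by blast
    obtain Q r where Q: "finite Q" "Q \<subseteq> P" "0 < r" "\<forall>g\<in>V. (\<forall>p\<in>Q. p (g - f) < r) \<longrightarrow> g \<in> U"
      using * f by blast
    let ?N = "(\<Inter>p\<in>Q. {g \<in> V. p (g - f) < r}) \<inter> topspace (seminorm_topology V P)"
    have "openin (seminorm_topology V P) ?N"
      using Q fV openin_seminorm_ball [of f V _ P r] by (cases "Q = {}") (auto intro!: openin_Int openin_INT)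
    moreover have "p (f - f) < r" if "p \<in> Q" for p
      using pseudometric_familyD(2) [OF pm _ fV, of p] that Q by auto
    then have "f \<in> ?N" using fV by (simp add: topspace_seminorm_topology [OF pm])
    moreover have "?N \<subseteq> U" using Q by (auto simp: topspace_seminorm_topology [OF pm])
    ultimately show "\<exists>T. openin (seminorm_topology V P) T \<and> f \<in> T \<and> T \<subseteq> U" by blast
  qed
qed

text \<open>The denominator exceeds \<open>C * card Q\<close> and stays positive even when
  \<open>C\<close> is 0 or \<open>Q\<close> is empty, so the strict inequality survives in all
  cases.\<close>

lemma sum_lt_bound:
  fixes q :: "'i \<Rightarrow> real" and C e :: real
  assumes "finite Q" "0 \<le> C" "0 < e" "\<And>p. p \<in> Q \<Longrightarrow> q p < e / (C * (card Q + 1) + 1)"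
  shows "C * sum q Q < e"
proof -
  let ?d = "C * (card Q + 1) + 1"
  have d: "?d > 0" using assms(2) by (simp add: add_nonneg_pos)
  have "sum q Q \<le> card Q * (e / ?d)" by (rule sum_bounded_above) (use assms(4) in force)
  then have "C * sum q Q \<le> C * (card Q * (e / ?d))" using assms(2) by (rule mult_left_mono)
  also have "\<dots> = (C * card Q) * e / ?d" by simp
  also have "\<dots> < e"
  proof -
    have "0 \<le> C * e" using assms(2,3) by simp
    then show ?thesis using d assms(3) by (simp add: pos_divide_less_eq algebra_simps add_pos_nonneg)
  qed
  finally show ?thesis .
qed

lemma continuous_map_seminorm_topology:
  assumes V: "pseudometric_family V P" and W: "pseudometric_family W Q" and A: "\<And>f. f \<in> V \<Longrightarrow> A f \<in> W"
    and bound: "\<And>q. q \<in> Q \<Longrightarrow> \<exists>C F. 0 \<le> C \<and> finite F \<and> F \<subseteq> P \<and> (\<forall>f\<in>V. \<forall>g\<in>V. q (A g - A f) \<le> C * (\<Sum>p\<in>F. p (g - f)))"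
  shows "continuous_map (seminorm_topology V P) (seminorm_topology W Q) A"
  unfolding continuous_map_def
proof (intro conjI allI impI)
  show "A \<in> topspace (seminorm_topology V P) \<rightarrow> topspace (seminorm_topology W Q)"
    using A by (auto simp: topspace_seminorm_topology V W)
  fix U assume U: "openin (seminorm_topology W Q) U"
  show "openin (seminorm_topology V P) {x \<in> topspace (seminorm_topology V P). A x \<in> U}"
    unfolding openin_seminorm_topology [OF V] topspace_seminorm_topology [OF V]
  proof (intro conjI ballI)
    fix f assume "f \<in> {x \<in> V. A x \<in> U}"
    then have f: "f \<in> V" "A f \<in> U" by auto
    obtain G r where G: "finite G" "G \<subseteq> Q" "0 < r" "\<And>g. g \<in> W \<Longrightarrow> (\<forall>q\<in>G. q (g - A f) < r) \<Longrightarrow> g \<in> U"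
      using U f unfolding openin_seminorm_topology [OF W] by meson
    have "\<forall>q\<in>G. \<exists>C F. 0 \<le> C \<and> finite F \<and> F \<subseteq> P \<and> (\<forall>f\<in>V. \<forall>g\<in>V. q (A g - A f) \<le> C * (\<Sum>p\<in>F. p (g - f)))"
      using bound G(2) by blast
    then obtain C F where CF: "\<And>q. q \<in> G \<Longrightarrow> 0 \<le> C q \<and> finite (F q) \<and> F q \<subseteq> P \<and>
        (\<forall>f\<in>V. \<forall>g\<in>V. q (A g - A f) \<le> C q * (\<Sum>p\<in>F q. p (g - f)))" by metis
    \<comment> \<open>The minimum over the finitely many target seminorms; the inserted 1 covers the
      case that there are none.\<close>
    define d where "d = Min (insert 1 ((\<lambda>q. r / (C q * (card (F q) + 1) + 1)) ` G))"
    have d: "0 < d" unfolding d_def using G CF by (auto simp: intro!: divide_pos_pos add_nonneg_pos)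
    have d': "d \<le> r / (C q * (card (F q) + 1) + 1)" if "q \<in> G" for q
      unfolding d_def using that G by (intro Min_le) auto
    show "\<exists>H s. finite H \<and> H \<subseteq> P \<and> 0 < s \<and> (\<forall>g\<in>V. (\<forall>p\<in>H. p (g - f) < s) \<longrightarrow> g \<in> {x \<in> V. A x \<in> U})"
    proof (intro exI conjI ballI impI)
      show "finite (\<Union>q\<in>G. F q)" "(\<Union>q\<in>G. F q) \<subseteq> P" using G CF by auto
      show "0 < d" by (rule d)
      fix g assume g: "g \<in> V" "\<forall>p\<in>(\<Union>q\<in>G. F q). p (g - f) < d"
      have "q (A g - A f) < r" if q: "q \<in> G" for q
      proof -
        have "q (A g - A f) \<le> C q * (\<Sum>p\<in>F q. p (g - f))" using CF [OF q] f g by blast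
        also have "\<dots> < r"
          by (rule sum_lt_bound) (use CF [OF q] G d' [OF q] g q in force)+
        finally show ?thesis .
      qed
      then show "g \<in> {x \<in> V. A x \<in> U}" using G(4) A g by blast
    qed
  qed auto
qed

lemma continuous_map_seminorm_euclidean:
  fixes u :: "'v::minus \<Rightarrow> complex"
  assumes V: "pseudometric_family V P"
    and bound: "\<exists>C F. 0 \<le> C \<and> finite F \<and> F \<subseteq> P \<and> (\<forall>f\<in>V. \<forall>g\<in>V. cmod (u g - u f) \<le> C * (\<Sum>p\<in>F. p (g - f)))"
  shows "continuous_map (seminorm_topology V P) euclidean u"
  unfolding continuous_map_def
proof (intro conjI allI impI)
  fix U :: "complex set" assume "openin euclidean U"
  then have U: "open U" by simp
  obtain C F where CF: "0 \<le> C" "finite F" "F \<subseteq> P" "\<forall>f\<in>V. \<forall>g\<in>V. cmod (u g - u f) \<le> C * (\<Sum>p\<in>F. p (g - f))"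
    using bound by blast
  show "openin (seminorm_topology V P) {x \<in> topspace (seminorm_topology V P). u x \<in> U}"
    unfolding openin_seminorm_topology [OF V] topspace_seminorm_topology [OF V]
  proof (intro conjI ballI)
    fix f assume "f \<in> {x \<in> V. u x \<in> U}"
    then have f: "f \<in> V" "u f \<in> U" by auto
    obtain r where r: "0 < r" "ball (u f) r \<subseteq> U" using U f open_contains_ball by blast
    have "u g \<in> U" if g: "g \<in> V" "\<forall>p\<in>F. p (g - f) < r / (C * (card F + 1) + 1)" for g
    proof -
      have "cmod (u g - u f) \<le> C * (\<Sum>p\<in>F. p (g - f))" using CF f g by blast
      also have "\<dots> < r" by (rule sum_lt_bound) (use CF r g in auto)
      finally show ?thesis using r by (auto simp: dist_norm norm_minus_commute)
    qed
    then show "\<exists>H s. finite H \<and> H \<subseteq> P \<and> 0 < s \<and> (\<forall>g\<in>V. (\<forall>p\<in>H. p (g - f) < s) \<longrightarrow> g \<in> {x \<in> V. u x \<in> U})"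
      using CF r by (intro exI [of _ F] exI [of _ "r / (C * (card F + 1) + 1)"]) (auto intro!: divide_pos_pos add_nonneg_pos)
  qed auto
qed auto

lemma Hausdorff_seminorm_topology:
  assumes V: "pseudometric_family V P"
    and sep: "\<And>f g. f \<in> V \<Longrightarrow> g \<in> V \<Longrightarrow> f \<noteq> g \<Longrightarrow> \<exists>p\<in>P. 0 < p (g - f)"
  shows "Hausdorff_space (seminorm_topology V P)"
  unfolding Hausdorff_space_def topspace_seminorm_topology [OF V]
proof (intro allI impI)
  fix f g assume "f \<in> V \<and> g \<in> V \<and> f \<noteq> g"
  then have f: "f \<in> V" and g: "g \<in> V" and "f \<noteq> g" by auto
  then obtain p where p: "p \<in> P" "0 < p (g - f)" using sep by blast
  let ?r = "p (g - f) / 2"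
  let ?B = "\<lambda>f. {h \<in> V. p (h - f) < ?r}"
  have "disjnt (?B f) (?B g)"
  proof -
    have False if h: "h \<in> V" "p (h - f) < ?r" "p (h - g) < ?r" for h
      using pseudometric_familyD(4) [OF V p(1) f h(1) g] pseudometric_familyD(3) [OF V p(1) g h(1)] h by simp
    then show ?thesis unfolding disjnt_def by blast
  qed
  moreover have "f \<in> ?B f" "g \<in> ?B g" using f g p by (auto simp: pseudometric_familyD(2) [OF V p(1)])
  moreover have "openin (seminorm_topology V P) (?B f)" "openin (seminorm_topology V P) (?B g)"
    using openin_seminorm_ball [of _ V p P ?r] f g p by auto
  ultimately show "\<exists>U W. openin (seminorm_topology V P) U \<and> openin (seminorm_topology V P) W \<and> f \<in> U \<and> g \<in> W \<and> disjnt U W"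
    by blast
qed

lemma closure_of_seminorm_topologyI:
  assumes V: "pseudometric_family V P" and f: "f \<in> V"
    and dense: "\<And>Q r. finite Q \<Longrightarrow> Q \<subseteq> P \<Longrightarrow> 0 < r \<Longrightarrow> \<exists>g\<in>S \<inter> V. \<forall>p\<in>Q. p (g - f) < r"
  shows "f \<in> seminorm_topology V P closure_of S"
  unfolding in_closure_of topspace_seminorm_topology [OF V]
proof (intro conjI allI impI f)
  fix T assume T: "f \<in> T \<and> openin (seminorm_topology V P) T"
  then obtain Q r where "finite Q" "Q \<subseteq> P" "0 < r" "\<forall>g\<in>V. (\<forall>p\<in>Q. p (g - f) < r) \<longrightarrow> g \<in> T"
    unfolding openin_seminorm_topology [OF V] by blast
  with dense [of Q r] show "\<exists>y. y \<in> S \<and> y \<in> T" by blast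
qed

section \<open>Tempered distributions\<close>

lemma schwartz_seminorm_diff:
  assumes f: "f \<in> schwartz_space" and g: "g \<in> schwartz_space" and bs: "bs \<in> lists Basis"
  shows "schwartz_seminorm N bs (f - g) = (SUP x. (1 + norm x) ^ N * cmod (partial_derivs bs f x - partial_derivs bs g x))"
  by (simp add: schwartz_seminorm_def fun_diff_def partial_derivs_diff schwartz_smooth f g bs)

lemma schwartz_diff_mem: "f \<in> schwartz_space \<Longrightarrow> g \<in> schwartz_space \<Longrightarrow> f - g \<in> schwartz_space"
  unfolding fun_diff_def by (rule schwartz_diff)

lemma smooth_diff_mem: "f \<in> smooth_space \<Longrightarrow> g \<in> smooth_space \<Longrightarrow> f - g \<in> smooth_space"
  unfolding fun_diff_def by (rule smooth_diff)

lemma schwartz_seminorm_triangle: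
  assumes "f \<in> schwartz_space" "g \<in> schwartz_space" "h \<in> schwartz_space" and bs: "bs \<in> lists Basis"
  shows "schwartz_seminorm N bs (h - f) \<le> schwartz_seminorm N bs (h - g) + schwartz_seminorm N bs (g - f)"
proof (rule schwartz_seminorm_least)
  fix x
  have D: "partial_derivs bs (u - v) x = partial_derivs bs u x - partial_derivs bs v x"
    if "u \<in> schwartz_space" "v \<in> schwartz_space" for u v
    using that by (simp add: fun_diff_def partial_derivs_diff schwartz_smooth bs)
  have "cmod (partial_derivs bs (h - f) x) \<le> cmod (partial_derivs bs (h - g) x) + cmod (partial_derivs bs (g - f) x)"
    using norm_triangle_ineq [of "partial_derivs bs (h - g) x" "partial_derivs bs (g - f) x"] by (simp add: D assms)
  then have "(1 + norm x) ^ N * cmod (partial_derivs bs (h - f) x) \<le>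
      (1 + norm x) ^ N * (cmod (partial_derivs bs (h - g) x) + cmod (partial_derivs bs (g - f) x))"
    by (intro mult_left_mono) auto
  also have "\<dots> \<le> schwartz_seminorm N bs (h - g) + schwartz_seminorm N bs (g - f)"
    unfolding distrib_left by (intro add_mono schwartz_seminorm_upper schwartz_diff_mem assms)
  finally show "(1 + norm x) ^ N * cmod (partial_derivs bs (h - f) x) \<le>
     schwartz_seminorm N bs (h - g) + schwartz_seminorm N bs (g - f)" .
qed

lemma pseudometric_schwartz:
  "pseudometric_family schwartz_space {schwartz_seminorm N bs | N bs. bs \<in> lists Basis}"
  unfolding pseudometric_family_def
proof (intro conjI ballI)
  fix p :: "('a \<Rightarrow> complex) \<Rightarrow> real" and f :: "'a \<Rightarrow> complex"
  assume "p \<in> {schwartz_seminorm N bs | N bs. bs \<in> lists Basis}" and f: "f \<in> schwartz_space"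
  then obtain N bs where bs: "bs \<in> lists Basis" and p: "p = schwartz_seminorm N bs" by blast
  show "p (f - f) = 0" unfolding p schwartz_seminorm_diff [OF f f bs] by simp
  fix g :: "'a \<Rightarrow> complex" assume g: "g \<in> schwartz_space"
  show "p (g - f) = p (f - g)"
    unfolding p schwartz_seminorm_diff [OF f g bs] schwartz_seminorm_diff [OF g f bs]
    by (simp add: norm_minus_commute)
  fix h :: "'a \<Rightarrow> complex" assume h: "h \<in> schwartz_space"
  show "p (h - f) \<le> p (h - g) + p (g - f)"
    unfolding p by (rule schwartz_seminorm_triangle [OF f g h bs])
qed (blast intro: lists.Nil)

lemma smooth_seminorm_upper:
  assumes "f \<in> smooth_space" "bs \<in> lists Basis" "compact K" "x \<in> K"
  shows "cmod (partial_derivs bs f x) \<le> smooth_seminorm K bs f"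
  unfolding smooth_seminorm_def
proof (rule cSUP_upper [OF assms(4)])
  have "compact ((\<lambda>x. cmod (partial_derivs bs f x)) ` K)"
    by (intro compact_continuous_image continuous_on_norm partial_derivs_continuous assms)
  then show "bdd_above ((\<lambda>x. cmod (partial_derivs bs f x)) ` K)"
    by (intro bounded_imp_bdd_above compact_imp_bounded)
qed

lemma smooth_seminorm_least:
  "K \<noteq> {} \<Longrightarrow> (\<And>x. x \<in> K \<Longrightarrow> cmod (partial_derivs bs f x) \<le> C) \<Longrightarrow> smooth_seminorm K bs f \<le> C"
  unfolding smooth_seminorm_def by (rule cSUP_least)

lemma smooth_seminorm_triangle:
  assumes "f \<in> smooth_space" "g \<in> smooth_space" "h \<in> smooth_space"
    and bs: "bs \<in> lists Basis" and K: "compact K" "K \<noteq> {}"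
  shows "smooth_seminorm K bs (h - f) \<le> smooth_seminorm K bs (h - g) + smooth_seminorm K bs (g - f)"
proof (rule smooth_seminorm_least [OF K(2)])
  fix x assume x: "x \<in> K"
  have D: "partial_derivs bs (u - v) x = partial_derivs bs u x - partial_derivs bs v x"
    if "u \<in> smooth_space" "v \<in> smooth_space" for u v
    using that by (simp add: fun_diff_def partial_derivs_diff bs)
  have "cmod (partial_derivs bs (h - f) x) \<le> cmod (partial_derivs bs (h - g) x) + cmod (partial_derivs bs (g - f) x)"
    using norm_triangle_ineq [of "partial_derivs bs (h - g) x" "partial_derivs bs (g - f) x"] by (simp add: D assms)
  also have "\<dots> \<le> smooth_seminorm K bs (h - g) + smooth_seminorm K bs (g - f)"
    by (intro add_mono smooth_seminorm_upper smooth_diff_mem assms x)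
  finally show "cmod (partial_derivs bs (h - f) x) \<le> smooth_seminorm K bs (h - g) + smooth_seminorm K bs (g - f)" .
qed

lemma pseudometric_smooth:
  "pseudometric_family smooth_space {smooth_seminorm K bs | K bs. compact K \<and> K \<noteq> {} \<and> bs \<in> lists Basis}"
proof -
  have diff: "smooth_seminorm K bs (f - g) = (SUP x\<in>K. cmod (partial_derivs bs f x - partial_derivs bs g x))"
    if "f \<in> smooth_space" "g \<in> smooth_space" "bs \<in> lists Basis" for K bs and f g :: "'a \<Rightarrow> complex"
    using that by (simp add: smooth_seminorm_def fun_diff_def partial_derivs_diff)
  show ?thesis
    unfolding pseudometric_family_def
  proof (intro conjI ballI)
    show "{smooth_seminorm K bs | K bs. compact K \<and> K \<noteq> {} \<and> bs \<in> lists (Basis :: 'a set)} \<noteq> {}"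
      using compact_sing [of "0 :: 'a"] by (blast intro: lists.Nil)
  next
    fix p :: "('a \<Rightarrow> complex) \<Rightarrow> real" and f :: "'a \<Rightarrow> complex"
    assume "p \<in> {smooth_seminorm K bs | K bs. compact K \<and> K \<noteq> {} \<and> bs \<in> lists Basis}" and f: "f \<in> smooth_space"
    then obtain K bs where K: "compact K" "K \<noteq> {}" and bs: "bs \<in> lists Basis" and p: "p = smooth_seminorm K bs" by blast
    show "p (f - f) = 0" unfolding p diff [OF f f bs] using K by simp
    fix g :: "'a \<Rightarrow> complex" assume g: "g \<in> smooth_space"
    show "p (g - f) = p (f - g)"
      unfolding p diff [OF f g bs] diff [OF g f bs] by (simp add: norm_minus_commute)
    fix h :: "'a \<Rightarrow> complex" assume h: "h \<in> smooth_space"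
    show "p (h - f) \<le> p (h - g) + p (g - f)"
      unfolding p by (rule smooth_seminorm_triangle [OF f g h bs K])
  qed
qed

lemma tempered_add: "u \<in> tempered \<Longrightarrow> f \<in> schwartz_space \<Longrightarrow> g \<in> schwartz_space \<Longrightarrow> u (\<lambda>x. f x + g x) = u f + u g"
  and tempered_cmult: "u \<in> tempered \<Longrightarrow> f \<in> schwartz_space \<Longrightarrow> u (\<lambda>x. c * f x) = c * u f"
  and tempered_extensional: "u \<in> tempered \<Longrightarrow> u \<in> extensional schwartz_space"
  by (auto simp: tempered_def)

lemma tempered_zero: "u \<in> tempered \<Longrightarrow> u (\<lambda>x. 0) = 0"
  using tempered_cmult [of u "\<lambda>x. 0" 0] by simp

lemma tempered_diff:
  "u \<in> tempered \<Longrightarrow> f \<in> schwartz_space \<Longrightarrow> g \<in> schwartz_space \<Longrightarrow> u (\<lambda>x. f x - g x) = u f - u g"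
  using tempered_add [of u f "\<lambda>x. -1 * g x"] tempered_cmult [of u g "-1"] schwartz_cmult(1) [of g "-1"] by simp

lemma tempered_sum:
  assumes u: "u \<in> tempered" and "\<And>i. i \<in> I \<Longrightarrow> f i \<in> schwartz_space"
  shows "u (\<lambda>x. \<Sum>i\<in>I. f i x) = (\<Sum>i\<in>I. u (f i))"
  using assms(2)
  by (induction I rule: infinite_finite_induct)
     (auto simp: tempered_zero [OF u] tempered_add [OF u] schwartz_sum)

text \<open>Continuity at 0 provides finitely many seminorms whose smallness forces
  \<open>cmod (u g) < 1\<close>. They are all dominated by one \<open>schwartz_norm\<close>, and
  homogeneity turns this into a linear bound.\<close>

lemma tempered_bound:
  fixes u :: "('a::euclidean_space \<Rightarrow> complex) \<Rightarrow> complex"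
  assumes u: "u \<in> tempered"
  shows "\<exists>M C. 0 \<le> C \<and> (\<forall>f\<in>schwartz_space. cmod (u f) \<le> C * schwartz_norm M f)"
proof -
  let ?P = "{schwartz_seminorm N bs | N bs. bs \<in> lists (Basis :: 'a set)}"
  let ?U = "{f \<in> schwartz_space. u f \<in> ball 0 1}"
  have "continuous_map schwartz_topology euclidean u" using u by (simp add: tempered_def)
  then have "openin (schwartz_topology :: ('a \<Rightarrow> complex) topology) {f \<in> topspace schwartz_topology. u f \<in> ball 0 1}"
    by (rule openin_continuous_map_preimage) simp
  then have "openin (seminorm_topology schwartz_space ?P) ?U"
    unfolding schwartz_topology_def topspace_seminorm_topology [OF pseudometric_schwartz] .
  moreover have "(\<lambda>x. 0) \<in> ?U" using tempered_zero [OF u] by simp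
  ultimately obtain Q r where Q: "finite Q" "Q \<subseteq> ?P" "0 < r"
    "\<forall>g\<in>schwartz_space. (\<forall>p\<in>Q. p (g - (\<lambda>x. 0)) < r) \<longrightarrow> g \<in> ?U"
    unfolding openin_seminorm_topology [OF pseudometric_schwartz] by (elim conjE) (drule (1) bspec, elim exE conjE, rule that)
  have "\<exists>M. \<forall>p\<in>Q. \<forall>f\<in>schwartz_space. p f \<le> schwartz_norm M f"
    using Q(1,2)
  proof (induction Q)
    case (insert p Q)
    then obtain M N bs where M: "\<forall>p\<in>Q. \<forall>f\<in>schwartz_space. p f \<le> schwartz_norm M f"
      and p: "p = schwartz_seminorm N bs" "bs \<in> lists Basis" by auto
    define L where "L = max M (max N (length bs))"
    have "schwartz_norm M f \<le> schwartz_norm L f" if "f \<in> schwartz_space" for f :: "'a \<Rightarrow> complex"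
      by (rule schwartz_norm_mono [OF that]) (simp add: L_def)
    moreover have "p f \<le> schwartz_norm L f" if "f \<in> schwartz_space" for f
      unfolding p by (rule schwartz_seminorm_le_norm [OF that p(2)]) (auto simp: L_def)
    ultimately have "\<forall>p\<in>insert p Q. \<forall>f\<in>schwartz_space. p f \<le> schwartz_norm L f"
      using M order_trans by blast
    then show ?case by blast
  qed auto
  then obtain M where M: "\<And>p f. p \<in> Q \<Longrightarrow> f \<in> schwartz_space \<Longrightarrow> p f \<le> schwartz_norm M f" by blast
  have small: "cmod (u g) < 1" if g: "g \<in> schwartz_space" "schwartz_norm M g < r" for g
  proof -
    have "g - (\<lambda>x. 0) = g" by (simp add: fun_eq_iff)
    then have "\<forall>p\<in>Q. p (g - (\<lambda>x. 0)) < r" using M [OF _ g(1)] g(2) by (auto intro: le_less_trans)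
    then show ?thesis using Q(4) g(1) by auto
  qed
  have "cmod (u f) \<le> (1 / r) * schwartz_norm M f" if f: "f \<in> schwartz_space" for f
  \<comment> \<open>Comparing with every number above the claimed bound avoids normalizing by a norm
    that might be 0.\<close>
  proof (rule dense_ge)
    fix s' assume s': "(1 / r) * schwartz_norm M f < s'"
    define s where "s = s' * r"
    have s: "schwartz_norm M f < s" "0 < s"
      using s' Q(3) schwartz_norm_nonneg [OF f, of M] by (auto simp: s_def field_simps)
    let ?g = "\<lambda>x. of_real (r / s) * f x"
    have "schwartz_norm M ?g \<le> cmod (of_real (r / s)) * schwartz_norm M f" by (rule schwartz_cmult(2) [OF f])
    also have "\<dots> < r" using s Q(3) by (simp add: norm_divide pos_divide_less_eq)
    finally have "cmod (u ?g) < 1" by (intro small schwartz_cmult(1) f)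
    then have "r / s * cmod (u f) < 1"
      using s Q(3) by (simp only: tempered_cmult [OF u f] norm_mult norm_of_real abs_of_pos divide_pos_pos)
    moreover have "0 < s'" using s(2) Q(3) by (simp add: s_def zero_less_mult_iff)
    ultimately show "cmod (u f) \<le> s'" using Q(3) by (simp add: s_def pos_divide_less_eq)
  qed
  then show ?thesis using Q(3) by (intro exI [of _ M] exI [of _ "1 / r"]) auto
qed

lemma temperedI:
  assumes "u \<in> extensional schwartz_space"
    and add: "\<And>f g. f \<in> schwartz_space \<Longrightarrow> g \<in> schwartz_space \<Longrightarrow> u (\<lambda>x. f x + g x) = u f + u g"
    and cmult: "\<And>c f. f \<in> schwartz_space \<Longrightarrow> u (\<lambda>x. c * f x) = c * u f"
    and bound: "\<And>f. f \<in> schwartz_space \<Longrightarrow> cmod (u f) \<le> C * schwartz_norm M f"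
  shows "u \<in> (tempered :: (('a::euclidean_space \<Rightarrow> complex) \<Rightarrow> complex) set)"
proof -
  have "continuous_map schwartz_topology euclidean u"
    unfolding schwartz_topology_def
  proof (rule continuous_map_seminorm_euclidean [OF pseudometric_schwartz], intro exI conjI ballI)
    let ?F = "schwartz_seminorm M ` multi_indices TYPE('a) M"
    \<comment> \<open>Different lists may give the same seminorm, which the set \<open>?F\<close>
      contains only once; the factor makes up for the lost terms.\<close>
    let ?k = "real (card (multi_indices TYPE('a) M))"
    show "0 \<le> \<bar>C\<bar> * ?k" "finite ?F" by simp_all
    show "?F \<subseteq> {schwartz_seminorm N bs | N bs. bs \<in> lists Basis}" by auto
    fix f g :: "'a \<Rightarrow> complex" assume f: "f \<in> schwartz_space" and g: "g \<in> schwartz_space"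
    have d: "g - f \<in> schwartz_space" by (rule schwartz_diff_mem [OF g f])
    have "u g = u (\<lambda>x. (g - f) x + f x)" by simp
    also have "\<dots> = u (g - f) + u f" by (rule add [OF d f])
    finally have "cmod (u g - u f) = cmod (u (g - f))" by simp
    also have "\<dots> \<le> C * schwartz_norm M (g - f)" by (rule bound [OF d])
    also have "\<dots> \<le> \<bar>C\<bar> * schwartz_norm M (g - f)"
      by (intro mult_right_mono schwartz_norm_nonneg d) auto
    also have "schwartz_norm M (g - f) \<le> ?k * (\<Sum>p\<in>?F. p (g - f))"
      unfolding schwartz_norm_def
    proof (rule sum_bounded_above)
      fix bs :: "'a list" assume bs: "bs \<in> multi_indices TYPE('a) M"
      show "schwartz_seminorm M bs (g - f) \<le> (\<Sum>p\<in>?F. p (g - f))"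
        by (rule member_le_sum [of _ ?F "\<lambda>p. p (g - f)"])
           (use bs in \<open>auto intro!: schwartz_seminorm_nonneg d\<close>)
    qed
    finally show "cmod (u g - u f) \<le> \<bar>C\<bar> * ?k * (\<Sum>p\<in>?F. p (g - f))"
      by (simp add: mult_left_mono mult.assoc)
  qed
  then show ?thesis using assms by (auto simp: tempered_def)
qed

lemma has_sum_metric:
  fixes f :: "'i \<Rightarrow> 'b::{comm_monoid_add, metric_space}"
  shows "(f has_sum s) I \<longleftrightarrow> (\<forall>e>0. \<exists>X. finite X \<and> X \<subseteq> I \<and>
    (\<forall>Y. finite Y \<and> X \<subseteq> Y \<and> Y \<subseteq> I \<longrightarrow> dist (sum f Y) s < e))"
  unfolding has_sum_def tendsto_iff eventually_finite_subsets_at_top ..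

text \<open>The error of a finite partial sum is \<open>u\<close> applied to the tail of the series.
  Its norm is at most a constant times the tail of the dominating series, which tends to 0.\<close>

lemma tempered_has_sum:
  fixes h :: "'i \<Rightarrow> 'a::euclidean_space \<Rightarrow> complex"
  assumes u: "u \<in> tempered" and h: "\<And>i. i \<in> I \<Longrightarrow> h i \<in> schwartz_space"
    and dom: "\<And>M. \<exists>a. a summable_on I \<and> (\<forall>i\<in>I. schwartz_norm M (h i) \<le> a i)"
  shows "((\<lambda>i. u (h i)) has_sum u (\<lambda>x. \<Sum>\<^sub>\<infinity>i\<in>I. h i x)) I"
  unfolding has_sum_metric
proof (intro allI impI)
  fix e :: real assume e: "0 < e"
  obtain M C where C: "0 \<le> C" "\<And>f. f \<in> schwartz_space \<Longrightarrow> cmod (u f) \<le> C * schwartz_norm M f"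
    using tempered_bound [OF u] by blast
  obtain a where a: "a summable_on I" "\<forall>i\<in>I. schwartz_norm M (h i) \<le> a i" using dom by blast
  \<comment> \<open>The added 1 only keeps the divisor positive when the constant of
    \<open>u\<close> is 0.\<close>
  define k where "k = C * real (card (multi_indices TYPE('a) M)) + 1"
  have k: "0 < k" using C by (simp add: k_def add_nonneg_pos)
  have "(a has_sum (\<Sum>\<^sub>\<infinity>i\<in>I. a i)) I" using a(1) by simp
  then obtain X where X: "finite X" "X \<subseteq> I"
    "\<And>Y. finite Y \<Longrightarrow> X \<subseteq> Y \<Longrightarrow> Y \<subseteq> I \<Longrightarrow> dist (sum a Y) (\<Sum>\<^sub>\<infinity>i\<in>I. a i) < e / k"
    unfolding has_sum_metric using e k by (metis divide_pos_pos)
  have "dist (\<Sum>i\<in>Y. u (h i)) (u (\<lambda>x. \<Sum>\<^sub>\<infinity>i\<in>I. h i x)) < e" if Y: "finite Y" "X \<subseteq> Y" "Y \<subseteq> I" for Y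
  proof -
    have aY: "a summable_on (I - Y)" using a(1) by (rule summable_on_subset) auto
    have "(\<Sum>\<^sub>\<infinity>i\<in>I. a i) = (\<Sum>i\<in>Y. a i) + (\<Sum>\<^sub>\<infinity>i\<in>I - Y. a i)"
      using infsum_Un_disjoint [of a Y "I - Y"] Y aY by (simp add: Un_absorb1)
    then have tail: "(\<Sum>\<^sub>\<infinity>i\<in>I - Y. a i) < e / k"
      using X(3) [OF Y] by (simp add: dist_real_def)
    have hY: "h i \<in> schwartz_space" if "i \<in> I - Y" for i using that h by blast
    have domY: "\<exists>a. a summable_on (I - Y) \<and> (\<forall>i\<in>I - Y. schwartz_norm N (h i) \<le> a i)" for N
      using dom [of N] summable_on_subset [of _ I "I - Y"] by blast
    note S = schwartz_infsum [of "I - Y" h, OF hY domY]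
    let ?r = "\<lambda>x. \<Sum>\<^sub>\<infinity>i\<in>I - Y. h i x"
    have sY: "(\<lambda>x. \<Sum>i\<in>Y. h i x) \<in> schwartz_space" using h Y by (intro schwartz_sum) auto
    have "(\<lambda>x. \<Sum>\<^sub>\<infinity>i\<in>I. h i x) = (\<lambda>x. (\<Sum>i\<in>Y. h i x) + ?r x)"
    proof
      fix x
      have "(\<lambda>i. h i x) summable_on (I - Y)" by (rule abs_summable_summable [OF S(3)])
      then show "(\<Sum>\<^sub>\<infinity>i\<in>I. h i x) = (\<Sum>i\<in>Y. h i x) + ?r x"
        using infsum_Un_disjoint [of "\<lambda>i. h i x" Y "I - Y"] Y by (simp add: Un_absorb1)
    qed
    then have "u (\<lambda>x. \<Sum>\<^sub>\<infinity>i\<in>I. h i x) = (\<Sum>i\<in>Y. u (h i)) + u ?r"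
      using tempered_add [OF u sY S(1)] tempered_sum [OF u, of Y h] h Y by auto
    then have "dist (\<Sum>i\<in>Y. u (h i)) (u (\<lambda>x. \<Sum>\<^sub>\<infinity>i\<in>I. h i x)) = cmod (u ?r)"
      by (simp add: dist_norm)
    also have "\<dots> \<le> C * schwartz_norm M ?r" by (rule C(2) [OF S(1)])
    also have "\<dots> \<le> C * (real (card (multi_indices TYPE('a) M)) * (\<Sum>\<^sub>\<infinity>i\<in>I - Y. a i))"
      using a(2) by (intro mult_left_mono C(1) S(2) aY) auto
    also have "\<dots> \<le> k * (\<Sum>\<^sub>\<infinity>i\<in>I - Y. a i)"
    proof -
      have "0 \<le> a i" if "i \<in> I - Y" for i
        using a(2) schwartz_norm_nonneg [OF hY [OF that], of M] that by force
      then have "0 \<le> (\<Sum>\<^sub>\<infinity>i\<in>I - Y. a i)" by (rule infsum_nonneg)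
      then show ?thesis by (simp add: k_def algebra_simps)
    qed
    also have "\<dots> < e" using tail k by (simp add: field_simps)
    finally show ?thesis .
  qed
  then show "\<exists>X. finite X \<and> X \<subseteq> I \<and> (\<forall>Y. finite Y \<and> X \<subseteq> Y \<and> Y \<subseteq> I \<longrightarrow>
      dist (\<Sum>i\<in>Y. u (h i)) (u (\<lambda>x. \<Sum>\<^sub>\<infinity>i\<in>I. h i x)) < e)"
    using X by blast
qed

lemma schwartz_bounded_norm:
  fixes B :: "('a::euclidean_space \<Rightarrow> complex) set"
  assumes "schwartz_bounded B"
  shows "\<exists>C. \<forall>f\<in>B. schwartz_norm M f \<le> C"
proof -
  have "\<forall>bs\<in>lists (Basis::'a set). \<exists>C. \<forall>f\<in>B. schwartz_seminorm M bs f \<le> C" using assms by (auto simp: schwartz_bounded_def)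
  then obtain C where C: "\<And>bs f. bs \<in> lists Basis \<Longrightarrow> f \<in> B \<Longrightarrow> schwartz_seminorm M bs f \<le> C bs" by metis
  have "schwartz_norm M f \<le> (\<Sum>bs\<in>multi_indices TYPE('a) M. C bs)" if "f \<in> B" for f
    unfolding schwartz_norm_def using that by (intro sum_mono C) auto
  then show ?thesis by blast
qed

lemma tempered_bounded_on:
  assumes u: "u \<in> tempered" and B: "schwartz_bounded B"
  shows "bdd_above ((\<lambda>\<phi>. cmod (u \<phi>)) ` B)"
proof -
  obtain M C where C: "0 \<le> C" "\<And>f. f \<in> schwartz_space \<Longrightarrow> cmod (u f) \<le> C * schwartz_norm M f"
    using tempered_bound [OF u] by blast
  obtain D where D: "\<And>f. f \<in> B \<Longrightarrow> schwartz_norm M f \<le> D" using schwartz_bounded_norm [OF B] by blast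
  have "cmod (u \<phi>) \<le> C * D" if "\<phi> \<in> B" for \<phi>
  proof -
    have "cmod (u \<phi>) \<le> C * schwartz_norm M \<phi>" using B that by (intro C(2)) (auto simp: schwartz_bounded_def)
    also have "\<dots> \<le> C * D" by (intro mult_left_mono D that C(1))
    finally show ?thesis .
  qed
  then show ?thesis by (intro bdd_aboveI2)
qed

lemma pseudometric_weak: "pseudometric_family tempered {\<lambda>u. cmod (u \<phi>) | \<phi>. \<phi> \<in> schwartz_space}"
  unfolding pseudometric_family_def
proof (intro conjI ballI)
  fix p :: "(('a \<Rightarrow> complex) \<Rightarrow> complex) \<Rightarrow> real" and f g h :: "('a \<Rightarrow> complex) \<Rightarrow> complex"
  assume "p \<in> {\<lambda>u. cmod (u \<phi>) | \<phi>. \<phi> \<in> schwartz_space}"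
  then obtain \<phi> where p: "p = (\<lambda>u. cmod (u \<phi>))" by blast
  show "p (f - f) = 0" "p (g - f) = p (f - g)" by (simp_all add: p norm_minus_commute)
  show "p (h - f) \<le> p (h - g) + p (g - f)"
    using norm_triangle_ineq [of "(h - g) \<phi>" "(g - f) \<phi>"] by (simp add: p)
qed (use schwartz_zero in blast)

lemma tempered_diff_bdd:
  assumes "u \<in> tempered" "v \<in> tempered" and B: "schwartz_bounded B"
  shows "bdd_above ((\<lambda>\<phi>. cmod ((u - v) \<phi>)) ` B)"
proof -
  obtain C D where "\<And>\<phi>. \<phi> \<in> B \<Longrightarrow> cmod (u \<phi>) \<le> C" "\<And>\<phi>. \<phi> \<in> B \<Longrightarrow> cmod (v \<phi>) \<le> D"
    using tempered_bounded_on [OF assms(1) B] tempered_bounded_on [OF assms(2) B] by (auto simp: bdd_above_def)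
  then have "cmod ((u - v) \<phi>) \<le> C + D" if "\<phi> \<in> B" for \<phi>
    using that norm_triangle_ineq4 [of "u \<phi>" "v \<phi>"] by fastforce
  then show ?thesis by (intro bdd_aboveI2)
qed

lemma schwartz_bounded_singleton: "\<phi> \<in> schwartz_space \<Longrightarrow> schwartz_bounded {\<phi>}"
  by (auto simp: schwartz_bounded_def)

lemma pseudometric_strong:
  "pseudometric_family tempered {\<lambda>u. SUP \<phi>\<in>B. cmod (u \<phi>) | B. schwartz_bounded B \<and> B \<noteq> {}}"
  unfolding pseudometric_family_def
proof (intro conjI ballI)
  show "{\<lambda>u. SUP \<phi>\<in>B. cmod (u \<phi>) | B. schwartz_bounded B \<and> B \<noteq> {}} \<noteq> {}"
    using schwartz_bounded_singleton [OF schwartz_zero] by blast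
next
  fix p :: "(('a \<Rightarrow> complex) \<Rightarrow> complex) \<Rightarrow> real" and f :: "('a \<Rightarrow> complex) \<Rightarrow> complex"
  assume "p \<in> {\<lambda>u. SUP \<phi>\<in>B. cmod (u \<phi>) | B. schwartz_bounded B \<and> B \<noteq> {}}"
  then obtain B :: "('a \<Rightarrow> complex) set" where B: "schwartz_bounded B" "B \<noteq> {}" and p: "p = (\<lambda>u. SUP \<phi>\<in>B. cmod (u \<phi>))" by blast
  show "p (f - f) = 0" using B by (simp add: p)
  fix g :: "('a \<Rightarrow> complex) \<Rightarrow> complex"
  show "p (g - f) = p (f - g)" by (simp add: p norm_minus_commute)
  fix h :: "('a \<Rightarrow> complex) \<Rightarrow> complex"
  assume f: "f \<in> tempered" and g: "g \<in> tempered" and h: "h \<in> tempered"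
  show "p (h - f) \<le> p (h - g) + p (g - f)"
    unfolding p
  proof (rule cSUP_least [OF B(2)])
    fix \<phi> assume \<phi>: "\<phi> \<in> B"
    have "cmod ((h - f) \<phi>) \<le> cmod ((h - g) \<phi>) + cmod ((g - f) \<phi>)"
      using norm_triangle_ineq [of "(h - g) \<phi>" "(g - f) \<phi>"] by simp
    also have "\<dots> \<le> (SUP \<phi>\<in>B. cmod ((h - g) \<phi>)) + (SUP \<phi>\<in>B. cmod ((g - f) \<phi>))"
      by (intro add_mono cSUP_upper \<phi> tempered_diff_bdd f g h B)
    finally show "cmod ((h - f) \<phi>) \<le> (SUP \<phi>\<in>B. cmod ((h - g) \<phi>)) + (SUP \<phi>\<in>B. cmod ((g - f) \<phi>))" .
  qed
qed

section \<open>Continuous operators between Schwartz spaces and their transposes\<close>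

definition schwartz_operator ::
  "(('a::euclidean_space \<Rightarrow> complex) \<Rightarrow> 'b::euclidean_space \<Rightarrow> complex) \<Rightarrow> bool" where
  "schwartz_operator A \<longleftrightarrow>
     (\<forall>f\<in>schwartz_space. A f \<in> schwartz_space) \<and>
     (\<forall>f\<in>schwartz_space. \<forall>g\<in>schwartz_space. A (\<lambda>x. f x + g x) = (\<lambda>x. A f x + A g x)) \<and>
     (\<forall>c. \<forall>f\<in>schwartz_space. A (\<lambda>x. c * f x) = (\<lambda>x. c * A f x)) \<and>
     (\<forall>M. \<exists>M' C. 0 \<le> C \<and> (\<forall>f\<in>schwartz_space. schwartz_norm M (A f) \<le> C * schwartz_norm M' f))"

definition transpose_op ::
  "(('a::euclidean_space \<Rightarrow> complex) \<Rightarrow> 'b::euclidean_space \<Rightarrow> complex) \<Rightarrow>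
    (('b \<Rightarrow> complex) \<Rightarrow> complex) \<Rightarrow> ('a \<Rightarrow> complex) \<Rightarrow> complex" where
  "transpose_op A u = (\<lambda>\<phi>\<in>schwartz_space. u (A \<phi>))"

lemma transpose_op_apply [simp]: "\<phi> \<in> schwartz_space \<Longrightarrow> transpose_op A u \<phi> = u (A \<phi>)"
  by (simp add: transpose_op_def)

lemma transpose_op_tempered:
  assumes A: "schwartz_operator A" and u: "u \<in> tempered"
  shows "transpose_op A u \<in> tempered"
proof -
  obtain M C where C: "0 \<le> C" "\<And>f. f \<in> schwartz_space \<Longrightarrow> cmod (u f) \<le> C * schwartz_norm M f"
    using tempered_bound [OF u] by blast
  obtain M' D where D: "0 \<le> D" "\<And>f. f \<in> schwartz_space \<Longrightarrow> schwartz_norm M (A f) \<le> D * schwartz_norm M' f"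
    using A unfolding schwartz_operator_def by meson
  show ?thesis
  proof (rule temperedI [where C = "C * D" and M = M'])
    show "transpose_op A u \<in> extensional schwartz_space" by (simp add: transpose_op_def)
    fix f assume f: "f \<in> (schwartz_space :: ('a \<Rightarrow> complex) set)"
    then have Af: "A f \<in> schwartz_space" using A by (simp add: schwartz_operator_def)
    have "cmod (u (A f)) \<le> C * (D * schwartz_norm M' f)"
      using C(2) [OF Af] mult_left_mono [OF D(2) [OF f] C(1)] by linarith
    then show "cmod (transpose_op A u f) \<le> C * D * schwartz_norm M' f" using f by (simp add: mult_ac)
    show "transpose_op A u (\<lambda>x. c * f x) = c * transpose_op A u f" for c
      using A f Af by (simp add: schwartz_operator_def schwartz_cmult tempered_cmult [OF u])
    fix g assume g: "g \<in> (schwartz_space :: ('a \<Rightarrow> complex) set)"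
    then have Ag: "A g \<in> schwartz_space" using A by (simp add: schwartz_operator_def)
    show "transpose_op A u (\<lambda>x. f x + g x) = transpose_op A u f + transpose_op A u g"
      using A f Af g Ag by (simp add: schwartz_operator_def schwartz_add tempered_add [OF u])
  qed
qed

lemma continuous_map_transpose_weak:
  assumes A: "schwartz_operator A"
  shows "continuous_map weak_topology weak_topology (transpose_op A)"
  unfolding weak_topology_def
proof (rule continuous_map_seminorm_topology [OF pseudometric_weak pseudometric_weak transpose_op_tempered [OF A]])
  fix q :: "(('a \<Rightarrow> complex) \<Rightarrow> complex) \<Rightarrow> real"
  assume "q \<in> {\<lambda>u. cmod (u \<phi>) | \<phi>. \<phi> \<in> schwartz_space}"
  then obtain \<phi> where \<phi>: "\<phi> \<in> schwartz_space" and q: "q = (\<lambda>u. cmod (u \<phi>))" by blast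
  have "A \<phi> \<in> schwartz_space" using A \<phi> by (simp add: schwartz_operator_def)
  then show "\<exists>C F. 0 \<le> C \<and> finite F \<and> F \<subseteq> {\<lambda>u. cmod (u \<phi>) | \<phi>. \<phi> \<in> schwartz_space} \<and>
      (\<forall>f\<in>tempered. \<forall>g\<in>tempered. q (transpose_op A g - transpose_op A f) \<le> C * (\<Sum>p\<in>F. p (g - f)))"
    using \<phi> by (intro exI [of _ 1] exI [of _ "{\<lambda>u. cmod (u (A \<phi>))}"]) (auto simp: q)
qed

lemma schwartz_bounded_image:
  assumes A: "schwartz_operator A" and B: "schwartz_bounded B"
  shows "schwartz_bounded (A ` B)"
proof -
  have "\<exists>C. \<forall>f\<in>A ` B. schwartz_seminorm N bs f \<le> C" if bs: "bs \<in> lists Basis" for N bs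
  proof -
    define M where "M = max N (length bs)"
    obtain M' D where D: "0 \<le> D" "\<And>f. f \<in> schwartz_space \<Longrightarrow> schwartz_norm M (A f) \<le> D * schwartz_norm M' f"
      using A unfolding schwartz_operator_def by meson
    obtain C where C: "\<And>f. f \<in> B \<Longrightarrow> schwartz_norm M' f \<le> C" using schwartz_bounded_norm [OF B] by blast
    have "schwartz_seminorm N bs (A f) \<le> D * C" if f: "f \<in> B" for f
    proof -
      have fS: "f \<in> schwartz_space" using f B by (auto simp: schwartz_bounded_def)
      then have "A f \<in> schwartz_space" using A by (simp add: schwartz_operator_def)
      then have "schwartz_seminorm N bs (A f) \<le> schwartz_norm M (A f)"
        by (rule schwartz_seminorm_le_norm [OF _ bs]) (auto simp: M_def)
      also have "\<dots> \<le> D * schwartz_norm M' f" by (rule D(2) [OF fS])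
      also have "\<dots> \<le> D * C" by (intro mult_left_mono C f D)
      finally show ?thesis .
    qed
    then show ?thesis by blast
  qed
  then show ?thesis using A B unfolding schwartz_bounded_def schwartz_operator_def by blast
qed

lemma continuous_map_transpose_strong:
  assumes A: "schwartz_operator A"
  shows "continuous_map strong_topology strong_topology (transpose_op A)"
  unfolding strong_topology_def
proof (rule continuous_map_seminorm_topology [OF pseudometric_strong pseudometric_strong transpose_op_tempered [OF A]])
  fix q :: "(('a \<Rightarrow> complex) \<Rightarrow> complex) \<Rightarrow> real"
  assume "q \<in> {\<lambda>u. SUP \<phi>\<in>B. cmod (u \<phi>) | B. schwartz_bounded B \<and> B \<noteq> {}}"
  then obtain B where B: "schwartz_bounded B" "B \<noteq> {}" and q: "q = (\<lambda>u. SUP \<phi>\<in>B. cmod (u \<phi>))" by blast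
  let ?p = "\<lambda>u. SUP \<phi>\<in>A ` B. cmod (u \<phi>)"
  have "q (transpose_op A g - transpose_op A f) = ?p (g - f)" for f g
    unfolding q image_image
    by (rule arg_cong [where f = Sup], rule image_cong) (use B in \<open>auto simp: schwartz_bounded_def subset_iff\<close>)
  then show "\<exists>C F. 0 \<le> C \<and> finite F \<and> F \<subseteq> {\<lambda>u. SUP \<phi>\<in>B. cmod (u \<phi>) | B. schwartz_bounded B \<and> B \<noteq> {}} \<and>
      (\<forall>f\<in>tempered. \<forall>g\<in>tempered. q (transpose_op A g - transpose_op A f) \<le> C * (\<Sum>p\<in>F. p (g - f)))"
    using B schwartz_bounded_image [OF A B(1)]
    by (intro exI [of _ 1] exI [of _ "{?p}"]) auto
qed

lemma schwartz_operatorI: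
  assumes "\<And>f. f \<in> schwartz_space \<Longrightarrow> A f \<in> schwartz_space"
    and "\<And>f g. f \<in> schwartz_space \<Longrightarrow> g \<in> schwartz_space \<Longrightarrow> A (\<lambda>x. f x + g x) = (\<lambda>x. A f x + A g x)"
    and "\<And>c f. f \<in> schwartz_space \<Longrightarrow> A (\<lambda>x. c * f x) = (\<lambda>x. c * A f x)"
    and "\<And>M. \<exists>M' C. 0 \<le> C \<and> (\<forall>f\<in>schwartz_space. schwartz_norm M (A f) \<le> C * schwartz_norm M' f)"
  shows "schwartz_operator A"
  using assms unfolding schwartz_operator_def by blast

section \<open>Integer points and the unit cell\<close>

definition int_points :: "'a::euclidean_space set" where
  "int_points = {v. \<forall>b\<in>Basis. v \<bullet> b \<in> \<int>}"

definition unit_cell :: "'a::euclidean_space set" where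
  "unit_cell = {v. \<forall>b\<in>Basis. 0 \<le> v \<bullet> b \<and> v \<bullet> b < 1}"

definition int_part :: "'a::euclidean_space \<Rightarrow> 'a" where
  "int_part x = (\<Sum>b\<in>Basis. of_int \<lfloor>x \<bullet> b\<rfloor> *\<^sub>R b)"

lemma int_part_inner: "b \<in> Basis \<Longrightarrow> int_part x \<bullet> b = of_int \<lfloor>x \<bullet> b\<rfloor>"
  by (simp add: int_part_def)

lemma int_part_int_points [simp]: "int_part x \<in> int_points"
  by (simp add: int_points_def int_part_inner)

lemma int_points_zero [simp]: "0 \<in> int_points"
  and int_points_add: "m \<in> int_points \<Longrightarrow> n \<in> int_points \<Longrightarrow> m + n \<in> int_points"
  and int_points_uminus: "n \<in> int_points \<Longrightarrow> - n \<in> int_points"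
  by (auto simp: int_points_def inner_add_left)

text \<open>The cell is half open, so in each coordinate exactly one integer shift, by the floor,
  leads into it. Hence the translates of the cell cover the space without overlap.\<close>

lemma cell_shift_iff: "n \<in> int_points \<Longrightarrow> x - n \<in> unit_cell \<longleftrightarrow> n = int_part x"
proof
  assume n: "n \<in> int_points" and x: "x - n \<in> unit_cell"
  show "n = int_part x"
  proof (rule euclidean_eqI)
    fix b :: 'a assume b: "b \<in> Basis"
    obtain k where k: "n \<bullet> b = of_int k" using n b by (auto simp: int_points_def Ints_def)
    have "0 \<le> x \<bullet> b - of_int k" "x \<bullet> b - of_int k < 1"
      using x b k by (auto simp: unit_cell_def inner_diff_left)
    then have "\<lfloor>x \<bullet> b\<rfloor> = k" by linarith
    then show "n \<bullet> b = int_part x \<bullet> b" using b k by (simp add: int_part_inner)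
  qed
next
  assume "n = int_part x"
  then show "x - n \<in> unit_cell"
    by (auto simp: unit_cell_def inner_diff_left int_part_inner) linarith
qed

lemma countable_int_points: "countable (int_points :: 'a::euclidean_space set)"
proof -
  have "int_points \<subseteq> (\<lambda>f. \<Sum>b\<in>Basis. of_int (f b) *\<^sub>R (b::'a)) ` (Basis \<rightarrow>\<^sub>E (UNIV :: int set))"
  proof
    fix v :: 'a assume v: "v \<in> int_points"
    have "v = (\<Sum>b\<in>Basis. of_int (restrict (\<lambda>b. \<lfloor>v \<bullet> b\<rfloor>) Basis b) *\<^sub>R b)"
      by (rule euclidean_eqI) (use v in \<open>auto simp: int_points_def elim!: Ints_cases\<close>)
    then show "v \<in> (\<lambda>f. \<Sum>b\<in>Basis. of_int (f b) *\<^sub>R b) ` (Basis \<rightarrow>\<^sub>E UNIV)"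
      by (rule image_eqI [where x = "restrict (\<lambda>b. \<lfloor>v \<bullet> b\<rfloor>) Basis"]) auto
  qed
  moreover have "countable ((Basis :: 'a set) \<rightarrow>\<^sub>E (UNIV :: int set))" by (rule countable_PiE) auto
  ultimately show ?thesis by (meson countable_image countable_subset)
qed

lemma summable_on_int_square: "(\<lambda>k. 1 / (1 + (of_int k)\<^sup>2) :: real) summable_on (UNIV :: int set)"
proof -
  have "summable (\<lambda>n. 1 / (1 + (real n)\<^sup>2))"
  proof (rule summable_comparison_test' [where N = 1])
    show "summable (\<lambda>n. inverse (real n ^ 2))" by (rule inverse_power_summable) simp
    show "norm (1 / (1 + (real n)\<^sup>2)) \<le> inverse (real n ^ 2)" if "1 \<le> n" for n
      using that by (simp add: inverse_eq_divide frac_le)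
  qed
  then have nat: "(\<lambda>n. 1 / (1 + (real n)\<^sup>2)) summable_on UNIV"
    by (simp add: summable_on_UNIV_nonneg_real_iff)
  have "(\<lambda>k. 1 / (1 + (of_int k)\<^sup>2) :: real) summable_on (range int)"
    using nat by (subst summable_on_reindex) (auto simp: o_def)
  moreover have "(\<lambda>k. 1 / (1 + (of_int k)\<^sup>2) :: real) summable_on (range (\<lambda>n. - int n))"
    using nat by (subst summable_on_reindex) (auto simp: o_def inj_def)
  ultimately have "(\<lambda>k. 1 / (1 + (of_int k)\<^sup>2) :: real) summable_on (range int \<union> range (\<lambda>n. - int n))"
    using summable_on_union by blast
  moreover have "range int \<union> range (\<lambda>n. - int n) = UNIV"
    by (auto simp: image_iff) (metis int_cases2)
  ultimately show ?thesis by simp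
qed

text \<open>Each factor \<open>1 + (of_int (f b))\<^sup>2\<close> is at most the square of
  \<open>1 + norm n\<close>, so the terms are bounded by a product of one-dimensional summable
  families. The exponent is twice the dimension because every coordinate contributes a
  square.\<close>

lemma summable_int_points:
  "(\<lambda>n. 1 / (1 + norm n) ^ (2 * DIM('a))) summable_on (int_points :: 'a::euclidean_space set)"
proof -
  define \<phi> where "\<phi> = (\<lambda>f :: 'a \<Rightarrow> int. \<Sum>b\<in>Basis. of_int (f b) *\<^sub>R (b::'a))"
  define I where "I = ((Basis :: 'a set) \<rightarrow>\<^sub>E (UNIV :: int set))"
  have inner: "\<phi> f \<bullet> b = of_int (f b)" if "b \<in> Basis" for f b
    using that by (simp add: \<phi>_def)
  have inj: "inj_on \<phi> I"
  proof (rule inj_onI)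
    fix f g assume fg: "f \<in> I" "g \<in> I" "\<phi> f = \<phi> g"
    have "f b = g b" if "b \<in> Basis" for b using inner [OF that, of f] inner [OF that, of g] fg(3) by simp
    then show "f = g" using fg unfolding I_def by (intro PiE_ext [of f Basis _ g]) auto
  qed
  have img: "int_points \<subseteq> \<phi> ` I"
  proof
    fix v :: 'a assume v: "v \<in> int_points"
    have "v = \<phi> (restrict (\<lambda>b. \<lfloor>v \<bullet> b\<rfloor>) Basis)"
      unfolding \<phi>_def by (rule euclidean_eqI) (use v in \<open>auto simp: int_points_def elim!: Ints_cases\<close>)
    then show "v \<in> \<phi> ` I" by (rule image_eqI [where x = "restrict (\<lambda>b. \<lfloor>v \<bullet> b\<rfloor>) Basis"]) (auto simp: I_def)
  qed
  have "Infinite_Set_Sum.abs_summable_on (\<lambda>k::int. 1 / (1 + (of_int k)\<^sup>2) :: real) UNIV"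
    using summable_on_int_square by (simp add: abs_summable_equivalent [symmetric])
  then have "Infinite_Set_Sum.abs_summable_on (\<lambda>f. \<Prod>b\<in>(Basis::'a set). 1 / (1 + (of_int (f b :: int))\<^sup>2) :: real) I"
    unfolding I_def by (intro abs_summable_on_prod_PiE) auto
  then have "(\<lambda>f. norm (\<Prod>b\<in>(Basis::'a set). 1 / (1 + (of_int (f b :: int))\<^sup>2) :: real)) summable_on I"
    unfolding abs_summable_equivalent [symmetric] .
  then have "((\<lambda>n. 1 / (1 + norm n) ^ (2 * DIM('a))) \<circ> \<phi>) summable_on I"
  proof (rule summable_on_comparison_test)
    fix f assume "f \<in> I"
    have "(\<Prod>b\<in>(Basis::'a set). 1 + (of_int (f b))\<^sup>2) \<le> (\<Prod>b\<in>(Basis::'a set). (1 + norm (\<phi> f))\<^sup>2)"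
    proof (rule prod_mono)
      fix b :: 'a assume b: "b \<in> Basis"
      have "\<bar>of_int (f b)\<bar> \<le> norm (\<phi> f)" using Basis_le_norm [OF b, of "\<phi> f"] inner [OF b] by simp
      then have "(of_int (f b))\<^sup>2 \<le> (norm (\<phi> f))\<^sup>2" using power_mono [of "\<bar>real_of_int (f b)\<bar>" "norm (\<phi> f)" 2] by simp
      then show "0 \<le> 1 + (real_of_int (f b))\<^sup>2 \<and> 1 + (of_int (f b))\<^sup>2 \<le> (1 + norm (\<phi> f))\<^sup>2"
        by (simp add: power2_sum add_increasing2)
    qed
    also have "\<dots> = (1 + norm (\<phi> f)) ^ (2 * DIM('a))" by (simp add: power_mult)
    finally have le: "(\<Prod>b\<in>(Basis::'a set). 1 + (of_int (f b))\<^sup>2) \<le> (1 + norm (\<phi> f)) ^ (2 * DIM('a))" .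
    have pos: "0 < (\<Prod>b\<in>(Basis::'a set). 1 + (real_of_int (f b))\<^sup>2)" by (rule prod_pos) (simp add: add_pos_nonneg)
    have "1 / (1 + norm (\<phi> f)) ^ (2 * DIM('a)) \<le> 1 / (\<Prod>b\<in>(Basis::'a set). 1 + (real_of_int (f b))\<^sup>2)"
      by (rule divide_left_mono [OF le]) (use pos in \<open>auto intro!: mult_pos_pos zero_less_power add_pos_nonneg\<close>)
    also have "\<dots> = norm (\<Prod>b\<in>(Basis::'a set). 1 / (1 + (of_int (f b :: int))\<^sup>2) :: real)"
      using pos by (simp add: prod_dividef abs_prod)
    finally show "((\<lambda>n. 1 / (1 + norm n) ^ (2 * DIM('a))) \<circ> \<phi>) f \<le> norm (\<Prod>b\<in>(Basis::'a set). 1 / (1 + (of_int (f b :: int))\<^sup>2) :: real)"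
      by simp
  qed simp
  then have "(\<lambda>n. 1 / (1 + norm n) ^ (2 * DIM('a))) summable_on (\<phi> ` I)"
    by (simp add: summable_on_reindex [OF inj])
  then show ?thesis by (rule summable_on_subset [OF _ img])
qed

section \<open>Tilings by unit cells\<close>

lemma infsum_norm_eq_suminf:
  fixes f :: "nat \<Rightarrow> 'b::banach"
  assumes "(\<lambda>n. norm (f n)) summable_on UNIV"
  shows "(\<Sum>\<^sub>\<infinity>n. f n) = (\<Sum>n. f n)"
proof -
  have "f summable_on UNIV" using assms by (rule abs_summable_summable)
  then have "(f has_sum (\<Sum>\<^sub>\<infinity>n. f n)) UNIV" by simp
  then show ?thesis using has_sum_imp_sums sums_unique by blast
qed

text \<open>An infinite index set is enumerated, and the theorem on integrating absolutely
  convergent series is applied to the sequence. A finite index set has no such enumeration and is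
  treated by additivity.\<close>

lemma
  fixes f :: "'i \<Rightarrow> 'a \<Rightarrow> 'b::{banach, second_countable_topology}"
  assumes I: "countable I" and int: "\<And>i. i \<in> I \<Longrightarrow> integrable M (f i)"
    and pt: "\<And>x. x \<in> space M \<Longrightarrow> (\<lambda>i. norm (f i x)) summable_on I"
    and sm: "(\<lambda>i. \<integral>x. norm (f i x) \<partial>M) summable_on I"
  shows integral_infsum: "(\<integral>x. (\<Sum>\<^sub>\<infinity>i\<in>I. f i x) \<partial>M) = (\<Sum>\<^sub>\<infinity>i\<in>I. \<integral>x. f i x \<partial>M)"
    and integrable_infsum: "integrable M (\<lambda>x. \<Sum>\<^sub>\<infinity>i\<in>I. f i x)"
proof -
  have "(\<integral>x. (\<Sum>\<^sub>\<infinity>i\<in>I. f i x) \<partial>M) = (\<Sum>\<^sub>\<infinity>i\<in>I. \<integral>x. f i x \<partial>M) \<and> integrable M (\<lambda>x. \<Sum>\<^sub>\<infinity>i\<in>I. f i x)"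
  proof (cases "finite I")
    case True
    then show ?thesis using int by (auto intro!: Bochner_Integration.integral_sum)
  next
    case False
    define \<sigma> where "\<sigma> = from_nat_into I"
    have bij: "bij_betw \<sigma> UNIV I" unfolding \<sigma>_def by (rule bij_betw_from_nat_into [OF I False])
    then have \<sigma>: "\<sigma> n \<in> I" for n using bij_betwE by blast
    have sm': "(\<lambda>n. \<integral>x. norm (f (\<sigma> n) x) \<partial>M) summable_on UNIV"
      using sm by (subst summable_on_reindex_bij_betw [OF bij])
    have pt': "(\<lambda>n. norm (f (\<sigma> n) x)) summable_on UNIV" if "x \<in> space M" for x
      using pt [OF that] summable_on_reindex_bij_betw [OF bij, of "\<lambda>i. norm (f i x)"] by simp
    have eq: "(\<Sum>\<^sub>\<infinity>i\<in>I. f i x) = (\<Sum>n. f (\<sigma> n) x)" if "x \<in> space M" for x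
      using infsum_reindex_bij_betw [OF bij, of "\<lambda>i. f i x"] infsum_norm_eq_suminf [OF pt' [OF that]] by simp
    have int': "integrable M (f (\<sigma> n))" for n by (rule int [OF \<sigma>])
    have ae: "AE x in M. summable (\<lambda>n. norm (f (\<sigma> n) x))"
      by (rule AE_I2) (rule summable_on_imp_summable [OF pt'])
    note S = integral_suminf [OF int' ae summable_on_imp_summable [OF sm']]
      integrable_suminf [OF int' ae summable_on_imp_summable [OF sm']]
    have "(\<lambda>n. norm (\<integral>x. f (\<sigma> n) x \<partial>M)) summable_on UNIV"
      by (rule summable_on_comparison_test [OF sm']) auto
    from infsum_norm_eq_suminf [OF this]
    have "(\<Sum>\<^sub>\<infinity>i\<in>I. \<integral>x. f i x \<partial>M) = (\<Sum>n. \<integral>x. f (\<sigma> n) x \<partial>M)"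
      using infsum_reindex_bij_betw [OF bij, of "\<lambda>i. \<integral>x. f i x \<partial>M"] by simp
    moreover have "(\<integral>x. (\<Sum>\<^sub>\<infinity>i\<in>I. f i x) \<partial>M) = (\<integral>x. (\<Sum>n. f (\<sigma> n) x) \<partial>M)"
      by (rule Bochner_Integration.integral_cong) (auto simp: eq)
    moreover have "integrable M (\<lambda>x. \<Sum>\<^sub>\<infinity>i\<in>I. f i x) = integrable M (\<lambda>x. \<Sum>n. f (\<sigma> n) x)"
      by (rule Bochner_Integration.integrable_cong) (auto simp: eq)
    ultimately show ?thesis using S by simp
  qed
  then show "(\<integral>x. (\<Sum>\<^sub>\<infinity>i\<in>I. f i x) \<partial>M) = (\<Sum>\<^sub>\<infinity>i\<in>I. \<integral>x. f i x \<partial>M)"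
    "integrable M (\<lambda>x. \<Sum>\<^sub>\<infinity>i\<in>I. f i x)" by auto
qed

lemma integrable_translate:
  fixes f :: "'a::euclidean_space \<Rightarrow> 'b::{banach, second_countable_topology}"
  assumes "integrable lborel f"
  shows "integrable lborel (\<lambda>x. f (x + a))"
proof -
  have "integrable (distr lborel borel ((+) a)) f" using assms by (simp add: lborel_distr_plus)
  then have "integrable lborel (\<lambda>x. f (a + x))" by (rule integrable_distr [rotated]) simp
  then show ?thesis by (simp add: add.commute)
qed

lemma integral_translate:
  fixes f :: "'a::euclidean_space \<Rightarrow> 'b::{banach, second_countable_topology}"
  assumes "f \<in> borel_measurable borel"
  shows "(\<integral>x. f (x + a) \<partial>lborel) = (\<integral>x. f x \<partial>lborel)"
proof -
  have "(\<integral>x. f x \<partial>distr lborel borel ((+) a)) = (\<integral>x. f (a + x) \<partial>lborel)"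
    by (rule integral_distr) (use assms in simp_all)
  then show ?thesis by (simp add: lborel_distr_plus add.commute)
qed

text \<open>The partial sums of a partition of unity are bounded by 1, which gives the domination.\<close>

lemma integral_partition:
  fixes g :: "'a \<Rightarrow> 'b::{banach, second_countable_topology, real_normed_field}" and \<omega> :: "'i \<Rightarrow> 'a \<Rightarrow> real"
  assumes I: "countable I" and g: "integrable M g"
    and \<omega>: "\<And>i. i \<in> I \<Longrightarrow> \<omega> i \<in> borel_measurable M" "\<And>i x. 0 \<le> \<omega> i x"
    and one: "\<And>x. x \<in> space M \<Longrightarrow> ((\<lambda>i. \<omega> i x) has_sum 1) I"
  shows "(\<Sum>\<^sub>\<infinity>i\<in>I. \<integral>x. \<omega> i x *\<^sub>R g x \<partial>M) = (\<integral>x. g x \<partial>M)"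
    and "(\<lambda>i. \<integral>x. norm (\<omega> i x *\<^sub>R g x) \<partial>M) summable_on I"
proof -
  have le1: "sum (\<lambda>i. \<omega> i x) F \<le> 1" if "finite F" "F \<subseteq> I" "x \<in> space M" for F x
  proof -
    have "sum (\<lambda>i. \<omega> i x) F = (\<Sum>\<^sub>\<infinity>i\<in>F. \<omega> i x)" using that by simp
    also have "\<dots> \<le> (\<Sum>\<^sub>\<infinity>i\<in>I. \<omega> i x)"
      using one [OF that(3)] that \<omega>(2) by (intro infsum_mono2) (auto dest: has_sum_imp_summable)
    also have "\<dots> = 1" using one [OF that(3)] by (rule infsumI)
    finally show ?thesis .
  qed
  have chi1: "\<omega> i x \<le> 1" if "i \<in> I" "x \<in> space M" for i x using le1 [of "{i}" x] that by simp
  have int: "integrable M (\<lambda>x. \<omega> i x *\<^sub>R g x)" if i: "i \<in> I" for i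
  proof (rule Bochner_Integration.integrable_bound [OF g])
    show "(\<lambda>x. \<omega> i x *\<^sub>R g x) \<in> borel_measurable M" using \<omega>(1) [OF i] g by measurable
    show "AE x in M. norm (\<omega> i x *\<^sub>R g x) \<le> norm (g x)"
      using chi1 [OF i] \<omega>(2) by (intro AE_I2) (auto intro: mult_left_le_one_le)
  qed
  show sm: "(\<lambda>i. \<integral>x. norm (\<omega> i x *\<^sub>R g x) \<partial>M) summable_on I"
  proof (rule nonneg_bdd_above_summable_on)
    show "bdd_above (sum (\<lambda>i. \<integral>x. norm (\<omega> i x *\<^sub>R g x) \<partial>M) ` {F. F \<subseteq> I \<and> finite F})"
    proof (rule bdd_aboveI2)
      fix F assume F: "F \<in> {F. F \<subseteq> I \<and> finite F}"
      have "(\<Sum>i\<in>F. \<integral>x. norm (\<omega> i x *\<^sub>R g x) \<partial>M) = (\<integral>x. (\<Sum>i\<in>F. norm (\<omega> i x *\<^sub>R g x)) \<partial>M)"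
        using F by (intro Bochner_Integration.integral_sum [symmetric] integrable_norm int) auto
      also have "\<dots> \<le> (\<integral>x. norm (g x) \<partial>M)"
      proof (rule integral_mono)
        show "integrable M (\<lambda>x. \<Sum>i\<in>F. norm (\<omega> i x *\<^sub>R g x))"
          using F int by (intro Bochner_Integration.integrable_sum integrable_norm) auto
        show "integrable M (\<lambda>x. norm (g x))" using g by simp
        fix x assume x: "x \<in> space M"
        have "(\<Sum>i\<in>F. norm (\<omega> i x *\<^sub>R g x)) = (\<Sum>i\<in>F. \<omega> i x) * norm (g x)"
          by (simp add: \<omega>(2) sum_distrib_right)
        also have "\<dots> \<le> 1 * norm (g x)" using F x by (intro mult_right_mono le1) auto
        finally show "(\<Sum>i\<in>F. norm (\<omega> i x *\<^sub>R g x)) \<le> norm (g x)" by simp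
      qed
      finally show "(\<Sum>i\<in>F. \<integral>x. norm (\<omega> i x *\<^sub>R g x) \<partial>M) \<le> (\<integral>x. norm (g x) \<partial>M)" .
    qed
  qed simp
  have hs: "((\<lambda>i. \<omega> i x *\<^sub>R g x) has_sum g x) I" if "x \<in> space M" for x
    using has_sum_bounded_linear [OF bounded_linear_scaleR_left one [OF that], of "g x"] by (simp add: o_def)
  have "(\<Sum>\<^sub>\<infinity>i\<in>I. \<integral>x. \<omega> i x *\<^sub>R g x \<partial>M) = (\<integral>x. (\<Sum>\<^sub>\<infinity>i\<in>I. \<omega> i x *\<^sub>R g x) \<partial>M)"
  proof (rule integral_infsum [OF I int _ sm, symmetric])
    fix x assume x: "x \<in> space M"
    have "(\<lambda>i. \<omega> i x * norm (g x)) summable_on I"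
      using has_sum_cmult_left [OF one [OF x], of "norm (g x)"] by (rule has_sum_imp_summable)
    then show "(\<lambda>i. norm (\<omega> i x *\<^sub>R g x)) summable_on I" by (simp add: \<omega>(2))
  qed
  also have "\<dots> = (\<integral>x. g x \<partial>M)"
    by (rule Bochner_Integration.integral_cong) (use hs infsumI in auto)
  finally show "(\<Sum>\<^sub>\<infinity>i\<in>I. \<integral>x. \<omega> i x *\<^sub>R g x \<partial>M) = (\<integral>x. g x \<partial>M)" .
qed

lemma unit_cell_borel [measurable]: "unit_cell \<in> sets borel"
proof -
  have "unit_cell = (\<Inter>b\<in>Basis. {v. 0 \<le> v \<bullet> b} \<inter> {v::'a. v \<bullet> b < 1})" by (auto simp: unit_cell_def)
  moreover have "\<dots> \<in> sets borel"
    by (intro sets.finite_INT sets.Int borel_closed borel_open closed_Collect_le open_Collect_less)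
       (auto intro!: continuous_intros)
  ultimately show ?thesis by simp
qed

lemma unit_cell_subset: "unit_cell \<subseteq> cbox 0 One"
  by (force simp: unit_cell_def mem_box)

lemma emeasure_unit_cell: "emeasure lborel (unit_cell :: 'a::euclidean_space set) = 1"
proof (rule antisym)
  have "emeasure lborel (unit_cell :: 'a set) \<le> emeasure lborel (cbox (0::'a) One)"
    by (rule emeasure_mono [OF unit_cell_subset]) simp
  then show "emeasure lborel (unit_cell :: 'a set) \<le> 1" by (simp add: emeasure_lborel_cbox_eq)
  have "emeasure lborel (box (0::'a) One) \<le> emeasure lborel (unit_cell :: 'a set)"
    by (rule emeasure_mono) (auto simp: unit_cell_def mem_box intro: less_imp_le)
  then show "1 \<le> emeasure lborel (unit_cell :: 'a set)" by simp
qed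

definition cell_measure :: "'a::euclidean_space measure" where
  "cell_measure = restrict_space lborel unit_cell"

lemma space_cell_measure [simp]: "space cell_measure = unit_cell"
  by (simp add: cell_measure_def space_restrict_space)

lemma integral_cell_measure:
  fixes f :: "'a::euclidean_space \<Rightarrow> 'b::{banach, second_countable_topology}"
  shows "(\<integral>x. f x \<partial>cell_measure) = (\<integral>x. indicator unit_cell x *\<^sub>R f x \<partial>lborel)"
  unfolding cell_measure_def by (rule integral_restrict_space) simp

lemma integrable_cell_measure:
  fixes f :: "'a::euclidean_space \<Rightarrow> 'b::{banach, second_countable_topology}"
  shows "integrable cell_measure f \<longleftrightarrow> integrable lborel (\<lambda>x. indicator unit_cell x *\<^sub>R f x)"
  unfolding cell_measure_def by (rule integrable_restrict_space) simp

lemma emeasure_cell_measure: "emeasure cell_measure (unit_cell :: 'a::euclidean_space set) = 1"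
  by (simp add: cell_measure_def emeasure_restrict_space emeasure_unit_cell)

interpretation cell: finite_measure "cell_measure :: 'a::euclidean_space measure"
  by (rule finite_measureI) (simp add: emeasure_cell_measure)

lemma cell_mean_const: "(\<integral>x. c \<partial>(cell_measure :: 'a::euclidean_space measure)) = (c :: complex)"
  by (simp add: measure_def emeasure_cell_measure)

lemma borel_measurable_cell_measure:
  "f \<in> borel_measurable borel \<Longrightarrow> f \<in> borel_measurable cell_measure"
  unfolding cell_measure_def by (rule measurable_restrict_space1) simp

lemma integrable_cell_continuous:
  fixes f :: "'a::euclidean_space \<Rightarrow> complex"
  assumes "continuous_on UNIV f"
  shows "integrable cell_measure f"
proof -
  have "compact (f ` cbox 0 One)" using assms by (intro compact_continuous_image compact_cbox) (rule continuous_on_subset, auto)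
  then obtain B where "\<And>x. x \<in> cbox 0 One \<Longrightarrow> cmod (f x) \<le> B"
    using compact_imp_bounded bounded_iff by (metis imageI)
  then have "AE x in cell_measure. cmod (f x) \<le> B" using unit_cell_subset by (intro AE_I2) auto
  then show ?thesis
    using assms by (intro cell.integrable_const_bound) (auto intro!: borel_measurable_cell_measure borel_measurable_continuous_onI)
qed

lemma has_sum_cell_indicator:
  "((\<lambda>n. indicator unit_cell (x - n) :: real) has_sum 1) int_points"
proof -
  have "((\<lambda>n. indicator unit_cell (x - n) :: real) has_sum 1) {int_part x}"
    using cell_shift_iff [of "int_part x" x] by (intro has_sum_finiteI) auto
  then show ?thesis
    by (rule has_sum_cong_neutral [THEN iffD1, rotated -1]) (auto simp: indicator_def cell_shift_iff)
qed

lemma has_sum_cell_indicator_plus: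
  "((\<lambda>n. indicator unit_cell (x + n) :: real) has_sum 1) int_points"
proof -
  have "bij_betw uminus int_points (int_points :: 'a set)"
    by (rule bij_betwI [where g = uminus]) (auto simp: int_points_uminus)
  from has_sum_reindex_bij_betw [OF this, of "\<lambda>n. indicator unit_cell (x - n) :: real" 1]
  show ?thesis using has_sum_cell_indicator [of x] by simp
qed

text \<open>The indicators of the translated cells form a partition of unity; translating each piece
  back to the cell turns its integral into the corresponding term.\<close>

lemma tiling:
  fixes g :: "'a::euclidean_space \<Rightarrow> complex"
  assumes g: "integrable lborel g"
  shows "(\<Sum>\<^sub>\<infinity>n\<in>int_points. \<integral>x. g (x + n) \<partial>cell_measure) = (\<integral>x. g x \<partial>lborel)"
    and "(\<lambda>n. \<integral>x. norm (g (x + n)) \<partial>cell_measure) summable_on int_points"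
proof -
  have m [measurable]: "g \<in> borel_measurable borel" using g by auto
  note P = integral_partition [OF countable_int_points g, of "\<lambda>n x. indicator unit_cell (x - n)"]
  have eq: "(\<integral>x. F (x + n) \<partial>cell_measure) = (\<integral>x. indicator unit_cell (x - n) *\<^sub>R F x \<partial>lborel)"
    if [measurable]: "F \<in> borel_measurable borel" for n and F :: "'a \<Rightarrow> 'b::{banach, second_countable_topology}"
    unfolding integral_cell_measure
    using integral_translate [of "\<lambda>x. indicator unit_cell (x - n) *\<^sub>R F x" n] by simp
  show "(\<Sum>\<^sub>\<infinity>n\<in>int_points. \<integral>x. g (x + n) \<partial>cell_measure) = (\<integral>x. g x \<partial>lborel)"
    unfolding eq [OF m] by (rule P(1)) (auto simp: has_sum_cell_indicator)
  have "(\<lambda>n. \<integral>x. norm ((indicator unit_cell (x - n) :: real) *\<^sub>R g x) \<partial>lborel) summable_on int_points"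
    by (rule P(2)) (auto simp: has_sum_cell_indicator)
  then show "(\<lambda>n. \<integral>x. norm (g (x + n)) \<partial>cell_measure) summable_on int_points"
    using eq [of "\<lambda>x. norm (g x)"] by simp
qed

text \<open>The mean over the shifted cell is a full integral of the cut-off function
  \<open>h\<close>. Tiling that integral by the original cells and using periodicity leaves
  \<open>g\<close> times a partition of unity.\<close>

lemma cell_mean_translate:
  fixes g :: "'a::euclidean_space \<Rightarrow> complex"
  assumes g: "continuous_on UNIV g" and per: "\<And>n x. n \<in> int_points \<Longrightarrow> g (x + n) = g x"
  shows "(\<integral>x. g (x + s) \<partial>cell_measure) = (\<integral>x. g x \<partial>cell_measure)"
proof -
  have m [measurable]: "g \<in> borel_measurable borel" using g by (rule borel_measurable_continuous_onI)
  define h where "h = (\<lambda>x. (indicator unit_cell (x - s) :: real) *\<^sub>R g x)"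
  have h: "integrable lborel h"
  proof -
    have "continuous_on UNIV (\<lambda>x. g (x + s))" by (intro continuous_on_compose2 [OF g] continuous_intros) auto
    then have "integrable cell_measure (\<lambda>x. g (x + s))" by (rule integrable_cell_continuous)
    then have "integrable lborel (\<lambda>x. indicator unit_cell x *\<^sub>R g (x + s))" by (simp add: integrable_cell_measure)
    from integrable_translate [OF this, of "- s"] show ?thesis by (simp add: h_def)
  qed
  have "(\<integral>x. g (x + s) \<partial>cell_measure) = (\<integral>x. h x \<partial>lborel)"
    unfolding integral_cell_measure using integral_translate [of h s] by (simp add: h_def)
  also have "\<dots> = (\<Sum>\<^sub>\<infinity>n\<in>int_points. \<integral>x. h (x + n) \<partial>cell_measure)" by (rule tiling(1) [OF h, symmetric])
  also have "\<dots> = (\<Sum>\<^sub>\<infinity>n\<in>int_points. \<integral>x. (indicator unit_cell (x - s + n) :: real) *\<^sub>R g x \<partial>cell_measure)"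
    by (rule infsum_cong) (simp add: h_def per add_diff_eq diff_add_eq)
  also have "\<dots> = (\<integral>x. g x \<partial>cell_measure)"
    by (rule integral_partition(1) [OF countable_int_points integrable_cell_continuous [OF g]])
       (auto intro!: borel_measurable_cell_measure has_sum_cell_indicator_plus)
  finally show ?thesis .
qed

section \<open>Fourier coefficients\<close>

definition torus_char :: "'a::euclidean_space \<Rightarrow> 'a \<Rightarrow> complex" where
  "torus_char n t = exp (\<i> * of_real (2 * pi * (n \<bullet> t)))"

lemma torus_char_add: "torus_char (m + n) t = torus_char m t * torus_char n t"
  by (simp add: torus_char_def inner_add_left algebra_simps exp_add)

lemma torus_char_zero [simp]: "torus_char 0 t = 1"
  by (simp add: torus_char_def)

lemma continuous_torus_char: "continuous_on S (torus_char n)"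
  unfolding torus_char_def by (intro continuous_intros)

lemma int_points_inner: "m \<in> int_points \<Longrightarrow> n \<in> int_points \<Longrightarrow> m \<bullet> n \<in> \<int>"
  unfolding euclidean_inner [of m n] by (intro Ints_sum Ints_mult) (auto simp: int_points_def)

lemma exp_2pi_Ints: "r \<in> \<int> \<Longrightarrow> exp (\<i> * of_real (2 * pi * r)) = 1"
  by (auto elim!: Ints_cases simp: exp_eq_1 mult_ac)

lemma torus_char_periodic: "m \<in> int_points \<Longrightarrow> n \<in> int_points \<Longrightarrow> torus_char m (t + n) = torus_char m t"
  using exp_2pi_Ints [OF int_points_inner, of m n]
  by (simp add: torus_char_def inner_add_right distrib_left exp_add mult_ac)

text \<open>For a coordinate with \<open>n \<bullet> b \<noteq> 0\<close>, translation by half a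
  period multiplies the character by -1. The mean is translation invariant, so it equals its own
  negative.\<close>

lemma integral_torus_char:
  fixes n :: "'a::euclidean_space"
  assumes n: "n \<in> int_points" "n \<noteq> 0"
  shows "(\<integral>t. torus_char n t \<partial>cell_measure) = 0"
proof -
  obtain b where b: "b \<in> Basis" "n \<bullet> b \<noteq> 0" using n(2) euclidean_all_zero_iff by blast
  define s where "s = (1 / (2 * (n \<bullet> b))) *\<^sub>R b"
  have "2 * pi * (n \<bullet> s) = pi" using b by (simp add: s_def)
  then have s: "torus_char n s = -1" unfolding torus_char_def by (simp only: exp_pi_i')
  have shift: "torus_char n (t + s) = - torus_char n t" for t
  proof -
    have "torus_char n (t + s) = torus_char n t * torus_char n s"
      by (simp add: torus_char_def inner_add_right algebra_simps exp_add)
    with s show ?thesis by simp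
  qed
  have "(\<integral>t. torus_char n (t + s) \<partial>cell_measure) = (\<integral>t. torus_char n t \<partial>cell_measure)"
    by (rule cell_mean_translate [OF continuous_torus_char torus_char_periodic [OF n(1)]])
  then show ?thesis by (simp add: shift)
qed

text \<open>The class is stable under multiplication by characters, hence by trigonometric
  polynomials, because that merely shifts the coefficients. This is what the peak functions
  exploit.\<close>

definition coeff_free :: "('a::euclidean_space \<Rightarrow> complex) \<Rightarrow> bool" where
  "coeff_free D \<longleftrightarrow> continuous_on UNIV D \<and> (\<forall>n\<in>int_points. \<forall>t. D (t + n) = D t) \<and>
     (\<forall>n\<in>int_points. (\<integral>t. D t * torus_char n t \<partial>cell_measure) = 0)"

lemma coeff_free_add:
  assumes D: "coeff_free D" and E: "coeff_free E"
  shows "coeff_free (\<lambda>t. D t + E t)"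
proof -
  have "integrable cell_measure (\<lambda>t. D t * torus_char n t)" "integrable cell_measure (\<lambda>t. E t * torus_char n t)" for n
    using D E by (auto simp: coeff_free_def intro!: integrable_cell_continuous continuous_intros continuous_torus_char)
  then show ?thesis using D E by (auto simp: coeff_free_def distrib_right intro!: continuous_intros)
qed

lemma coeff_free_cmult: "coeff_free D \<Longrightarrow> coeff_free (\<lambda>t. c * D t)"
  by (auto simp: coeff_free_def mult.assoc intro!: continuous_intros)

lemma coeff_free_char: "coeff_free D \<Longrightarrow> m \<in> int_points \<Longrightarrow> coeff_free (\<lambda>t. D t * torus_char m t)"
  by (auto simp: coeff_free_def mult.assoc torus_char_add [symmetric] int_points_add torus_char_periodic
      intro!: continuous_intros continuous_torus_char)

lemma Basis_int_points: "b \<in> Basis \<Longrightarrow> b \<in> int_points"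
  by (auto simp: int_points_def inner_Basis)

text \<open>A trigonometric polynomial with values between 0 and 1 that attains 1 exactly on the
  lattice translates of \<open>t0\<close>. Its powers act as an approximate identity there.\<close>

definition peak :: "'a::euclidean_space \<Rightarrow> 'a \<Rightarrow> real" where
  "peak t0 t = (\<Prod>b\<in>Basis. (1 + cos (2 * pi * ((t - t0) \<bullet> b))) / 2)"

lemma half_cos_bounds: "0 \<le> (1 + cos x) / 2 \<and> (1 + cos x) / 2 \<le> (1 :: real)"
proof -
  have "0 \<le> 1 + cos x" using cos_ge_minus_one [of x] by linarith
  then show ?thesis using cos_le_one [of x] by simp
qed

lemma peak_bounds: "0 \<le> peak t0 t" "peak t0 t \<le> 1"
proof -
  show "0 \<le> peak t0 t" "peak t0 t \<le> 1"
    unfolding peak_def using half_cos_bounds by (auto intro!: prod_nonneg prod_le_1)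
qed

lemma continuous_peak: "continuous_on S (peak t0)"
  unfolding peak_def by (intro continuous_intros) auto

lemma peak_eq_1:
  assumes "peak t0 t = 1"
  shows "t - t0 \<in> int_points"
proof -
  have "(t - t0) \<bullet> b \<in> \<int>" if b: "b \<in> Basis" for b
  proof -
    let ?q = "\<lambda>b. (1 + cos (2 * pi * ((t - t0) \<bullet> b))) / 2"
    have q: "0 \<le> ?q c \<and> ?q c \<le> 1" for c by (rule half_cos_bounds)
    have "1 = ?q b * (\<Prod>c\<in>Basis - {b}. ?q c)"
      using assms b by (simp add: peak_def prod.remove)
    also have "\<dots> \<le> ?q b * 1" using q by (intro mult_left_mono prod_le_1) auto
    finally have "1 \<le> cos (2 * pi * ((t - t0) \<bullet> b))" by simp
    then have "cos (2 * pi * ((t - t0) \<bullet> b)) = 1" by (intro antisym cos_le_one)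
    then show ?thesis
      unfolding cos_one_2pi_int by auto
  qed
  then show ?thesis by (simp add: int_points_def)
qed

text \<open>Euler's formula writes the raised cosine as a constant plus the characters of
  \<open>b\<close> and \<open>- b\<close>; the shift by \<open>t0\<close> only enters their
  coefficients.\<close>

lemma coeff_free_cos:
  assumes D: "coeff_free D" and b: "b \<in> Basis"
  shows "coeff_free (\<lambda>t. D t * of_real ((1 + cos (2 * pi * ((t - t0) \<bullet> b))) / 2))"
proof -
  define c where "c = torus_char b (- t0) / 4"
  define c' where "c' = torus_char (- b) (- t0) / 4"
  have cos: "of_real ((1 + cos (2 * pi * ((t - t0) \<bullet> b))) / 2) = 1 / 2 + c * torus_char b t + c' * torus_char (- b) t" for t
  proof -
    have s: "torus_char m (- t0) * torus_char m t = torus_char m (t - t0)" for m :: 'a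
      by (simp add: torus_char_def inner_diff_right algebra_simps exp_add exp_diff exp_minus field_simps)
    have 1: "c * torus_char b t = torus_char b (t - t0) / 4" "c' * torus_char (- b) t = torus_char (- b) (t - t0) / 4"
      using s [of b] s [of "- b"] by (simp_all add: c_def c'_def)
    have 2: "complex_of_real (cos r) = (exp (\<i> * of_real r) + exp (- (\<i> * of_real r))) / 2" for r
      by (simp add: cos_exp_eq flip: cos_of_real)
    show ?thesis unfolding 1
      by (simp add: 2 torus_char_def inner_commute field_simps)
  qed
  have "coeff_free (\<lambda>t. ((1 / 2) * D t + c * (D t * torus_char b t)) + c' * (D t * torus_char (- b) t))"
    by (intro coeff_free_add coeff_free_cmult coeff_free_char D int_points_uminus Basis_int_points b)
  then show ?thesis unfolding cos by (simp add: algebra_simps)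
qed

lemma coeff_free_peak:
  assumes D: "coeff_free D"
  shows "coeff_free (\<lambda>t. D t * of_real (peak t0 t ^ k))"
proof -
  have step: "coeff_free (\<lambda>t. E t * of_real (\<Prod>b\<in>B. (1 + cos (2 * pi * ((t - t0) \<bullet> b))) / 2))"
    if "finite B" "B \<subseteq> Basis" "coeff_free E" for B and E :: "'a \<Rightarrow> complex"
    using that
  proof (induction B)
    case (insert b B)
    have "coeff_free (\<lambda>t. E t * of_real (\<Prod>b\<in>B. (1 + cos (2 * pi * ((t - t0) \<bullet> b))) / 2) *
        of_real ((1 + cos (2 * pi * ((t - t0) \<bullet> b))) / 2))"
      by (rule coeff_free_cos) (use insert in auto)
    then show ?case using insert.hyps by (simp add: mult_ac)
  qed simp
  show ?thesis
  proof (induction k)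
    case 0
    show ?case using D by simp
  next
    case (Suc k)
    then have "coeff_free (\<lambda>t. (D t * of_real (peak t0 t ^ k)) * of_real (peak t0 t))"
      unfolding peak_def by (intro step) auto
    then show ?case by (simp add: mult_ac)
  qed
qed

text \<open>If \<open>D t0 = 1\<close>, then the powers of the peak function at \<open>t0\<close> concentrate where \<open>D\<close> has real part
  greater than 1/2, which contradicts that their integrals against \<open>D\<close> vanish.\<close>

lemma coeff_free_imp_zero:
  fixes D :: "'a::euclidean_space \<Rightarrow> complex"
  assumes D: "coeff_free D"
  shows "D t0 = 0"
proof (rule ccontr)
  assume nz: "D t0 \<noteq> 0"
  define E where "E = (\<lambda>t. (1 / D t0) * D t)"
  have E: "coeff_free E" unfolding E_def by (rule coeff_free_cmult [OF D])
  then have contE: "continuous_on UNIV E" and perE: "\<And>n t. n \<in> int_points \<Longrightarrow> E (t + n) = E t"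
    by (auto simp: coeff_free_def)
  define R where "R = (\<lambda>t. Re (E t))"
  have R0: "R t0 = 1" using nz by (simp add: R_def E_def)
  have contR: "continuous_on S R" for S
    unfolding R_def by (intro continuous_intros continuous_on_subset [OF contE]) auto
  let ?Q = "peak t0" and ?K = "cbox (0::'a) One"
  have int0: "(\<integral>t. R t * ?Q t ^ k \<partial>cell_measure) = 0" for k
  proof -
    have cf: "coeff_free (\<lambda>t. E t * of_real (?Q t ^ k))" by (rule coeff_free_peak [OF E])
    then have "(\<integral>t. E t * of_real (?Q t ^ k) * torus_char 0 t \<partial>cell_measure) = 0"
      unfolding coeff_free_def using int_points_zero by blast
    then have i0: "(\<integral>t. E t * of_real (?Q t ^ k) \<partial>cell_measure) = 0" by simp
    have "integrable cell_measure (\<lambda>t. E t * of_real (?Q t ^ k))"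
      by (rule integrable_cell_continuous) (use cf in \<open>simp add: coeff_free_def\<close>)
    then have "(\<integral>t. Re (E t * of_real (?Q t ^ k)) \<partial>cell_measure) = Re (\<integral>t. E t * of_real (?Q t ^ k) \<partial>cell_measure)"
      by (rule integral_Re)
    then show ?thesis using i0 by (simp add: R_def flip: of_real_power)
  qed
  \<comment> \<open>The part of the cell where the real part of \<open>E\<close> is not large. The
    peak equals 1 only at translates of \<open>t0\<close>, where \<open>E\<close> is 1, so it stays
    below some \<open>r < 1\<close> on this compact set.\<close>
  define A where "A = {t \<in> ?K. R t \<le> 1 / 2}"
  have "compact A"
  proof -
    have "A = ?K \<inter> {t. R t \<le> 1 / 2}" by (auto simp: A_def)
    moreover have "closed {t. R t \<le> 1 / 2}" by (rule closed_Collect_le [OF contR continuous_on_const])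
    ultimately show ?thesis using compact_Int_closed [OF compact_cbox] by simp
  qed
  have Q_less: "?Q t < 1" if "t \<in> A" for t
  proof (rule ccontr)
    assume "\<not> ?Q t < 1"
    then have "?Q t = 1" using peak_bounds [of t0 t] by simp
    from perE [OF peak_eq_1 [OF this], of t0] have "R t = R t0" by (simp add: R_def)
    then show False using that R0 by (simp add: A_def)
  qed
  obtain r where r: "0 < r" "r < 1" and rA: "\<And>t. t \<in> A \<Longrightarrow> ?Q t \<le> r"
  proof (cases "A = {}")
    case True
    then show ?thesis using that [of "1/2"] by simp
  next
    case False
    obtain s where s: "s \<in> A" "\<And>t. t \<in> A \<Longrightarrow> ?Q t \<le> ?Q s"
      using continuous_attains_sup [OF \<open>compact A\<close> False continuous_peak] by blast
    show ?thesis
      by (rule that [of "max (1/2) (?Q s)"]) (use s Q_less in \<open>auto intro: le_max_iff_disj [THEN iffD2]\<close>)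
  qed
  obtain r' where r': "r < r'" "r' < 1" using dense [OF r(2)] by blast
  define t1 where "t1 = t0 - int_part t0"
  have t1: "t1 \<in> unit_cell" using cell_shift_iff [of "int_part t0" t0] by (simp add: t1_def)
  have Q1: "?Q t1 = 1"
  proof -
    have "cos (2 * pi * ((t1 - t0) \<bullet> b)) = 1" if b: "b \<in> Basis" for b
      using b unfolding cos_one_2pi_int
      by (intro exI [of _ "- \<lfloor>t0 \<bullet> b\<rfloor>"]) (simp add: t1_def inner_diff_left int_part_inner)
    then show ?thesis by (simp add: peak_def)
  qed
  \<comment> \<open>The representative \<open>t1\<close> of \<open>t0\<close> may lie on the
    boundary of the cell. It is in the closure of the open box, so the open set of large peak still
    meets the box in a set of positive measure.\<close>
  define W where "W = {t. r' < ?Q t} \<inter> box 0 One"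
  have openW': "open {t. r' < ?Q t}" by (intro open_Collect_less continuous_peak continuous_on_const)
  then have openW: "open W" unfolding W_def by (intro open_Int open_box)
  have "W \<noteq> {}"
  proof -
    have "t1 \<in> closure (box (0::'a) One)"
      using t1 unit_cell_subset closure_box [of "0::'a" One] by (auto simp: box_ne_empty)
    moreover have "t1 \<in> {t. r' < ?Q t}" using Q1 r' by simp
    ultimately have "{t. r' < ?Q t} \<inter> closure (box 0 One) \<noteq> {}" by blast
    then show ?thesis unfolding open_Int_closure_eq_empty [OF openW'] W_def .
  qed
  have Wm [measurable]: "W \<in> sets borel" using openW by (rule borel_open)
  have Wcell: "W \<subseteq> unit_cell" by (auto simp: W_def unit_cell_def mem_box intro: less_imp_le)
  define \<mu> where "\<mu> = measure lborel W"
  have "emeasure lborel W \<noteq> 0"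
    using open_not_negligible [OF openW \<open>W \<noteq> {}\<close>] Wm by (auto simp: negligible_iff_emeasure0)
  moreover have fin: "emeasure lborel W < \<infinity>"
  proof (rule le_less_trans)
    show "emeasure lborel W \<le> 1" using emeasure_mono [OF Wcell, of lborel] by (simp add: emeasure_unit_cell)
  qed simp
  ultimately have \<mu>: "0 < \<mu>" unfolding \<mu>_def measure_def
    by (simp add: enn2real_positive_iff zero_less_iff_neq_zero)
  obtain B where B: "\<And>t. t \<in> ?K \<Longrightarrow> \<bar>R t\<bar> \<le> B"
  proof -
    have "compact (R ` ?K)" by (intro compact_continuous_image contR compact_cbox)
    then show ?thesis using that compact_imp_bounded bounded_iff by (metis imageI real_norm_def)
  qed
  \<comment> \<open>In the vanishing integral of \<open>R\<close> against the \<open>k\<close>-th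
    power, \<open>A\<close> contributes at least \<open>- (B * r ^ k)\<close>. The rest is
    nonnegative and at least \<open>r' ^ k / 2\<close> on \<open>W\<close>. As
    \<open>r < r'\<close>, this fails for large \<open>k\<close>.\<close>
  have ineq: "\<mu> / 2 * r' ^ k \<le> B * r ^ k" for k
  proof -
    have iW: "integrable cell_measure (\<lambda>t. indicator W t :: real)"
      unfolding integrable_cell_measure using Wcell fin
      by (subst Bochner_Integration.integrable_cong [OF refl, of _ "\<lambda>x. indicator unit_cell x *\<^sub>R indicator W x" "indicator W"])
         (auto simp: indicator_def)
    have intW: "(\<integral>t. (indicator W t :: real) \<partial>cell_measure) = \<mu>"
    proof -
      have "(\<integral>t. (indicator W t :: real) \<partial>cell_measure) = (\<integral>t. (indicator W t :: real) \<partial>lborel)"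
        unfolding integral_cell_measure by (rule Bochner_Integration.integral_cong) (use Wcell in \<open>auto simp: indicator_def\<close>)
      then show ?thesis by (simp add: \<mu>_def)
    qed
    have iRQ: "integrable cell_measure (\<lambda>t. R t * ?Q t ^ k)"
    proof -
      have "integrable cell_measure (\<lambda>t. complex_of_real (R t * ?Q t ^ k))"
        by (intro integrable_cell_continuous continuous_intros contR continuous_peak)
      from integrable_Re [OF this] show ?thesis by simp
    qed
    have "(\<integral>t. - (B * r ^ k) + (1 / 2 * r' ^ k) * indicator W t \<partial>cell_measure) \<le> (\<integral>t. R t * ?Q t ^ k \<partial>cell_measure)"
    proof (rule integral_mono [OF _ iRQ])
      show "integrable cell_measure (\<lambda>t. - (B * r ^ k) + (1 / 2 * r' ^ k) * indicator W t)"
        using iW by (intro Bochner_Integration.integrable_add integrable_mult_right) auto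
      fix t :: 'a assume "t \<in> space cell_measure"
      then have t: "t \<in> ?K" using unit_cell_subset by auto
      have Qk: "0 \<le> ?Q t ^ k" by (rule zero_le_power [OF peak_bounds(1)])
      show "- (B * r ^ k) + (1 / 2 * r' ^ k) * indicator W t \<le> R t * ?Q t ^ k"
      proof (cases "t \<in> A")
        case True
        then have "t \<notin> W" using rA [OF True] r' by (auto simp: W_def)
        have "- R t * ?Q t ^ k \<le> B * r ^ k"
          using B [OF t] rA [OF True] by (intro mult_mono power_mono peak_bounds(1) Qk) auto
        then show ?thesis using \<open>t \<notin> W\<close> by simp
      next
        case False
        then have R: "1 / 2 < R t" using t by (simp add: A_def)
        have "1 / 2 * r' ^ k * indicator W t \<le> 1 / 2 * ?Q t ^ k"
          using r r' Qk by (auto simp: indicator_def W_def intro!: power_mono)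
        also have "\<dots> \<le> R t * ?Q t ^ k" using R Qk by (intro mult_right_mono) auto
        finally have "1 / 2 * r' ^ k * indicator W t \<le> R t * ?Q t ^ k" .
        moreover have "0 \<le> B * r ^ k" using B [OF t] r R by (intro mult_nonneg_nonneg) auto
        ultimately show ?thesis by linarith
      qed
    qed
    also have "(\<integral>t. - (B * r ^ k) + (1 / 2 * r' ^ k) * indicator W t \<partial>cell_measure) = - (B * r ^ k) + (1 / 2 * r' ^ k) * \<mu>"
      using iW intW by (subst Bochner_Integration.integral_add) (auto simp: measure_def emeasure_cell_measure)
    finally show ?thesis using int0 [of k] by (simp add: mult.commute)
  qed
  obtain k where "2 * B / \<mu> < (r' / r) ^ k"
    using real_arch_pow [of "r' / r" "2 * B / \<mu>"] r r' by (auto simp: field_simps)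
  with ineq [of k] show False
    using \<mu> r by (simp add: power_divide field_simps)
qed

section \<open>Lattice sums\<close>

definition twisted_sum ::
  "('b \<Rightarrow> 'a::euclidean_space) \<Rightarrow> ('a \<Rightarrow> 'b::euclidean_space) \<Rightarrow> 'b set \<Rightarrow> ('b \<Rightarrow> complex) \<Rightarrow> 'a \<Rightarrow> complex" where
  "twisted_sum lam B \<Lambda> \<Phi> = (\<lambda>z. \<Sum>\<^sub>\<infinity>l\<in>\<Lambda>. exp_twist (lam l) B l \<Phi> z)"

text \<open>A common frame for all lattice sums below, with or without phases and on either space.
  Differentiating a phase costs powers of \<open>norm (lam l)\<close>; the bound by
  \<open>norm l\<close> lets the decay in \<open>l\<close> pay for them.\<close>

locale twisted_summation =
  fixes lam :: "'b::euclidean_space \<Rightarrow> 'a::euclidean_space" and B :: "'a \<Rightarrow> 'b" and \<Lambda> :: "'b set" and N0 :: nat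
  assumes B: "bounded_linear B" and lam: "\<And>l. norm (lam l) \<le> norm l"
    and summable: "(\<lambda>l. 1 / (1 + norm l) ^ N0) summable_on \<Lambda>"
begin

text \<open>Schwartz decay is used with weight \<open>N0 + n\<close> at \<open>B z + l\<close>. Of
  the resulting decay in \<open>l\<close>, the power \<open>n\<close> compensates the differentiated
  phases and the power \<open>N0\<close> is left for summation; moving the weight costs polynomial
  growth in \<open>z\<close>.\<close>

lemma term_bound:
  "\<exists>K\<ge>0. \<forall>l bs z. \<forall>\<Phi>\<in>schwartz_space. bs \<in> lists Basis \<longrightarrow> length bs \<le> n \<longrightarrow>
     cmod (partial_derivs bs (exp_twist (lam l) B l \<Phi>) z)
       \<le> K * (1 + norm z) ^ (N0 + n) * schwartz_norm (N0 + n + n) \<Phi> * (1 / (1 + norm l) ^ N0)"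
proof -
  obtain K where K: "0 \<le> K" and K': "\<And>v l bs z \<Phi>. \<Phi> \<in> schwartz_space \<Longrightarrow> bs \<in> lists Basis \<Longrightarrow> length bs \<le> n \<Longrightarrow>
     (1 + norm (B z + l)) ^ (N0 + n) * cmod (partial_derivs bs (exp_twist v B l \<Phi>) z)
       \<le> K * (1 + norm v) ^ n * schwartz_norm (N0 + n + n) \<Phi>"
    using exp_twist_bound [OF B, of n "N0 + n"] by blast
  define \<beta> where "\<beta> = 1 + onorm B"
  have \<beta>: "1 \<le> \<beta>" using onorm_pos_le [OF B] by (simp add: \<beta>_def)
  have Bz: "1 + norm (B z) \<le> \<beta> * (1 + norm z)" for z
  proof -
    have "\<beta> * (1 + norm z) = 1 + onorm B + norm z + onorm B * norm z" by (simp add: \<beta>_def algebra_simps)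
    then show ?thesis using onorm [OF B, of z] onorm_pos_le [OF B] norm_ge_zero [of z] by linarith
  qed
  have "cmod (partial_derivs bs (exp_twist (lam l) B l \<Phi>) z)
       \<le> (K * \<beta> ^ (N0 + n)) * (1 + norm z) ^ (N0 + n) * schwartz_norm (N0 + n + n) \<Phi> * (1 / (1 + norm l) ^ N0)"
    if \<Phi>: "\<Phi> \<in> schwartz_space" and bs: "bs \<in> lists Basis" "length bs \<le> n" for l bs z \<Phi>
  proof -
    let ?D = "cmod (partial_derivs bs (exp_twist (lam l) B l \<Phi>) z)" and ?q = "schwartz_norm (N0 + n + n) \<Phi>" and ?w = "1 + norm l"
    have w: "0 < ?w" by (simp add: add_pos_nonneg)
    have q: "0 \<le> ?q" by (rule schwartz_norm_nonneg [OF \<Phi>])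
    have "?w ^ (N0 + n) * ?D \<le> ((1 + norm (B z)) ^ (N0 + n) * (1 + norm (B z + l)) ^ (N0 + n)) * ?D"
      using norm_weight_divide [of l "N0 + n" "B z"] by (intro mult_right_mono) (simp_all add: add.commute)
    also have "\<dots> = (1 + norm (B z)) ^ (N0 + n) * ((1 + norm (B z + l)) ^ (N0 + n) * ?D)" by simp
    also have "\<dots> \<le> (\<beta> * (1 + norm z)) ^ (N0 + n) * (K * ?w ^ n * ?q)"
    proof (rule mult_mono)
      show "(1 + norm (B z)) ^ (N0 + n) \<le> (\<beta> * (1 + norm z)) ^ (N0 + n)" by (rule power_mono [OF Bz]) simp
      have "(1 + norm (B z + l)) ^ (N0 + n) * ?D \<le> K * (1 + norm (lam l)) ^ n * ?q" by (rule K' [OF \<Phi> bs])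
      also have "\<dots> \<le> K * ?w ^ n * ?q" using K q lam [of l] by (intro mult_right_mono mult_left_mono power_mono) auto
      finally show "(1 + norm (B z + l)) ^ (N0 + n) * ?D \<le> K * ?w ^ n * ?q" .
    qed (use \<beta> in auto)
    also have "\<dots> = ?w ^ n * (K * \<beta> ^ (N0 + n) * (1 + norm z) ^ (N0 + n) * ?q)" by (simp add: power_mult_distrib mult_ac)
    finally have "?w ^ n * (?w ^ N0 * ?D) \<le> ?w ^ n * (K * \<beta> ^ (N0 + n) * (1 + norm z) ^ (N0 + n) * ?q)"
      by (simp add: power_add mult_ac)
    then have "?w ^ N0 * ?D \<le> K * \<beta> ^ (N0 + n) * (1 + norm z) ^ (N0 + n) * ?q"
      using w by (simp only: mult_le_cancel_left_pos zero_less_power)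
    then show ?thesis using w by (simp add: pos_le_divide_eq mult.commute)
  qed
  moreover have "0 \<le> K * \<beta> ^ (N0 + n)" using K \<beta> by simp
  ultimately show ?thesis by blast
qed

lemma dominated:
  assumes \<Phi>: "\<Phi> \<in> schwartz_space" and bs: "bs \<in> lists Basis"
  shows "\<exists>a. a summable_on \<Lambda> \<and>
    (\<forall>l\<in>\<Lambda>. \<forall>z. norm z \<le> r \<longrightarrow> cmod (partial_derivs bs (exp_twist (lam l) B l \<Phi>) z) \<le> a l)"
proof -
  let ?n = "length bs"
  obtain K where K: "0 \<le> K" and K': "\<And>l z. cmod (partial_derivs bs (exp_twist (lam l) B l \<Phi>) z)
       \<le> K * (1 + norm z) ^ (N0 + ?n) * schwartz_norm (N0 + ?n + ?n) \<Phi> * (1 / (1 + norm l) ^ N0)"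
    using term_bound [of ?n] \<Phi> bs by blast
  define C where "C = K * (1 + r) ^ (N0 + ?n) * schwartz_norm (N0 + ?n + ?n) \<Phi>"
  have "cmod (partial_derivs bs (exp_twist (lam l) B l \<Phi>) z) \<le> C * (1 / (1 + norm l) ^ N0)" if "norm z \<le> r" for l z
  proof (rule order_trans [OF K'])
    have "K * (1 + norm z) ^ (N0 + ?n) * schwartz_norm (N0 + ?n + ?n) \<Phi> \<le> C"
      unfolding C_def using that K
      by (intro mult_right_mono mult_left_mono power_mono schwartz_norm_nonneg [OF \<Phi>]) auto
    then show "K * (1 + norm z) ^ (N0 + ?n) * schwartz_norm (N0 + ?n + ?n) \<Phi> * (1 / (1 + norm l) ^ N0) \<le> C * (1 / (1 + norm l) ^ N0)"
      by (rule mult_right_mono) simp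
  qed
  moreover have "(\<lambda>l. C * (1 / (1 + norm l) ^ N0)) summable_on \<Lambda>" by (rule summable_on_cmult_right [OF summable])
  ultimately show ?thesis by (intro exI [of _ "\<lambda>l. C * (1 / (1 + norm l) ^ N0)"]) auto
qed

lemma abs_summable:
  assumes "\<Phi> \<in> schwartz_space"
  shows "(\<lambda>l. cmod (exp_twist (lam l) B l \<Phi> z)) summable_on \<Lambda>"
proof -
  obtain a where "a summable_on \<Lambda>" "\<And>l. l \<in> \<Lambda> \<Longrightarrow> cmod (exp_twist (lam l) B l \<Phi> z) \<le> a l"
    using dominated [OF assms lists.Nil, of "norm z"] by auto
  then show ?thesis by (rule abs_summable_dominated(1))
qed

lemma twisted_sum_smooth:
  assumes \<Phi>: "\<Phi> \<in> schwartz_space"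
  shows "twisted_sum lam B \<Lambda> \<Phi> \<in> smooth_space"
  unfolding twisted_sum_def
  by (rule smooth_infsum(1) [OF exp_twist_smooth [OF schwartz_smooth [OF \<Phi>] B] dominated [OF \<Phi>]])

text \<open>The bound depends on \<open>\<Phi>\<close> only through one norm and grows polynomially
  in \<open>z\<close>, as needed for continuity on compact sets and for multiplication with a
  Schwartz function.\<close>

lemma twisted_sum_bound:
  "\<exists>K\<ge>0. \<exists>m M. \<forall>\<Phi>\<in>schwartz_space. \<forall>z. \<forall>bs\<in>lists Basis. length bs \<le> n \<longrightarrow>
    cmod (partial_derivs bs (twisted_sum lam B \<Lambda> \<Phi>) z) \<le> K * schwartz_norm M \<Phi> * (1 + norm z) ^ m"
proof -
  obtain K where K: "0 \<le> K" and K': "\<And>l bs z \<Phi>. \<Phi> \<in> schwartz_space \<Longrightarrow> bs \<in> lists Basis \<Longrightarrow> length bs \<le> n \<Longrightarrow>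
    cmod (partial_derivs bs (exp_twist (lam l) B l \<Phi>) z)
       \<le> K * (1 + norm z) ^ (N0 + n) * schwartz_norm (N0 + n + n) \<Phi> * (1 / (1 + norm l) ^ N0)"
    using term_bound [of n] by blast
  define S where "S = (\<Sum>\<^sub>\<infinity>l\<in>\<Lambda>. 1 / (1 + norm l) ^ N0)"
  have "cmod (partial_derivs bs (twisted_sum lam B \<Lambda> \<Phi>) z) \<le> (K * S) * schwartz_norm (N0 + n + n) \<Phi> * (1 + norm z) ^ (N0 + n)"
    if \<Phi>: "\<Phi> \<in> schwartz_space" and bs: "bs \<in> lists Basis" "length bs \<le> n" for \<Phi> z bs
  proof -
    have "partial_derivs bs (twisted_sum lam B \<Lambda> \<Phi>) z = (\<Sum>\<^sub>\<infinity>l\<in>\<Lambda>. partial_derivs bs (exp_twist (lam l) B l \<Phi>) z)"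
      unfolding twisted_sum_def
      by (subst smooth_infsum(2) [OF exp_twist_smooth [OF schwartz_smooth [OF \<Phi>] B] dominated [OF \<Phi>] bs(1)]) auto
    also have "cmod \<dots> \<le> (\<Sum>\<^sub>\<infinity>l\<in>\<Lambda>. K * (1 + norm z) ^ (N0 + n) * schwartz_norm (N0 + n + n) \<Phi> * (1 / (1 + norm l) ^ N0))"
      by (rule abs_summable_dominated(3) [OF summable_on_cmult_right [OF summable] K' [OF \<Phi> bs]])
    also have "\<dots> = (K * S) * schwartz_norm (N0 + n + n) \<Phi> * (1 + norm z) ^ (N0 + n)"
      unfolding infsum_cmult_right' S_def by (simp add: mult_ac)
    finally show ?thesis .
  qed
  moreover have "0 \<le> S" unfolding S_def by (rule infsum_nonneg) simp
  ultimately show ?thesis using K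
    by (intro exI [of _ "K * S"] exI [of _ "N0 + n"] exI [of _ "N0 + n + n"] conjI ballI allI impI) simp_all
qed

lemma twisted_sum_add:
  assumes "f \<in> schwartz_space" "g \<in> schwartz_space"
  shows "twisted_sum lam B \<Lambda> (\<lambda>x. f x + g x) = (\<lambda>z. twisted_sum lam B \<Lambda> f z + twisted_sum lam B \<Lambda> g z)"
proof
  fix z
  have "(\<lambda>l. exp_twist (lam l) B l f z) summable_on \<Lambda>" "(\<lambda>l. exp_twist (lam l) B l g z) summable_on \<Lambda>"
    by (rule abs_summable_summable, rule abs_summable, rule assms)+
  from infsum_add [OF this] show "twisted_sum lam B \<Lambda> (\<lambda>x. f x + g x) z = twisted_sum lam B \<Lambda> f z + twisted_sum lam B \<Lambda> g z"
    by (simp add: twisted_sum_def exp_twist_def distrib_left)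
qed

lemma twisted_sum_cmult: "twisted_sum lam B \<Lambda> (\<lambda>x. c * f x) = (\<lambda>z. c * twisted_sum lam B \<Lambda> f z)"
proof
  fix z
  have "(\<lambda>l. exp_twist (lam l) B l (\<lambda>x. c * f x) z) = (\<lambda>l. c * exp_twist (lam l) B l f z)"
    by (simp add: exp_twist_def mult_ac fun_eq_iff)
  then show "twisted_sum lam B \<Lambda> (\<lambda>x. c * f x) z = c * twisted_sum lam B \<Lambda> f z"
    by (simp add: twisted_sum_def infsum_cmult_right')
qed

end

lemma summable_linear_int_points:
  fixes L :: "'a::euclidean_space \<Rightarrow> 'b::euclidean_space"
  assumes L: "linear L" "inj L"
  shows "(\<lambda>l. 1 / (1 + norm l) ^ (2 * DIM('a))) summable_on (L ` int_points)"
proof -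
  obtain c where c: "0 < c" "\<And>x. c * norm x \<le> norm (L x)"
    using linear_inj_bounded_below_pos [OF L] by blast
  \<comment> \<open>Capping at 1 lets the lower bound for \<open>L\<close> also cover the summand 1
    of the weight.\<close>
  define c' where "c' = min 1 c"
  have c': "0 < c'" using c by (simp add: c'_def)
  let ?d = "2 * DIM('a)"
  have "((\<lambda>l. 1 / (1 + norm l) ^ ?d) \<circ> L) summable_on int_points"
  proof (rule summable_on_comparison_test)
    show "(\<lambda>n::'a. (1 / c' ^ ?d) * (1 / (1 + norm n) ^ ?d)) summable_on int_points"
      by (rule summable_on_cmult_right [OF summable_int_points])
    fix n :: 'a
    have "c' * (1 + norm n) \<le> 1 + norm (L n)"
      using c(2) [of n] mult_right_mono [of c' c "norm n"] by (simp add: c'_def algebra_simps)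
    then have "(c' * (1 + norm n)) ^ ?d \<le> (1 + norm (L n)) ^ ?d" using c' by (intro power_mono) auto
    moreover have "0 < (c' * (1 + norm n)) ^ ?d" using c' by (intro zero_less_power mult_pos_pos) (auto simp: add_pos_nonneg)
    ultimately show "((\<lambda>l. 1 / (1 + norm l) ^ ?d) \<circ> L) n \<le> (1 / c' ^ ?d) * (1 / (1 + norm n) ^ ?d)"
      by (simp add: power_mult_distrib frac_le)
  qed auto
  then show ?thesis using L(2) by (subst summable_on_reindex) (auto intro: inj_on_subset)
qed

lemma int_points_Pair: "(m, n) \<in> int_points \<longleftrightarrow> m \<in> int_points \<and> n \<in> int_points"
  by (simp add: int_points_def Basis_prod_def ball_Un)

lemma unit_cell_Pair: "(m, n) \<in> unit_cell \<longleftrightarrow> m \<in> unit_cell \<and> n \<in> unit_cell"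
  by (simp add: unit_cell_def Basis_prod_def ball_Un)

lemma int_points_vec: "v \<in> int_points \<longleftrightarrow> (\<forall>j. v $ j \<in> \<int>)" for v :: "real^'d::finite"
  by (auto simp: int_points_def Basis_vec_def inner_axis)

lemma linear_image_int_points:
  assumes "linear L"
  shows "k \<in> L ` int_points \<Longrightarrow> - k \<in> L ` int_points"
    and "k \<in> L ` int_points \<Longrightarrow> l \<in> L ` int_points \<Longrightarrow> k + l \<in> L ` int_points"
    and "0 \<in> L ` int_points"
proof -
  show "- k \<in> L ` int_points" if "k \<in> L ` int_points"
    using that int_points_uminus by (auto simp: linear_neg [OF assms, symmetric] intro!: imageI)
  show "k + l \<in> L ` int_points" if "k \<in> L ` int_points" "l \<in> L ` int_points"
    using that int_points_add by (auto simp: linear_add [OF assms, symmetric] intro!: imageI)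
  have "L 0 \<in> L ` int_points" by (rule imageI) simp
  then show "0 \<in> L ` int_points" by (simp add: linear_0 [OF assms])
qed

locale lattice_basis =
  fixes e :: "'d::finite \<Rightarrow> real^'d"
  assumes ordered_basis: "ordered_basis e"
begin

text \<open>Lattice coordinates: \<open>lin\<close> and \<open>dlin\<close> carry the integer points
  to the two lattices and the unit cell to a fundamental cell. By duality the phases
  \<open>exp (\<i> * of_real (k \<bullet> \<xi>))\<close> become the characters
  \<open>torus_char\<close>.\<close>

definition lin :: "real^'d \<Rightarrow> real^'d" where
  "lin t = (\<Sum>j\<in>UNIV. (t $ j) *\<^sub>R e j)"

definition dlin :: "real^'d \<Rightarrow> real^'d" where
  "dlin t = (\<Sum>j\<in>UNIV. (t $ j) *\<^sub>R dual_basis e j)"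

lemma dual_basis_inner: "e j \<bullet> dual_basis e k = (if j = k then 2 * pi else 0)"
  using theI' [OF dual_basis_ex1 [OF ordered_basis]] unfolding dual_basis_def by blast

lemma linear_lin: "linear lin" and linear_dlin: "linear dlin"
  by (intro linearI; simp add: lin_def dlin_def scaleR_left_distrib sum.distrib scaleR_right.sum)+

lemma lin_inner_dlin: "lin s \<bullet> dlin t = 2 * pi * (s \<bullet> t)"
proof -
  have "lin s \<bullet> dlin t = (\<Sum>j\<in>UNIV. \<Sum>k\<in>UNIV. s $ j * (t $ k * (e j \<bullet> dual_basis e k)))"
    unfolding lin_def dlin_def inner_sum_left inner_sum_right
    by (subst sum.swap, intro sum.cong refl) (simp add: mult_ac)
  also have "\<dots> = (\<Sum>j\<in>UNIV. s $ j * (t $ j * (2 * pi)))"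
    by (simp add: dual_basis_inner if_distrib cong: if_cong)
  also have "\<dots> = 2 * pi * (s \<bullet> t)" by (simp add: inner_vec_def sum_distrib_left mult_ac)
  finally show ?thesis .
qed

lemma inj_lin: "inj lin"
proof (rule linear_injective_0 [THEN iffD2, OF linear_lin], intro allI impI)
  fix t assume "lin t = 0"
  then have "2 * pi * (t \<bullet> t) = 0" using lin_inner_dlin [of t t] by simp
  then show "t = 0" by simp
qed

lemma inj_dlin: "inj dlin"
proof (rule linear_injective_0 [THEN iffD2, OF linear_dlin], intro allI impI)
  fix t assume "dlin t = 0"
  then have "2 * pi * (t \<bullet> t) = 0" using lin_inner_dlin [of t t] by simp
  then show "t = 0" by simp
qed

lemma surj_lin: "surj lin" and surj_dlin: "surj dlin"
  by (rule linear_inj_imp_surj [OF linear_lin inj_lin], rule linear_inj_imp_surj [OF linear_dlin inj_dlin])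

lemma range_int_points: "range (\<lambda>n :: 'd \<Rightarrow> int. \<chi> j. of_int (n j)) = (int_points :: (real^'d) set)"
proof (intro equalityI subsetI)
  fix v :: "real^'d" assume v: "v \<in> int_points"
  have "v = (\<chi> j. of_int \<lfloor>v $ j\<rfloor>)" using v by (auto simp: int_points_vec vec_eq_iff elim!: Ints_cases)
  then show "v \<in> range (\<lambda>n :: 'd \<Rightarrow> int. \<chi> j. of_int (n j))" by (rule range_eqI [where x = "\<lambda>j. \<lfloor>v $ j\<rfloor>"])
qed (auto simp: int_points_vec)

lemma lattice_eq: "lattice e = lin ` int_points" and dual_lattice_eq: "dual_lattice e = dlin ` int_points"
  unfolding lattice_def lin_def dlin_def range_int_points [symmetric] image_image by simp_all

lemma lattice_inner_dual: "k \<in> lattice e \<Longrightarrow> \<kappa> \<in> dual_lattice e \<Longrightarrow> exp (\<i> * of_real (k \<bullet> \<kappa>)) = 1"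
  unfolding lattice_eq dual_lattice_eq
  using exp_2pi_Ints [OF int_points_inner] by (elim imageE) (simp only: lin_inner_dlin)

lemma lattice_uminus: "k \<in> lattice e \<Longrightarrow> - k \<in> lattice e"
  and lattice_add: "k \<in> lattice e \<Longrightarrow> l \<in> lattice e \<Longrightarrow> k + l \<in> lattice e"
  and lattice_zero: "0 \<in> lattice e"
  unfolding lattice_eq using linear_image_int_points [OF linear_lin] by simp_all

lemma dual_lattice_uminus: "k \<in> dual_lattice e \<Longrightarrow> - k \<in> dual_lattice e"
  and dual_lattice_add: "k \<in> dual_lattice e \<Longrightarrow> l \<in> dual_lattice e \<Longrightarrow> k + l \<in> dual_lattice e"
  and dual_lattice_zero: "0 \<in> dual_lattice e"
  unfolding dual_lattice_eq using linear_image_int_points [OF linear_dlin] by simp_all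

definition lin2 :: "(real^'d) \<times> (real^'d) \<Rightarrow> (real^'d) \<times> (real^'d)" where
  "lin2 = (\<lambda>(s, t). (lin s, dlin t))"

lemma linear_lin2: "linear lin2"
  by (rule linearI) (auto simp: lin2_def linear_add [OF linear_lin] linear_add [OF linear_dlin]
      linear_scale [OF linear_lin] linear_scale [OF linear_dlin])

lemma inj_lin2: "inj lin2"
  by (rule injI) (auto simp: lin2_def split: prod.splits dest: injD [OF inj_lin] injD [OF inj_dlin])

lemma surj_lin2: "surj lin2"
  by (rule linear_inj_imp_surj [OF linear_lin2 inj_lin2])

abbreviation phase_lattice :: "((real^'d) \<times> (real^'d)) set" where
  "phase_lattice \<equiv> lattice e \<times> dual_lattice e"

lemma phase_lattice_eq: "phase_lattice = lin2 ` int_points"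
proof -
  have "(k, \<kappa>) \<in> lin2 ` int_points" if k: "k \<in> lin ` int_points" "\<kappa> \<in> dlin ` int_points" for k \<kappa>
  proof -
    obtain m n where "k = lin m" "m \<in> int_points" "\<kappa> = dlin n" "n \<in> int_points" using k by blast
    then show ?thesis by (intro image_eqI [where x = "(m, n)"]) (auto simp: lin2_def int_points_Pair)
  qed
  then show ?thesis unfolding lattice_eq dual_lattice_eq by (auto simp: lin2_def int_points_Pair)
qed

lemma countable_lattice: "countable (lattice e)" and countable_phase_lattice: "countable phase_lattice"
  unfolding phase_lattice_eq unfolding lattice_eq by (simp_all add: countable_int_points)

end

section \<open>The inverse of the Zak transform\<close>

lemma smooth_linear:
  fixes v :: "'a::euclidean_space"
  shows "(\<lambda>z. complex_of_real (z \<bullet> v)) \<in> smooth_space"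
proof -
  let ?X = "{\<lambda>z. complex_of_real (z \<bullet> v) + c | (v :: 'a) c. True}"
  have D: "((\<lambda>z. complex_of_real (z \<bullet> v) + c) has_derivative (\<lambda>h. complex_of_real (h \<bullet> v))) (at x)" for v x :: 'a and c
  proof -
    have "bounded_linear (\<lambda>z. complex_of_real (z \<bullet> v))"
      by (rule bounded_linear_compose [OF bounded_linear_of_real bounded_linear_inner_left])
    from has_derivative_add [OF bounded_linear_imp_has_derivative [OF this] has_derivative_const [of c]]
    show ?thesis by simp
  qed
  show ?thesis
  proof (rule smooth_space_coinduct [of _ ?X])
    show "(\<lambda>z. complex_of_real (z \<bullet> v)) \<in> ?X" by (rule CollectI, rule exI [of _ v], rule exI [of _ 0]) simp
    fix g x assume "g \<in> ?X"
    then show "g differentiable at x" using D unfolding differentiable_def by blast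
  next
    fix g b assume "g \<in> ?X"
    then obtain v c where "g = (\<lambda>z. complex_of_real (z \<bullet> v) + c)" by blast
    then have "partial_deriv b g = (\<lambda>z. complex_of_real (z \<bullet> 0) + of_real (b \<bullet> v))"
      using partial_derivI [OF D] by auto
    then show "partial_deriv b g \<in> ?X" by blast
  qed
qed

section \<open>The Zak transform and its inverse on smooth functions\<close>

lemma Basis_left: "b \<in> Basis \<Longrightarrow> (b, 0) \<in> Basis" and Basis_right: "b \<in> Basis \<Longrightarrow> (0, b) \<in> Basis"
  by (auto simp: Basis_prod_def)

lemma map_left_Basis: "bs \<in> lists Basis \<Longrightarrow> map (\<lambda>b. (b, 0)) bs \<in> lists Basis"
  by (induction bs) (simp_all add: Basis_left)

lemma partial_derivs_section:
  fixes G :: "'a::euclidean_space \<times> 'b::euclidean_space \<Rightarrow> complex"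
  assumes G: "G \<in> smooth_space" and bs: "bs \<in> lists Basis"
  shows "partial_derivs bs (\<lambda>x. G (x, 0)) = (\<lambda>x. partial_derivs (map (\<lambda>b. (b, 0)) bs) G (x, 0))"
  using bs
proof (induction bs)
  case (Cons b bs)
  have bl: "bounded_linear (\<lambda>x. (x, 0) :: 'a \<times> 'b)" by (intro bounded_linear_Pair bounded_linear_ident bounded_linear_zero)
  let ?H = "partial_derivs (map (\<lambda>b. (b, 0)) bs) G"
  have H: "?H \<in> smooth_space" using Cons.hyps by (intro partial_derivs_smooth G map_left_Basis)
  have b: "(b, 0) \<in> (Basis :: ('a \<times> 'b) set)" using Cons.hyps by (intro Basis_left) auto
  have "partial_deriv b (\<lambda>x. ?H (x, 0)) = (\<lambda>x. \<Sum>c\<in>Basis. of_real ((b, 0) \<bullet> c) * partial_deriv c ?H (x, 0))"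
    using partial_deriv_affine [OF H bl, of b 0] by simp
  also have "\<dots> = (\<lambda>x. partial_deriv (b, 0) ?H (x, 0))"
    using sum_inner_Basis [OF b, of "\<lambda>c. partial_deriv c ?H (_, 0)"] by (simp add: scaleR_conv_of_real)
  finally show ?case using Cons by simp
qed simp

context lattice_basis
begin

lemma summable_lattice: "(\<lambda>l. 1 / (1 + norm l) ^ (2 * DIM(real^'d))) summable_on lattice e"
  unfolding lattice_eq by (rule summable_linear_int_points [OF linear_lin inj_lin])

lemma summable_phase_lattice: "(\<lambda>l. 1 / (1 + norm l) ^ (2 * DIM((real^'d) \<times> (real^'d)))) summable_on phase_lattice"
  unfolding phase_lattice_eq by (rule summable_linear_int_points [OF linear_lin2 inj_lin2])

end

sublocale lattice_basis \<subseteq> Z: twisted_summation "\<lambda>l. (0, - l)" "fst" "lattice e" "2 * DIM(real^'d)"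
  by (rule twisted_summation.intro [OF bounded_linear_fst _ summable_lattice]) (simp add: norm_Pair)

context lattice_basis
begin

text \<open>Summing over \<open>l = - j\<close> turns \<open>f (x - j)\<close> into
  \<open>f (x + l)\<close>, so the frequency of the term at \<open>l\<close> becomes
  \<open>(0, - l)\<close>.\<close>

lemma zak_eq: "zak e f = twisted_sum (\<lambda>l. (0, - l)) fst (lattice e) f"
proof
  fix z :: "(real^'d) \<times> (real^'d)"
  obtain x \<xi> where z: "z = (x, \<xi>)" by fastforce
  have bij: "bij_betw uminus (lattice e) (lattice e)"
    by (rule bij_betwI [where g = uminus]) (auto intro: lattice_uminus)
  show "zak e f z = twisted_sum (\<lambda>l. (0, - l)) fst (lattice e) f z"
    using infsum_reindex_bij_betw [OF bij, of "\<lambda>j. f (x - j) * exp (\<i> * of_real (j \<bullet> \<xi>))"]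
    by (simp add: z zak_def twisted_sum_def exp_twist_def inner_commute mult.commute)
qed

lemma zak_smooth: "f \<in> schwartz_space \<Longrightarrow> zak e f \<in> smooth_space"
  unfolding zak_eq by (rule Z.twisted_sum_smooth)

lemma zak_quasi_periodic: "quasi_periodic e (zak e f)"
  unfolding quasi_periodic_def
proof (intro ballI allI conjI)
  fix k \<kappa> x \<xi> assume k: "k \<in> lattice e" and \<kappa>: "\<kappa> \<in> dual_lattice e"
  have bij: "bij_betw (\<lambda>j. j + k) (lattice e) (lattice e)"
    by (rule bij_betwI [where g = "\<lambda>j. j - k"]) (use k lattice_add lattice_uminus [OF k] in \<open>auto simp: diff_conv_add_uminus simp del: add_uminus_conv_diff\<close>)
  have "zak e f (x + k, \<xi>) = (\<Sum>\<^sub>\<infinity>j\<in>lattice e. f (x + k - (j + k)) * exp (\<i> * of_real ((j + k) \<bullet> \<xi>)))"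
    unfolding zak_def by (simp only: case_prod_conv infsum_reindex_bij_betw [OF bij, of "\<lambda>j. f (x + k - j) * exp (\<i> * of_real (j \<bullet> \<xi>))"])
  also have "\<dots> = (\<Sum>\<^sub>\<infinity>j\<in>lattice e. exp (\<i> * of_real (k \<bullet> \<xi>)) * (f (x - j) * exp (\<i> * of_real (j \<bullet> \<xi>))))"
    by (rule infsum_cong) (simp add: inner_add_left exp_add distrib_left mult_ac)
  also have "\<dots> = exp (\<i> * of_real (k \<bullet> \<xi>)) * zak e f (x, \<xi>)" by (simp add: zak_def infsum_cmult_right')
  finally show "zak e f (x + k, \<xi>) = exp (\<i> * of_real (k \<bullet> \<xi>)) * zak e f (x, \<xi>)" .
  have "exp (\<i> * of_real (j \<bullet> (\<xi> + \<kappa>))) = exp (\<i> * of_real (j \<bullet> \<xi>))" if "j \<in> lattice e" for j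
    using lattice_inner_dual [OF that \<kappa>] by (simp add: inner_add_right distrib_left exp_add)
  then show "zak e f (x, \<xi> + \<kappa>) = zak e f (x, \<xi>)" by (simp add: zak_def cong: infsum_cong)
qed

lemma quasi_periodic_left:
  "quasi_periodic e F \<Longrightarrow> k \<in> lattice e \<Longrightarrow> F (z + (k, 0)) = exp (\<i> * of_real (z \<bullet> (0, k))) * F z"
  unfolding quasi_periodic_def using dual_lattice_zero
  by (cases z) (auto simp: inner_commute)

lemma quasi_periodic_right:
  "quasi_periodic e F \<Longrightarrow> \<kappa> \<in> dual_lattice e \<Longrightarrow> F (z + (0, \<kappa>)) = F z"
  unfolding quasi_periodic_def using lattice_zero by (cases z) auto

lemma quasi_periodicI:
  assumes "\<And>k z. k \<in> lattice e \<Longrightarrow> F (z + (k, 0)) = exp (\<i> * of_real (z \<bullet> (0, k))) * F z"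
    and "\<And>\<kappa> z. \<kappa> \<in> dual_lattice e \<Longrightarrow> F (z + (0, \<kappa>)) = F z"
  shows "quasi_periodic e F"
  unfolding quasi_periodic_def
  using assms(1) [of _ "(_, _)"] assms(2) [of _ "(_, _)"] by (auto simp: inner_commute)

text \<open>The multiplier of a shift by \<open>k\<close> depends on \<xi> only. Derivatives in
  \<open>x\<close> therefore stay quasi-periodic, whereas a derivative in \<xi> also hits the
  multiplier and picks up the term \<open>\<i> * of_real (c \<bullet> (0, k)) * F z\<close>.\<close>

lemma partial_deriv_quasi_periodic:
  assumes F: "F \<in> smooth_space" "quasi_periodic e F" and c: "c \<in> Basis"
  shows "k \<in> lattice e \<Longrightarrow> partial_deriv c F (z + (k, 0)) =
      exp (\<i> * of_real (z \<bullet> (0, k))) * (\<i> * of_real (c \<bullet> (0, k)) * F z + partial_deriv c F z)"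
    and "\<kappa> \<in> dual_lattice e \<Longrightarrow> partial_deriv c F (z + (0, \<kappa>)) = partial_deriv c F z"
proof -
  have tr: "partial_deriv c (\<lambda>z. F (z + l)) = (\<lambda>z. partial_deriv c F (z + l))" for l
    using partial_derivs_translate [OF F(1), of "[c]" l] c by simp
  show "partial_deriv c F (z + (k, 0)) = exp (\<i> * of_real (z \<bullet> (0, k))) * (\<i> * of_real (c \<bullet> (0, k)) * F z + partial_deriv c F z)"
    if k: "k \<in> lattice e"
  proof -
    have "(\<lambda>z. F (z + (k, 0))) = exp_twist (0, k) (\<lambda>z. z) 0 F"
      using quasi_periodic_left [OF F(2) k] by (auto simp: exp_twist_def)
    then have "partial_deriv c F (z + (k, 0)) = exp_twist (0, k) (\<lambda>z. z) 0 (twist_deriv (0, k) (\<lambda>z. z) c F) z"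
      using tr [of "(k, 0)"] partial_deriv_exp_twist [OF F(1) bounded_linear_ident, of c "(0, k)" 0] by (metis (no_types, lifting))
    also have "\<dots> = exp (\<i> * of_real (z \<bullet> (0, k))) * (\<i> * of_real (c \<bullet> (0, k)) * F z + partial_deriv c F z)"
      using sum_inner_Basis [OF c, of "\<lambda>b. partial_deriv b F z"]
      by (simp add: exp_twist_def twist_deriv_def scaleR_conv_of_real)
    finally show ?thesis .
  qed
  show "partial_deriv c F (z + (0, \<kappa>)) = partial_deriv c F z" if \<kappa>: "\<kappa> \<in> dual_lattice e"
    using tr [of "(0, \<kappa>)"] quasi_periodic_right [OF F(2) \<kappa>] by (metis (no_types, lifting) ext)
qed

lemma smooth_Z_partial_left:
  assumes F: "F \<in> smooth_Z e" and b: "b \<in> Basis"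
  shows "partial_deriv (b, 0) F \<in> smooth_Z e"
proof -
  have S: "F \<in> smooth_space" "quasi_periodic e F" using F by (auto simp: smooth_Z_def)
  show ?thesis
    unfolding smooth_Z_def
    using partial_deriv_quasi_periodic [OF S Basis_left [OF b]] partial_deriv_smooth [OF S(1) Basis_left [OF b]]
    by (auto intro!: quasi_periodicI)
qed

lemma smooth_Z_partials_left:
  "F \<in> smooth_Z e \<Longrightarrow> bs \<in> lists Basis \<Longrightarrow> partial_derivs (map (\<lambda>b. (b, 0)) bs) F \<in> smooth_Z e"
  by (induction bs) (auto intro: smooth_Z_partial_left)

text \<open>The operator on quasi-periodic functions which corresponds to multiplication by \<open>x \<bullet> b\<close>.\<close>

definition position :: "real^'d \<Rightarrow> ((real^'d) \<times> (real^'d) \<Rightarrow> complex) \<Rightarrow> (real^'d) \<times> (real^'d) \<Rightarrow> complex" where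
  "position b F = (\<lambda>z. of_real (z \<bullet> (b, 0)) * F z + \<i> * partial_deriv (0, b) F z)"

lemma position_smooth: "F \<in> smooth_space \<Longrightarrow> b \<in> Basis \<Longrightarrow> position b F \<in> smooth_space"
  unfolding position_def
  by (intro smooth_add smooth_mult smooth_linear smooth_const partial_deriv_smooth Basis_right)

text \<open>Under a shift by \<open>k\<close>, the factor \<open>x \<bullet> b\<close> gains
  \<open>k \<bullet> b\<close>, while the differentiated multiplier contributes its negative because
  of the two factors \<open>\<i>\<close>. The defects cancel.\<close>

lemma position_smooth_Z:
  assumes F: "F \<in> smooth_Z e" and b: "b \<in> Basis"
  shows "position b F \<in> smooth_Z e"
proof -
  have S: "F \<in> smooth_space" "quasi_periodic e F" using F by (auto simp: smooth_Z_def)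
  note P = partial_deriv_quasi_periodic [OF S Basis_right [OF b]]
  have "quasi_periodic e (position b F)"
  proof (rule quasi_periodicI)
    fix k z assume k: "k \<in> lattice e"
    have "\<i> * (\<i> * (w :: complex)) = - w" for w by (simp add: mult.assoc [symmetric])
    then show "position b F (z + (k, 0)) = exp (\<i> * of_real (z \<bullet> (0, k))) * position b F z"
      unfolding position_def P(1) [OF k] quasi_periodic_left [OF S(2) k]
      by (simp add: inner_add_left inner_commute algebra_simps)
  next
    fix \<kappa> z assume \<kappa>: "\<kappa> \<in> dual_lattice e"
    show "position b F (z + (0, \<kappa>)) = position b F z"
      unfolding position_def P(2) [OF \<kappa>] quasi_periodic_right [OF S(2) \<kappa>] by (simp add: inner_add_left)
  qed
  then show ?thesis using position_smooth [OF S(1) b] by (simp add: smooth_Z_def)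
qed

text \<open>The mean is kept as a function on the whole phase space, so that its derivative in \<xi>
  can be formed and shown to vanish.\<close>

definition cell_mean :: "((real^'d) \<times> (real^'d) \<Rightarrow> complex) \<Rightarrow> (real^'d) \<times> (real^'d) \<Rightarrow> complex" where
  "cell_mean F z = (\<integral>t. F (z + (0, dlin t)) \<partial>cell_measure)"

text \<open>The unit cell has mass 1, so averaging in the coordinates \<open>dlin t\<close> is a
  normalized mean over a dual cell whatever the volume of that cell is.\<close>

definition inv_zak :: "((real^'d) \<times> (real^'d) \<Rightarrow> complex) \<Rightarrow> real^'d \<Rightarrow> complex" where
  "inv_zak F x = (\<integral>t. F (x, dlin t) \<partial>cell_measure)"

lemma inv_zak_cell_mean: "inv_zak F x = cell_mean F (x, 0)"
  by (simp add: inv_zak_def cell_mean_def)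

lemma continuous_dlin: "continuous_on S dlin" and continuous_lin: "continuous_on S lin"
  using linear_dlin linear_lin by (simp_all add: linear_continuous_on linear_conv_bounded_linear)

lemma continuous_section:
  "F \<in> smooth_space \<Longrightarrow> continuous_on UNIV (\<lambda>t. F (z + (0, dlin t)))"
  by (intro continuous_on_compose2 [OF smooth_continuous [of F UNIV]] continuous_intros continuous_dlin) auto

lemma integrable_section:
  "F \<in> smooth_space \<Longrightarrow> integrable cell_measure (\<lambda>t. F (z + (0, dlin t)))"
  by (rule integrable_cell_continuous [OF continuous_section])

lemma integrable_section':
  "F \<in> smooth_space \<Longrightarrow> integrable cell_measure (\<lambda>t. F (x, dlin t))"
  using integrable_section [of F "(x, 0)"] by simp

lemma cell_mean_smooth:
  assumes F: "F \<in> smooth_space"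
  shows "cell_mean F \<in> smooth_space"
    and "bs \<in> lists Basis \<Longrightarrow> partial_derivs bs (cell_mean F) = cell_mean (partial_derivs bs F)"
proof -
  let ?g = "\<lambda>t z. F (z + (0, dlin t))"
  have pd: "partial_derivs bs (?g t) = (\<lambda>z. partial_derivs bs F (z + (0, dlin t)))" if "bs \<in> lists Basis" for bs t
    by (rule partial_derivs_translate [OF F that])
  have 1: "?g t \<in> smooth_space" for t by (rule smooth_translate [OF F])
  have 2: "(\<lambda>t. partial_derivs bs (?g t) x) \<in> borel_measurable cell_measure" if bs: "bs \<in> lists Basis" for bs x
    unfolding pd [OF bs]
    by (intro borel_measurable_cell_measure borel_measurable_continuous_onI continuous_section partial_derivs_smooth F bs)
  have 3: "\<exists>a. integrable cell_measure a \<and> (\<forall>t\<in>space cell_measure. \<forall>x. norm x \<le> r \<longrightarrow> cmod (partial_derivs bs (?g t) x) \<le> a t)"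
    if bs: "bs \<in> lists Basis" for bs r
  proof -
    let ?K = "(\<lambda>(x, t). x + (0 :: real^'d, dlin t)) ` (cball 0 r \<times> cbox 0 One)"
    have c: "continuous_on S (\<lambda>x. dlin (snd x))" for S :: "(((real^'d) \<times> (real^'d)) \<times> (real^'d)) set"
      by (rule continuous_on_compose2 [OF continuous_dlin [of UNIV]]) (auto intro: continuous_intros)
    have "compact (cball (0 :: (real^'d) \<times> (real^'d)) r \<times> cbox (0 :: real^'d) One)"
      by (rule compact_Times [OF compact_cball compact_cbox])
    moreover have "continuous_on (cball (0 :: (real^'d) \<times> (real^'d)) r \<times> cbox (0 :: real^'d) One) (\<lambda>(x, t). x + (0, dlin t))"
      unfolding split_beta by (intro continuous_intros c)
    ultimately have "compact ?K" by (intro compact_continuous_image)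
    then have "compact (partial_derivs bs F ` ?K)"
      by (rule compact_continuous_image [OF partial_derivs_continuous [OF F bs]])
    then have "bounded (partial_derivs bs F ` ?K)" by (rule compact_imp_bounded)
    then obtain C where C: "\<forall>w\<in>partial_derivs bs F ` ?K. cmod w \<le> C" unfolding bounded_iff by (elim exE) (rule that)
    have "cmod (partial_derivs bs (?g t) x) \<le> C" if tx: "t \<in> unit_cell" "norm x \<le> r" for t x
    proof -
      have "x + (0, dlin t) \<in> ?K" using tx unit_cell_subset by (intro image_eqI [where x = "(x, t)"]) auto
      then have "partial_derivs bs F (x + (0, dlin t)) \<in> partial_derivs bs F ` ?K" by (rule imageI)
      with C show ?thesis unfolding pd [OF bs] by (rule bspec)
    qed
    then show ?thesis by (intro exI [of _ "\<lambda>_. C"]) auto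
  qed
  note S = smooth_integral [of cell_measure ?g, OF 1 2 3]
  have eq: "(\<lambda>x. \<integral>t. ?g t x \<partial>cell_measure) = cell_mean F" by (simp add: cell_mean_def fun_eq_iff)
  show "cell_mean F \<in> smooth_space" using S(1) eq by simp
  show "partial_derivs bs (cell_mean F) = cell_mean (partial_derivs bs F)" if bs: "bs \<in> lists Basis"
    using S(2) [OF _ _ bs] eq by (simp add: pd [OF bs] cell_mean_def fun_eq_iff)
qed

lemma inv_zak_smooth:
  assumes F: "F \<in> smooth_space"
  shows "inv_zak F \<in> smooth_space"
    and "bs \<in> lists Basis \<Longrightarrow> partial_derivs bs (inv_zak F) = inv_zak (partial_derivs (map (\<lambda>b. (b, 0)) bs) F)"
proof -
  note S = cell_mean_smooth [OF F]
  have eq: "inv_zak F = (\<lambda>x. cell_mean F (x, 0))" by (simp add: inv_zak_cell_mean fun_eq_iff)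
  have bl: "bounded_linear (\<lambda>x :: real^'d. (x, 0 :: real^'d))" by (intro bounded_linear_Pair bounded_linear_ident bounded_linear_zero)
  show "inv_zak F \<in> smooth_space" unfolding eq using smooth_affine [OF S(1) bl, of 0] by simp
  show "partial_derivs bs (inv_zak F) = inv_zak (partial_derivs (map (\<lambda>b. (b, 0)) bs) F)" if bs: "bs \<in> lists Basis"
  proof -
    have bs': "map (\<lambda>b. (b, 0)) bs \<in> lists Basis" using bs by (rule map_left_Basis)
    show ?thesis
      unfolding eq partial_derivs_section [OF S(1) bs] S(2) [OF bs'] by (simp add: inv_zak_cell_mean fun_eq_iff)
  qed
qed

lemma cell_mean_translate_right:
  assumes F: "F \<in> smooth_space" "quasi_periodic e F"
  shows "cell_mean F (z + (0, \<eta>)) = cell_mean F z"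
proof -
  obtain s where s: "\<eta> = dlin s" using surj_dlin by blast
  let ?g = "\<lambda>t. F (z + (0, dlin t))"
  have "cell_mean F (z + (0, \<eta>)) = (\<integral>t. ?g (t + s) \<partial>cell_measure)"
    by (simp add: cell_mean_def s linear_add [OF linear_dlin] add_ac)
  also have "\<dots> = (\<integral>t. ?g t \<partial>cell_measure)"
  proof (rule cell_mean_translate [OF continuous_section [OF F(1)]])
    fix n t :: "real^'d" assume "n \<in> int_points"
    then have "dlin n \<in> dual_lattice e" by (auto simp: dual_lattice_eq)
    from quasi_periodic_right [OF F(2) this, of "z + (0, dlin t)"]
    show "?g (t + n) = ?g t" by (simp add: linear_add [OF linear_dlin] add_ac)
  qed
  finally show ?thesis by (simp add: cell_mean_def)
qed

text \<open>Differentiation passes into the mean, and the mean does not depend on \<xi>: it factors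
  through the projection to \<open>x\<close>, which maps \<open>(0, b)\<close> to 0.\<close>

lemma cell_mean_partial_right:
  assumes F: "F \<in> smooth_space" "quasi_periodic e F" and b: "b \<in> Basis"
  shows "cell_mean (partial_deriv (0, b) F) z = 0"
proof -
  let ?B = "\<lambda>z :: (real^'d) \<times> (real^'d). (fst z, 0 :: real^'d)"
  have bl: "bounded_linear ?B" by (intro bounded_linear_Pair bounded_linear_fst bounded_linear_zero)
  have eq: "cell_mean F = (\<lambda>z. cell_mean F (?B z + 0))"
  proof
    fix z
    show "cell_mean F z = cell_mean F (?B z + 0)"
      using cell_mean_translate_right [OF F, of "(fst z, 0)" "snd z"] by (cases z) simp
  qed
  have "partial_deriv (0, b) (cell_mean F) z = (\<Sum>c\<in>Basis. of_real (?B (0, b) \<bullet> c) * partial_deriv c (cell_mean F) (?B z + 0))"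
    by (subst (1) eq) (rule fun_cong [OF partial_deriv_affine [OF cell_mean_smooth(1) [OF F(1)] bl]])
  moreover have "?B (0, b) = 0" by (simp add: zero_prod_def)
  ultimately have "partial_deriv (0, b) (cell_mean F) z = 0" by (simp only: inner_zero_left of_real_0 mult_zero_left sum.neutral_const)
  moreover have "partial_derivs [(0, b)] (cell_mean F) = cell_mean (partial_derivs [(0, b)] F)"
    by (rule cell_mean_smooth(2) [OF F(1)]) (simp add: Basis_right b)
  then have "partial_deriv (0, b) (cell_mean F) = cell_mean (partial_deriv (0, b) F)" by simp
  ultimately show ?thesis by (simp only:)
qed

lemma inv_zak_position:
  assumes F: "F \<in> smooth_Z e" and b: "b \<in> Basis"
  shows "inv_zak (position b F) x = of_real (x \<bullet> b) * inv_zak F x"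
proof -
  have S: "F \<in> smooth_space" "quasi_periodic e F" using F by (auto simp: smooth_Z_def)
  have P: "partial_deriv (0, b) F \<in> smooth_space" by (rule partial_deriv_smooth [OF S(1) Basis_right [OF b]])
  have "inv_zak (position b F) x = (\<integral>t. of_real (x \<bullet> b) * F (x, dlin t) + \<i> * partial_deriv (0, b) F (x, dlin t) \<partial>cell_measure)"
    by (simp add: inv_zak_def position_def)
  also have "\<dots> = of_real (x \<bullet> b) * inv_zak F x + \<i> * cell_mean (partial_deriv (0, b) F) (x, 0)"
    using integrable_section' [OF S(1), of x] integrable_section' [OF P, of x]
    by (simp add: inv_zak_def cell_mean_def)
  finally show ?thesis by (simp add: cell_mean_partial_right [OF S b])
qed

end

section \<open>Decay estimates for the inverse Zak transform\<close>

lemma weight_le_coordinates: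
  fixes x :: "'a::euclidean_space"
  shows "(1 + norm x) ^ N \<le> (1 + real DIM('a)) ^ N * (1 + (\<Sum>b\<in>Basis. \<bar>x \<bullet> b\<bar> ^ N))"
proof -
  \<comment> \<open>The largest coordinate, but at least 1: then the norm is at most the dimension
    times \<open>m\<close>, and the summand 1 of the weight is covered too. Powers of single
    coordinates are what \<open>position\<close> can produce.\<close>
  define m where "m = Max (insert 1 ((\<lambda>b. \<bar>x \<bullet> b\<bar>) ` (Basis :: 'a set)))"
  have m1: "1 \<le> m" and mb: "\<And>b. b \<in> Basis \<Longrightarrow> \<bar>x \<bullet> b\<bar> \<le> m"
    unfolding m_def by (rule Max_ge; simp)+
  have "norm x \<le> (\<Sum>b\<in>(Basis :: 'a set). m)"
    using norm_le_l1 [of x] by (rule order_trans) (rule sum_mono [OF mb])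
  then have "1 + norm x \<le> (1 + real DIM('a)) * m" using m1 by (simp add: algebra_simps)
  then have "(1 + norm x) ^ N \<le> ((1 + real DIM('a)) * m) ^ N" by (intro power_mono) auto
  also have "\<dots> = (1 + real DIM('a)) ^ N * m ^ N" by (rule power_mult_distrib)
  also have "m ^ N \<le> 1 + (\<Sum>b\<in>Basis. \<bar>x \<bullet> b\<bar> ^ N)"
  proof -
    have "m \<in> insert 1 ((\<lambda>b. \<bar>x \<bullet> b\<bar>) ` (Basis :: 'a set))" unfolding m_def by (rule Max_in) auto
    then consider "m = 1" | b where "b \<in> Basis" "m = \<bar>x \<bullet> b\<bar>" by auto
    then show ?thesis
    proof cases
      case 2
      have "m ^ N \<le> (\<Sum>b\<in>Basis. \<bar>x \<bullet> b\<bar> ^ N)"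
        unfolding 2(2) by (rule member_le_sum [OF 2(1), of "\<lambda>b. \<bar>x \<bullet> b\<bar> ^ N"]) auto
      then show ?thesis by simp
    qed (simp add: sum_nonneg)
  qed
  finally show ?thesis by (simp add: mult_left_mono)
qed

context lattice_basis
begin

text \<open>The closed cell: compact, and each point of phase space is a lattice translate of one of
  its points. One compact set thus controls a quasi-periodic function.\<close>

definition phase_cell :: "((real^'d) \<times> (real^'d)) set" where
  "phase_cell = lin ` cbox 0 One \<times> dlin ` cbox 0 One"

lemma compact_phase_cell: "compact phase_cell"
  unfolding phase_cell_def
  by (intro compact_Times compact_continuous_image continuous_lin continuous_dlin compact_cbox)

lemma phase_cell_nonempty: "phase_cell \<noteq> {}"
  unfolding phase_cell_def by (simp add: box_ne_empty)

definition smooth_norm :: "nat \<Rightarrow> ((real^'d) \<times> (real^'d) \<Rightarrow> complex) \<Rightarrow> real" where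
  "smooth_norm M F = (\<Sum>bs | set bs \<subseteq> Basis \<and> length bs \<le> M. smooth_seminorm phase_cell bs F)"

lemma smooth_seminorm_cell_nonneg:
  assumes "F \<in> smooth_space" "bs \<in> lists Basis"
  shows "0 \<le> smooth_seminorm phase_cell bs F"
proof -
  obtain z where "z \<in> phase_cell" using phase_cell_nonempty by blast
  from smooth_seminorm_upper [OF assms compact_phase_cell this] show ?thesis by (rule order_trans [OF norm_ge_zero])
qed

lemma smooth_seminorm_le_norm:
  assumes "F \<in> smooth_space" "bs \<in> lists Basis" "length bs \<le> M"
  shows "smooth_seminorm phase_cell bs F \<le> smooth_norm M F"
  unfolding smooth_norm_def using assms
  by (intro member_le_sum smooth_seminorm_cell_nonneg) (auto simp: lists_eq_set)

lemma smooth_norm_upper: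
  assumes "F \<in> smooth_space" "bs \<in> lists Basis" "length bs \<le> M" "z \<in> phase_cell"
  shows "cmod (partial_derivs bs F z) \<le> smooth_norm M F"
  by (rule order_trans [OF smooth_seminorm_upper [OF assms(1,2) compact_phase_cell assms(4)] smooth_seminorm_le_norm [OF assms(1-3)]])

lemma smooth_norm_nonneg: "F \<in> smooth_space \<Longrightarrow> 0 \<le> smooth_norm M F"
  unfolding smooth_norm_def by (intro sum_nonneg smooth_seminorm_cell_nonneg) auto

abbreviation phase_indices :: "nat \<Rightarrow> ((real^'d) \<times> (real^'d)) list set" where
  "phase_indices \<equiv> multi_indices TYPE((real^'d) \<times> (real^'d))"

lemma smooth_norm_least:
  assumes "\<And>bs z. bs \<in> lists Basis \<Longrightarrow> length bs \<le> M \<Longrightarrow> z \<in> phase_cell \<Longrightarrow> cmod (partial_derivs bs F z) \<le> C"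
  shows "smooth_norm M F \<le> real (card (phase_indices M)) * C"
  unfolding smooth_norm_def
  by (rule order_trans [OF sum_bounded_above [where K = C]])
     (auto intro!: smooth_seminorm_least phase_cell_nonempty assms simp: lists_eq_set)

lemma smooth_norm_partial:
  assumes F: "F \<in> smooth_space" and cs: "cs \<in> lists Basis"
  shows "smooth_norm M (partial_derivs cs F) \<le> real (card (phase_indices M)) * smooth_norm (M + length cs) F"
proof (rule smooth_norm_least)
  fix bs z assume "bs \<in> lists (Basis :: ((real^'d) \<times> (real^'d)) set)" "length bs \<le> M" "z \<in> phase_cell"
  then show "cmod (partial_derivs bs (partial_derivs cs F) z) \<le> smooth_norm (M + length cs) F"
    unfolding partial_derivs_append [symmetric] using cs by (intro smooth_norm_upper F) auto
qed

lemma position_bound: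
  assumes b: "b \<in> Basis"
  shows "\<exists>C\<ge>0. \<forall>F\<in>smooth_space. smooth_norm M (position b F) \<le> C * smooth_norm (Suc M) F"
proof -
  let ?l = "\<lambda>z :: (real^'d) \<times> (real^'d). complex_of_real (z \<bullet> (b, 0))"
  \<comment> \<open>A bound on the cell for the coordinate function and its derivatives; the factor
    \<open>2 ^ M\<close> below comes from the product rule.\<close>
  define A where "A = smooth_norm M ?l"
  have A0: "0 \<le> A" unfolding A_def by (rule smooth_norm_nonneg [OF smooth_linear])
  have b': "(0, b) \<in> (Basis :: ((real^'d) \<times> (real^'d)) set)" by (rule Basis_right [OF b])
  have le: "cmod (partial_derivs bs (position b F) z) \<le> (2 ^ M * A + 1) * smooth_norm (Suc M) F"
    if F: "F \<in> smooth_space" and bs: "bs \<in> lists Basis" "length bs \<le> M" and z: "z \<in> phase_cell" for F bs z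
  proof -
    let ?s = "smooth_norm (Suc M) F"
    have s0: "0 \<le> ?s" by (rule smooth_norm_nonneg [OF F])
    have "cmod (partial_derivs bs (\<lambda>z. ?l z * F z) z) \<le> 2 ^ length bs * (A * ?s)"
      by (rule leibniz_bound [OF smooth_linear F bs(1)])
         (use bs z in \<open>auto simp: A_def intro!: smooth_norm_upper smooth_linear F\<close>)
    also have "\<dots> \<le> 2 ^ M * (A * ?s)" using bs(2) A0 s0 by (intro mult_right_mono power_increasing) auto
    finally have 1: "cmod (partial_derivs bs (\<lambda>z. ?l z * F z) z) \<le> 2 ^ M * A * ?s" by simp
    have "cmod (partial_derivs (bs @ [(0, b)]) F z) \<le> ?s"
      by (rule smooth_norm_upper [OF F]) (use bs b' z in auto)
    then have 2: "cmod (\<i> * partial_derivs bs (partial_deriv (0, b) F) z) \<le> ?s"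
      by (simp add: partial_derivs_append norm_mult)
    have "partial_derivs bs (position b F) = (\<lambda>z. partial_derivs bs (\<lambda>z. ?l z * F z) z + \<i> * partial_derivs bs (partial_deriv (0, b) F) z)"
      unfolding position_def
      by (simp add: partial_derivs_add partial_derivs_cmult smooth_mult smooth_linear smooth_cmult partial_deriv_smooth F b' bs(1))
    then have "cmod (partial_derivs bs (position b F) z) \<le> 2 ^ M * A * ?s + ?s"
      using norm_triangle_mono [OF 1 2] by simp
    then show ?thesis by (simp add: algebra_simps)
  qed
  have "smooth_norm M (position b F) \<le> (real (card (phase_indices M)) * (2 ^ M * A + 1)) * smooth_norm (Suc M) F" if "F \<in> smooth_space" for F
    unfolding mult.assoc by (rule smooth_norm_least) (use le [OF that] in auto)
  moreover have "0 \<le> real (card (phase_indices M)) * (2 ^ M * A + 1)" using A0 by simp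
  ultimately show ?thesis by blast
qed

lemma position_power_smooth_Z: "F \<in> smooth_Z e \<Longrightarrow> b \<in> Basis \<Longrightarrow> (position b ^^ N) F \<in> smooth_Z e"
  by (induction N) (auto intro: position_smooth_Z)

lemma position_power_bound:
  assumes b: "b \<in> Basis"
  shows "\<exists>C\<ge>0. \<forall>F\<in>smooth_Z e. smooth_norm M ((position b ^^ N) F) \<le> C * smooth_norm (M + N) F"
proof (induction N arbitrary: M)
  case 0
  show ?case by (rule exI [of _ 1]) simp
next
  case (Suc N)
  obtain C where C: "0 \<le> C" "\<And>F. F \<in> smooth_space \<Longrightarrow> smooth_norm M (position b F) \<le> C * smooth_norm (Suc M) F"
    using position_bound [OF b] by blast
  obtain D where D: "0 \<le> D" "\<And>F. F \<in> smooth_Z e \<Longrightarrow> smooth_norm (Suc M) ((position b ^^ N) F) \<le> D * smooth_norm (Suc M + N) F"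
    using Suc.IH [of "Suc M"] by blast
  have "smooth_norm M ((position b ^^ Suc N) F) \<le> C * D * smooth_norm (M + Suc N) F" if F: "F \<in> smooth_Z e" for F
  proof -
    have "smooth_norm M ((position b ^^ Suc N) F) \<le> C * smooth_norm (Suc M) ((position b ^^ N) F)"
      using C(2) position_power_smooth_Z [OF F b] by (simp add: smooth_Z_def)
    also have "\<dots> \<le> C * (D * smooth_norm (Suc M + N) F)" by (intro mult_left_mono D F C)
    finally show ?thesis by simp
  qed
  then show ?case using C(1) D(1) by (intro exI [of _ "C * D"]) auto
qed

lemma inv_zak_position_power:
  "F \<in> smooth_Z e \<Longrightarrow> b \<in> Basis \<Longrightarrow> inv_zak ((position b ^^ N) F) x = of_real (x \<bullet> b) ^ N * inv_zak F x"
  by (induction N) (auto simp: inv_zak_position position_power_smooth_Z mult_ac)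

text \<open>Subtracting a lattice vector brings \<open>x\<close> into the cell and changes
  \<open>F\<close> only by a factor of modulus 1.\<close>

lemma quasi_periodic_bounded:
  assumes F: "F \<in> smooth_Z e" and t: "t \<in> unit_cell"
  shows "cmod (F (x, dlin t)) \<le> smooth_norm 0 F"
proof -
  have S: "F \<in> smooth_space" "quasi_periodic e F" using F by (auto simp: smooth_Z_def)
  obtain s where s: "x = lin s" using surj_lin by blast
  define y where "y = lin (s - int_part s)"
  have k: "lin (int_part s) \<in> lattice e" by (auto simp: lattice_eq)
  have "x = y + lin (int_part s)" unfolding s y_def linear_add [OF linear_lin, symmetric] by simp
  then have "cmod (F (x, dlin t)) = cmod (F (y, dlin t))"
    using quasi_periodic_left [OF S(2) k, of "(y, dlin t)"] by (simp add: norm_mult)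
  moreover have "(y, dlin t) \<in> phase_cell"
  proof -
    have "s - int_part s \<in> unit_cell" using cell_shift_iff [of "int_part s" s] by simp
    then have "y \<in> lin ` cbox 0 One" "dlin t \<in> dlin ` cbox 0 One"
      using t unit_cell_subset unfolding y_def by blast+
    then show ?thesis by (simp add: phase_cell_def)
  qed
  then have "cmod (F (y, dlin t)) \<le> smooth_norm 0 F"
    using smooth_norm_upper [OF S(1), of "[]" 0] by simp
  ultimately show ?thesis by simp
qed

lemma inv_zak_bounded:
  assumes F: "F \<in> smooth_Z e"
  shows "cmod (inv_zak F x) \<le> smooth_norm 0 F"
proof -
  have "cmod (inv_zak F x) \<le> (\<integral>t. smooth_norm 0 F \<partial>(cell_measure :: (real^'d) measure))"
    unfolding inv_zak_def by (rule norm_integral_le) (auto intro: quasi_periodic_bounded [OF F])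
  then show ?thesis by (simp add: measure_def emeasure_cell_measure)
qed

lemma smooth_norm_mono: "F \<in> smooth_space \<Longrightarrow> M \<le> M' \<Longrightarrow> smooth_norm M F \<le> smooth_norm M' F"
  unfolding smooth_norm_def by (intro sum_mono2 smooth_seminorm_cell_nonneg) auto

text \<open>Derivatives in \<open>x\<close> commute with the mean and preserve quasi-periodicity. A
  power of a coordinate is traded for the same power of \<open>position\<close>, at the price of one
  derivative each, whence the order \<open>N + length bs\<close>.\<close>

lemma inv_zak_decay:
  assumes bs: "bs \<in> lists Basis"
  shows "\<exists>C\<ge>0. \<forall>F\<in>smooth_Z e. \<forall>x. (1 + norm x) ^ N * cmod (partial_derivs bs (inv_zak F) x) \<le> C * smooth_norm (N + length bs) F"
proof -
  let ?cs = "map (\<lambda>b. (b, 0)) bs :: ((real^'d) \<times> (real^'d)) list"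
  have cs: "?cs \<in> lists Basis" by (rule map_left_Basis [OF bs])
  have "\<forall>b\<in>(Basis :: (real^'d) set). \<exists>C. 0 \<le> C \<and> (\<forall>F\<in>smooth_Z e. smooth_norm 0 ((position b ^^ N) F) \<le> C * smooth_norm N F)"
    using position_power_bound [of _ 0 N] by auto
  then obtain C where C: "\<And>b. b \<in> Basis \<Longrightarrow> 0 \<le> C b"
    "\<And>b F. b \<in> Basis \<Longrightarrow> F \<in> smooth_Z e \<Longrightarrow> smooth_norm 0 ((position b ^^ N) F) \<le> C b * smooth_norm N F"
    by metis
  define c where "c = (1 + real DIM(real^'d)) ^ N * (1 + sum C Basis)"
  have c0: "0 \<le> c" unfolding c_def using C(1) by (intro mult_nonneg_nonneg add_nonneg_nonneg sum_nonneg) auto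
  define k where "k = real (card (phase_indices N))"
  have "(1 + norm x) ^ N * cmod (partial_derivs bs (inv_zak F) x) \<le> (c * k) * smooth_norm (N + length bs) F"
    if F: "F \<in> smooth_Z e" for F x
  proof -
    define G where "G = partial_derivs ?cs F"
    have FS: "F \<in> smooth_space" using F by (simp add: smooth_Z_def)
    have G: "G \<in> smooth_Z e" unfolding G_def by (rule smooth_Z_partials_left [OF F bs])
    then have GS: "G \<in> smooth_space" by (simp add: smooth_Z_def)
    have eq: "partial_derivs bs (inv_zak F) x = inv_zak G x" unfolding G_def inv_zak_smooth(2) [OF FS bs] ..
    have "(1 + norm x) ^ N * cmod (inv_zak G x) \<le>
        ((1 + real DIM(real^'d)) ^ N * (1 + (\<Sum>b\<in>Basis. \<bar>x \<bullet> b\<bar> ^ N))) * cmod (inv_zak G x)"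
      by (intro mult_right_mono weight_le_coordinates) auto
    also have "\<dots> = (1 + real DIM(real^'d)) ^ N * (cmod (inv_zak G x) + (\<Sum>b\<in>Basis. cmod (inv_zak ((position b ^^ N) G) x)))"
      by (simp add: inv_zak_position_power [OF G] norm_mult norm_power distrib_right sum_distrib_right mult.assoc)
    also have "\<dots> \<le> (1 + real DIM(real^'d)) ^ N * (smooth_norm N G + (\<Sum>b\<in>Basis. C b * smooth_norm N G))"
    proof (intro mult_left_mono add_mono sum_mono)
      show "cmod (inv_zak G x) \<le> smooth_norm N G"
        by (rule order_trans [OF inv_zak_bounded [OF G] smooth_norm_mono [OF GS]]) simp
      fix b :: "real^'d" assume b: "b \<in> Basis"
      show "cmod (inv_zak ((position b ^^ N) G) x) \<le> C b * smooth_norm N G"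
        by (rule order_trans [OF inv_zak_bounded [OF position_power_smooth_Z [OF G b]] C(2) [OF b G]])
    qed simp
    also have "\<dots> = c * smooth_norm N G" by (simp add: c_def sum_distrib_right distrib_right distrib_left mult.assoc)
    also have "\<dots> \<le> c * (k * smooth_norm (N + length bs) F)"
      using smooth_norm_partial [OF FS cs, of N] by (intro mult_left_mono c0) (simp add: G_def k_def)
    finally show ?thesis by (simp add: eq)
  qed
  then show ?thesis using c0 by (intro exI [of _ "c * k"]) (auto simp: k_def)
qed

lemma inv_zak_schwartz:
  assumes F: "F \<in> smooth_Z e"
  shows "inv_zak F \<in> schwartz_space"
proof (rule schwartz_spaceI)
  show "inv_zak F \<in> smooth_space" using inv_zak_smooth(1) F by (simp add: smooth_Z_def)
  show "\<exists>C. \<forall>x. (1 + norm x) ^ N * cmod (partial_derivs bs (inv_zak F) x) \<le> C" if "bs \<in> lists Basis" for bs N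
    using inv_zak_decay [OF that, of N] F by blast
qed

lemma inv_zak_norm_bound:
  "\<exists>C\<ge>0. \<forall>F\<in>smooth_Z e. schwartz_norm M (inv_zak F) \<le> C * smooth_norm (M + M) F"
proof -
  have "\<forall>bs\<in>lists (Basis :: (real^'d) set). \<exists>C. 0 \<le> C \<and> (\<forall>F\<in>smooth_Z e. \<forall>x. (1 + norm x) ^ M * cmod (partial_derivs bs (inv_zak F) x) \<le> C * smooth_norm (M + length bs) F)"
    using inv_zak_decay [of _ M] by blast
  then obtain C where C: "\<And>bs. bs \<in> lists Basis \<Longrightarrow> 0 \<le> C bs"
    "\<And>bs F x. bs \<in> lists Basis \<Longrightarrow> F \<in> smooth_Z e \<Longrightarrow> (1 + norm x) ^ M * cmod (partial_derivs bs (inv_zak F) x) \<le> C bs * smooth_norm (M + length bs) F"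
    by metis
  have "schwartz_norm M (inv_zak F) \<le> sum C (multi_indices TYPE(real^'d) M) * smooth_norm (M + M) F" if F: "F \<in> smooth_Z e" for F
    unfolding schwartz_norm_def sum_distrib_right
  proof (intro sum_mono schwartz_seminorm_least)
    fix bs x assume "bs \<in> multi_indices TYPE(real^'d) M"
    then have bs: "bs \<in> lists Basis" "length bs \<le> M" by auto
    have FS: "F \<in> smooth_space" using F by (simp add: smooth_Z_def)
    have "(1 + norm x) ^ M * cmod (partial_derivs bs (inv_zak F) x) \<le> C bs * smooth_norm (M + length bs) F" by (rule C(2) [OF bs(1) F])
    also have "\<dots> \<le> C bs * smooth_norm (M + M) F"
      using bs by (intro mult_left_mono smooth_norm_mono C FS) auto
    finally show "(1 + norm x) ^ M * cmod (partial_derivs bs (inv_zak F) x) \<le> C bs * smooth_norm (M + M) F" .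
  qed
  moreover have "0 \<le> sum C (multi_indices TYPE(real^'d) M)" by (rule sum_nonneg) (auto intro!: C(1))
  ultimately show ?thesis by blast
qed

lemma torus_char_lattice: "torus_char n t = exp (\<i> * of_real (lin n \<bullet> dlin t))"
  by (simp add: torus_char_def lin_inner_dlin)

text \<open>Multiplying by a character is the same as shifting \<open>x\<close> by a lattice vector,
  so every Fourier coefficient in \<xi> is a value of \<open>inv_zak F\<close>.\<close>

lemma quasi_periodic_coeff:
  assumes F: "quasi_periodic e F" and n: "n \<in> int_points"
  shows "F (x, dlin t) * torus_char n t = F (x + lin n, dlin t)"
proof -
  have "lin n \<in> lattice e" using n by (auto simp: lattice_eq)
  from quasi_periodic_left [OF F this, of "(x, dlin t)"]
  show ?thesis by (simp add: torus_char_lattice inner_commute mult.commute)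
qed

text \<open>The mean is taken term by term; orthogonality of the characters removes every lattice
  vector except 0.\<close>

lemma inv_zak_zak:
  assumes f: "f \<in> schwartz_space"
  shows "inv_zak (zak e f) = f"
proof
  fix x
  have sm: "(\<lambda>j. cmod (f (x - j))) summable_on lattice e"
  proof -
    have bij: "bij_betw uminus (lattice e) (lattice e)"
      by (rule bij_betwI [where g = uminus]) (auto intro: lattice_uminus)
    have "(\<lambda>l. cmod (f (x + l))) summable_on lattice e"
      using Z.abs_summable [OF f, of "(x, 0)"] by (simp add: exp_twist_def norm_mult)
    then show ?thesis using summable_on_reindex_bij_betw [OF bij, of "\<lambda>l. cmod (f (x + l))"] by simp
  qed
  have "inv_zak (zak e f) x = (\<integral>t. (\<Sum>\<^sub>\<infinity>j\<in>lattice e. f (x - j) * exp (\<i> * of_real (j \<bullet> dlin t))) \<partial>cell_measure)"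
    by (simp add: inv_zak_def zak_def)
  also have "\<dots> = (\<Sum>\<^sub>\<infinity>j\<in>lattice e. \<integral>t. f (x - j) * exp (\<i> * of_real (j \<bullet> dlin t)) \<partial>cell_measure)"
  proof (rule integral_infsum [OF countable_lattice])
    show "integrable cell_measure (\<lambda>t. f (x - j) * exp (\<i> * of_real (j \<bullet> dlin t)))" for j
      by (intro integrable_cell_continuous continuous_intros continuous_dlin)
  qed (use sm in \<open>simp_all add: norm_mult measure_def emeasure_cell_measure\<close>)
  also have "\<dots> = (\<Sum>\<^sub>\<infinity>j\<in>{0}. f (x - j))"
  proof (rule infsum_cong_neutral)
    fix j assume "j \<in> lattice e - {0}"
    then obtain n where n: "j = lin n" "n \<in> int_points" "n \<noteq> 0"
      using linear_0 [OF linear_lin] by (auto simp: lattice_eq)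
    show "(\<integral>t. f (x - j) * exp (\<i> * of_real (j \<bullet> dlin t)) \<partial>cell_measure) = 0"
      using integral_torus_char [OF n(2,3)] by (simp add: n(1) torus_char_lattice [symmetric])
  qed (use lattice_zero in \<open>auto simp: cell_mean_const measure_def emeasure_cell_measure\<close>)
  also have "\<dots> = f x" by simp
  finally show "inv_zak (zak e f) x = f x" .
qed

lemma zak_smooth_Z: "f \<in> schwartz_space \<Longrightarrow> zak e f \<in> smooth_Z e"
  by (simp add: smooth_Z_def zak_smooth zak_quasi_periodic)

text \<open>\<open>F\<close> and \<open>G = zak e (inv_zak F)\<close> have the same means at all
  points, in particular at all shifts of \<open>x\<close> by the lattice. So their difference in
  \<xi> has vanishing Fourier coefficients and is zero by
  \<open>coeff_free_imp_zero\<close>.\<close>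

lemma zak_inv_zak:
  assumes F: "F \<in> smooth_Z e"
  shows "zak e (inv_zak F) = F"
proof
  fix z :: "(real^'d) \<times> (real^'d)"
  obtain x t where z: "z = (x, dlin t)" using surj_dlin by (metis surjE surj_pair)
  define G where "G = zak e (inv_zak F)"
  have G: "G \<in> smooth_Z e" unfolding G_def by (rule zak_smooth_Z [OF inv_zak_schwartz [OF F]])
  have inv: "inv_zak G = inv_zak F" unfolding G_def by (rule inv_zak_zak [OF inv_zak_schwartz [OF F]])
  have FS: "F \<in> smooth_space" "quasi_periodic e F" and GS: "G \<in> smooth_space" "quasi_periodic e G"
    using F G by (auto simp: smooth_Z_def)
  have cont: "continuous_on UNIV (\<lambda>t. H (x, dlin t))" if "H \<in> smooth_space" for H x
    using continuous_section [OF that, of "(x, 0)"] by simp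
  have "coeff_free (\<lambda>t. F (x, dlin t) - G (x, dlin t))"
    unfolding coeff_free_def
  proof (intro conjI ballI allI)
    show "continuous_on UNIV (\<lambda>t. F (x, dlin t) - G (x, dlin t))" by (intro continuous_intros cont FS GS)
    fix n assume n: "n \<in> (int_points :: (real^'d) set)"
    then have "dlin n \<in> dual_lattice e" by (auto simp: dual_lattice_eq)
    then have per: "H (x, dlin (t + n)) = H (x, dlin t)" if "quasi_periodic e H" for H t
      using quasi_periodic_right [OF that, of "dlin n" "(x, dlin t)"] by (simp add: linear_add [OF linear_dlin])
    show "F (x, dlin (t + n)) - G (x, dlin (t + n)) = F (x, dlin t) - G (x, dlin t)" for t
      by (simp add: per [OF FS(2)] per [OF GS(2)])
    have "(\<integral>t. (F (x, dlin t) - G (x, dlin t)) * torus_char n t \<partial>cell_measure)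
        = (\<integral>t. F (x + lin n, dlin t) - G (x + lin n, dlin t) \<partial>cell_measure)"
      by (simp add: left_diff_distrib quasi_periodic_coeff [OF _ n] FS GS)
    also have "\<dots> = inv_zak F (x + lin n) - inv_zak G (x + lin n)"
      unfolding inv_zak_def by (intro Bochner_Integration.integral_diff integrable_section' FS GS)
    finally show "(\<integral>t. (F (x, dlin t) - G (x, dlin t)) * torus_char n t \<partial>cell_measure) = 0"
      by (simp add: inv)
  qed
  from coeff_free_imp_zero [OF this, of t] show "zak e (inv_zak F) z = F z"
    by (simp add: z G_def)
qed

end

section \<open>The homeomorphism onto smooth quasi-periodic functions\<close>

lemma openin_seminorm_finite_ball:
  assumes pm: "pseudometric_family V P" and Q: "finite Q" "Q \<subseteq> P" and f: "f \<in> V" and r: "0 < r"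
  shows "openin (seminorm_topology V P) {g \<in> V. \<forall>p\<in>Q. p (g - f) < r}"
proof -
  have "{g \<in> V. \<forall>p\<in>Q. p (g - f) < r} = (\<Inter>p\<in>Q. {g \<in> V. p (g - f) < r}) \<inter> topspace (seminorm_topology V P)"
    by (auto simp: topspace_seminorm_topology [OF pm])
  moreover have "openin (seminorm_topology V P) \<dots>"
    using Q openin_seminorm_ball [OF f _ r, of _ P] by (cases "Q = {}") (auto intro!: openin_Int openin_INT)
  ultimately show ?thesis by simp
qed

lemma pseudometric_family_subset:
  "pseudometric_family V P \<Longrightarrow> W \<subseteq> V \<Longrightarrow> pseudometric_family W P"
  unfolding pseudometric_family_def by blast

text \<open>This makes the continuity criterion for seminorm topologies applicable to maps defined
  on a subspace such as \<open>smooth_Z e\<close>.\<close>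

lemma subtopology_seminorm_topology:
  assumes V: "pseudometric_family V P" and WV: "W \<subseteq> V"
  shows "subtopology (seminorm_topology V P) W = seminorm_topology W P"
  unfolding topology_eq
proof (intro allI iffI)
  note W = pseudometric_family_subset [OF V WV]
  fix S
  assume "openin (subtopology (seminorm_topology V P) W) S"
  then obtain T where T: "openin (seminorm_topology V P) T" and S: "S = T \<inter> W" unfolding openin_subtopology by blast
  show "openin (seminorm_topology W P) S"
    unfolding openin_seminorm_topology [OF W]
  proof (intro conjI ballI)
    fix f assume f: "f \<in> S"
    then obtain Q r where "finite Q" "Q \<subseteq> P" "0 < r" "\<forall>g\<in>V. (\<forall>p\<in>Q. p (g - f) < r) \<longrightarrow> g \<in> T"
      using T unfolding openin_seminorm_topology [OF V] S by (elim IntE conjE) (drule (1) bspec, elim exE conjE, rule that)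
    then show "\<exists>Q r. finite Q \<and> Q \<subseteq> P \<and> 0 < r \<and> (\<forall>g\<in>W. (\<forall>p\<in>Q. p (g - f) < r) \<longrightarrow> g \<in> S)"
      using WV unfolding S by (intro exI [of _ Q] exI [of _ r]) auto
  qed (simp add: S)
next
  note W = pseudometric_family_subset [OF V WV]
  fix S
  assume S: "openin (seminorm_topology W P) S"
  then have SW: "S \<subseteq> W" unfolding openin_seminorm_topology [OF W] by blast
  \<comment> \<open>The largest open set of the big space whose trace on \<open>W\<close> stays
    inside \<open>S\<close>; balls around points of \<open>S\<close> show that the trace is all of
    \<open>S\<close>.\<close>
  let ?T = "\<Union> {U. openin (seminorm_topology V P) U \<and> U \<inter> W \<subseteq> S}"
  have "f \<in> ?T" if f: "f \<in> S" for f
  proof -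
    obtain Q r where Q: "finite Q" "Q \<subseteq> P" "0 < r" "\<forall>g\<in>W. (\<forall>p\<in>Q. p (g - f) < r) \<longrightarrow> g \<in> S"
      using S f unfolding openin_seminorm_topology [OF W] by (elim conjE) (drule (1) bspec, elim exE conjE, rule that)
    have fV: "f \<in> V" using f SW WV by blast
    have "p (f - f) < r" if "p \<in> Q" for p
      using pseudometric_familyD(2) [OF V _ fV, of p] that Q by auto
    then have "f \<in> {g \<in> V. \<forall>p\<in>Q. p (g - f) < r}" using fV by simp
    moreover have "{g \<in> V. \<forall>p\<in>Q. p (g - f) < r} \<inter> W \<subseteq> S" using Q(4) by blast
    ultimately show ?thesis using openin_seminorm_finite_ball [OF V Q(1,2) fV Q(3)] by blast
  qed
  then have "S = ?T \<inter> W" using SW by blast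
  moreover have "openin (seminorm_topology V P) ?T" by (intro openin_Union) blast
  ultimately show "openin (subtopology (seminorm_topology V P) W) S" unfolding openin_subtopology by blast
qed

text \<open>Different indices may give equal seminorms, which the image counts once; the cardinality
  compensates for this.\<close>

lemma sum_le_card_image:
  fixes p :: "'i \<Rightarrow> 'v \<Rightarrow> real"
  assumes "finite I" "\<And>i. i \<in> I \<Longrightarrow> 0 \<le> p i x"
  shows "(\<Sum>i\<in>I. p i x) \<le> real (card I) * (\<Sum>q\<in>p ` I. q x)"
proof (rule sum_bounded_above)
  fix i assume i: "i \<in> I"
  show "p i x \<le> (\<Sum>q\<in>p ` I. q x)"
    by (rule member_le_sum [of "p i" "p ` I" "\<lambda>q. q x"]) (use i assms in auto)
qed

lemma schwartz_norm_le_sum: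
  fixes h :: "'a::euclidean_space \<Rightarrow> complex"
  assumes "h \<in> schwartz_space"
  shows "schwartz_norm M h \<le> real (card (multi_indices TYPE('a) M)) * (\<Sum>p\<in>schwartz_seminorm M ` multi_indices TYPE('a) M. p h)"
  unfolding schwartz_norm_def
  by (rule sum_le_card_image [where p = "schwartz_seminorm M"]) (auto intro!: schwartz_seminorm_nonneg assms)

context lattice_basis
begin

lemma zak_diff: "f \<in> schwartz_space \<Longrightarrow> g \<in> schwartz_space \<Longrightarrow> zak e (g - f) = zak e g - zak e f"
  using Z.twisted_sum_add [of g "\<lambda>x. -1 * f x"] Z.twisted_sum_cmult [of "-1" f] schwartz_cmult(1) [of f "-1"]
  by (simp add: zak_eq fun_diff_def)

lemma smooth_Z_diff: "F \<in> smooth_Z e \<Longrightarrow> G \<in> smooth_Z e \<Longrightarrow> G - F \<in> smooth_Z e"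
  by (auto simp: smooth_Z_def quasi_periodic_def smooth_diff_mem right_diff_distrib)

lemma inv_zak_diff: "F \<in> smooth_Z e \<Longrightarrow> G \<in> smooth_Z e \<Longrightarrow> inv_zak (G - F) = inv_zak G - inv_zak F"
  by (auto simp: inv_zak_def smooth_Z_def fun_eq_iff intro!: Bochner_Integration.integral_diff integrable_section')

lemma zak_bound:
  "\<exists>C\<ge>0. \<exists>m M. \<forall>\<Phi>\<in>schwartz_space. \<forall>z. \<forall>cs\<in>lists Basis. length cs \<le> n \<longrightarrow>
    cmod (partial_derivs cs (zak e \<Phi>) z) \<le> C * schwartz_norm M \<Phi> * (1 + norm z) ^ m"
  unfolding zak_eq by (rule Z.twisted_sum_bound)

lemma continuous_map_zak: "continuous_map schwartz_topology (subtopology smooth_topology (smooth_Z e)) (zak e)"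
  unfolding continuous_map_in_subtopology
proof
  show "zak e \<in> topspace schwartz_topology \<rightarrow> smooth_Z e"
    using zak_smooth_Z by (auto simp: schwartz_topology_def topspace_seminorm_topology [OF pseudometric_schwartz])
  show "continuous_map schwartz_topology smooth_topology (zak e)"
    unfolding schwartz_topology_def smooth_topology_def
  proof (rule continuous_map_seminorm_topology [OF pseudometric_schwartz pseudometric_smooth])
    fix q assume "q \<in> {smooth_seminorm K bs | K bs. compact K \<and> K \<noteq> {} \<and> bs \<in> lists (Basis :: ((real^'d) \<times> (real^'d)) set)}"
    then obtain K bs where K: "compact K" "K \<noteq> {}" and bs: "bs \<in> lists Basis" and q: "q = smooth_seminorm K bs" by blast
    obtain C m M where C: "0 \<le> C" and C': "\<forall>\<Phi>\<in>schwartz_space. \<forall>z. \<forall>cs\<in>lists Basis. length cs \<le> length bs \<longrightarrow>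
        cmod (partial_derivs cs (zak e \<Phi>) z) \<le> C * schwartz_norm M \<Phi> * (1 + norm z) ^ m"
      using zak_bound [of "length bs"] by (elim exE conjE) (rule that)
    obtain R where R: "\<And>z. z \<in> K \<Longrightarrow> norm z \<le> R" "0 < R" using compact_imp_bounded [OF K(1)] unfolding bounded_pos by blast
    let ?F = "schwartz_seminorm M ` multi_indices TYPE(real^'d) M"
    let ?C = "C * (1 + R) ^ m * real (card (multi_indices TYPE(real^'d) M))"
    have "q (zak e g - zak e f) \<le> ?C * (\<Sum>p\<in>?F. p (g - f))" if f: "f \<in> schwartz_space" and g: "g \<in> schwartz_space" for f g
    proof -
      let ?h = "g - f"
      have h: "?h \<in> schwartz_space" by (rule schwartz_diff_mem [OF g f])
      have "q (zak e ?h) \<le> C * schwartz_norm M ?h * (1 + R) ^ m"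
        unfolding q
      proof (rule smooth_seminorm_least [OF K(2)])
        fix z assume z: "z \<in> K"
        have "C * schwartz_norm M ?h * (1 + norm z) ^ m \<le> C * schwartz_norm M ?h * (1 + R) ^ m"
          using R z C by (intro mult_left_mono power_mono mult_nonneg_nonneg schwartz_norm_nonneg h) auto
        moreover have "cmod (partial_derivs bs (zak e ?h) z) \<le> C * schwartz_norm M ?h * (1 + norm z) ^ m"
          by (rule C' [rule_format, OF h bs order_refl])
        ultimately show "cmod (partial_derivs bs (zak e ?h) z) \<le> C * schwartz_norm M ?h * (1 + R) ^ m" by linarith
      qed
      also have "\<dots> = C * (1 + R) ^ m * schwartz_norm M ?h" by simp
      also have "\<dots> \<le> C * (1 + R) ^ m * (real (card (multi_indices TYPE(real^'d) M)) * (\<Sum>p\<in>?F. p ?h))"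
        using C R(2) by (intro mult_left_mono schwartz_norm_le_sum h) auto
      finally show ?thesis by (simp add: zak_diff [OF f g] mult.assoc)
    qed
    moreover have "?F \<subseteq> {schwartz_seminorm N bs | N bs. bs \<in> lists Basis}" by blast
    ultimately show "\<exists>C F. 0 \<le> C \<and> finite F \<and> F \<subseteq> {schwartz_seminorm N bs | N bs. bs \<in> lists Basis} \<and>
        (\<forall>f\<in>schwartz_space. \<forall>g\<in>schwartz_space. q (zak e g - zak e f) \<le> C * (\<Sum>p\<in>F. p (g - f)))"
      using C R(2) by (intro exI [of _ ?C] exI [of _ ?F] conjI ballI) simp_all
  qed (rule zak_smooth)
qed

lemma smooth_Z_subset: "smooth_Z e \<subseteq> smooth_space"
  by (auto simp: smooth_Z_def)

lemma continuous_map_inv_zak: "continuous_map (subtopology smooth_topology (smooth_Z e)) schwartz_topology inv_zak"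
  unfolding smooth_topology_def schwartz_topology_def subtopology_seminorm_topology [OF pseudometric_smooth smooth_Z_subset]
proof (rule continuous_map_seminorm_topology [OF pseudometric_family_subset [OF pseudometric_smooth smooth_Z_subset] pseudometric_schwartz])
  fix q :: "(real^'d \<Rightarrow> complex) \<Rightarrow> real" assume "q \<in> {schwartz_seminorm N bs | N bs. bs \<in> lists Basis}"
  then obtain N bs where bs: "bs \<in> lists Basis" and q: "q = schwartz_seminorm N bs" by blast
  define M where "M = max N (length bs)"
  obtain C where C: "0 \<le> C" "\<And>F. F \<in> smooth_Z e \<Longrightarrow> schwartz_norm M (inv_zak F) \<le> C * smooth_norm (M + M) F"
    using inv_zak_norm_bound [of M] by blast
  let ?I = "phase_indices (M + M)"
  let ?F = "smooth_seminorm phase_cell ` ?I"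
  let ?C = "C * real (card ?I)"
  have "q (inv_zak G - inv_zak F) \<le> ?C * (\<Sum>p\<in>?F. p (G - F))" if F: "F \<in> smooth_Z e" and G: "G \<in> smooth_Z e" for F G
  proof -
    let ?H = "G - F"
    have H: "?H \<in> smooth_Z e" by (rule smooth_Z_diff [OF F G])
    have "q (inv_zak ?H) \<le> schwartz_norm M (inv_zak ?H)"
      unfolding q by (rule schwartz_seminorm_le_norm [OF inv_zak_schwartz [OF H] bs]) (auto simp: M_def)
    also have "\<dots> \<le> C * smooth_norm (M + M) ?H" by (rule C(2) [OF H])
    also have "\<dots> \<le> C * (real (card ?I) * (\<Sum>p\<in>?F. p ?H))"
      unfolding smooth_norm_def
      using H smooth_Z_subset by (intro mult_left_mono C(1) sum_le_card_image [where p = "smooth_seminorm phase_cell"])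
        (auto intro!: smooth_seminorm_cell_nonneg)
    finally show ?thesis by (simp add: inv_zak_diff [OF F G] mult.assoc)
  qed
  moreover have "?F \<subseteq> {smooth_seminorm K bs | K bs. compact K \<and> K \<noteq> {} \<and> bs \<in> lists Basis}"
  proof (rule image_subsetI)
    fix bs assume "bs \<in> ?I"
    then have "bs \<in> lists Basis" by auto
    then show "smooth_seminorm phase_cell bs \<in> {smooth_seminorm K bs | K bs. compact K \<and> K \<noteq> {} \<and> bs \<in> lists Basis}"
      using compact_phase_cell phase_cell_nonempty by blast
  qed
  ultimately show "\<exists>C F. 0 \<le> C \<and> finite F \<and> F \<subseteq> {smooth_seminorm K bs | K bs. compact K \<and> K \<noteq> {} \<and> bs \<in> lists Basis} \<and>
      (\<forall>f\<in>smooth_Z e. \<forall>g\<in>smooth_Z e. q (inv_zak g - inv_zak f) \<le> C * (\<Sum>p\<in>F. p (g - f)))"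
    using C(1) by (intro exI [of _ ?C] exI [of _ ?F] conjI ballI) simp_all
qed (rule inv_zak_schwartz)

lemma homeomorphic_map_zak: "homeomorphic_map schwartz_topology (subtopology smooth_topology (smooth_Z e)) (zak e)"
proof (rule homeomorphic_maps_imp_map)
  show "homeomorphic_maps schwartz_topology (subtopology smooth_topology (smooth_Z e)) (zak e) inv_zak"
    unfolding homeomorphic_maps_def
    using continuous_map_zak continuous_map_inv_zak
    by (auto simp: schwartz_topology_def smooth_topology_def topspace_seminorm_topology [OF pseudometric_schwartz]
        topspace_seminorm_topology [OF pseudometric_smooth] inv_zak_zak zak_inv_zak)
qed

end

section \<open>Gaussians are Schwartz functions\<close>

inductive_set gauss_polys :: "('a::euclidean_space \<Rightarrow> complex) set" where
  gauss: "(\<lambda>x. of_real (exp (- (x \<bullet> x)))) \<in> gauss_polys"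
| times: "f \<in> gauss_polys \<Longrightarrow> (\<lambda>x. of_real (x \<bullet> b) * f x) \<in> gauss_polys"
| cmult: "f \<in> gauss_polys \<Longrightarrow> (\<lambda>x. c * f x) \<in> gauss_polys"
| add: "f \<in> gauss_polys \<Longrightarrow> g \<in> gauss_polys \<Longrightarrow> (\<lambda>x. f x + g x) \<in> gauss_polys"

text \<open>Polynomials times the Gaussian are closed under directional derivatives. Smoothness is
  then a coinduction over this class, and decay of all derivatives reduces to decay of its
  members.\<close>

lemma gauss_polys_derivative:
  "f \<in> gauss_polys \<Longrightarrow> \<exists>D. (\<forall>x. (f has_derivative (\<lambda>h. D h x)) (at x)) \<and> (\<forall>h. D h \<in> gauss_polys)"
proof (induction rule: gauss_polys.induct)
  case gauss
  have "((\<lambda>x. complex_of_real (exp (- (x \<bullet> x)))) has_derivative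
      (\<lambda>h. -2 * (of_real (x \<bullet> h) * of_real (exp (- (x \<bullet> x)))))) (at x)" for x :: 'a
  proof -
    have "((\<lambda>x. exp (- (x \<bullet> x))) has_derivative (\<lambda>h. exp (- (x \<bullet> x)) * (- (2 * (x \<bullet> h))))) (at x)"
      by (auto intro!: derivative_eq_intros simp: inner_commute)
    from has_derivative_compose [OF this bounded_linear_imp_has_derivative [OF bounded_linear_of_real]]
    show ?thesis by (rule has_derivative_eq_rhs) (auto simp: fun_eq_iff)
  qed
  then show ?case
    by (intro exI [of _ "\<lambda>h x. -2 * (of_real (x \<bullet> h) * of_real (exp (- (x \<bullet> x))))"] conjI allI
        gauss_polys.cmult gauss_polys.times gauss_polys.gauss)
next
  case (times f b)
  then obtain D where D: "\<And>x. (f has_derivative (\<lambda>h. D h x)) (at x)" "\<And>h. D h \<in> gauss_polys" by blast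
  have l: "((\<lambda>x. complex_of_real (x \<bullet> b)) has_derivative (\<lambda>h. of_real (h \<bullet> b))) (at x)" for x
    by (rule bounded_linear_imp_has_derivative [OF bounded_linear_compose [OF bounded_linear_of_real bounded_linear_inner_left]])
  show ?case
    by (intro exI [of _ "\<lambda>h x. of_real (x \<bullet> b) * D h x + of_real (h \<bullet> b) * f x"] conjI allI has_derivative_mult l D)
       (auto intro!: gauss_polys.intros D times)
next
  case (cmult f c)
  then obtain D where D: "\<And>x. (f has_derivative (\<lambda>h. D h x)) (at x)" "\<And>h. D h \<in> gauss_polys" by blast
  show ?case
    by (intro exI [of _ "\<lambda>h x. c * D h x"] conjI allI has_derivative_mult_right D gauss_polys.intros)
next
  case (add f g)
  then obtain D E where D: "\<And>x. (f has_derivative (\<lambda>h. D h x)) (at x)" "\<And>h. D h \<in> gauss_polys"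
    and E: "\<And>x. (g has_derivative (\<lambda>h. E h x)) (at x)" "\<And>h. E h \<in> gauss_polys" by blast
  show ?case
    by (intro exI [of _ "\<lambda>h x. D h x + E h x"] conjI allI has_derivative_add D E gauss_polys.intros)
qed

lemma gauss_polys_partial: "f \<in> gauss_polys \<Longrightarrow> partial_deriv b f \<in> gauss_polys"
proof -
  assume "f \<in> gauss_polys"
  then obtain D where D: "\<And>x. (f has_derivative (\<lambda>h. D h x)) (at x)" "\<And>h. D h \<in> gauss_polys"
    using gauss_polys_derivative by blast
  have "partial_deriv b f = D b" using partial_derivI [OF D(1)] by blast
  with D(2) show ?thesis by simp
qed

lemma gauss_polys_smooth: "f \<in> gauss_polys \<Longrightarrow> f \<in> smooth_space"
proof (rule smooth_space_coinduct [of f gauss_polys])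
  show "g differentiable (at x)" if "g \<in> gauss_polys" for g :: "'a \<Rightarrow> complex" and x
    using gauss_polys_derivative [OF that] unfolding differentiable_def by blast
qed (auto intro: gauss_polys_partial)

text \<open>A single term of the exponential series gives
  \<open>(1 + r) ^ N \<le> fact N * exp (1 + r)\<close>, and \<open>1 + r - r\<^sup>2\<close> is at
  most 2, by completing the square.\<close>

lemma gauss_decay: "\<exists>C. \<forall>r\<ge>0. (1 + r) ^ N * exp (- (r\<^sup>2)) \<le> (C :: real)"
proof -
  have "(1 + r) ^ N * exp (- (r\<^sup>2)) \<le> fact N * exp 2" if r: "0 \<le> r" for r :: real
  proof -
    have "(1 + r) ^ N / fact N \<le> exp (1 + r)"
    proof -
      have "(\<Sum>n\<in>{N}. (1 + r) ^ n / fact n) \<le> (\<Sum>n. (1 + r) ^ n / fact n)"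
        using r summable_exp [of "1 + r"] by (intro sum_le_suminf) (auto simp: divide_inverse mult.commute)
      then show ?thesis using exp_converges [of "1 + r"] by (simp add: sums_iff divide_inverse mult.commute)
    qed
    then have "(1 + r) ^ N \<le> fact N * exp (1 + r)" by (simp add: divide_le_eq mult.commute)
    then have "(1 + r) ^ N * exp (- (r\<^sup>2)) \<le> fact N * exp (1 + r) * exp (- (r\<^sup>2))" by (rule mult_right_mono) simp
    also have "\<dots> = fact N * exp (1 + r - r\<^sup>2)" by (simp add: exp_add exp_diff exp_minus field_simps)
    also have "\<dots> \<le> fact N * exp 2"
    proof -
      have "0 \<le> (r - 1 / 2)\<^sup>2" by simp
      then have "1 + r - r\<^sup>2 \<le> 2" by (simp add: power2_eq_square algebra_simps)
      then show ?thesis by simp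
    qed
    finally show ?thesis .
  qed
  then show ?thesis by blast
qed

lemma gauss_polys_decay: "f \<in> gauss_polys \<Longrightarrow> \<exists>C. \<forall>x. (1 + norm x) ^ N * cmod (f x) \<le> C"
proof (induction arbitrary: N rule: gauss_polys.induct)
  case gauss
  obtain C :: real where C: "\<forall>r\<ge>0. (1 + r) ^ N * exp (- (r\<^sup>2)) \<le> C"
    using gauss_decay [of N] by (elim exE) (rule that)
  have "(1 + norm x) ^ N * cmod (of_real (exp (- (x \<bullet> x)))) \<le> C" for x :: 'a
    using C [rule_format, OF norm_ge_zero, of x] by (simp only: power2_norm_eq_inner norm_of_real abs_exp_cancel)
  then show ?case by blast
next
  case (times f b)
  obtain C where C: "\<And>x. (1 + norm x) ^ Suc N * cmod (f x) \<le> C" using times.IH by blast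
  have "(1 + norm x) ^ N * cmod (of_real (x \<bullet> b) * f x) \<le> norm b * C" for x
  proof -
    have "\<bar>x \<bullet> b\<bar> \<le> norm x * norm b" by (rule Cauchy_Schwarz_ineq2)
    also have "\<dots> \<le> (1 + norm x) * norm b" by (intro mult_right_mono) auto
    finally have "(1 + norm x) ^ N * (\<bar>x \<bullet> b\<bar> * cmod (f x)) \<le> (1 + norm x) ^ N * (((1 + norm x) * norm b) * cmod (f x))"
      by (intro mult_left_mono mult_right_mono) auto
    also have "\<dots> = norm b * ((1 + norm x) ^ Suc N * cmod (f x))" by (simp add: mult_ac)
    also have "\<dots> \<le> norm b * C" by (intro mult_left_mono C) auto
    finally show ?thesis by (simp add: norm_mult)
  qed
  then show ?case by blast
next
  case (cmult f c)
  obtain C where C: "\<And>x. (1 + norm x) ^ N * cmod (f x) \<le> C" using cmult.IH by blast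
  have "(1 + norm x) ^ N * cmod (c * f x) \<le> cmod c * C" for x
    using mult_left_mono [OF C, of "cmod c" x] by (simp add: norm_mult mult_ac)
  then show ?case by blast
next
  case (add f g)
  obtain C D where C: "\<And>x. (1 + norm x) ^ N * cmod (f x) \<le> C" and D: "\<And>x. (1 + norm x) ^ N * cmod (g x) \<le> D"
    using add.IH by metis
  have "(1 + norm x) ^ N * cmod (f x + g x) \<le> C + D" for x
  proof -
    have "(1 + norm x) ^ N * cmod (f x + g x) \<le> (1 + norm x) ^ N * (cmod (f x) + cmod (g x))"
      by (intro mult_left_mono norm_triangle_ineq) auto
    then show ?thesis using C [of x] D [of x] by (simp add: distrib_left)
  qed
  then show ?case by blast
qed

lemma gauss_polys_partials: "f \<in> gauss_polys \<Longrightarrow> partial_derivs bs f \<in> gauss_polys"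
  by (induction bs) (auto intro: gauss_polys_partial)

definition gaussian :: "'a::euclidean_space \<Rightarrow> real" where
  "gaussian x = exp (- (x \<bullet> x))"

lemma gaussian_schwartz: "(\<lambda>x. complex_of_real (gaussian x)) \<in> schwartz_space"
  unfolding gaussian_def
  by (intro schwartz_spaceI gauss_polys_smooth gauss_polys.gauss gauss_polys_decay gauss_polys_partials)

section \<open>Integrals of Schwartz functions\<close>

lemma integrable_dominated:
  fixes f :: "'t \<Rightarrow> 'b::{banach, second_countable_topology}"
  assumes "integrable M g" "f \<in> borel_measurable M" and le: "\<And>x. norm (f x) \<le> g x"
  shows "integrable M f"
proof (rule Bochner_Integration.integrable_bound [OF assms(1,2)])
  have "norm (f x) \<le> norm (g x)" for x using le [of x] by simp
  then show "AE x in M. norm (f x) \<le> norm (g x)" by simp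
qed

text \<open>The function is cut along the translates of the unit cell. On the cell at
  \<open>n\<close> it is comparable with its value at \<open>n\<close>, so integrability follows
  from \<open>summable_int_points\<close>.\<close>

lemma integrable_weight: "integrable lborel (\<lambda>x :: 'a::euclidean_space. 1 / (1 + norm x) ^ (2 * DIM('a)))"
proof -
  let ?w = "\<lambda>x :: 'a. 1 / (1 + norm x) ^ (2 * DIM('a))"
  let ?f = "\<lambda>n x. indicator unit_cell (x - n) * ?w x"
  have [measurable]: "?w \<in> borel_measurable borel"
    by (intro borel_measurable_continuous_onI continuous_intros) (smt (verit) norm_ge_zero zero_less_power)
  obtain R where R: "\<And>x :: 'a. x \<in> unit_cell \<Longrightarrow> norm x \<le> R" "0 < R"
    using compact_imp_bounded [OF compact_cbox [of "0 :: 'a" One]] unit_cell_subset unfolding bounded_pos by blast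
  let ?C = "(1 + R) ^ (2 * DIM('a))"
  have le: "?w x \<le> ?C * ?w n" if x: "x - n \<in> unit_cell" for x n :: 'a
  proof -
    have "(1 + norm n) ^ (2 * DIM('a)) \<le> (1 + norm (x - n)) ^ (2 * DIM('a)) * (1 + norm x) ^ (2 * DIM('a))"
      using norm_weight_divide [of n "2 * DIM('a)" "x - n"] by simp
    also have "\<dots> \<le> ?C * (1 + norm x) ^ (2 * DIM('a))"
      using R(1) [OF x] by (intro mult_right_mono power_mono) auto
    finally show ?thesis by (simp add: divide_simps add_pos_nonneg zero_less_power)
  qed
  have meas: "measure lborel {x :: 'a. x - n \<in> unit_cell} = 1" "emeasure lborel {x :: 'a. x - n \<in> unit_cell} = 1" for n
  proof -
    have "emeasure lborel {x :: 'a. x - n \<in> unit_cell} = emeasure (distr lborel borel ((+) (- n))) unit_cell"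
      by (subst emeasure_distr) (auto intro!: arg_cong [where f = "emeasure lborel"])
    then show "emeasure lborel {x :: 'a. x - n \<in> unit_cell} = 1" by (simp add: lborel_distr_plus emeasure_unit_cell)
    then show "measure lborel {x :: 'a. x - n \<in> unit_cell} = 1" by (simp add: measure_def)
  qed
  have ind: "integrable lborel (\<lambda>x. indicator unit_cell (x - n) :: real)"
    "(\<integral>x. (indicator unit_cell (x - n) :: real) \<partial>lborel) = 1" for n :: 'a
  proof -
    have eq: "(\<lambda>x. indicator unit_cell (x - n) :: real) = indicator {x. x - n \<in> unit_cell}" by (auto simp: indicator_def)
    have s: "{x. x - n \<in> unit_cell} \<in> sets lborel" by measurable
    show "integrable lborel (\<lambda>x. indicator unit_cell (x - n) :: real)"
      unfolding eq using s meas(2) [of n] by (intro integrable_real_indicator) auto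
    show "(\<integral>x. (indicator unit_cell (x - n) :: real) \<partial>lborel) = 1"
      unfolding eq using s meas(1) [of n] by simp
  qed
  have ile: "norm (?f n x) \<le> ?C * ?w n * indicator unit_cell (x - n)" for n x :: 'a
    using le [of x n] by (auto simp: indicator_def)
  have int: "integrable lborel (?f n)" for n
  proof (rule integrable_dominated [OF _ _ ile])
    show "integrable lborel (\<lambda>x. ?C * ?w n * indicator unit_cell (x - n))" by (intro integrable_mult_right ind)
  qed measurable
  have "integrable lborel (\<lambda>x. \<Sum>\<^sub>\<infinity>n\<in>int_points. ?f n x)"
  proof (rule integrable_infsum [OF countable_int_points int])
    show "(\<lambda>n. norm (?f n x)) summable_on int_points" for x :: 'a
      using summable_on_cmult_left [of _ int_points "?w x"] has_sum_cell_indicator [of x]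
      by (auto simp: abs_mult intro!: summable_on_cmult_left dest: has_sum_imp_summable)
    show "(\<lambda>n. \<integral>x. norm (?f n x) \<partial>lborel) summable_on (int_points :: 'a set)"
    proof (rule summable_on_comparison_test)
      show "(\<lambda>n. ?C * ?w n) summable_on int_points" by (rule summable_on_cmult_right [OF summable_int_points])
      show "(\<integral>x. norm (?f n x) \<partial>lborel) \<le> ?C * ?w n" for n
      proof -
        have "(\<integral>x. norm (?f n x) \<partial>lborel) \<le> (\<integral>x. ?C * ?w n * indicator unit_cell (x - n) \<partial>lborel)"
          by (rule integral_mono) (use int ind(1) ile in auto)
        also have "\<dots> = ?C * ?w n" using ind [of n] by simp
        finally show ?thesis .
      qed
    qed simp
  qed
  moreover have "(\<Sum>\<^sub>\<infinity>n\<in>int_points. ?f n x) = ?w x" for x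
    using has_sum_cmult_left [OF has_sum_cell_indicator [of x], of "?w x"] by (auto dest: infsumI)
  ultimately show ?thesis by simp
qed

lemma integrable_decay:
  fixes f :: "'a::euclidean_space \<Rightarrow> complex"
  assumes "f \<in> borel_measurable borel" and le: "\<And>x. (1 + norm x) ^ (2 * DIM('a)) * cmod (f x) \<le> C"
  shows "integrable lborel f"
proof (rule integrable_dominated)
  show "integrable lborel (\<lambda>x :: 'a. C * (1 / (1 + norm x) ^ (2 * DIM('a))))"
    by (intro integrable_mult_right integrable_weight)
  show "cmod (f x) \<le> C * (1 / (1 + norm x) ^ (2 * DIM('a)))" for x
  proof -
    have "0 < (1 + norm x) ^ (2 * DIM('a))" by (simp add: add_pos_nonneg)
    then show ?thesis using le [of x] by (simp add: pos_le_divide_eq mult.commute)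
  qed
qed (use assms in simp)

lemma schwartz_measurable: "f \<in> schwartz_space \<Longrightarrow> f \<in> borel_measurable borel"
  by (intro borel_measurable_continuous_onI smooth_continuous schwartz_smooth)

lemma schwartz_integrable:
  fixes f :: "'a::euclidean_space \<Rightarrow> complex"
  assumes f: "f \<in> schwartz_space"
  shows "integrable lborel f"
  by (rule integrable_decay [OF schwartz_measurable [OF f]])
     (use schwartz_seminorm_upper [OF f lists.Nil] in simp)

text \<open>An injective linear map is bounded below, so decay in \<open>L t\<close> is decay in
  \<open>t\<close>. The weight is that of the source dimension.\<close>

lemma integrable_schwartz_linear:
  fixes f :: "'a::euclidean_space \<Rightarrow> complex"
  assumes f: "f \<in> schwartz_space" and L: "linear L" "inj L"
  shows "integrable lborel (\<lambda>t :: 'b::euclidean_space. f (L t))"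
proof -
  obtain c where c: "0 < c" "\<And>x. c * norm x \<le> norm (L x)" using linear_inj_bounded_below_pos [OF L] by blast
  define c' where "c' = min 1 c"
  have c': "0 < c'" using c by (simp add: c'_def)
  let ?d = "2 * DIM('b)"
  have cont: "continuous_on UNIV L" using L(1) by (simp add: linear_continuous_on linear_conv_bounded_linear)
  have "continuous_on UNIV (\<lambda>t. f (L t))"
    by (intro continuous_on_compose2 [OF smooth_continuous [OF schwartz_smooth [OF f], of UNIV] cont]) auto
  then have m: "(\<lambda>t. f (L t)) \<in> borel_measurable borel" by (rule borel_measurable_continuous_onI)
  have "(1 + norm t) ^ ?d * cmod (f (L t)) \<le> (1 / c') ^ ?d * schwartz_seminorm ?d [] f" for t
  proof -
    have "c' * (1 + norm t) \<le> 1 + norm (L t)"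
      using c(2) [of t] mult_right_mono [of c' c "norm t"] by (simp add: c'_def algebra_simps)
    then have "1 + norm t \<le> (1 / c') * (1 + norm (L t))" using c' by (simp add: field_simps)
    then have "(1 + norm t) ^ ?d \<le> (1 / c') ^ ?d * (1 + norm (L t)) ^ ?d"
      unfolding power_mult_distrib [symmetric] by (intro power_mono) auto
    then have "(1 + norm t) ^ ?d * cmod (f (L t)) \<le> (1 / c') ^ ?d * (1 + norm (L t)) ^ ?d * cmod (f (L t))"
      by (rule mult_right_mono) simp
    also have "\<dots> \<le> (1 / c') ^ ?d * schwartz_seminorm ?d [] f"
      unfolding mult.assoc using schwartz_seminorm_upper [OF f lists.Nil, of "L t" ?d] c' by (intro mult_left_mono) auto
    finally show ?thesis .
  qed
  then show ?thesis by (rule integrable_decay [OF m])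
qed

text \<open>If the integral were 0, a strictly positive function would vanish almost everywhere,
  although Lebesgue measure is not zero.\<close>

lemma gaussian_integral_nonzero:
  fixes L :: "'b::euclidean_space \<Rightarrow> 'a::euclidean_space"
  assumes L: "linear L" "inj L"
  shows "0 < (\<integral>t. gaussian (L t) \<partial>lborel)"
proof -
  have "integrable lborel (\<lambda>t. complex_of_real (gaussian (L t)))"
    by (rule integrable_schwartz_linear [OF gaussian_schwartz L])
  from integrable_Re [OF this] have int: "integrable lborel (\<lambda>t. gaussian (L t))" by simp
  have nn: "0 \<le> (\<integral>t. gaussian (L t) \<partial>lborel)" by (rule Bochner_Integration.integral_nonneg) (simp add: gaussian_def)
  have "(\<integral>t. gaussian (L t) \<partial>lborel) \<noteq> 0"
  proof
    assume "(\<integral>t. gaussian (L t) \<partial>lborel) = 0"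
    then have "AE t in lborel. gaussian (L t) = 0"
      using integral_nonneg_eq_0_iff_AE [OF int] by (simp add: gaussian_def)
    then have "AE t in (lborel :: 'b measure). False" by (simp add: gaussian_def)
    then show False by (simp add: AE_iff_null null_sets_def emeasure_lborel_UNIV)
  qed
  with nn show ?thesis by simp
qed

text \<open>The measure \<open>g \<mapsto> \<integral> g (L t) dt\<close> is a multiple of Lebesgue measure: the double integral of
  \<open>g (\<xi> + L t)\<close> times a Gaussian in \<open>L t\<close> can be evaluated in both orders.\<close>

lemma linear_change_of_variables:
  fixes L :: "'a::euclidean_space \<Rightarrow> 'a"
  assumes L: "linear L" "inj L"
  shows "\<exists>c>0. \<forall>g\<in>schwartz_space. (\<integral>x. g x \<partial>lborel) = of_real c * (\<integral>t. g (L t) \<partial>lborel)"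
proof -
  let ?G = "\<lambda>x :: 'a. complex_of_real (gaussian x)"
  have surj: "surj L" by (rule linear_inj_imp_surj [OF L])
  define I where "I = (\<integral>x. gaussian (x :: 'a) \<partial>lborel)"
  define J where "J = (\<integral>t. gaussian (L t) \<partial>lborel)"
  have I: "0 < I" unfolding I_def using gaussian_integral_nonzero [of "\<lambda>x::'a. x"] by (simp add: linear_id [unfolded id_def])
  have J: "0 < J" unfolding J_def by (rule gaussian_integral_nonzero [OF L])
  have contL: "continuous_on S L" for S using L(1) by (simp add: linear_continuous_on linear_conv_bounded_linear)
  have [measurable]: "L \<in> borel_measurable borel" by (rule borel_measurable_continuous_onI [OF contL])
  have [measurable]: "gaussian \<in> borel_measurable (borel :: 'a measure)"
    unfolding gaussian_def by (intro borel_measurable_continuous_onI continuous_intros)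
  have "(\<integral>x. g x \<partial>lborel) = of_real (I / J) * (\<integral>t. g (L t) \<partial>lborel)" if g: "g \<in> schwartz_space" for g
  proof -
    have [measurable]: "g \<in> borel_measurable borel" by (rule schwartz_measurable [OF g])
    have ig: "integrable lborel g" by (rule schwartz_integrable [OF g])
    have iG: "integrable lborel (\<lambda>t. ?G (L t))" by (rule integrable_schwartz_linear [OF gaussian_schwartz L])
    let ?H = "\<lambda>\<xi> t. g (\<xi> + L t) * ?G (L t)"
    have tr: "(\<integral>\<xi>. ?H \<xi> t \<partial>lborel) = (\<integral>\<xi>. g \<xi> \<partial>lborel) * ?G (L t)" for t
      using integral_translate [of g "L t"] by simp
    have trn: "(\<integral>\<xi>. norm (?H \<xi> t) \<partial>lborel) = (\<integral>\<xi>. norm (g \<xi>) \<partial>lborel) * norm (?G (L t))" for t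
      using integral_translate [of "\<lambda>x. norm (g x)" "L t"] by (simp add: norm_mult)
    have prod: "integrable (lborel \<Otimes>\<^sub>M lborel) (\<lambda>(t, \<xi>). ?H \<xi> t)"
    proof (rule lborel_pair.Fubini_integrable)
      show "(\<lambda>(t, \<xi>). ?H \<xi> t) \<in> borel_measurable (lborel \<Otimes>\<^sub>M lborel)" by measurable
      show "integrable lborel (\<lambda>t. \<integral>\<xi>. norm (case (t, \<xi>) of (t, \<xi>) \<Rightarrow> ?H \<xi> t) \<partial>lborel)"
        unfolding prod.case trn by (intro integrable_mult_right integrable_norm iG)
      show "AE t in lborel. integrable lborel (\<lambda>\<xi>. case (t, \<xi>) of (t, \<xi>) \<Rightarrow> ?H \<xi> t)"
        unfolding prod.case by (intro AE_I2 integrable_mult_left impI integrable_translate ig)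
    qed
    \<comment> \<open>Since \<open>L\<close> is onto, the shift by \<xi> is a translation of
      \<open>t\<close>. It frees \<open>g\<close> from \<xi>, and the \<xi>-integral then sees only
      the Gaussian and yields the constant \<open>I\<close>.\<close>
    have inner: "(\<integral>t. ?H \<xi> t \<partial>lborel) = (\<integral>t. g (L t) * ?G (L t - \<xi>) \<partial>lborel)" for \<xi>
    proof -
      obtain s where s: "\<xi> = L s" using surj by blast
      have "(\<integral>t. ?H \<xi> t \<partial>lborel) = (\<integral>t. g (L (t + s)) * ?G (L (t + s) - \<xi>) \<partial>lborel)"
        by (simp add: s linear_add [OF L(1)] add.commute)
      also have "\<dots> = (\<integral>t. g (L t) * ?G (L t - \<xi>) \<partial>lborel)" by (rule integral_translate) measurable
      finally show ?thesis .
    qed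
    have Gsym: "(\<integral>\<xi>. gaussian (y - \<xi>) \<partial>lborel) = I" for y :: 'a
    proof -
      have "(\<integral>\<xi>. gaussian (y - \<xi>) \<partial>lborel) = (\<integral>\<xi>. gaussian (\<xi> + (- y)) \<partial>lborel)"
        by (rule Bochner_Integration.integral_cong) (auto simp: gaussian_def inner_diff_left inner_diff_right inner_commute)
      also have "\<dots> = I" unfolding I_def by (rule integral_translate [of gaussian]) measurable
      finally show ?thesis .
    qed
    let ?H' = "\<lambda>\<xi> t. g (L t) * ?G (L t - \<xi>)"
    have igL: "integrable lborel (\<lambda>t. g (L t))" by (rule integrable_schwartz_linear [OF g L])
    have Gn: "(\<integral>\<xi>. norm (?G (y - \<xi>)) \<partial>lborel) = I" for y
      using Gsym [of y] by (simp add: gaussian_def)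
    have prod': "integrable (lborel \<Otimes>\<^sub>M lborel) (\<lambda>(t, \<xi>). ?H' \<xi> t)"
    proof (rule lborel_pair.Fubini_integrable)
      show "(\<lambda>(t, \<xi>). ?H' \<xi> t) \<in> borel_measurable (lborel \<Otimes>\<^sub>M lborel)" by measurable
      have "(\<integral>\<xi>. norm (?H' \<xi> t) \<partial>lborel) = norm (g (L t)) * I" for t
        using Gn [of "L t"] by (simp add: norm_mult)
      then show "integrable lborel (\<lambda>t. \<integral>\<xi>. norm (case (t, \<xi>) of (t, \<xi>) \<Rightarrow> ?H' \<xi> t) \<partial>lborel)"
        using igL by simp
      have "integrable lborel (\<lambda>\<xi>. ?G (y - \<xi>))" for y :: 'a
      proof -
        have "(\<lambda>\<xi>. ?G (y - \<xi>)) = (\<lambda>\<xi>. ?G (\<xi> + (- y)))"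
          by (auto simp: gaussian_def inner_diff_left inner_diff_right inner_commute)
        then show ?thesis using integrable_translate [OF schwartz_integrable [OF gaussian_schwartz], of "- y"] by simp
      qed
      then show "AE t in lborel. integrable lborel (\<lambda>\<xi>. case (t, \<xi>) of (t, \<xi>) \<Rightarrow> ?H' \<xi> t)"
        unfolding prod.case by (intro AE_I2 integrable_mult_right impI)
    qed
    have "(\<integral>x. g x \<partial>lborel) * of_real J = (\<integral>t. (\<integral>\<xi>. ?H \<xi> t \<partial>lborel) \<partial>lborel)"
      unfolding tr J_def by simp
    also have "\<dots> = (\<integral>\<xi>. (\<integral>t. ?H \<xi> t \<partial>lborel) \<partial>lborel)"
      using lborel_pair.Fubini_integral [OF prod] by simp
    also have "\<dots> = (\<integral>\<xi>. (\<integral>t. ?H' \<xi> t \<partial>lborel) \<partial>lborel)" unfolding inner ..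
    also have "\<dots> = (\<integral>t. (\<integral>\<xi>. ?H' \<xi> t \<partial>lborel) \<partial>lborel)"
      using lborel_pair.Fubini_integral [OF prod'] by simp
    also have "\<dots> = (\<integral>t. g (L t) \<partial>lborel) * of_real I" by (simp add: Gsym)
    finally show ?thesis using J by (simp add: field_simps)
  qed
  then show ?thesis using I J by (intro exI [of _ "I / J"]) auto
qed

section \<open>Projection onto quasi-periodic objects\<close>

lemma gaussian_minus: "gaussian (- x) = gaussian x"
  by (simp add: gaussian_def)

context lattice_basis
begin

lemma phase_lattice_uminus: "l \<in> phase_lattice \<Longrightarrow> - l \<in> phase_lattice"
  by (auto simp: lattice_uminus dual_lattice_uminus)

lemma phase_lattice_add: "l \<in> phase_lattice \<Longrightarrow> m \<in> phase_lattice \<Longrightarrow> l + m \<in> phase_lattice"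
  by (auto simp: lattice_add dual_lattice_add)

lemma phase_lattice_diff: "l \<in> phase_lattice \<Longrightarrow> m \<in> phase_lattice \<Longrightarrow> l - m \<in> phase_lattice"
  using phase_lattice_add [of l "- m"] phase_lattice_uminus [of m] by simp

lemma infsum_phase_shift:
  assumes "l0 \<in> phase_lattice"
  shows "(\<Sum>\<^sub>\<infinity>l\<in>phase_lattice. h (l + l0)) = (\<Sum>\<^sub>\<infinity>l\<in>phase_lattice. h l)"
  by (rule infsum_reindex_bij_betw, rule bij_betwI [where g = "\<lambda>l. l - l0"])
     (use assms phase_lattice_add phase_lattice_diff in \<open>auto simp del: mem_Times_iff\<close>)

lemma infsum_phase_uminus: "(\<Sum>\<^sub>\<infinity>l\<in>phase_lattice. h (- l)) = (\<Sum>\<^sub>\<infinity>l\<in>phase_lattice. h l)"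
  by (rule infsum_reindex_bij_betw, rule bij_betwI [where g = uminus])
     (use phase_lattice_uminus in \<open>auto simp del: mem_Times_iff\<close>)

definition theta_mass :: real where
  "theta_mass = (\<integral>t. gaussian (lin2 t) \<partial>lborel)"

lemma theta_mass_pos: "0 < theta_mass"
  unfolding theta_mass_def by (rule gaussian_integral_nonzero [OF linear_lin2 inj_lin2])

text \<open>A normalized Gaussian averaged over one phase cell, that is, its convolution with the
  uniform distribution on the cell. The averages over all translates of the cell add up to the full
  integral.\<close>

definition theta :: "(real^'d) \<times> (real^'d) \<Rightarrow> complex" where
  "theta z = of_real (1 / theta_mass) * (\<integral>t. complex_of_real (gaussian (z - lin2 t)) \<partial>cell_measure)"

lemma continuous_lin2: "continuous_on S lin2"
  using linear_lin2 by (simp add: linear_continuous_on linear_conv_bounded_linear)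

text \<open>The average runs over translates by a bounded set of vectors, so by Peetre's inequality
  each weighted derivative loses at most the factor \<open>(1 + R) ^ N\<close>.\<close>

lemma theta_schwartz: "theta \<in> schwartz_space"
proof -
  let ?G = "\<lambda>z :: (real^'d) \<times> (real^'d). complex_of_real (gaussian z)"
  note G = gaussian_schwartz [where 'a = "(real^'d) \<times> (real^'d)"]
  let ?g = "\<lambda>t z. ?G (z + (- lin2 t))"
  have pd: "partial_derivs bs (?g t) = (\<lambda>z. partial_derivs bs ?G (z + (- lin2 t)))" if "bs \<in> lists Basis" for bs t
    by (rule partial_derivs_translate [OF schwartz_smooth [OF G] that])
  have 1: "?g t \<in> smooth_space" for t by (rule smooth_translate [OF schwartz_smooth [OF G]])
  have 2: "(\<lambda>t. partial_derivs bs (?g t) z) \<in> borel_measurable cell_measure" if bs: "bs \<in> lists Basis" for bs z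
  proof -
    have "continuous_on UNIV (\<lambda>t. partial_derivs bs ?G (z + (- lin2 t)))"
      by (intro continuous_on_compose2 [OF partial_derivs_continuous [OF schwartz_smooth [OF G] bs, of UNIV]]
          continuous_intros continuous_lin2) auto
    then show ?thesis unfolding pd [OF bs] by (intro borel_measurable_cell_measure borel_measurable_continuous_onI)
  qed
  have 3: "\<exists>a. integrable cell_measure a \<and> (\<forall>t\<in>space cell_measure. \<forall>x. norm x \<le> r \<longrightarrow> cmod (partial_derivs bs (?g t) x) \<le> a t)"
    if bs: "bs \<in> lists Basis" for bs r
  proof (intro exI conjI ballI allI impI)
    show "integrable cell_measure (\<lambda>t. schwartz_seminorm 0 bs ?G)" by simp
    show "cmod (partial_derivs bs (?g t) x) \<le> schwartz_seminorm 0 bs ?G" for t x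
      unfolding pd [OF bs] using schwartz_seminorm_upper [OF G bs, of _ 0] by simp
  qed
  note S = smooth_integral [of cell_measure ?g, OF 1 2 3]
  obtain R where R: "\<And>t. t \<in> unit_cell \<Longrightarrow> norm (lin2 t) \<le> R" "0 < R"
  proof -
    have "compact (lin2 ` cbox 0 One)" by (intro compact_continuous_image continuous_lin2 compact_cbox)
    then have "bounded (lin2 ` cbox 0 One)" by (rule compact_imp_bounded)
    then show ?thesis using that unit_cell_subset unfolding bounded_pos by blast
  qed
  have S': "(\<lambda>z. \<integral>t. ?g t z \<partial>cell_measure) \<in> schwartz_space"
  proof (rule schwartz_spaceI [OF S(1)])
    fix bs :: "((real^'d) \<times> (real^'d)) list" and N assume bs: "bs \<in> lists Basis"
    let ?C = "(1 + R) ^ N * schwartz_seminorm N bs ?G"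
    have "(1 + norm z) ^ N * cmod (partial_derivs bs (\<lambda>z. \<integral>t. ?g t z \<partial>cell_measure) z) \<le> ?C" for z
    proof -
      have "cmod (\<integral>t. of_real ((1 + norm z) ^ N) * partial_derivs bs (?g t) z \<partial>cell_measure)
          \<le> (\<integral>t. ?C \<partial>(cell_measure :: ((real^'d) \<times> (real^'d)) measure))"
      proof (rule norm_integral_le)
        fix t :: "(real^'d) \<times> (real^'d)" assume t: "t \<in> space cell_measure"
        have "(1 + norm z) ^ N * cmod (partial_derivs bs ?G (z + (- lin2 t)))
            \<le> ((1 + norm (- lin2 t)) ^ N * (1 + norm (z + (- lin2 t))) ^ N) * cmod (partial_derivs bs ?G (z + (- lin2 t)))"
          by (intro mult_right_mono norm_weight_divide) auto
        also have "\<dots> \<le> ?C"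
          unfolding mult.assoc using t R
          by (intro mult_mono power_mono schwartz_seminorm_upper G bs) auto
        finally show "cmod (of_real ((1 + norm z) ^ N) * partial_derivs bs (?g t) z) \<le> ?C"
          unfolding pd [OF bs] norm_mult norm_of_real by simp
      qed simp
      also have "\<dots> = ?C" by (simp add: measure_def emeasure_cell_measure)
      finally have "cmod (of_real ((1 + norm z) ^ N) * (\<integral>t. partial_derivs bs (?g t) z \<partial>cell_measure)) \<le> ?C"
        by (simp only: integral_mult_right_zero)
      then have "\<bar>(1 + norm z) ^ N\<bar> * cmod (\<integral>t. partial_derivs bs (?g t) z \<partial>cell_measure) \<le> ?C"
        by (simp only: norm_mult norm_of_real)
      moreover have "\<bar>(1 + norm z) ^ N\<bar> = (1 + norm z) ^ N" by simp
      moreover have "partial_derivs bs (\<lambda>z. \<integral>t. ?g t z \<partial>cell_measure) z = (\<integral>t. partial_derivs bs (?g t) z \<partial>cell_measure)"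
        by (rule fun_cong [OF S(2) [OF _ _ bs]])
      ultimately show ?thesis by (simp only:)
    qed
    then show "\<exists>C. \<forall>z. (1 + norm z) ^ N * cmod (partial_derivs bs (\<lambda>z. \<integral>t. ?g t z \<partial>cell_measure) z) \<le> C" by blast
  qed
  have "theta = (\<lambda>z. of_real (1 / theta_mass) * (\<integral>t. ?g t z \<partial>cell_measure))"
    by (simp add: theta_def fun_eq_iff)
  then show ?thesis using schwartz_cmult(1) [OF S', of "of_real (1 / theta_mass)"] by (simp only:)
qed

text \<open>In the coordinates of \<open>lin2\<close> the lattice sum of cell integrals is an
  integral over the whole space. Translation invariance makes it independent of \<open>z\<close>,
  and \<open>theta_mass\<close> normalizes it.\<close>

lemma theta_sum: "(\<Sum>\<^sub>\<infinity>l\<in>phase_lattice. theta (z + l)) = 1"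
proof -
  obtain s where s: "z = lin2 s" using surj_lin2 by blast
  let ?h = "\<lambda>t. complex_of_real (gaussian (lin2 (t + (- s))))"
  have h: "integrable lborel ?h"
    by (rule integrable_translate, rule integrable_schwartz_linear [OF gaussian_schwartz linear_lin2 inj_lin2])
  have "(\<Sum>\<^sub>\<infinity>l\<in>phase_lattice. theta (z + l)) = (\<Sum>\<^sub>\<infinity>l\<in>phase_lattice. theta (z + - l))"
    using infsum_phase_uminus [of "\<lambda>l. theta (z + l)"] by simp
  also have "\<dots> = (\<Sum>\<^sub>\<infinity>n\<in>int_points. theta (z + - lin2 n))"
    unfolding phase_lattice_eq by (subst infsum_reindex) (auto simp: o_def inj_on_def dest: injD [OF inj_lin2])
  also have "\<dots> = (\<Sum>\<^sub>\<infinity>n\<in>int_points. of_real (1 / theta_mass) * (\<integral>t. ?h (t + n) \<partial>cell_measure))"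
  proof (rule infsum_cong)
    fix n
    have "gaussian (z + - lin2 n - lin2 t) = gaussian (lin2 (t + n + (- s)))" for t
    proof -
      have "z + - lin2 n - lin2 t = - lin2 (t + n + (- s))"
        by (simp add: s linear_add [OF linear_lin2] linear_diff [OF linear_lin2] linear_neg [OF linear_lin2])
      then show ?thesis by (simp only: gaussian_minus)
    qed
    then show "theta (z + - lin2 n) = of_real (1 / theta_mass) * (\<integral>t. ?h (t + n) \<partial>cell_measure)"
      by (simp only: theta_def)
  qed
  also have "\<dots> = of_real (1 / theta_mass) * (\<integral>t. ?h t \<partial>lborel)"
    unfolding infsum_cmult_right' tiling(1) [OF h] ..
  also have "(\<integral>t. ?h t \<partial>lborel) = (\<integral>t. complex_of_real (gaussian (lin2 t)) \<partial>lborel)"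
  proof (rule integral_translate)
    have "continuous_on UNIV (\<lambda>t. complex_of_real (gaussian (lin2 t)))"
      unfolding gaussian_def by (intro continuous_intros continuous_lin2)
    then show "(\<lambda>t. complex_of_real (gaussian (lin2 t))) \<in> borel_measurable borel" by (rule borel_measurable_continuous_onI)
  qed
  also have "\<dots> = of_real theta_mass" by (simp add: theta_mass_def)
  finally show ?thesis using theta_mass_pos by simp
qed

end

sublocale lattice_basis \<subseteq> P: twisted_summation "\<lambda>l. (0, - fst l)" "\<lambda>z. (fst z, - snd z)" phase_lattice "2 * DIM((real^'d) \<times> (real^'d))"
proof (rule twisted_summation.intro [OF _ _ summable_phase_lattice])
  show "bounded_linear (\<lambda>z :: (real^'d) \<times> (real^'d). (fst z, - snd z))"
    by (intro bounded_linear_Pair bounded_linear_fst bounded_linear_minus bounded_linear_snd)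
  show "norm (0 :: real^'d, - fst l) \<le> norm l" for l :: "(real^'d) \<times> (real^'d)"
    using norm_fst_le [of "fst l" "snd l"] by (simp add: norm_Pair)
qed

sublocale lattice_basis \<subseteq> W: twisted_summation "\<lambda>l. (0, l)" fst "lattice e" "2 * DIM(real^'d)"
  by (rule twisted_summation.intro [OF bounded_linear_fst _ summable_lattice]) (simp add: norm_Pair)

text \<open>\<open>Q\<close> supplies the bounds for the terms of \<open>lift (adj \<Phi>)\<close>;
  its variant \<open>Q0\<close>, without phases, those for the terms obtained after the lattice
  shifts have been undone.\<close>

sublocale lattice_basis \<subseteq> Q: twisted_summation "\<lambda>l. (0, fst l)" "\<lambda>z. z" phase_lattice "2 * DIM((real^'d) \<times> (real^'d))"
proof (rule twisted_summation.intro [OF bounded_linear_ident _ summable_phase_lattice])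
  show "norm (0 :: real^'d, fst l) \<le> norm l" for l :: "(real^'d) \<times> (real^'d)"
    using norm_fst_le [of "fst l" "snd l"] by (simp add: norm_Pair)
qed

sublocale lattice_basis \<subseteq> Q0: twisted_summation "\<lambda>l. 0" "\<lambda>z. z" phase_lattice "2 * DIM((real^'d) \<times> (real^'d))"
  by (rule twisted_summation.intro [OF bounded_linear_ident _ summable_phase_lattice]) simp

context lattice_basis
begin

text \<open>Folding the integral of \<open>zak e f\<close> times \<open>\<Phi>\<close> onto a phase
  cell produces a lattice sum of \<open>\<Phi>\<close> with the multipliers of the Zak transform.
  That sum has the inverse multipliers; reflecting \<xi> makes it quasi-periodic of order
  \<open>e\<close>.\<close>

definition periodize :: "((real^'d) \<times> (real^'d) \<Rightarrow> complex) \<Rightarrow> (real^'d) \<times> (real^'d) \<Rightarrow> complex" where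
  "periodize = twisted_sum (\<lambda>l. (0, - fst l)) (\<lambda>z. (fst z, - snd z)) phase_lattice"

lemma periodize_apply:
  "periodize \<Phi> (x, \<xi>) = (\<Sum>\<^sub>\<infinity>l\<in>phase_lattice. exp (- (\<i> * of_real (\<xi> \<bullet> fst l))) * \<Phi> ((x, - \<xi>) + l))"
  by (simp add: periodize_def twisted_sum_def exp_twist_def)

lemma exp_dual: "m \<in> lattice e \<Longrightarrow> \<kappa> \<in> dual_lattice e \<Longrightarrow> exp (\<i> * of_real (\<kappa> \<bullet> m)) = 1"
  using lattice_inner_dual [of m \<kappa>] by (simp add: inner_commute)

lemma periodize_smooth_Z:
  assumes \<Phi>: "\<Phi> \<in> schwartz_space"
  shows "periodize \<Phi> \<in> smooth_Z e"
proof -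
  have "quasi_periodic e (periodize \<Phi>)"
    unfolding quasi_periodic_def
  proof (intro ballI allI conjI)
    fix k \<kappa> x \<xi> assume k: "k \<in> lattice e" and \<kappa>: "\<kappa> \<in> dual_lattice e"
    have k': "(k, 0) \<in> phase_lattice" using k dual_lattice_zero by simp
    have \<kappa>': "(0, \<kappa>) \<in> phase_lattice" using \<kappa> lattice_zero by simp
    have "exp (\<i> * of_real (k \<bullet> \<xi>)) * periodize \<Phi> (x, \<xi>)
        = exp (\<i> * of_real (k \<bullet> \<xi>)) * (\<Sum>\<^sub>\<infinity>l\<in>phase_lattice. exp (- (\<i> * of_real (\<xi> \<bullet> fst (l + (k, 0))))) * \<Phi> ((x, - \<xi>) + (l + (k, 0))))"
      unfolding periodize_apply
      by (subst infsum_phase_shift [OF k', of "\<lambda>l. exp (- (\<i> * of_real (\<xi> \<bullet> fst l))) * \<Phi> ((x, - \<xi>) + l)"]) (rule refl)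
    also have "\<dots> = periodize \<Phi> (x + k, \<xi>)"
      unfolding periodize_apply infsum_cmult_right' [symmetric]
    proof (rule infsum_cong)
      fix l :: "(real^'d) \<times> (real^'d)"
      have "(x, - \<xi>) + (l + (k, 0)) = (x + k, - \<xi>) + l" by (cases l) (simp add: add_ac)
      moreover have "exp (\<i> * of_real (k \<bullet> \<xi>)) * exp (- (\<i> * of_real (\<xi> \<bullet> fst (l + (k, 0))))) = exp (- (\<i> * of_real (\<xi> \<bullet> fst l)))"
        by (simp add: inner_add_right inner_commute exp_add [symmetric] algebra_simps)
      ultimately show "exp (\<i> * of_real (k \<bullet> \<xi>)) * (exp (- (\<i> * of_real (\<xi> \<bullet> fst (l + (k, 0))))) * \<Phi> ((x, - \<xi>) + (l + (k, 0))))
          = exp (- (\<i> * of_real (\<xi> \<bullet> fst l))) * \<Phi> ((x + k, - \<xi>) + l)"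
        by (simp only: mult.assoc [symmetric])
    qed
    finally show "periodize \<Phi> (x + k, \<xi>) = exp (\<i> * of_real (k \<bullet> \<xi>)) * periodize \<Phi> (x, \<xi>)" by simp
    have "periodize \<Phi> (x, \<xi> + \<kappa>) = (\<Sum>\<^sub>\<infinity>l\<in>phase_lattice. exp (- (\<i> * of_real ((\<xi> + \<kappa>) \<bullet> fst (l + (0, \<kappa>))))) * \<Phi> ((x, - (\<xi> + \<kappa>)) + (l + (0, \<kappa>))))"
      unfolding periodize_apply
      by (subst infsum_phase_shift [OF \<kappa>', of "\<lambda>l. exp (- (\<i> * of_real ((\<xi> + \<kappa>) \<bullet> fst l))) * \<Phi> ((x, - (\<xi> + \<kappa>)) + l)"]) (rule refl)
    also have "\<dots> = periodize \<Phi> (x, \<xi>)"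
      unfolding periodize_apply
    proof (rule infsum_cong)
      fix l assume l: "l \<in> phase_lattice"
      have "(x, - (\<xi> + \<kappa>)) + (l + (0, \<kappa>)) = (x, - \<xi>) + l" by (cases l) simp
      moreover have "exp (- (\<i> * of_real ((\<xi> + \<kappa>) \<bullet> fst (l + (0, \<kappa>))))) = exp (- (\<i> * of_real (\<xi> \<bullet> fst l)))"
        using exp_dual [OF _ \<kappa>, of "fst l"] l by (auto simp: inner_add_left distrib_left exp_add exp_minus exp_diff field_simps)
      ultimately show "exp (- (\<i> * of_real ((\<xi> + \<kappa>) \<bullet> fst (l + (0, \<kappa>))))) * \<Phi> ((x, - (\<xi> + \<kappa>)) + (l + (0, \<kappa>)))
          = exp (- (\<i> * of_real (\<xi> \<bullet> fst l))) * \<Phi> ((x, - \<xi>) + l)" by (simp only:)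
    qed
    finally show "periodize \<Phi> (x, \<xi> + \<kappa>) = periodize \<Phi> (x, \<xi>)" .
  qed
  then show ?thesis using P.twisted_sum_smooth [OF \<Phi>] by (simp add: smooth_Z_def periodize_def)
qed

definition adj :: "((real^'d) \<times> (real^'d) \<Rightarrow> complex) \<Rightarrow> real^'d \<Rightarrow> complex" where
  "adj \<Phi> = inv_zak (periodize \<Phi>)"

lemma periodize_bound:
  "\<exists>K\<ge>0. \<exists>m M. \<forall>\<Phi>\<in>schwartz_space. \<forall>z. \<forall>bs\<in>lists Basis. length bs \<le> n \<longrightarrow>
    cmod (partial_derivs bs (periodize \<Phi>) z) \<le> K * schwartz_norm M \<Phi> * (1 + norm z) ^ m"
  unfolding periodize_def by (rule P.twisted_sum_bound)

lemma adj_operator: "schwartz_operator adj"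
proof (rule schwartz_operatorI)
  show "adj f \<in> schwartz_space" if "f \<in> schwartz_space" for f
    unfolding adj_def by (rule inv_zak_schwartz [OF periodize_smooth_Z [OF that]])
  show "adj (\<lambda>z. f z + g z) = (\<lambda>x. adj f x + adj g x)" if "f \<in> schwartz_space" "g \<in> schwartz_space" for f g
  proof -
    have int: "integrable cell_measure (\<lambda>t. periodize h (x, dlin t))" if "h \<in> schwartz_space" for h x
      using periodize_smooth_Z [OF that] by (intro integrable_section') (simp add: smooth_Z_def)
    show ?thesis
      unfolding adj_def inv_zak_def periodize_def P.twisted_sum_add [OF that]
      unfolding periodize_def [symmetric] by (intro ext Bochner_Integration.integral_add int that)
  qed
  show "adj (\<lambda>z. c * f z) = (\<lambda>x. c * adj f x)" for c f
    unfolding adj_def inv_zak_def periodize_def P.twisted_sum_cmult by simp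
  fix M
  obtain C where C: "0 \<le> C" "\<And>F. F \<in> smooth_Z e \<Longrightarrow> schwartz_norm M (inv_zak F) \<le> C * smooth_norm (M + M) F"
    using inv_zak_norm_bound [of M] by blast
  obtain K m M' where K: "0 \<le> K" and K': "\<forall>\<Phi>\<in>schwartz_space. \<forall>z. \<forall>bs\<in>lists Basis. length bs \<le> M + M \<longrightarrow>
    cmod (partial_derivs bs (periodize \<Phi>) z) \<le> K * schwartz_norm M' \<Phi> * (1 + norm z) ^ m"
    using periodize_bound [of "M + M"] by (elim exE conjE) (rule that)
  obtain R where R: "\<And>z. z \<in> phase_cell \<Longrightarrow> norm z \<le> R" "0 < R"
    using compact_imp_bounded [OF compact_phase_cell] unfolding bounded_pos by blast
  define D where "D = C * (real (card (phase_indices (M + M))) * (K * (1 + R) ^ m))"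
  have "schwartz_norm M (adj \<Phi>) \<le> D * schwartz_norm M' \<Phi>" if \<Phi>: "\<Phi> \<in> schwartz_space" for \<Phi>
  proof -
    have "schwartz_norm M (adj \<Phi>) \<le> C * smooth_norm (M + M) (periodize \<Phi>)"
      unfolding adj_def by (rule C(2) [OF periodize_smooth_Z [OF \<Phi>]])
    also have "\<dots> \<le> C * (real (card (phase_indices (M + M))) * (K * schwartz_norm M' \<Phi> * (1 + R) ^ m))"
    proof (intro mult_left_mono smooth_norm_least C(1))
      fix bs z assume bs: "bs \<in> lists (Basis :: ((real^'d) \<times> (real^'d)) set)" "length bs \<le> M + M" and z: "z \<in> phase_cell"
      have "cmod (partial_derivs bs (periodize \<Phi>) z) \<le> K * schwartz_norm M' \<Phi> * (1 + norm z) ^ m"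
        by (rule K' [rule_format, OF \<Phi> bs])
      also have "\<dots> \<le> K * schwartz_norm M' \<Phi> * (1 + R) ^ m"
        using R z K by (intro mult_left_mono power_mono mult_nonneg_nonneg schwartz_norm_nonneg \<Phi>) auto
      finally show "cmod (partial_derivs bs (periodize \<Phi>) z) \<le> K * schwartz_norm M' \<Phi> * (1 + R) ^ m" .
    qed
    finally show ?thesis by (simp add: D_def mult_ac)
  qed
  moreover have "0 \<le> D" using C(1) K R(2) by (simp add: D_def)
  ultimately show "\<exists>M' D. 0 \<le> D \<and> (\<forall>\<Phi>\<in>schwartz_space. schwartz_norm M (adj \<Phi>) \<le> D * schwartz_norm M' \<Phi>)" by blast
qed

text \<open>The Zak transform at \<open>(x, - \<xi>)\<close>, which for real \<open>f\<close> is the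
  complex conjugate. Its multipliers are inverse to those of \<open>zak e f\<close>, so the product
  of the two is periodic.\<close>

definition zak_conj :: "(real^'d \<Rightarrow> complex) \<Rightarrow> (real^'d) \<times> (real^'d) \<Rightarrow> complex" where
  "zak_conj = twisted_sum (\<lambda>l. (0, l)) fst (lattice e)"

lemma zak_conj_bound:
  "\<exists>K\<ge>0. \<exists>m M. \<forall>\<Phi>\<in>schwartz_space. \<forall>z. \<forall>bs\<in>lists Basis. length bs \<le> n \<longrightarrow>
    cmod (partial_derivs bs (zak_conj \<Phi>) z) \<le> K * schwartz_norm M \<Phi> * (1 + norm z) ^ m"
  unfolding zak_conj_def by (rule W.twisted_sum_bound)

lemma zak_conj_apply: "zak_conj f (x, \<xi>) = zak e f (x, - \<xi>)"
  by (simp add: zak_conj_def zak_eq twisted_sum_def exp_twist_def)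

definition lift :: "(real^'d \<Rightarrow> complex) \<Rightarrow> (real^'d) \<times> (real^'d) \<Rightarrow> complex" where
  "lift f = (\<lambda>z. theta z * zak_conj f z)"

lemma lift_operator: "schwartz_operator lift"
proof (rule schwartz_operatorI)
  have sm: "zak_conj f \<in> smooth_space" if "f \<in> schwartz_space" for f
    unfolding zak_conj_def by (rule W.twisted_sum_smooth [OF that])
  show "lift f \<in> schwartz_space" if f: "f \<in> schwartz_space" for f
    unfolding lift_def
  proof (rule schwartz_mult [OF theta_schwartz sm [OF f]])
    fix M
    obtain K m M' where "\<forall>\<Phi>\<in>schwartz_space. \<forall>z. \<forall>bs\<in>lists Basis. length bs \<le> M \<longrightarrow>
      cmod (partial_derivs bs (zak_conj \<Phi>) z) \<le> K * schwartz_norm M' \<Phi> * (1 + norm z) ^ m"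
      using zak_conj_bound [of M] by (elim exE conjE) (rule that)
    with f show "\<exists>A m. \<forall>z. \<forall>c\<in>lists Basis. length c \<le> M \<longrightarrow> cmod (partial_derivs c (zak_conj f) z) \<le> A * (1 + norm z) ^ m"
      by (intro exI [of _ "K * schwartz_norm M' f"] exI [of _ m]) simp
  qed
  show "lift (\<lambda>z. f z + g z) = (\<lambda>x. lift f x + lift g x)" if "f \<in> schwartz_space" "g \<in> schwartz_space" for f g
    unfolding lift_def zak_conj_def W.twisted_sum_add [OF that] by (simp add: distrib_left)
  show "lift (\<lambda>z. c * f z) = (\<lambda>x. c * lift f x)" for c f
    unfolding lift_def zak_conj_def W.twisted_sum_cmult by (simp add: mult_ac)
  fix M
  obtain K m M' where K: "0 \<le> K" and K': "\<forall>\<Phi>\<in>schwartz_space. \<forall>z. \<forall>bs\<in>lists Basis. length bs \<le> M \<longrightarrow>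
    cmod (partial_derivs bs (zak_conj \<Phi>) z) \<le> K * schwartz_norm M' \<Phi> * (1 + norm z) ^ m"
    using zak_conj_bound [of M] by (elim exE conjE) (rule that)
  define D where "D = real (card (phase_indices M)) * (2 ^ M * K * schwartz_norm (M + m) theta)"
  have "schwartz_norm M (lift f) \<le> D * schwartz_norm M' f" if f: "f \<in> schwartz_space" for f
  proof -
    have "schwartz_norm M (lift f) \<le> real (card (phase_indices M)) * (2 ^ M * (K * schwartz_norm M' f) * schwartz_norm (M + m) theta)"
      unfolding lift_def
    proof (rule schwartz_norm_least)
      fix bs z assume bs: "bs \<in> lists (Basis :: ((real^'d) \<times> (real^'d)) set)" "length bs \<le> M"
      show "(1 + norm z) ^ M * cmod (partial_derivs bs (\<lambda>z. theta z * zak_conj f z) z)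
          \<le> 2 ^ M * (K * schwartz_norm M' f) * schwartz_norm (M + m) theta"
        by (rule schwartz_mult_bound [OF theta_schwartz sm [OF f] bs]) (rule K' [rule_format, OF f])
    qed
    then show ?thesis by (simp add: D_def mult_ac)
  qed
  moreover have "0 \<le> D" using K by (simp add: D_def schwartz_norm_nonneg [OF theta_schwartz])
  ultimately show "\<exists>M' D. 0 \<le> D \<and> (\<forall>f\<in>schwartz_space. schwartz_norm M (lift f) \<le> D * schwartz_norm M' f)" by blast
qed

text \<open>The phases in \<open>periodize\<close> cancel the multipliers of
  \<open>zak_conj f\<close>, so the Zak transform comes out of the lattice sum and only the sum of
  \<open>theta\<close> remains.\<close>

lemma periodize_lift:
  assumes f: "f \<in> schwartz_space"
  shows "periodize (lift f) = zak e f"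
proof
  fix z :: "(real^'d) \<times> (real^'d)"
  obtain x \<xi> where z: "z = (x, \<xi>)" by fastforce
  have "periodize (lift f) z = (\<Sum>\<^sub>\<infinity>l\<in>phase_lattice. zak e f (x, \<xi>) * theta ((x, - \<xi>) + l))"
    unfolding z periodize_apply
  proof (rule infsum_cong)
    fix l assume l: "l \<in> phase_lattice"
    obtain m \<kappa> where m: "l = (m, \<kappa>)" "m \<in> lattice e" "\<kappa> \<in> dual_lattice e" using l by auto
    have "zak_conj f ((x, - \<xi>) + l) = zak e f (x + m, \<xi> + (- \<kappa>))" by (simp add: m zak_conj_apply)
    also have "\<dots> = exp (\<i> * of_real (m \<bullet> \<xi>)) * zak e f (x, \<xi>)"
      using zak_quasi_periodic [of f] m dual_lattice_uminus [OF m(3)] lattice_zero dual_lattice_zero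
      unfolding quasi_periodic_def by metis
    finally have "exp (- (\<i> * of_real (\<xi> \<bullet> fst l))) * zak_conj f ((x, - \<xi>) + l) = zak e f (x, \<xi>)"
      by (simp add: m(1) inner_commute exp_minus)
    then show "exp (- (\<i> * of_real (\<xi> \<bullet> fst l))) * lift f ((x, - \<xi>) + l) = zak e f (x, \<xi>) * theta ((x, - \<xi>) + l)"
      by (simp add: lift_def mult_ac)
  qed
  also have "\<dots> = zak e f z" by (simp add: infsum_cmult_right' theta_sum z)
  finally show "periodize (lift f) z = zak e f z" .
qed

lemma adj_lift: "f \<in> schwartz_space \<Longrightarrow> adj (lift f) = f"
  by (simp add: adj_def periodize_lift inv_zak_zak)

text \<open>As \<open>periodize \<Phi>\<close> is smooth and quasi-periodic, the Zak transform of
  its mean gives it back; thus \<open>lift (adj \<Phi>)\<close> is an explicit lattice sum.\<close>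

lemma lift_adj:
  assumes \<Phi>: "\<Phi> \<in> schwartz_space"
  shows "lift (adj \<Phi>) = (\<lambda>z. \<Sum>\<^sub>\<infinity>l\<in>phase_lattice. theta z * exp_twist (0, fst l) (\<lambda>z. z) l \<Phi> z)"
proof
  fix z :: "(real^'d) \<times> (real^'d)"
  obtain x \<xi> where z: "z = (x, \<xi>)" by fastforce
  have "zak_conj (adj \<Phi>) z = periodize \<Phi> (x, - \<xi>)"
    by (simp add: z zak_conj_apply adj_def zak_inv_zak [OF periodize_smooth_Z [OF \<Phi>]])
  also have "\<dots> = (\<Sum>\<^sub>\<infinity>l\<in>phase_lattice. exp_twist (0, fst l) (\<lambda>z. z) l \<Phi> z)"
    by (simp add: periodize_apply exp_twist_def z)
  finally show "lift (adj \<Phi>) z = (\<Sum>\<^sub>\<infinity>l\<in>phase_lattice. theta z * exp_twist (0, fst l) (\<lambda>z. z) l \<Phi> z)"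
    by (simp add: lift_def infsum_cmult_right')
qed

end

lemma schwartz_norm_mult_le:
  fixes f g :: "'a::euclidean_space \<Rightarrow> complex"
  assumes f: "f \<in> schwartz_space" and g: "g \<in> smooth_space"
    and G: "\<And>z c. c \<in> lists Basis \<Longrightarrow> length c \<le> M \<Longrightarrow> cmod (partial_derivs c g z) \<le> A * (1 + norm z) ^ m"
  shows "schwartz_norm M (\<lambda>z. f z * g z) \<le> real (card (multi_indices TYPE('a) M)) * (2 ^ M * A * schwartz_norm (M + m) f)"
  by (rule schwartz_norm_least, rule schwartz_mult_bound [OF f g]) (use G in auto)

lemma schwartz_times:
  fixes f g :: "'a::euclidean_space \<Rightarrow> complex"
  assumes f: "f \<in> schwartz_space" and g: "g \<in> schwartz_space"
  shows "(\<lambda>z. f z * g z) \<in> schwartz_space"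
proof (rule schwartz_mult [OF f schwartz_smooth [OF g]])
  fix M
  have "cmod (partial_derivs c g z) \<le> schwartz_norm M g * (1 + norm z) ^ 0"
    if "c \<in> lists Basis" "length c \<le> M" for c z
    using schwartz_norm_upper [OF g that, of 0] by simp
  then show "\<exists>A m. \<forall>z. \<forall>c\<in>lists Basis. length c \<le> M \<longrightarrow> cmod (partial_derivs c g z) \<le> A * (1 + norm z) ^ m"
    by blast
qed

lemma schwartz_operator_cmult:
  assumes A: "schwartz_operator A"
  shows "schwartz_operator (\<lambda>\<Phi> x. c * A \<Phi> x)"
proof (rule schwartz_operatorI)
  have AS: "A f \<in> schwartz_space" if "f \<in> schwartz_space" for f using A that by (simp add: schwartz_operator_def)
  show "(\<lambda>x. c * A f x) \<in> schwartz_space" if "f \<in> schwartz_space" for f by (rule schwartz_cmult(1) [OF AS [OF that]])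
  show "(\<lambda>x. c * A (\<lambda>x. f x + g x) x) = (\<lambda>x. c * A f x + c * A g x)" if "f \<in> schwartz_space" "g \<in> schwartz_space" for f g
    using A that by (simp add: schwartz_operator_def distrib_left)
  show "(\<lambda>x. c * A (\<lambda>x. k * f x) x) = (\<lambda>x. k * (c * A f x))" if "f \<in> schwartz_space" for f k
    using A that by (simp add: schwartz_operator_def mult_ac)
  fix M
  obtain M' C where C: "0 \<le> C" "\<And>f. f \<in> schwartz_space \<Longrightarrow> schwartz_norm M (A f) \<le> C * schwartz_norm M' f"
    using A unfolding schwartz_operator_def by meson
  have "schwartz_norm M (\<lambda>x. c * A f x) \<le> (cmod c * C) * schwartz_norm M' f" if f: "f \<in> schwartz_space" for f
    unfolding mult.assoc
    by (rule order_trans [OF schwartz_cmult(2) [OF AS [OF f]]]) (rule mult_left_mono [OF C(2) [OF f]], simp)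
  then show "\<exists>M' C'. 0 \<le> C' \<and> (\<forall>f\<in>schwartz_space. schwartz_norm M (\<lambda>x. c * A f x) \<le> C' * schwartz_norm M' f)"
    using C(1) by (intro exI [of _ M'] exI [of _ "cmod c * C"]) auto
qed

context lattice_basis
begin

text \<open>Both conditions read on test functions: the dual component of the translation
  disappears, and the other one may be exchanged for a modulation.\<close>

lemma quasi_periodic_distr_shift:
  assumes w: "w \<in> tempered_Z e" and l: "l \<in> phase_lattice" and \<psi>: "\<psi> \<in> schwartz_space"
  shows "w (\<lambda>z. exp (\<i> * of_real (z \<bullet> (0, fst l))) * \<psi> z) = w (\<lambda>z. \<psi> (z - l))"
proof -
  obtain k \<kappa> where kk: "l = (k, \<kappa>)" "k \<in> lattice e" "\<kappa> \<in> dual_lattice e" using l by auto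
  have qp: "distr_shift (k, 0) w = distr_mult (\<lambda>(x, \<xi>). exp (\<i> * of_real (k \<bullet> \<xi>))) w" "distr_shift (0, \<kappa>) w = w"
    using w kk(2,3) by (auto simp: tempered_Z_def quasi_periodic_distr_def)
  have tr: "(\<lambda>z. \<psi> (z - (k, 0))) \<in> schwartz_space" using schwartz_translate [OF \<psi>, of "- (k, 0)"] by (simp only: add_uminus_conv_diff)
  have "w (\<lambda>z. \<psi> (z - l)) = distr_shift (0, \<kappa>) w (\<lambda>z. \<psi> (z - (k, 0)))"
    by (simp add: distr_shift_def tr kk(1) diff_diff_eq)
  also have "\<dots> = distr_shift (k, 0) w \<psi>" unfolding qp(2) by (simp add: distr_shift_def \<psi>)
  also have "\<dots> = w (\<lambda>z. exp (\<i> * of_real (z \<bullet> (0, fst l))) * \<psi> z)"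
    unfolding qp(1) by (simp add: distr_mult_def \<psi> case_prod_beta kk(1) inner_prod_def inner_commute)
  finally show ?thesis by simp
qed

text \<open>Both sides are expanded into sums over the phase lattice; the terms agree because \<open>w\<close> absorbs
  the translation by a lattice vector together with the corresponding modulation.\<close>

lemma tempered_Z_lift_adj:
  assumes w: "w \<in> tempered_Z e" and \<Phi>: "\<Phi> \<in> schwartz_space"
  shows "w (lift (adj \<Phi>)) = w \<Phi>"
proof -
  have wt: "w \<in> tempered" using w by (simp add: tempered_Z_def)
  let ?N = "2 * DIM((real^'d) \<times> (real^'d))"
  let ?h = "\<lambda>l z. theta z * exp_twist (0, fst l) (\<lambda>z. z) l \<Phi> z"
  let ?g = "\<lambda>l z. \<Phi> z * exp_twist 0 (\<lambda>z. z) (- l) theta z"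
  have tw: "exp_twist v (\<lambda>z. z) l f \<in> schwartz_space" if "f \<in> schwartz_space" for v l and f :: "(real^'d) \<times> (real^'d) \<Rightarrow> complex"
    by (rule exp_twist_in_schwartz [OF that])
  have h: "?h l \<in> schwartz_space" for l by (rule schwartz_times [OF theta_schwartz tw [OF \<Phi>]])
  have g: "?g l \<in> schwartz_space" for l by (rule schwartz_times [OF \<Phi> tw [OF theta_schwartz]])
  \<comment> \<open>Used for both expansions: the fixed Schwartz factor absorbs the growth in
    \<open>z\<close>, while the twisted factor provides the summable decay in
    \<open>l\<close>.\<close>
  have dom: "\<exists>a. a summable_on phase_lattice \<and> (\<forall>l\<in>phase_lattice. schwartz_norm M (\<lambda>z. f z * G l z) \<le> a l)"
    if f: "f \<in> schwartz_space" and G: "\<And>l. G l \<in> schwartz_space"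
      and B: "\<And>l bs z. bs \<in> lists Basis \<Longrightarrow> length bs \<le> M \<Longrightarrow>
        cmod (partial_derivs bs (G l) z) \<le> K * (1 + norm z) ^ m * C * (1 / (1 + norm l) ^ ?N)"
    for f :: "(real^'d) \<times> (real^'d) \<Rightarrow> complex" and G and K C :: real and m M
  proof (intro exI conjI ballI)
    let ?a = "\<lambda>l :: (real^'d) \<times> (real^'d). real (card (phase_indices M)) * (2 ^ M * (K * C * (1 / (1 + norm l) ^ ?N)) * schwartz_norm (M + m) f)"
    show "schwartz_norm M (\<lambda>z. f z * G l z) \<le> ?a l" for l
      by (rule schwartz_norm_mult_le [OF f schwartz_smooth [OF G]]) (use B in \<open>simp add: mult_ac\<close>)
    have "?a = (\<lambda>l. (real (card (phase_indices M)) * 2 ^ M * K * C * schwartz_norm (M + m) f) * (1 / (1 + norm l) ^ ?N))"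
      by (simp add: fun_eq_iff mult_ac)
    then show "?a summable_on phase_lattice" by (simp only:) (rule summable_on_cmult_right [OF summable_phase_lattice])
  qed
  have domh: "\<exists>a. a summable_on phase_lattice \<and> (\<forall>l\<in>phase_lattice. schwartz_norm M (?h l) \<le> a l)" for M
  proof -
    obtain K where "\<forall>l bs z. \<forall>\<Phi>\<in>(schwartz_space :: ((real^'d) \<times> (real^'d) \<Rightarrow> complex) set). bs \<in> lists Basis \<longrightarrow> length bs \<le> M \<longrightarrow>
      cmod (partial_derivs bs (exp_twist (0, fst l) (\<lambda>z. z) l \<Phi>) z)
        \<le> K * (1 + norm z) ^ (?N + M) * schwartz_norm (?N + M + M) \<Phi> * (1 / (1 + norm l) ^ ?N)"
      using Q.term_bound [of M] by (elim exE conjE) (rule that)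
    then show ?thesis using \<Phi> by (intro dom [OF theta_schwartz tw [OF \<Phi>]]) blast
  qed
  have domg: "\<exists>a. a summable_on phase_lattice \<and> (\<forall>l\<in>phase_lattice. schwartz_norm M (?g l) \<le> a l)" for M
  proof -
    obtain K where K: "\<forall>l bs z. \<forall>\<Phi>\<in>(schwartz_space :: ((real^'d) \<times> (real^'d) \<Rightarrow> complex) set). bs \<in> lists Basis \<longrightarrow> length bs \<le> M \<longrightarrow>
      cmod (partial_derivs bs (exp_twist 0 (\<lambda>z. z) l \<Phi>) z)
        \<le> K * (1 + norm z) ^ (?N + M) * schwartz_norm (?N + M + M) \<Phi> * (1 / (1 + norm l) ^ ?N)"
      using Q0.term_bound [of M] by (elim exE conjE) (rule that)
    show ?thesis
    proof (rule dom [OF \<Phi> tw [OF theta_schwartz]])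
      fix l z bs assume bs: "bs \<in> lists (Basis :: ((real^'d) \<times> (real^'d)) set)" "length bs \<le> M"
      show "cmod (partial_derivs bs (exp_twist 0 (\<lambda>z. z) (- l) theta) z)
        \<le> K * (1 + norm z) ^ (?N + M) * schwartz_norm (?N + M + M) theta * (1 / (1 + norm l) ^ ?N)"
        using K [rule_format, OF theta_schwartz bs, of "- l" z] by (simp only: norm_minus_cancel)
    qed
  qed
  have "w (lift (adj \<Phi>)) = (\<Sum>\<^sub>\<infinity>l\<in>phase_lattice. w (?h l))"
    unfolding lift_adj [OF \<Phi>] by (rule infsumI [symmetric], rule tempered_has_sum [OF wt h domh])
  also have "\<dots> = (\<Sum>\<^sub>\<infinity>l\<in>phase_lattice. w (?g l))"
  proof (rule infsum_cong)
    fix l assume l: "l \<in> phase_lattice"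
    \<comment> \<open>Removing the modulation translates this product by \<open>l\<close>. That
      moves the shift from \<open>\<Phi>\<close> to \<open>theta\<close>, whose translates sum to
      1.\<close>
    let ?\<psi> = "\<lambda>z. theta z * \<Phi> (z + l)"
    have \<psi>: "?\<psi> \<in> schwartz_space" by (rule schwartz_times [OF theta_schwartz schwartz_translate [OF \<Phi>]])
    have "?h l = (\<lambda>z. exp (\<i> * of_real (z \<bullet> (0, fst l))) * ?\<psi> z)" by (simp add: exp_twist_def fun_eq_iff)
    then have "w (?h l) = w (\<lambda>z. ?\<psi> (z - l))" using quasi_periodic_distr_shift [OF w l \<psi>] by (simp only:)
    also have "(\<lambda>z. ?\<psi> (z - l)) = ?g l" by (simp add: exp_twist_def fun_eq_iff mult.commute)
    finally show "w (?h l) = w (?g l)" .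
  qed
  also have "\<dots> = w (\<lambda>z. \<Sum>\<^sub>\<infinity>l\<in>phase_lattice. ?g l z)"
    by (rule infsumI, rule tempered_has_sum [OF wt g domg])
  also have "(\<lambda>z. \<Sum>\<^sub>\<infinity>l\<in>phase_lattice. ?g l z) = \<Phi>"
  proof
    fix z
    have "(\<Sum>\<^sub>\<infinity>l\<in>phase_lattice. theta (z + - l)) = 1"
      using infsum_phase_uminus [of "\<lambda>l. theta (z + l)"] theta_sum [of z] by (simp only:)
    then show "(\<Sum>\<^sub>\<infinity>l\<in>phase_lattice. ?g l z) = \<Phi> z"
      by (simp only: infsum_cmult_right' exp_twist_def inner_zero_right of_real_0 mult_zero_right exp_zero mult_1 mult_1_right)
  qed
  finally show ?thesis .
qed

text \<open>Reindexing by \<open>(k, 0)\<close> produces the factor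
  \<open>exp (- (\<i> * of_real (\<xi> \<bullet> k)))\<close>. This is the modulation evaluated at
  \<open>(x, - \<xi>) + l\<close>, because the dual lattice part of \<open>l\<close> pairs with
  \<open>k\<close> to an integer multiple of 2 pi.\<close>

lemma adj_shift_left:
  assumes k: "k \<in> lattice e"
  shows "adj (\<lambda>z. \<Phi> (z - (k, 0))) = adj (\<lambda>z. exp (\<i> * of_real (k \<bullet> snd z)) * \<Phi> z)"
proof -
  have k': "(k, 0) \<in> phase_lattice" using k dual_lattice_zero by simp
  have "periodize (\<lambda>z. \<Phi> (z - (k, 0))) (x, \<xi>) = periodize (\<lambda>z. exp (\<i> * of_real (k \<bullet> snd z)) * \<Phi> z) (x, \<xi>)" for x \<xi>
  proof -
    have "periodize (\<lambda>z. \<Phi> (z - (k, 0))) (x, \<xi>)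
        = (\<Sum>\<^sub>\<infinity>l\<in>phase_lattice. exp (- (\<i> * of_real (\<xi> \<bullet> fst (l + (k, 0))))) * \<Phi> ((x, - \<xi>) + (l + (k, 0)) - (k, 0)))"
      unfolding periodize_apply
      by (subst infsum_phase_shift [OF k', of "\<lambda>l. exp (- (\<i> * of_real (\<xi> \<bullet> fst l))) * \<Phi> ((x, - \<xi>) + l - (k, 0))"]) (rule refl)
    also have "\<dots> = periodize (\<lambda>z. exp (\<i> * of_real (k \<bullet> snd z)) * \<Phi> z) (x, \<xi>)"
      unfolding periodize_apply
    proof (rule infsum_cong)
      fix l assume l: "l \<in> phase_lattice"
      have 1: "(x, - \<xi>) + (l + (k, 0)) - (k, 0) = (x, - \<xi>) + l" by simp
      have "exp (\<i> * of_real (k \<bullet> snd l)) = 1" using exp_dual [OF k, of "snd l"] l by (auto simp: inner_commute)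
      then have 2: "exp (\<i> * of_real (k \<bullet> snd ((x, - \<xi>) + l))) = exp (- (\<i> * of_real (\<xi> \<bullet> k)))"
        by (simp add: inner_diff_right inner_commute [of \<xi>] right_diff_distrib exp_diff exp_minus divide_inverse)
      have 3: "exp (- (\<i> * of_real (\<xi> \<bullet> fst (l + (k, 0))))) = exp (- (\<i> * of_real (\<xi> \<bullet> fst l))) * exp (- (\<i> * of_real (\<xi> \<bullet> k)))"
        by (simp add: inner_add_right distrib_left exp_add [symmetric])
      show "exp (- (\<i> * of_real (\<xi> \<bullet> fst (l + (k, 0))))) * \<Phi> ((x, - \<xi>) + (l + (k, 0)) - (k, 0))
          = exp (- (\<i> * of_real (\<xi> \<bullet> fst l))) * (exp (\<i> * of_real (k \<bullet> snd ((x, - \<xi>) + l))) * \<Phi> ((x, - \<xi>) + l))"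
        by (simp only: 1 2 3 mult.assoc)
    qed
    finally show ?thesis .
  qed
  then have "periodize (\<lambda>z. \<Phi> (z - (k, 0))) = periodize (\<lambda>z. exp (\<i> * of_real (k \<bullet> snd z)) * \<Phi> z)"
    by (simp add: fun_eq_iff)
  then show ?thesis by (simp only: adj_def)
qed

lemma adj_shift_right:
  assumes \<kappa>: "\<kappa> \<in> dual_lattice e"
  shows "adj (\<lambda>z. \<Phi> (z - (0, \<kappa>))) = adj \<Phi>"
proof -
  have \<kappa>': "(0, \<kappa>) \<in> phase_lattice" using \<kappa> lattice_zero by simp
  have "periodize (\<lambda>z. \<Phi> (z - (0, \<kappa>))) (x, \<xi>) = periodize \<Phi> (x, \<xi>)" for x \<xi>
    unfolding periodize_apply
    by (subst infsum_phase_shift [OF \<kappa>', of "\<lambda>l. exp (- (\<i> * of_real (\<xi> \<bullet> fst l))) * \<Phi> ((x, - \<xi>) + l - (0, \<kappa>))", symmetric])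
       (rule infsum_cong, simp)
  then have "periodize (\<lambda>z. \<Phi> (z - (0, \<kappa>))) = periodize \<Phi>" by (simp add: fun_eq_iff)
  then show ?thesis by (simp only: adj_def)
qed

text \<open>Transposition turns the two shift identities of \<open>adj\<close> into
  quasi-periodicity. Outside the Schwartz space both sides are \<open>undefined\<close>, so the
  equations hold as equations of total functions.\<close>

lemma transpose_adj_tempered_Z:
  assumes u: "u \<in> tempered"
  shows "transpose_op (\<lambda>\<Phi> x. c * adj \<Phi> x) u \<in> tempered_Z e"
proof -
  let ?w = "transpose_op (\<lambda>\<Phi> x. c * adj \<Phi> x) u"
  have t: "?w \<in> tempered" by (rule transpose_op_tempered [OF schwartz_operator_cmult [OF adj_operator] u])
  have tr: "(\<lambda>z. \<Phi> (z - l)) \<in> schwartz_space" if "\<Phi> \<in> schwartz_space" for l and \<Phi> :: "(real^'d) \<times> (real^'d) \<Rightarrow> complex"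
    using schwartz_translate [OF that, of "- l"] by simp
  have tw: "(\<lambda>z. exp (\<i> * of_real (k \<bullet> snd z)) * \<Phi> z) \<in> schwartz_space" if "\<Phi> \<in> schwartz_space" for k and \<Phi> :: "(real^'d) \<times> (real^'d) \<Rightarrow> complex"
    using exp_twist_in_schwartz [OF that, of "(0, k)" 0] by (simp add: exp_twist_def inner_prod_def inner_commute)
  have "quasi_periodic_distr e ?w"
    unfolding quasi_periodic_distr_def
  proof (intro ballI conjI ext)
    fix k \<kappa> \<Phi> assume k: "k \<in> lattice e" and \<kappa>: "\<kappa> \<in> dual_lattice e"
    show "distr_shift (k, 0) ?w \<Phi> = distr_mult (\<lambda>(x, \<xi>). exp (\<i> * of_real (k \<bullet> \<xi>))) ?w \<Phi>"
      by (cases "\<Phi> \<in> schwartz_space")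
         (simp_all add: distr_shift_def distr_mult_def tr tw adj_shift_left [OF k] case_prod_beta)
    show "distr_shift (0, \<kappa>) ?w \<Phi> = ?w \<Phi>"
      by (cases "\<Phi> \<in> schwartz_space") (simp_all add: distr_shift_def tr adj_shift_right [OF \<kappa>] transpose_op_def)
  qed
  with t show ?thesis by (simp add: tempered_Z_def)
qed

end

section \<open>Parseval's formula and the transpose of the Zak transform\<close>

lemma integral_cell_sum:
  fixes g :: "'a::euclidean_space \<Rightarrow> complex"
  assumes g: "integrable lborel g" and sm: "\<And>x. (\<lambda>n. cmod (g (x + n))) summable_on int_points"
  shows "(\<integral>x. (\<Sum>\<^sub>\<infinity>n\<in>int_points. g (x + n)) \<partial>cell_measure) = (\<integral>x. g x \<partial>lborel)"
proof -
  have "integrable cell_measure (\<lambda>x. g (x + n))" for n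
    unfolding integrable_cell_measure
    by (rule integrable_mult_indicator [OF _ integrable_translate [OF g]]) simp
  from integral_infsum [OF countable_int_points this sm tiling(2) [OF g]]
  show ?thesis by (simp only: tiling(1) [OF g])
qed

lemma integral_cell_prod:
  fixes h :: "'a::euclidean_space \<times> 'b::euclidean_space \<Rightarrow> complex"
  assumes h: "continuous_on UNIV h"
  shows "(\<integral>p. h p \<partial>cell_measure) = (\<integral>s. (\<integral>t. h (s, t) \<partial>cell_measure) \<partial>cell_measure)"
proof -
  let ?h = "\<lambda>p. indicator unit_cell p *\<^sub>R h p"
  have "integrable lborel ?h"
    using integrable_cell_continuous [OF h] by (simp only: integrable_cell_measure)
  then have int: "integrable (lborel \<Otimes>\<^sub>M lborel) ?h" by (simp only: lborel_prod)
  have "(\<integral>p. h p \<partial>cell_measure) = (\<integral>p. ?h p \<partial>(lborel \<Otimes>\<^sub>M lborel))"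
    by (simp only: integral_cell_measure lborel_prod)
  also have "\<dots> = (\<integral>s. (\<integral>t. ?h (s, t) \<partial>lborel) \<partial>lborel)"
    using lborel_pair.integral_fst' [OF int] by simp
  also have "\<dots> = (\<integral>s. (\<integral>t. h (s, t) \<partial>cell_measure) \<partial>cell_measure)"
  proof -
    have "indicator unit_cell (s, t) = (indicator unit_cell s * indicator unit_cell t :: real)" for s :: 'a and t :: 'b
      by (simp add: indicator_def unit_cell_Pair)
    then show ?thesis by (simp add: integral_cell_measure scaleR_scaleR [symmetric] del: scaleR_scaleR)
  qed
  finally show ?thesis .
qed

context lattice_basis
begin

lemma zak_times_schwartz:
  assumes f: "f \<in> schwartz_space" and \<Phi>: "\<Phi> \<in> schwartz_space"
  shows "(\<lambda>z. zak e f z * \<Phi> z) \<in> schwartz_space"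
proof -
  have "(\<lambda>z. \<Phi> z * zak e f z) \<in> schwartz_space"
  proof (rule schwartz_mult [OF \<Phi> zak_smooth [OF f]])
    fix M
    obtain C m M' where "\<forall>\<Phi>\<in>schwartz_space. \<forall>z. \<forall>cs\<in>lists Basis. length cs \<le> M \<longrightarrow>
        cmod (partial_derivs cs (zak e \<Phi>) z) \<le> C * schwartz_norm M' \<Phi> * (1 + norm z) ^ m"
      using zak_bound [of M] by (elim exE conjE) (rule that)
    with f show "\<exists>A m. \<forall>z. \<forall>c\<in>lists Basis. length c \<le> M \<longrightarrow> cmod (partial_derivs c (zak e f) z) \<le> A * (1 + norm z) ^ m"
      by (intro exI [of _ "C * schwartz_norm M' f"] exI [of _ m]) simp
  qed
  then show ?thesis by (simp only: mult.commute)
qed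

lemma zak_phase_shift:
  assumes l: "l \<in> phase_lattice"
  shows "zak e f (z + l) = exp (\<i> * of_real (snd z \<bullet> fst l)) * zak e f z"
proof -
  obtain m \<kappa> where m: "l = (m, \<kappa>)" "m \<in> lattice e" "\<kappa> \<in> dual_lattice e" using l by auto
  have "zak e f (z + l) = zak e f ((z + (m, 0)) + (0, \<kappa>))" by (simp add: m add.assoc)
  also have "\<dots> = exp (\<i> * of_real (z \<bullet> (0, m))) * zak e f z"
    by (simp only: quasi_periodic_right [OF zak_quasi_periodic m(3)] quasi_periodic_left [OF zak_quasi_periodic m(2)])
  finally show ?thesis by (simp add: m inner_prod_def)
qed

text \<open>The integral is folded onto one phase cell. The multipliers of the Zak transform under
  the phase lattice are collected with \<open>\<Phi>\<close>, where they form
  \<open>periodize \<Phi>\<close> at \<open>(x, - \<xi>)\<close>, that is,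
  \<open>zak_conj (adj \<Phi>)\<close>.\<close>

lemma integral_zak_unfold:
  assumes f: "f \<in> schwartz_space" and \<Phi>: "\<Phi> \<in> schwartz_space"
  shows "(\<integral>p. zak e f (lin2 p) * \<Phi> (lin2 p) \<partial>lborel)
    = (\<integral>p. zak e f (lin2 p) * zak_conj (adj \<Phi>) (lin2 p) \<partial>cell_measure)"
proof -
  let ?g = "\<lambda>z. zak e f z * \<Phi> z"
  have g: "?g \<in> schwartz_space" by (rule zak_times_schwartz [OF f \<Phi>])
  have lat: "infsum (\<lambda>n. G (lin2 (p + n))) int_points = (\<Sum>\<^sub>\<infinity>l\<in>phase_lattice. G (lin2 p + l))"
    for G :: "(real^'d) \<times> (real^'d) \<Rightarrow> complex" and p
    unfolding phase_lattice_eq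
    by (subst infsum_reindex) (auto simp: o_def inj_on_def linear_add [OF linear_lin2] dest: injD [OF inj_lin2])
  have "(\<lambda>l. cmod (?g (lin2 p + l))) summable_on phase_lattice" for p
    using Q0.abs_summable [OF g, of "lin2 p"] by (simp add: exp_twist_def)
  then have sm: "(\<lambda>n. cmod (?g (lin2 (p + n)))) summable_on int_points" for p
    unfolding phase_lattice_eq
    by (subst (asm) summable_on_reindex) (auto simp: o_def inj_on_def linear_add [OF linear_lin2] dest: injD [OF inj_lin2])
  have "(\<integral>p. ?g (lin2 p) \<partial>lborel) = (\<integral>p. (\<Sum>\<^sub>\<infinity>n\<in>int_points. ?g (lin2 (p + n))) \<partial>cell_measure)"
    using integral_cell_sum [OF integrable_schwartz_linear [OF g linear_lin2 inj_lin2] sm] by simp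
  also have "\<dots> = (\<integral>p. zak e f (lin2 p) * zak_conj (adj \<Phi>) (lin2 p) \<partial>cell_measure)"
  proof (rule Bochner_Integration.integral_cong [OF refl])
    fix p
    obtain x \<xi> where z: "lin2 p = (x, \<xi>)" by fastforce
    have "(\<Sum>\<^sub>\<infinity>n\<in>int_points. ?g (lin2 (p + n))) = (\<Sum>\<^sub>\<infinity>l\<in>phase_lattice. ?g ((x, \<xi>) + l))"
      using lat [of ?g p] by (simp only: z)
    also have "\<dots> = (\<Sum>\<^sub>\<infinity>l\<in>phase_lattice. zak e f (x, \<xi>) * (exp (- (\<i> * of_real ((- \<xi>) \<bullet> fst l))) * \<Phi> ((x, - (- \<xi>)) + l)))"
      by (rule infsum_cong) (simp add: zak_phase_shift del: mem_Times_iff)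
    also have "\<dots> = zak e f (x, \<xi>) * periodize \<Phi> (x, - \<xi>)" by (simp only: infsum_cmult_right' periodize_apply)
    also have "periodize \<Phi> (x, - \<xi>) = zak_conj (adj \<Phi>) (x, \<xi>)"
      by (simp add: zak_conj_apply adj_def zak_inv_zak [OF periodize_smooth_Z [OF \<Phi>]])
    finally show "(\<Sum>\<^sub>\<infinity>n\<in>int_points. ?g (lin2 (p + n))) = zak e f (lin2 p) * zak_conj (adj \<Phi>) (lin2 p)"
      by (simp only: z)
  qed
  finally show ?thesis .
qed

text \<open>Expanding only \<open>zak_conj \<psi>\<close> suffices: each phase shifts the other
  factor to \<open>x + l\<close> by quasi-periodicity, and its mean over the dual cell is
  \<open>f (x + l)\<close>. Unfolding the remaining lattice sum gives an integral over the whole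
  space.\<close>

lemma zak_parseval:
  assumes f: "f \<in> schwartz_space" and \<psi>: "\<psi> \<in> schwartz_space"
  shows "(\<integral>p. zak e f (lin2 p) * zak_conj \<psi> (lin2 p) \<partial>cell_measure) = (\<integral>s. f (lin s) * \<psi> (lin s) \<partial>lborel)"
proof -
  let ?F = "zak e f"
  have F: "?F \<in> smooth_space" by (rule zak_smooth [OF f])
  have W: "zak_conj \<psi> \<in> smooth_space" unfolding zak_conj_def by (rule W.twisted_sum_smooth [OF \<psi>])
  have inner: "(\<integral>t. ?F (x, dlin t) * zak_conj \<psi> (x, dlin t) \<partial>cell_measure) = (\<Sum>\<^sub>\<infinity>l\<in>lattice e. f (x + l) * \<psi> (x + l))" for x
  proof -
    have eq: "?F (x, dlin t) * zak_conj \<psi> (x, dlin t) = (\<Sum>\<^sub>\<infinity>l\<in>lattice e. \<psi> (x + l) * ?F (x + l, dlin t))" for t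
    proof -
      have "?F (x, dlin t) * zak_conj \<psi> (x, dlin t)
          = (\<Sum>\<^sub>\<infinity>l\<in>lattice e. ?F (x, dlin t) * (exp (\<i> * of_real ((x, dlin t) \<bullet> (0, l))) * \<psi> (x + l)))"
        by (simp add: zak_conj_def twisted_sum_def exp_twist_def infsum_cmult_right')
      also have "\<dots> = (\<Sum>\<^sub>\<infinity>l\<in>lattice e. \<psi> (x + l) * ?F (x + l, dlin t))"
        using quasi_periodic_left [OF zak_quasi_periodic, of _ f "(x, dlin t)"] by (intro infsum_cong) simp
      finally show ?thesis .
    qed
    have n: "cmod (?F (x + l, dlin t)) = cmod (?F (x, dlin t))" if "l \<in> lattice e" for l t
      using quasi_periodic_left [OF zak_quasi_periodic that, of f "(x, dlin t)"] by (simp add: norm_mult)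
    have sm: "(\<lambda>l. cmod (\<psi> (x + l))) summable_on lattice e"
      using W.abs_summable [OF \<psi>, of "(x, 0)"] by (simp add: exp_twist_def)
    have "(\<integral>t. (\<Sum>\<^sub>\<infinity>l\<in>lattice e. \<psi> (x + l) * ?F (x + l, dlin t)) \<partial>cell_measure)
        = (\<Sum>\<^sub>\<infinity>l\<in>lattice e. \<integral>t. \<psi> (x + l) * ?F (x + l, dlin t) \<partial>cell_measure)"
    proof (rule integral_infsum [OF countable_lattice])
      show "integrable cell_measure (\<lambda>t. \<psi> (x + l) * ?F (x + l, dlin t))" for l
        by (intro integrable_mult_right integrable_section' F)
      have "(\<lambda>l. cmod (\<psi> (x + l) * ?F (x + l, dlin t))) summable_on lattice e
          \<longleftrightarrow> (\<lambda>l. cmod (\<psi> (x + l)) * cmod (?F (x, dlin t))) summable_on lattice e" for t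
        by (rule summable_on_cong) (simp add: norm_mult n)
      then show "(\<lambda>l. cmod (\<psi> (x + l) * ?F (x + l, dlin t))) summable_on lattice e" for t
        using summable_on_cmult_left [OF sm] by blast
      have "(\<lambda>l. \<integral>t. cmod (\<psi> (x + l) * ?F (x + l, dlin t)) \<partial>cell_measure) summable_on lattice e
          \<longleftrightarrow> (\<lambda>l. cmod (\<psi> (x + l)) * (\<integral>t. cmod (?F (x, dlin t)) \<partial>cell_measure)) summable_on lattice e"
        by (rule summable_on_cong) (simp add: norm_mult n)
      then show "(\<lambda>l. \<integral>t. cmod (\<psi> (x + l) * ?F (x + l, dlin t)) \<partial>cell_measure) summable_on lattice e"
        using summable_on_cmult_left [OF sm] by blast
    qed
    also have "\<dots> = (\<Sum>\<^sub>\<infinity>l\<in>lattice e. f (x + l) * \<psi> (x + l))"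
      using inv_zak_zak [OF f] by (simp add: inv_zak_def fun_eq_iff mult.commute)
    finally show ?thesis by (simp only: eq)
  qed
  let ?g = "\<lambda>x. f x * \<psi> x"
  have g: "?g \<in> schwartz_space" by (rule schwartz_times [OF f \<psi>])
  have lat: "infsum (\<lambda>n. ?g (lin (s + n))) int_points = (\<Sum>\<^sub>\<infinity>l\<in>lattice e. ?g (lin s + l))" for s
    unfolding lattice_eq
    by (subst infsum_reindex) (auto simp: o_def inj_on_def linear_add [OF linear_lin] dest: injD [OF inj_lin])
  have "(\<lambda>l. cmod (?g (lin s + l))) summable_on lattice e" for s
    using W.abs_summable [OF g, of "(lin s, 0)"] by (simp add: exp_twist_def)
  then have sm: "(\<lambda>n. cmod (?g (lin (s + n)))) summable_on int_points" for s
    unfolding lattice_eq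
    by (subst (asm) summable_on_reindex) (auto simp: o_def inj_on_def linear_add [OF linear_lin] dest: injD [OF inj_lin])
  have "continuous_on UNIV (\<lambda>p. ?F (lin2 p) * zak_conj \<psi> (lin2 p))"
    by (intro continuous_intros continuous_on_compose2 [OF smooth_continuous [OF F, of UNIV] continuous_lin2]
        continuous_on_compose2 [OF smooth_continuous [OF W, of UNIV] continuous_lin2]) auto
  from integral_cell_prod [OF this]
  have "(\<integral>p. ?F (lin2 p) * zak_conj \<psi> (lin2 p) \<partial>cell_measure)
      = (\<integral>s. (\<integral>t. ?F (lin s, dlin t) * zak_conj \<psi> (lin s, dlin t) \<partial>cell_measure) \<partial>cell_measure)"
    by (simp add: lin2_def)
  also have "\<dots> = (\<integral>s. (\<Sum>\<^sub>\<infinity>n\<in>int_points. ?g (lin (s + n))) \<partial>cell_measure)" unfolding inner lat ..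
  also have "\<dots> = (\<integral>s. ?g (lin s) \<partial>lborel)"
    by (rule integral_cell_sum [OF integrable_schwartz_linear [OF g linear_lin inj_lin] sm])
  finally show ?thesis .
qed

text \<open>The constant is the quotient of the Jacobians of \<open>lin2\<close> and
  \<open>lin\<close>, hence that of \<open>dlin\<close>: the mean in \<open>inv_zak\<close> is
  normalized, whereas the integral over phase space is not.\<close>

lemma integral_zak_adj:
  "\<exists>c>0. \<forall>f\<in>schwartz_space. \<forall>\<Phi>\<in>schwartz_space.
    (\<integral>z. zak e f z * \<Phi> z \<partial>lborel) = of_real c * (\<integral>x. f x * adj \<Phi> x \<partial>lborel)"
proof -
  obtain c1 where c1: "0 < c1" "\<And>g. g \<in> schwartz_space \<Longrightarrow> (\<integral>x. g x \<partial>lborel) = of_real c1 * (\<integral>t. g (lin t) \<partial>lborel)"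
    using linear_change_of_variables [OF linear_lin inj_lin] by blast
  obtain c2 where c2: "0 < c2" "\<And>g. g \<in> schwartz_space \<Longrightarrow> (\<integral>x. g x \<partial>lborel) = of_real c2 * (\<integral>t. g (lin2 t) \<partial>lborel)"
    using linear_change_of_variables [OF linear_lin2 inj_lin2] by blast
  have "(\<integral>z. zak e f z * \<Phi> z \<partial>lborel) = of_real (c2 / c1) * (\<integral>x. f x * adj \<Phi> x \<partial>lborel)"
    if f: "f \<in> schwartz_space" and \<Phi>: "\<Phi> \<in> schwartz_space" for f \<Phi>
  proof -
    have A: "adj \<Phi> \<in> schwartz_space" using adj_operator \<Phi> by (simp add: schwartz_operator_def)
    have "(\<integral>z. zak e f z * \<Phi> z \<partial>lborel) = of_real c2 * (\<integral>s. f (lin s) * adj \<Phi> (lin s) \<partial>lborel)"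
      by (simp only: c2(2) [OF zak_times_schwartz [OF f \<Phi>]] integral_zak_unfold [OF f \<Phi>] zak_parseval [OF f A])
    moreover have "(\<integral>x. f x * adj \<Phi> x \<partial>lborel) = of_real c1 * (\<integral>s. f (lin s) * adj \<Phi> (lin s) \<partial>lborel)"
      by (rule c1(2) [OF schwartz_times [OF f A]])
    ultimately show ?thesis using c1(1) by simp
  qed
  then show ?thesis using c1(1) c2(1) by (intro exI [of _ "c2 / c1"]) simp
qed

end

section \<open>The extension to tempered distributions\<close>

lemma topspace_weak_topology [simp]: "topspace weak_topology = tempered"
  and topspace_strong_topology [simp]: "topspace strong_topology = tempered"
  unfolding weak_topology_def strong_topology_def
  by (rule topspace_seminorm_topology [OF pseudometric_weak], rule topspace_seminorm_topology [OF pseudometric_strong])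

lemma tempered_separated:
  assumes "u \<in> tempered" "v \<in> tempered" "u \<noteq> v"
  shows "\<exists>\<phi>\<in>schwartz_space. 0 < cmod ((v - u) \<phi>)"
proof (rule ccontr)
  assume "\<not> ?thesis"
  then have "u \<phi> = v \<phi>" if "\<phi> \<in> schwartz_space" for \<phi> using that by fastforce
  then have "u = v" using assms(1,2) by (intro extensionalityI [OF tempered_extensional tempered_extensional])
  with assms(3) show False ..
qed

lemma Hausdorff_weak_topology: "Hausdorff_space weak_topology"
  unfolding weak_topology_def
proof (rule Hausdorff_seminorm_topology [OF pseudometric_weak])
  show "\<exists>p\<in>{\<lambda>u. cmod (u \<phi>) | \<phi>. \<phi> \<in> schwartz_space}. 0 < p (v - u)"
    if "u \<in> tempered" "v \<in> tempered" "u \<noteq> v" for u v :: "('a \<Rightarrow> complex) \<Rightarrow> complex"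
  proof -
    note sep = tempered_separated [OF that]
    from sep obtain \<phi> where \<phi>: "\<phi> \<in> schwartz_space" "0 < cmod ((v - u) \<phi>)" by blast
    then have "(\<lambda>u. cmod (u \<phi>)) \<in> {\<lambda>u. cmod (u \<phi>) | \<phi>. \<phi> \<in> schwartz_space}" by blast
    with \<phi>(2) show ?thesis by (intro bexI)
  qed
qed

lemma Hausdorff_strong_topology: "Hausdorff_space strong_topology"
  unfolding strong_topology_def
proof (rule Hausdorff_seminorm_topology [OF pseudometric_strong])
  show "\<exists>p\<in>{\<lambda>u. SUP \<phi>\<in>B. cmod (u \<phi>) | B. schwartz_bounded B \<and> B \<noteq> {}}. 0 < p (v - u)"
    if "u \<in> tempered" "v \<in> tempered" "u \<noteq> v" for u v :: "('a \<Rightarrow> complex) \<Rightarrow> complex"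
  proof -
    note sep = tempered_separated [OF that]
    from sep obtain \<phi> where \<phi>: "\<phi> \<in> schwartz_space" "0 < cmod ((v - u) \<phi>)" by blast
    let ?p = "\<lambda>u :: ('a \<Rightarrow> complex) \<Rightarrow> complex. SUP \<phi>\<in>{\<phi>}. cmod (u \<phi>)"
    have "?p \<in> {\<lambda>u. SUP \<phi>\<in>B. cmod (u \<phi>) | B. schwartz_bounded B \<and> B \<noteq> {}}"
      using schwartz_bounded_singleton [OF \<phi>(1)] by blast
    moreover have "0 < ?p (v - u)" using \<phi>(2) by simp
    ultimately show ?thesis by (intro bexI)
  qed
qed

lemma distr_of_tempered:
  fixes f :: "'a::euclidean_space \<Rightarrow> complex"
  assumes f: "f \<in> schwartz_space"
  shows "distr_of f \<in> tempered"
proof (rule temperedI [where M = 0 and C = "\<integral>x. cmod (f x) \<partial>lborel"])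
  show "distr_of f \<in> extensional schwartz_space" by (simp add: distr_of_def)
  have int: "integrable lborel (\<lambda>x. f x * \<phi> x)" if "\<phi> \<in> schwartz_space" for \<phi>
    by (rule schwartz_integrable [OF schwartz_times [OF f that]])
  show "distr_of f (\<lambda>x. g x + h x) = distr_of f g + distr_of f h" if "g \<in> schwartz_space" "h \<in> schwartz_space" for g h
    using that by (simp add: distr_of_def schwartz_add distrib_left int)
  show "distr_of f (\<lambda>x. c * g x) = c * distr_of f g" if "g \<in> schwartz_space" for c g
    using that by (simp add: distr_of_def schwartz_cmult mult.left_commute [of _ c])
  show "cmod (distr_of f \<phi>) \<le> (\<integral>x. cmod (f x) \<partial>lborel) * schwartz_norm 0 \<phi>" if \<phi>: "\<phi> \<in> schwartz_space" for \<phi>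
  proof -
    have "cmod (\<integral>x. f x * \<phi> x \<partial>lborel) \<le> (\<integral>x. cmod (f x) * schwartz_norm 0 \<phi> \<partial>lborel)"
    proof (rule norm_integral_le)
      show "integrable lborel (\<lambda>x. cmod (f x) * schwartz_norm 0 \<phi>)"
        by (intro integrable_mult_left integrable_norm schwartz_integrable f)
      show "cmod (f x * \<phi> x) \<le> cmod (f x) * schwartz_norm 0 \<phi>" for x
        using schwartz_norm_upper [OF \<phi> lists.Nil, of 0 0 x] by (simp add: norm_mult mult_left_mono)
    qed
    then show ?thesis using \<phi> by (simp add: distr_of_def)
  qed
qed

context lattice_basis
begin

text \<open>The topologies enter only through continuity of transposed operators, the Hausdorff
  property and density, so the weak and the strong case are instances of one argument.\<close>

lemma zak_extension:
  fixes X :: "((real^'d \<Rightarrow> complex) \<Rightarrow> complex) topology"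
    and Y :: "(((real^'d) \<times> (real^'d) \<Rightarrow> complex) \<Rightarrow> complex) topology"
  assumes X: "topspace X = tempered" and Y: "topspace Y = tempered" "Hausdorff_space Y"
    and XY: "\<And>A. schwartz_operator A \<Longrightarrow> continuous_map X Y (transpose_op A)"
    and YX: "\<And>A. schwartz_operator A \<Longrightarrow> continuous_map Y X (transpose_op A)"
    and dense: "tempered \<subseteq> X closure_of (distr_of ` schwartz_space)"
  shows "\<exists>!T. T \<in> extensional tempered \<and> homeomorphic_map X (subtopology Y (tempered_Z e)) T \<and>
    (\<forall>f\<in>schwartz_space. T (distr_of f) = distr_of (zak e f))"
proof -
  obtain c where c: "0 < c" and c': "\<forall>f\<in>schwartz_space. \<forall>\<Phi>\<in>schwartz_space.
    (\<integral>z. zak e f z * \<Phi> z \<partial>lborel) = of_real c * (\<integral>x. f x * adj \<Phi> x \<partial>lborel)"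
    using integral_zak_adj by (elim exE conjE) (rule that)
  \<comment> \<open>The constant makes the transpose of \<open>A\<close> agree with the Zak
    transform on Schwartz functions; its inverse in \<open>R\<close> keeps
    \<open>A (R \<phi>) = \<phi>\<close>.\<close>
  define A where "A = (\<lambda>\<Phi> x. of_real c * adj \<Phi> x)"
  define R where "R = (\<lambda>\<phi> z. of_real (1 / c) * lift \<phi> z)"
  have A: "schwartz_operator A" unfolding A_def by (rule schwartz_operator_cmult [OF adj_operator])
  have R: "schwartz_operator R" unfolding R_def by (rule schwartz_operator_cmult [OF lift_operator])
  have AS: "A \<Phi> \<in> schwartz_space" "adj \<Phi> \<in> schwartz_space" if "\<Phi> \<in> schwartz_space" for \<Phi>
    using A adj_operator that by (simp_all add: schwartz_operator_def)
  have RS: "R \<phi> \<in> schwartz_space" "lift \<phi> \<in> schwartz_space" if "\<phi> \<in> schwartz_space" for \<phi>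
    using R lift_operator that by (simp_all add: schwartz_operator_def)
  have AR: "A (R \<phi>) = \<phi>" if "\<phi> \<in> schwartz_space" for \<phi>
  proof -
    have "adj (R \<phi>) = (\<lambda>x. of_real (1 / c) * adj (lift \<phi>) x)"
      using adj_operator RS(2) [OF that] unfolding schwartz_operator_def R_def by blast
    then show ?thesis using c by (simp add: A_def adj_lift [OF that])
  qed
  have RA: "R (A \<Phi>) = lift (adj \<Phi>)" if "\<Phi> \<in> schwartz_space" for \<Phi>
  proof -
    have "lift (A \<Phi>) = (\<lambda>x. of_real c * lift (adj \<Phi>) x)"
      using lift_operator AS(2) [OF that] unfolding schwartz_operator_def A_def by blast
    then show ?thesis using c by (simp add: R_def)
  qed
  \<comment> \<open>Outside \<open>tempered\<close> the value is fixed, so that uniqueness on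
    distributions is uniqueness of the total function.\<close>
  define T where "T = restrict (transpose_op A) tempered"
  have Z: "transpose_op A u \<in> tempered_Z e" if "u \<in> tempered" for u
    unfolding A_def by (rule transpose_adj_tempered_Z [OF that])
  have "homeomorphic_maps X (subtopology Y (tempered_Z e)) T (transpose_op R)"
    unfolding homeomorphic_maps_def
  proof (intro conjI ballI)
    have "continuous_map X (subtopology Y (tempered_Z e)) (transpose_op A)"
      unfolding continuous_map_in_subtopology using XY [OF A] Z by (auto simp: X)
    then show "continuous_map X (subtopology Y (tempered_Z e)) T"
      by (rule continuous_map_eq) (simp add: T_def X)
    show "continuous_map (subtopology Y (tempered_Z e)) X (transpose_op R)"
      by (rule continuous_map_from_subtopology [OF YX [OF R]])
    show "transpose_op R (T u) = u" if "u \<in> topspace X" for u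
    proof (rule extensionalityI [of _ schwartz_space])
      show "u \<in> extensional schwartz_space" using that by (simp add: X tempered_extensional)
      show "transpose_op R (T u) \<phi> = u \<phi>" if "\<phi> \<in> schwartz_space" for \<phi>
        using \<open>u \<in> topspace X\<close> that by (simp add: T_def X RS AR)
    qed (simp add: transpose_op_def)
    show "T (transpose_op R w) = w" if "w \<in> topspace (subtopology Y (tempered_Z e))" for w
    proof (rule extensionalityI [of _ schwartz_space])
      have w: "w \<in> tempered_Z e" "w \<in> tempered" using that by (auto simp: Y)
      show "w \<in> extensional schwartz_space" by (rule tempered_extensional [OF w(2)])
      have t: "T (transpose_op R w) = transpose_op A (transpose_op R w)"
        using transpose_op_tempered [OF R w(2)] by (simp add: T_def)
      then show "T (transpose_op R w) \<in> extensional schwartz_space" by (simp add: transpose_op_def)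
      show "T (transpose_op R w) \<Phi> = w \<Phi>" if "\<Phi> \<in> schwartz_space" for \<Phi>
        unfolding t using that by (simp add: AS RA tempered_Z_lift_adj [OF w(1)])
    qed
  qed
  then have hom: "homeomorphic_map X (subtopology Y (tempered_Z e)) T" by (rule homeomorphic_maps_map [THEN iffD1, THEN conjunct1])
  have zak: "T (distr_of f) = distr_of (zak e f)" if f: "f \<in> schwartz_space" for f
  proof (rule extensionalityI [of _ schwartz_space])
    have t: "T (distr_of f) = transpose_op A (distr_of f)" by (simp add: T_def distr_of_tempered [OF f])
    then show "T (distr_of f) \<in> extensional schwartz_space" by (simp add: transpose_op_def)
    show "distr_of (zak e f) \<in> extensional schwartz_space" by (simp add: distr_of_def)
    show "T (distr_of f) \<Phi> = distr_of (zak e f) \<Phi>" if \<Phi>: "\<Phi> \<in> schwartz_space" for \<Phi>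
    proof -
      have "T (distr_of f) \<Phi> = (\<integral>x. f x * A \<Phi> x \<partial>lborel)"
        unfolding t using AS(1) [OF \<Phi>] \<Phi> by (simp add: distr_of_def)
      also have "\<dots> = of_real c * (\<integral>x. f x * adj \<Phi> x \<partial>lborel)"
        by (simp add: A_def mult.left_commute [of _ "of_real c"])
      also have "\<dots> = (\<integral>z. zak e f z * \<Phi> z \<partial>lborel)" using c' [rule_format, OF f \<Phi>] by simp
      finally show ?thesis using \<Phi> by (simp add: distr_of_def)
    qed
  qed
  \<comment> \<open>Uniqueness compares two continuous maps into the Hausdorff space
    \<open>Y\<close> on a dense subset, so the maps are viewed with the full codomain.\<close>
  have cont: "continuous_map X Y U" if "homeomorphic_map X (subtopology Y (tempered_Z e)) U" for U
    using homeomorphic_imp_continuous_map [OF that] by (rule continuous_map_into_fulltopology)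
  show ?thesis
  proof (rule ex1I [of _ T])
    show "T \<in> extensional tempered \<and> homeomorphic_map X (subtopology Y (tempered_Z e)) T \<and>
      (\<forall>f\<in>schwartz_space. T (distr_of f) = distr_of (zak e f))"
      using hom zak by (simp add: T_def)
    fix U assume U: "U \<in> extensional tempered \<and> homeomorphic_map X (subtopology Y (tempered_Z e)) U \<and>
      (\<forall>f\<in>schwartz_space. U (distr_of f) = distr_of (zak e f))"
    then have hU: "homeomorphic_map X (subtopology Y (tempered_Z e)) U" by blast
    show "U = T"
    proof (rule extensionalityI [of _ tempered])
      show "U u = T u" if "u \<in> tempered" for u
      proof (rule forall_in_closure_of_eq [OF _ Y(2) cont [OF hU] cont [OF hom]])
        show "u \<in> X closure_of (distr_of ` schwartz_space)" using dense that by blast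
        show "U v = T v" if "v \<in> distr_of ` schwartz_space" for v using that U zak by auto
      qed
      show "U \<in> extensional tempered" using U by blast
      show "T \<in> extensional tempered" by (simp add: T_def)
    qed
  qed
qed

end

section \<open>Density of Schwartz functions\<close>

text \<open>On the segment from \<open>y\<close> to \<open>y + h\<close> the weight changes by at
  most the factor \<open>(1 + norm h) ^ M\<close>. The gradient bound given by the norm of order
  \<open>Suc M\<close> therefore holds with the weight at \<open>y\<close>.\<close>

lemma schwartz_lipschitz:
  fixes \<phi> :: "'a::euclidean_space \<Rightarrow> complex"
  assumes \<phi>: "\<phi> \<in> schwartz_space" and bs: "bs \<in> lists Basis" "length bs \<le> M"
  shows "(1 + norm y) ^ M * cmod (partial_derivs bs \<phi> y - partial_derivs bs \<phi> (y + h))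
    \<le> real DIM('a) * norm h * (1 + norm h) ^ M * schwartz_norm (Suc M) \<phi>"
proof -
  define w where "w = (1 + norm y) ^ M"
  let ?f = "partial_derivs bs \<phi>"
  let ?A = "(1 + norm h) ^ M * schwartz_norm (Suc M) \<phi> / w"
  have w: "0 < w" by (simp add: w_def add_pos_nonneg)
  have "cmod (?f y - ?f (y + h)) \<le> DIM('a) * ?A * norm (y - (y + h))"
  proof (rule smooth_lipschitz [OF partial_derivs_smooth [OF schwartz_smooth [OF \<phi>] bs(1)] convex_closed_segment])
    fix z b assume z: "z \<in> closed_segment (y + h) y" and b: "b \<in> (Basis :: 'a set)"
    have zy: "norm (z - y) \<le> norm h"
      using segment_bound(2) [of z "y + h" y] z by (simp add: norm_minus_commute)
    have "w \<le> (1 + norm (z - y)) ^ M * (1 + norm z) ^ M"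
      using norm_weight_divide [of y M "z - y"] by (simp add: w_def)
    also have "\<dots> \<le> (1 + norm h) ^ M * (1 + norm z) ^ M" using zy by (intro mult_right_mono power_mono) auto
    finally have "w * cmod (partial_derivs (b # bs) \<phi> z) \<le> (1 + norm h) ^ M * (1 + norm z) ^ M * cmod (partial_derivs (b # bs) \<phi> z)"
      by (rule mult_right_mono) simp
    also have "\<dots> \<le> (1 + norm h) ^ M * schwartz_norm (Suc M) \<phi>"
      unfolding mult.assoc using bs b by (intro mult_left_mono schwartz_norm_upper \<phi>) auto
    finally show "cmod (partial_deriv b ?f z) \<le> ?A" using w by (simp add: pos_le_divide_eq mult.commute)
  qed auto
  then have "w * cmod (?f y - ?f (y + h)) \<le> w * (DIM('a) * ?A * norm h)"
    using w by (intro mult_left_mono) auto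
  also have "\<dots> = real DIM('a) * norm h * (1 + norm h) ^ M * schwartz_norm (Suc M) \<phi>"
    using w by (simp add: mult_ac)
  finally show ?thesis by (simp only: w_def)
qed

lemma schwartz_weight_integrable:
  fixes f :: "'a::euclidean_space \<Rightarrow> complex"
  assumes f: "f \<in> schwartz_space"
  shows "integrable lborel (\<lambda>x. (1 + norm x) ^ N * cmod (f x))"
proof -
  have [measurable]: "f \<in> borel_measurable borel" by (rule schwartz_measurable [OF f])
  have "integrable lborel (\<lambda>x. of_real ((1 + norm x) ^ N) * f x)"
  proof (rule integrable_decay)
    fix x
    show "(1 + norm x) ^ (2 * DIM('a)) * cmod (of_real ((1 + norm x) ^ N) * f x) \<le> schwartz_seminorm (2 * DIM('a) + N) [] f"
      using schwartz_seminorm_upper [OF f lists.Nil, of x "2 * DIM('a) + N"]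
      by (simp add: norm_mult norm_power power_add mult.assoc del: of_real_power of_real_add)
  qed measurable
  from integrable_norm [OF this] show ?thesis
    by (simp add: norm_mult norm_power del: of_real_power of_real_add)
qed

text \<open>The mollifier is a Gaussian of integral 1, so its support is not compact; its finite
  moments take over that role. It is even, which later turns a correlation into a
  convolution.\<close>

definition bump :: "'a::euclidean_space \<Rightarrow> complex" where
  "bump z = of_real (1 / (\<integral>x. gaussian (x :: 'a) \<partial>lborel)) * of_real (gaussian z)"

lemma bump_schwartz: "bump \<in> schwartz_space"
  unfolding bump_def [abs_def] by (rule schwartz_cmult(1) [OF gaussian_schwartz])

lemma bump_minus: "bump (- z) = bump z"
  by (simp add: bump_def gaussian_minus)

lemma integral_bump: "(\<integral>z. bump (z :: 'a::euclidean_space) \<partial>lborel) = 1"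
proof -
  have "0 < (\<integral>x. gaussian (x :: 'a) \<partial>lborel)"
    using gaussian_integral_nonzero [of "\<lambda>x::'a. x"] by (simp add: linear_id [unfolded id_def])
  then show ?thesis by (simp add: bump_def)
qed

text \<open>Dilating the argument of \<open>\<phi>\<close> instead of the kernel puts the
  derivatives on \<open>\<phi>\<close> and makes the comparison with \<open>\<phi>\<close>
  immediate. \<open>mollify_kernel\<close> gives the convolution form.\<close>

definition mollify :: "real \<Rightarrow> ('a::euclidean_space \<Rightarrow> complex) \<Rightarrow> 'a \<Rightarrow> complex" where
  "mollify \<delta> \<phi> y = (\<integral>z. bump z * \<phi> (y + \<delta> *\<^sub>R z) \<partial>lborel)"

lemma mollify_smooth:
  fixes \<phi> :: "'a::euclidean_space \<Rightarrow> complex"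
  assumes \<phi>: "\<phi> \<in> schwartz_space"
  shows "mollify \<delta> \<phi> \<in> smooth_space"
    and "bs \<in> lists Basis \<Longrightarrow> partial_derivs bs (mollify \<delta> \<phi>) = (\<lambda>y. \<integral>z. bump z * partial_derivs bs \<phi> (y + \<delta> *\<^sub>R z) \<partial>lborel)"
    and "bs \<in> lists Basis \<Longrightarrow> integrable lborel (\<lambda>z. bump z * partial_derivs bs \<phi> (y + \<delta> *\<^sub>R z))"
proof -
  let ?g = "\<lambda>z y. bump z * \<phi> (y + \<delta> *\<^sub>R z)"
  have sm: "(\<lambda>y. \<phi> (y + \<delta> *\<^sub>R z)) \<in> smooth_space" for z by (rule smooth_translate [OF schwartz_smooth [OF \<phi>]])
  have pd: "partial_derivs bs (?g z) = (\<lambda>y. bump z * partial_derivs bs \<phi> (y + \<delta> *\<^sub>R z))" if bs: "bs \<in> lists Basis" for bs z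
    unfolding partial_derivs_cmult [OF sm bs] partial_derivs_translate [OF schwartz_smooth [OF \<phi>] bs] ..
  have 1: "?g z \<in> smooth_space" for z by (rule smooth_cmult [OF sm])
  have cont: "continuous_on UNIV (\<lambda>z. bump z * partial_derivs bs \<phi> (y + \<delta> *\<^sub>R z))" if bs: "bs \<in> lists Basis" for bs y
    by (intro continuous_on_mult smooth_continuous schwartz_smooth bump_schwartz
        continuous_on_compose2 [OF partial_derivs_continuous [OF schwartz_smooth [OF \<phi>] bs, of UNIV]] continuous_intros) auto
  have 2: "(\<lambda>z. partial_derivs bs (?g z) y) \<in> borel_measurable lborel" if bs: "bs \<in> lists Basis" for bs y
    unfolding pd [OF bs] using borel_measurable_continuous_onI [OF cont [OF bs]] by simp
  have bd: "integrable lborel (\<lambda>z. cmod (bump z) * schwartz_seminorm 0 bs \<phi>)" for bs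
    by (intro integrable_mult_left integrable_norm schwartz_integrable bump_schwartz)
  have le: "cmod (bump z * partial_derivs bs \<phi> (y + \<delta> *\<^sub>R z)) \<le> cmod (bump z) * schwartz_seminorm 0 bs \<phi>"
    if bs: "bs \<in> lists Basis" for bs y z
    using schwartz_seminorm_upper [OF \<phi> bs, of "y + \<delta> *\<^sub>R z" 0] by (simp add: norm_mult mult_left_mono)
  have 3: "\<exists>a. integrable lborel a \<and> (\<forall>z\<in>space lborel. \<forall>y. norm y \<le> r \<longrightarrow> cmod (partial_derivs bs (?g z) y) \<le> a z)"
    if bs: "bs \<in> lists Basis" for bs r
    unfolding pd [OF bs] using bd le [OF bs] by blast
  note S = smooth_integral [of lborel ?g, OF 1 2 3]
  show "mollify \<delta> \<phi> \<in> smooth_space" using S(1) by (simp add: mollify_def [abs_def])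
  assume bs: "bs \<in> lists Basis"
  from S(2) [OF _ _ bs] show "partial_derivs bs (mollify \<delta> \<phi>) = (\<lambda>y. \<integral>z. bump z * partial_derivs bs \<phi> (y + \<delta> *\<^sub>R z) \<partial>lborel)"
    by (simp add: mollify_def [abs_def] pd [OF bs])
  show "integrable lborel (\<lambda>z. bump z * partial_derivs bs \<phi> (y + \<delta> *\<^sub>R z))"
    by (rule integrable_dominated [OF bd _ le [OF bs]]) (use borel_measurable_continuous_onI [OF cont [OF bs]] in simp)
qed

text \<open>The difference is an integral of increments
  \<open>\<phi> y - \<phi> (y + \<delta> *\<^sub>R z)\<close> against a kernel of integral 1.
  \<open>schwartz_lipschitz\<close> bounds them with one factor \<delta> and one more derivative;
  the power of \<open>1 + norm z\<close> is integrated as a moment of the kernel.\<close>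

lemma mollify_error:
  fixes M :: nat
  shows "\<exists>K\<ge>0. \<forall>\<delta>. 0 \<le> \<delta> \<longrightarrow> \<delta> \<le> 1 \<longrightarrow> (\<forall>\<phi>\<in>(schwartz_space :: ('a::euclidean_space \<Rightarrow> complex) set).
    mollify \<delta> \<phi> \<in> schwartz_space \<and>
    schwartz_norm M (\<lambda>y. \<phi> y - mollify \<delta> \<phi> y) \<le> \<delta> * K * schwartz_norm (Suc M) \<phi>)"
proof -
  define J where "J = (\<lambda>M. \<integral>z. (1 + norm z) ^ Suc M * cmod (bump (z :: 'a)) \<partial>lborel)"
  have J: "0 \<le> J M" for M unfolding J_def by (rule Bochner_Integration.integral_nonneg) simp
  have est: "(1 + norm y) ^ M * cmod (partial_derivs bs (\<lambda>y. \<phi> y - mollify \<delta> \<phi> y) y)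
      \<le> \<delta> * (real DIM('a) * J M) * schwartz_norm (Suc M) \<phi>"
    if \<delta>: "0 \<le> \<delta>" "\<delta> \<le> 1" and \<phi>: "\<phi> \<in> schwartz_space" and bs: "bs \<in> lists Basis" "length bs \<le> M"
    for \<delta> M bs y and \<phi> :: "'a \<Rightarrow> complex"
  proof -
    let ?p = "partial_derivs bs \<phi>" and ?w = "(1 + norm y) ^ M"
    have "partial_derivs bs (\<lambda>y. \<phi> y - mollify \<delta> \<phi> y) y
        = (\<integral>z. bump (z :: 'a) * ?p y \<partial>lborel) - (\<integral>z. bump z * ?p (y + \<delta> *\<^sub>R z) \<partial>lborel)"
      by (simp add: partial_derivs_diff schwartz_smooth [OF \<phi>] mollify_smooth [OF \<phi>] bs integral_bump)
    also have "\<dots> = (\<integral>z. bump z * (?p y - ?p (y + \<delta> *\<^sub>R z)) \<partial>lborel)"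
      by (simp add: right_diff_distrib mollify_smooth(3) [OF \<phi> bs(1)] schwartz_integrable bump_schwartz)
    finally have "?w * cmod (partial_derivs bs (\<lambda>y. \<phi> y - mollify \<delta> \<phi> y) y)
        = cmod (\<integral>z. of_real ?w * (bump z * (?p y - ?p (y + \<delta> *\<^sub>R z))) \<partial>lborel)"
      by (simp add: norm_mult norm_power del: of_real_power of_real_add)
    also have "\<dots> \<le> (\<integral>z. (\<delta> * real DIM('a) * schwartz_norm (Suc M) \<phi>) * ((1 + norm z) ^ Suc M * cmod (bump (z :: 'a))) \<partial>lborel)"
    proof (rule norm_integral_le)
      show "integrable lborel (\<lambda>z. (\<delta> * real DIM('a) * schwartz_norm (Suc M) \<phi>) * ((1 + norm z) ^ Suc M * cmod (bump (z :: 'a))))"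
        by (intro integrable_mult_right schwartz_weight_integrable bump_schwartz)
      fix z :: 'a
      have dz: "\<delta> * norm z \<le> norm z" using \<delta> mult_right_mono [of \<delta> 1 "norm z"] by simp
      have "?w * cmod (?p y - ?p (y + \<delta> *\<^sub>R z))
          \<le> real DIM('a) * norm (\<delta> *\<^sub>R z) * (1 + norm (\<delta> *\<^sub>R z)) ^ M * schwartz_norm (Suc M) \<phi>"
        by (rule schwartz_lipschitz [OF \<phi> bs])
      also have "\<dots> = real DIM('a) * (\<delta> * norm z) * (1 + \<delta> * norm z) ^ M * schwartz_norm (Suc M) \<phi>" using \<delta> by simp
      also have "\<dots> \<le> real DIM('a) * (\<delta> * (1 + norm z)) * (1 + norm z) ^ M * schwartz_norm (Suc M) \<phi>"
        using dz \<delta> by (intro mult_mono mult_left_mono mult_right_mono power_mono schwartz_norm_nonneg \<phi> mult_nonneg_nonneg) auto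
      also have "\<dots> = (\<delta> * real DIM('a) * schwartz_norm (Suc M) \<phi>) * (1 + norm z) ^ Suc M" by simp
      finally have "?w * cmod (?p y - ?p (y + \<delta> *\<^sub>R z)) * cmod (bump z)
          \<le> (\<delta> * real DIM('a) * schwartz_norm (Suc M) \<phi>) * (1 + norm z) ^ Suc M * cmod (bump z)"
        by (rule mult_right_mono) simp
      then show "cmod (of_real ?w * (bump z * (?p y - ?p (y + \<delta> *\<^sub>R z))))
          \<le> (\<delta> * real DIM('a) * schwartz_norm (Suc M) \<phi>) * ((1 + norm z) ^ Suc M * cmod (bump z))"
        by (simp add: norm_mult norm_power mult_ac del: of_real_power of_real_add)
    qed
    finally show ?thesis unfolding integral_mult_right_zero J_def by (simp only: mult_ac)
  qed
  have mem: "mollify \<delta> \<phi> \<in> schwartz_space" if \<delta>: "0 \<le> \<delta>" "\<delta> \<le> 1" and \<phi>: "\<phi> \<in> schwartz_space"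
    for \<delta> and \<phi> :: "'a \<Rightarrow> complex"
  proof -
    have "(\<lambda>y. \<phi> y - mollify \<delta> \<phi> y) \<in> schwartz_space"
    proof (rule schwartz_spaceI [OF smooth_diff [OF schwartz_smooth [OF \<phi>] mollify_smooth(1) [OF \<phi>]]])
      fix bs :: "'a list" and N assume bs: "bs \<in> lists Basis"
      let ?M = "max N (length bs)"
      have "(1 + norm y) ^ N * cmod (partial_derivs bs (\<lambda>y. \<phi> y - mollify \<delta> \<phi> y) y)
          \<le> \<delta> * (real DIM('a) * J ?M) * schwartz_norm (Suc ?M) \<phi>" for y
      proof (rule order_trans [OF mult_right_mono est [OF \<delta> \<phi> bs]])
        show "(1 + norm y) ^ N \<le> (1 + norm y) ^ ?M" by (rule power_increasing) auto
      qed auto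
      then show "\<exists>C. \<forall>y. (1 + norm y) ^ N * cmod (partial_derivs bs (\<lambda>y. \<phi> y - mollify \<delta> \<phi> y) y) \<le> C" by blast
    qed
    from schwartz_diff(1) [OF \<phi> this] show ?thesis by simp
  qed
  let ?K = "real (card (multi_indices TYPE('a) M)) * (real DIM('a) * J M)"
  have "schwartz_norm M (\<lambda>y. \<phi> y - mollify \<delta> \<phi> y) \<le> \<delta> * ?K * schwartz_norm (Suc M) \<phi>"
    if \<delta>: "0 \<le> \<delta>" "\<delta> \<le> 1" and \<phi>: "\<phi> \<in> schwartz_space" for \<delta> and \<phi> :: "'a \<Rightarrow> complex"
  proof -
    have "schwartz_norm M (\<lambda>y. \<phi> y - mollify \<delta> \<phi> y) \<le> real (card (multi_indices TYPE('a) M)) * (\<delta> * (real DIM('a) * J M) * schwartz_norm (Suc M) \<phi>)"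
      by (rule schwartz_norm_least [OF est [OF \<delta> \<phi>]])
    then show ?thesis by (simp add: mult_ac)
  qed
  with mem J show ?thesis by (intro exI [of _ ?K]) simp
qed

lemma schwartz_scale:
  fixes \<phi> :: "'a::euclidean_space \<Rightarrow> complex"
  assumes \<phi>: "\<phi> \<in> schwartz_space" and s: "s \<noteq> 0"
  shows "(\<lambda>z. \<phi> (s *\<^sub>R z)) \<in> schwartz_space"
proof (rule schwartz_spaceI)
  have bl: "bounded_linear (\<lambda>z :: 'a. s *\<^sub>R z)" by (rule bounded_linear_scaleR_right)
  show "(\<lambda>z. \<phi> (s *\<^sub>R z)) \<in> smooth_space" using smooth_affine [OF schwartz_smooth [OF \<phi>] bl, of 0] by simp
  fix bs :: "'a list" and N assume bs: "bs \<in> lists Basis"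
  let ?n = "length bs" and ?f = "\<lambda>z. \<phi> (s *\<^sub>R z)"
  obtain K where K: "\<forall>v l bs z. \<forall>\<Phi>\<in>(schwartz_space :: ('a \<Rightarrow> complex) set). bs \<in> lists Basis \<longrightarrow> length bs \<le> ?n \<longrightarrow>
     (1 + norm (s *\<^sub>R z + l)) ^ N * cmod (partial_derivs bs (exp_twist v (\<lambda>z. s *\<^sub>R z) l \<Phi>) z)
       \<le> K * (1 + norm v) ^ ?n * schwartz_norm (N + ?n) \<Phi>"
    using exp_twist_bound [OF bl, of ?n N] by (elim exE conjE) (rule that)
  have tw: "exp_twist 0 (\<lambda>z. s *\<^sub>R z) 0 \<phi> = ?f" by (simp add: exp_twist_def)
  have "(1 + norm z) ^ N * cmod (partial_derivs bs ?f z) \<le> (1 + 1 / \<bar>s\<bar>) ^ N * (K * schwartz_norm (N + ?n) \<phi>)" for z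
  proof -
    have "1 + norm z \<le> (1 + 1 / \<bar>s\<bar>) * (1 + norm (s *\<^sub>R z))" using s by (simp add: field_simps)
    then have "(1 + norm z) ^ N \<le> (1 + 1 / \<bar>s\<bar>) ^ N * (1 + norm (s *\<^sub>R z)) ^ N"
      unfolding power_mult_distrib [symmetric] by (intro power_mono) auto
    then have "(1 + norm z) ^ N * cmod (partial_derivs bs ?f z)
        \<le> (1 + 1 / \<bar>s\<bar>) ^ N * ((1 + norm (s *\<^sub>R z)) ^ N * cmod (partial_derivs bs ?f z))"
      unfolding mult.assoc [symmetric] by (rule mult_right_mono) simp
    also have "\<dots> \<le> (1 + 1 / \<bar>s\<bar>) ^ N * (K * schwartz_norm (N + ?n) \<phi>)"
      using K [rule_format, OF \<phi> bs order_refl, of z 0 0] unfolding tw by (intro mult_left_mono) auto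
    finally show ?thesis .
  qed
  then show "\<exists>C. \<forall>z. (1 + norm z) ^ N * cmod (partial_derivs bs ?f z) \<le> C" by blast
qed

text \<open>Substituting \<open>w = y + \<delta> *\<^sub>R z\<close> puts the dilation on the
  kernel. The Jacobian is the constant \<open>c\<close>, and evenness of the kernel allows
  \<open>y - w\<close> in place of \<open>w - y\<close>.\<close>

lemma mollify_kernel:
  assumes \<delta>: "0 < \<delta>"
  shows "\<exists>\<theta>\<in>(schwartz_space :: ('a::euclidean_space \<Rightarrow> complex) set). (\<forall>x. \<theta> (- x) = \<theta> x) \<and>
    (\<forall>\<phi>\<in>schwartz_space. \<forall>y. mollify \<delta> \<phi> y = (\<integral>w. \<phi> w * \<theta> (y - w) \<partial>lborel))"
proof -
  have L: "linear (\<lambda>z :: 'a. \<delta> *\<^sub>R z)" "inj (\<lambda>z :: 'a. \<delta> *\<^sub>R z)"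
    using \<delta> by (auto simp: bounded_linear_scaleR_right bounded_linear.linear intro: injI)
  obtain c where c: "0 < c" "\<And>g :: 'a \<Rightarrow> complex. g \<in> schwartz_space \<Longrightarrow> (\<integral>x. g x \<partial>lborel) = of_real c * (\<integral>t. g (\<delta> *\<^sub>R t) \<partial>lborel)"
    using linear_change_of_variables [OF L] by blast
  define \<theta> :: "'a \<Rightarrow> complex" where "\<theta> x = of_real (1 / c) * bump ((1 / \<delta>) *\<^sub>R x)" for x
  have b: "(\<lambda>x :: 'a. bump ((1 / \<delta>) *\<^sub>R x)) \<in> schwartz_space" using \<delta> by (intro schwartz_scale bump_schwartz) simp
  have \<theta>: "\<theta> \<in> schwartz_space" unfolding \<theta>_def [abs_def] by (rule schwartz_cmult(1) [OF b])
  have sym: "\<theta> (- x) = \<theta> x" for x by (simp add: \<theta>_def bump_minus)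
  have "mollify \<delta> \<phi> y = (\<integral>w. \<phi> w * \<theta> (y - w) \<partial>lborel)" if \<phi>: "\<phi> \<in> schwartz_space" for \<phi> y
  proof -
    have [measurable]: "\<phi> \<in> borel_measurable borel" "\<theta> \<in> borel_measurable borel"
      by (rule schwartz_measurable [OF \<phi>], rule schwartz_measurable [OF \<theta>])
    have tr: "(\<lambda>w. \<phi> (y + w)) \<in> schwartz_space" using schwartz_translate [OF \<phi>, of y] by (simp only: add.commute)
    have "(\<integral>w. \<phi> w * \<theta> (y - w) \<partial>lborel) = (\<integral>w. \<phi> w * \<theta> (w - y) \<partial>lborel)"
      using sym [of "_ - y"] by simp
    also have "\<dots> = (\<integral>w. \<phi> (w + y) * \<theta> (w + y - y) \<partial>lborel)"
      by (rule integral_translate [symmetric, of "\<lambda>w. \<phi> w * \<theta> (w - y)"]) measurable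
    also have "\<dots> = (\<integral>w. of_real (1 / c) * (bump ((1 / \<delta>) *\<^sub>R w) * \<phi> (y + w)) \<partial>lborel)"
      by (simp add: \<theta>_def mult_ac add.commute)
    also have "\<dots> = of_real (1 / c) * (\<integral>w. bump ((1 / \<delta>) *\<^sub>R w) * \<phi> (y + w) \<partial>lborel)"
      by (simp only: integral_mult_right_zero)
    also have "\<dots> = mollify \<delta> \<phi> y"
      unfolding c(2) [OF schwartz_times [OF b tr]] using \<delta> c(1) by (simp add: mollify_def)
    finally show ?thesis by simp
  qed
  with \<theta> sym show ?thesis by blast
qed

text \<open>Coordinates are rounded down to multiples of \<open>h\<close> divided by the dimension,
  so that the coordinate errors add up to at most \<open>h\<close>. The map yields the nodes of a
  Riemann sum as the values of a step function.\<close>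

lemma grid_rounding:
  fixes R h :: real
  assumes h: "0 < h"
  shows "\<exists>r :: 'a::euclidean_space \<Rightarrow> 'a. r \<in> borel_measurable borel \<and> finite (r ` cball 0 R) \<and> (\<forall>w. norm (r w - w) \<le> h)"
proof -
  define a where "a = h / DIM('a)"
  have a: "0 < a" using h by (simp add: a_def)
  define r :: "'a \<Rightarrow> 'a" where "r w = (\<Sum>b\<in>Basis. (a * of_int \<lfloor>(w \<bullet> b) / a\<rfloor>) *\<^sub>R b)" for w
  have rb: "r w \<bullet> b = a * of_int \<lfloor>(w \<bullet> b) / a\<rfloor>" if "b \<in> Basis" for w b using that by (simp add: r_def)
  have "r \<in> borel_measurable borel" unfolding r_def [abs_def] by measurable
  moreover have "norm (r w - w) \<le> h" for w
  proof -
    have "norm (r w - w) \<le> (\<Sum>b\<in>(Basis :: 'a set). \<bar>(r w - w) \<bullet> b\<bar>)" by (rule norm_le_l1)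
    also have "\<dots> \<le> (\<Sum>b\<in>(Basis :: 'a set). a)"
    proof (rule sum_mono)
      fix b :: 'a assume b: "b \<in> Basis"
      define t where "t = (w \<bullet> b) / a"
      have "w \<bullet> b = a * t" using a by (simp add: t_def)
      then have "(r w - w) \<bullet> b = a * (of_int \<lfloor>t\<rfloor> - t)" using rb [OF b, of w] by (simp add: inner_diff_left t_def right_diff_distrib)
      moreover have "\<bar>of_int \<lfloor>t\<rfloor> - t\<bar> \<le> 1" by linarith
      ultimately show "\<bar>(r w - w) \<bullet> b\<bar> \<le> a" using a mult_left_mono [of "\<bar>of_int \<lfloor>t\<rfloor> - t\<bar>" 1 a] by (simp add: abs_mult)
    qed
    also have "\<dots> = h" by (simp add: a_def)
    finally show ?thesis .
  qed
  moreover have "finite (r ` cball 0 R)"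
  proof -
    \<comment> \<open>The extra 1 allows for rounding down at the negative end.\<close>
    define m where "m = \<lceil>R / a\<rceil> + 1"
    have "r ` cball 0 R \<subseteq> (\<lambda>n. \<Sum>b\<in>Basis. (a * of_int (n b)) *\<^sub>R b) ` PiE Basis (\<lambda>_. {- m..m})"
    proof
      fix k assume "k \<in> r ` cball 0 R"
      then obtain w where w: "norm w \<le> R" "k = r w" by auto
      have "\<lfloor>(w \<bullet> b) / a\<rfloor> \<in> {- m..m}" if b: "b \<in> Basis" for b
      proof -
        have "\<bar>w \<bullet> b\<bar> \<le> R" using Basis_le_norm [OF b, of w] w(1) by linarith
        then have "\<bar>(w \<bullet> b) / a\<bar> \<le> R / a" using a by (simp add: abs_divide divide_right_mono)
        then show ?thesis unfolding m_def atLeastAtMost_iff by linarith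
      qed
      then show "k \<in> (\<lambda>n. \<Sum>b\<in>Basis. (a * of_int (n b)) *\<^sub>R b) ` PiE Basis (\<lambda>_. {- m..m})"
        unfolding w(2) r_def by (intro image_eqI [where x = "\<lambda>b\<in>Basis. \<lfloor>(w \<bullet> b) / a\<rfloor>"]) auto
    qed
    then show ?thesis by (rule finite_subset) (intro finite_imageI finite_PiE finite_Basis; simp)
  qed
  ultimately show ?thesis by blast
qed

text \<open>A Riemann sum is the integral of a step function: the weight of a node is the measure of
  the points of the ball that are rounded to it. Sum and integral can thus be compared under one
  integral sign.\<close>

lemma integral_grid:
  fixes r :: "'a::euclidean_space \<Rightarrow> 'a" and H :: "'a \<Rightarrow> complex"
  assumes r: "r \<in> borel_measurable borel" "finite (r ` cball 0 R)"
  shows "has_bochner_integral lborel (\<lambda>w. indicator (cball 0 R) w *\<^sub>R H (r w))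
    (\<Sum>k\<in>r ` cball 0 R. measure lborel (cball 0 R \<inter> r -` {k}) *\<^sub>R H k)"
proof -
  let ?A = "\<lambda>k. cball 0 R \<inter> r -` {k}"
  have A: "?A k \<in> sets borel" for k using measurable_sets [OF r(1), of "{k}"] by simp
  have fin: "emeasure lborel (?A k) < \<infinity>" for k
    by (rule le_less_trans [OF emeasure_mono emeasure_lborel_cball_finite]) auto
  have eq: "indicator (cball 0 R) w *\<^sub>R H (r w) = (\<Sum>k\<in>r ` cball 0 R. indicator (?A k) w *\<^sub>R H k)" for w
  proof (cases "w \<in> cball 0 R")
    case True
    have "(\<Sum>k\<in>r ` cball 0 R. indicator (?A k) w *\<^sub>R H k) = (\<Sum>k\<in>r ` cball 0 R. if k = r w then H k else 0)"
      using True by (intro sum.cong refl) (auto simp: indicator_def)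
    also have "\<dots> = H (r w)" using True r(2) by (subst sum.delta) auto
    finally show ?thesis using True by simp
  qed (auto simp: indicator_def)
  show ?thesis
    unfolding eq using A fin by (intro has_bochner_integral_sum has_bochner_integral_indicator) simp_all
qed

text \<open>The derivatives are put on the kernel this time, because the Riemann sums will only
  contain point values of \<open>\<phi>\<close>.\<close>

lemma
  fixes \<theta> \<phi> :: "'a::euclidean_space \<Rightarrow> complex"
  assumes \<theta>: "\<theta> \<in> schwartz_space" and \<phi>: "\<phi> \<in> schwartz_space"
  shows convolution_smooth: "(\<lambda>y. \<integral>w. \<phi> w * \<theta> (y - w) \<partial>lborel) \<in> smooth_space"
    and convolution_derivs: "bs \<in> lists Basis \<Longrightarrow> partial_derivs bs (\<lambda>y. \<integral>w. \<phi> w * \<theta> (y - w) \<partial>lborel) = (\<lambda>y. \<integral>w. \<phi> w * partial_derivs bs \<theta> (y - w) \<partial>lborel)"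
    and convolution_integrable: "bs \<in> lists Basis \<Longrightarrow> integrable lborel (\<lambda>w. \<phi> w * partial_derivs bs \<theta> (y - w))"
proof -
  let ?g = "\<lambda>w y. \<phi> w * \<theta> (y - w)"
  note s\<theta> = schwartz_smooth [OF \<theta>]
  have sm: "(\<lambda>y. \<theta> (y - w)) \<in> smooth_space" for w using smooth_translate [OF s\<theta>, of "- w"] by simp
  have pd: "partial_derivs bs (?g w) = (\<lambda>y. \<phi> w * partial_derivs bs \<theta> (y - w))" if bs: "bs \<in> lists Basis" for bs w
    using partial_derivs_translate [OF s\<theta> bs, of "- w"] by (simp add: partial_derivs_cmult [OF sm bs])
  have 1: "?g w \<in> smooth_space" for w by (rule smooth_cmult [OF sm])
  have cont: "continuous_on UNIV (\<lambda>w. \<phi> w * partial_derivs bs \<theta> (y - w))" if bs: "bs \<in> lists Basis" for bs y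
    by (intro continuous_on_mult smooth_continuous schwartz_smooth [OF \<phi>]
        continuous_on_compose2 [OF partial_derivs_continuous [OF s\<theta> bs, of UNIV]] continuous_intros) auto
  have 2: "(\<lambda>w. partial_derivs bs (?g w) y) \<in> borel_measurable lborel" if bs: "bs \<in> lists Basis" for bs y
    unfolding pd [OF bs] using borel_measurable_continuous_onI [OF cont [OF bs]] by simp
  have bd: "integrable lborel (\<lambda>w. cmod (\<phi> w) * schwartz_seminorm 0 bs \<theta>)" for bs
    by (intro integrable_mult_left integrable_norm schwartz_integrable \<phi>)
  have le: "cmod (\<phi> w * partial_derivs bs \<theta> (y - w)) \<le> cmod (\<phi> w) * schwartz_seminorm 0 bs \<theta>"
    if bs: "bs \<in> lists Basis" for bs y w
    using schwartz_seminorm_upper [OF \<theta> bs, of "y - w" 0] by (simp add: norm_mult mult_left_mono)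
  have 3: "\<exists>a. integrable lborel a \<and> (\<forall>w\<in>space lborel. \<forall>y. norm y \<le> r \<longrightarrow> cmod (partial_derivs bs (?g w) y) \<le> a w)"
    if bs: "bs \<in> lists Basis" for bs r
    unfolding pd [OF bs] using bd le [OF bs] by blast
  note S = smooth_integral [of lborel ?g, OF 1 2 3]
  show "(\<lambda>y. \<integral>w. \<phi> w * \<theta> (y - w) \<partial>lborel) \<in> smooth_space" by (rule S(1))
  assume bs: "bs \<in> lists Basis"
  from S(2) [OF _ _ bs] show "partial_derivs bs (\<lambda>y. \<integral>w. \<phi> w * \<theta> (y - w) \<partial>lborel) = (\<lambda>y. \<integral>w. \<phi> w * partial_derivs bs \<theta> (y - w) \<partial>lborel)"
    by (simp add: pd [OF bs])
  show "integrable lborel (\<lambda>w. \<phi> w * partial_derivs bs \<theta> (y - w))"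
    by (rule integrable_dominated [OF bd _ le [OF bs]]) (use borel_measurable_continuous_onI [OF cont [OF bs]] in simp)
qed

text \<open>The difference of products is split into an increment of the kernel and an increment of
  \<open>\<phi>\<close>, each estimated by \<open>schwartz_lipschitz\<close>. In \<open>N\<close>,
  the part \<open>M\<close> pays for moving the weight from \<open>y\<close> to \<open>w\<close>,
  and twice the dimension gives integrability in \<open>w\<close>.\<close>

lemma kernel_oscillation:
  fixes \<theta> \<phi> :: "'a::euclidean_space \<Rightarrow> complex"
  assumes \<theta>: "\<theta> \<in> schwartz_space" and \<phi>: "\<phi> \<in> schwartz_space"
    and bs: "bs \<in> lists Basis" "length bs \<le> M" and q: "norm q \<le> h" "h \<le> 1"
  defines "N \<equiv> M + 2 * DIM('a)"
  shows "(1 + norm y) ^ M * cmod (\<phi> w * partial_derivs bs \<theta> (y - w) - \<phi> (w + q) * partial_derivs bs \<theta> (y - (w + q)))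
    \<le> h * (real DIM('a) * 2 ^ M * (schwartz_norm (Suc M) \<theta> + 2 ^ N * schwartz_norm M \<theta>)) * schwartz_norm (Suc N) \<phi>
      * (1 / (1 + norm w) ^ (2 * DIM('a)))"
proof -
  let ?T = "partial_derivs bs \<theta>" and ?D = "real DIM('a)"
  define P where "P = (1 + norm w) ^ (2 * DIM('a))"
  have P: "0 < P" by (simp add: P_def add_pos_nonneg)
  have PN: "P * (1 + norm w) ^ M = (1 + norm w) ^ N" by (simp add: P_def N_def power_add)
  have h0: "0 \<le> h" using q(1) norm_ge_zero [of q] by linarith
  have q1: "(1 + norm q) ^ k \<le> 2 ^ k" for k using q by (intro power_mono) auto
  have n\<theta>: "0 \<le> schwartz_norm k \<theta>" and n\<phi>: "0 \<le> schwartz_norm k \<phi>" for k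
    by (rule schwartz_norm_nonneg [OF \<theta>], rule schwartz_norm_nonneg [OF \<phi>])
  have lip\<theta>: "(1 + norm (y - w)) ^ M * cmod (?T (y - w) - ?T (y - (w + q))) \<le> ?D * h * 2 ^ M * schwartz_norm (Suc M) \<theta>"
  proof -
    have "(1 + norm (y - w)) ^ M * cmod (?T (y - w) - ?T (y - w + (- q)))
        \<le> ?D * norm (- q) * (1 + norm (- q)) ^ M * schwartz_norm (Suc M) \<theta>"
      by (rule schwartz_lipschitz [OF \<theta> bs])
    also have "\<dots> \<le> ?D * h * 2 ^ M * schwartz_norm (Suc M) \<theta>"
      using q h0 q1 [of M] by (intro mult_right_mono mult_mono n\<theta>) auto
    finally show ?thesis by (simp add: diff_diff_eq)
  qed
  have lip\<phi>: "(1 + norm w) ^ N * cmod (\<phi> w - \<phi> (w + q)) \<le> ?D * h * 2 ^ N * schwartz_norm (Suc N) \<phi>"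
  proof -
    have "(1 + norm w) ^ N * cmod (\<phi> w - \<phi> (w + q)) \<le> ?D * norm q * (1 + norm q) ^ N * schwartz_norm (Suc N) \<phi>"
      using schwartz_lipschitz [OF \<phi> lists.Nil, of N w q] by simp
    also have "\<dots> \<le> ?D * h * 2 ^ N * schwartz_norm (Suc N) \<phi>"
      using q h0 q1 [of N] by (intro mult_right_mono mult_mono n\<phi>) auto
    finally show ?thesis .
  qed
  have first: "P * (1 + norm y) ^ M * cmod (\<phi> w * (?T (y - w) - ?T (y - (w + q))))
      \<le> h * (?D * 2 ^ M * schwartz_norm (Suc M) \<theta>) * schwartz_norm (Suc N) \<phi>"
  proof -
    have "P * (1 + norm y) ^ M * cmod (\<phi> w * (?T (y - w) - ?T (y - (w + q))))
        \<le> P * ((1 + norm w) ^ M * (1 + norm (y - w)) ^ M) * cmod (\<phi> w * (?T (y - w) - ?T (y - (w + q))))"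
      using P norm_weight_power_mult [of w "y - w" M] by (intro mult_right_mono mult_left_mono) auto
    also have "\<dots> = ((1 + norm w) ^ N * cmod (\<phi> w)) * ((1 + norm (y - w)) ^ M * cmod (?T (y - w) - ?T (y - (w + q))))"
      by (simp add: PN [symmetric] norm_mult)
    also have "\<dots> \<le> schwartz_norm (Suc N) \<phi> * (?D * h * 2 ^ M * schwartz_norm (Suc M) \<theta>)"
      using schwartz_norm_upper [OF \<phi> lists.Nil, of "Suc N" N w] by (intro mult_mono lip\<theta> n\<phi>) auto
    finally show ?thesis by (simp add: mult_ac)
  qed
  have second: "P * (1 + norm y) ^ M * cmod ((\<phi> w - \<phi> (w + q)) * ?T (y - (w + q)))
      \<le> h * (?D * 2 ^ M * (2 ^ N * schwartz_norm M \<theta>)) * schwartz_norm (Suc N) \<phi>"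
  proof -
    have "(1 + norm y) ^ M \<le> (1 + norm (w + q)) ^ M * (1 + norm (y - (w + q))) ^ M"
      using norm_weight_power_mult [of "w + q" "y - (w + q)" M] by simp
    also have "\<dots> \<le> ((1 + norm w) ^ M * 2 ^ M) * (1 + norm (y - (w + q))) ^ M"
      using norm_weight_power_mult [of w q M] q1 [of M]
      by (intro mult_right_mono order_trans [OF norm_weight_power_mult [of w q M]] mult_left_mono) auto
    finally have "P * (1 + norm y) ^ M * cmod ((\<phi> w - \<phi> (w + q)) * ?T (y - (w + q)))
        \<le> P * (((1 + norm w) ^ M * 2 ^ M) * (1 + norm (y - (w + q))) ^ M) * cmod ((\<phi> w - \<phi> (w + q)) * ?T (y - (w + q)))"
      using P by (intro mult_right_mono mult_left_mono) auto
    also have "\<dots> = 2 ^ M * ((1 + norm w) ^ N * cmod (\<phi> w - \<phi> (w + q))) * ((1 + norm (y - (w + q))) ^ M * cmod (?T (y - (w + q))))"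
      by (simp add: PN [symmetric] norm_mult)
    also have "\<dots> \<le> 2 ^ M * (?D * h * 2 ^ N * schwartz_norm (Suc N) \<phi>) * schwartz_norm M \<theta>"
      using h0 by (intro mult_mono mult_left_mono lip\<phi> schwartz_norm_upper \<theta> bs mult_nonneg_nonneg n\<phi>) auto
    finally show ?thesis by (simp add: mult_ac)
  qed
  have "\<phi> w * ?T (y - w) - \<phi> (w + q) * ?T (y - (w + q))
      = \<phi> w * (?T (y - w) - ?T (y - (w + q))) + (\<phi> w - \<phi> (w + q)) * ?T (y - (w + q))" by (simp add: algebra_simps)
  then have "P * (1 + norm y) ^ M * cmod (\<phi> w * ?T (y - w) - \<phi> (w + q) * ?T (y - (w + q)))
      \<le> P * (1 + norm y) ^ M * (cmod (\<phi> w * (?T (y - w) - ?T (y - (w + q)))) + cmod ((\<phi> w - \<phi> (w + q)) * ?T (y - (w + q))))"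
    using P by (intro mult_left_mono) (simp_all add: norm_triangle_ineq)
  also have "\<dots> \<le> h * (?D * 2 ^ M * schwartz_norm (Suc M) \<theta>) * schwartz_norm (Suc N) \<phi>
      + h * (?D * 2 ^ M * (2 ^ N * schwartz_norm M \<theta>)) * schwartz_norm (Suc N) \<phi>"
    unfolding distrib_left by (rule add_mono [OF first second])
  also have "\<dots> = h * (?D * 2 ^ M * (schwartz_norm (Suc M) \<theta> + 2 ^ N * schwartz_norm M \<theta>)) * schwartz_norm (Suc N) \<phi>"
    by (simp add: algebra_simps)
  finally show ?thesis using P unfolding P_def [symmetric]
    by (simp add: pos_le_divide_eq mult_ac)
qed

text \<open>One further power of the weight is spent: for \<open>R \<le> norm w\<close> it gains the
  factor \<open>1 / (1 + R)\<close>.\<close>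

lemma kernel_tail:
  fixes \<theta> \<phi> :: "'a::euclidean_space \<Rightarrow> complex"
  assumes \<theta>: "\<theta> \<in> schwartz_space" and \<phi>: "\<phi> \<in> schwartz_space"
    and bs: "bs \<in> lists Basis" "length bs \<le> M" and w: "R \<le> norm w" "0 \<le> R"
  defines "N \<equiv> M + 2 * DIM('a)"
  shows "(1 + norm y) ^ M * cmod (\<phi> w * partial_derivs bs \<theta> (y - w))
    \<le> 1 / (1 + R) * schwartz_norm M \<theta> * schwartz_norm (Suc N) \<phi> * (1 / (1 + norm w) ^ (2 * DIM('a)))"
proof -
  let ?T = "partial_derivs bs \<theta>"
  define P where "P = (1 + norm w) ^ (2 * DIM('a))"
  have P: "0 < P" by (simp add: P_def add_pos_nonneg)
  have "(1 + R) * P * ((1 + norm y) ^ M * cmod (\<phi> w * ?T (y - w)))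
      \<le> (1 + norm w) * P * (((1 + norm w) ^ M * (1 + norm (y - w)) ^ M) * cmod (\<phi> w * ?T (y - w)))"
    using P w norm_weight_power_mult [of w "y - w" M] by (intro mult_mono mult_right_mono) auto
  also have "\<dots> = ((1 + norm w) ^ Suc N * cmod (\<phi> w)) * ((1 + norm (y - w)) ^ M * cmod (?T (y - w)))"
    by (simp add: P_def N_def power_add norm_mult)
  also have "\<dots> \<le> schwartz_norm (Suc N) \<phi> * schwartz_norm M \<theta>"
    using schwartz_norm_upper [OF \<phi> lists.Nil, of "Suc N" "Suc N" w]
    by (intro mult_mono schwartz_norm_upper [OF \<theta> bs] schwartz_norm_nonneg [OF \<phi>]) auto
  finally show ?thesis using P w unfolding P_def [symmetric]
    by (simp add: pos_le_divide_eq mult_ac)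
qed

text \<open>Nodes and weights are chosen before \<open>\<phi>\<close>, so the error is controlled by
  a norm of \<open>\<phi>\<close> alone. Inside the ball the oscillation of the integrand is small,
  outside it the integrand itself.\<close>

lemma convolution_riemann_sum:
  fixes \<theta> :: "'a::euclidean_space \<Rightarrow> complex" and \<eta> :: real
  assumes \<theta>: "\<theta> \<in> schwartz_space" and \<eta>: "0 < \<eta>"
  shows "\<exists>(F :: 'a set) (v :: 'a \<Rightarrow> real). finite F \<and> (\<forall>\<phi>\<in>schwartz_space.
    schwartz_norm M (\<lambda>y. (\<integral>w. \<phi> w * \<theta> (y - w) \<partial>lborel) - (\<Sum>k\<in>F. of_real (v k) * \<phi> k * \<theta> (y - k)))
      \<le> \<eta> * schwartz_norm (Suc (M + 2 * DIM('a))) \<phi>)"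
proof -
  let ?d = "2 * DIM('a)"
  let ?N = "M + ?d" and ?card = "real (card (multi_indices TYPE('a) M))"
  define I where "I = (\<integral>w. 1 / (1 + norm (w :: 'a)) ^ ?d \<partial>lborel)"
  have I: "0 \<le> I" unfolding I_def by (rule Bochner_Integration.integral_nonneg) simp
  define K where "K = real DIM('a) * 2 ^ M * (schwartz_norm (Suc M) \<theta> + 2 ^ ?N * schwartz_norm M \<theta>)"
  have n\<theta>: "0 \<le> schwartz_norm k \<theta>" for k by (rule schwartz_norm_nonneg [OF \<theta>])
  have K: "0 \<le> K" using n\<theta> by (simp add: K_def)
  \<comment> \<open>The error is multiplied by the integral \<open>I\<close> of the weight and by
    the number of lists in the norm; both are divided out in advance.\<close>
  define \<eta>' where "\<eta>' = \<eta> / (?card * I + 1)"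
  have \<eta>': "0 < \<eta>'" "?card * (\<eta>' * I) \<le> \<eta>"
  proof -
    have p: "0 < ?card * I + 1" using I by (simp add: add_nonneg_pos)
    then show "0 < \<eta>'" using \<eta> by (simp add: \<eta>'_def)
    have "\<eta> * (?card * I) \<le> \<eta> * (?card * I + 1)" using \<eta> by simp
    then show "?card * (\<eta>' * I) \<le> \<eta>" using p by (simp add: \<eta>'_def pos_divide_le_eq mult_ac)
  qed
  define h where "h = min 1 (\<eta>' / (K + 1))"
  have h: "0 < h" "h \<le> 1" "h * K \<le> \<eta>'"
  proof -
    show "0 < h" "h \<le> 1" using \<eta>' K by (auto simp: h_def)
    have "h * K \<le> \<eta>' / (K + 1) * (K + 1)" using \<eta>' K by (intro mult_mono) (auto simp: h_def)
    then show "h * K \<le> \<eta>'" using K by simp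
  qed
  \<comment> \<open>The radius at which \<open>1 / (1 + R)\<close> times the norm of the kernel is
    at most \<open>\<eta>'\<close>, as required for the tail.\<close>
  define R where "R = schwartz_norm M \<theta> / \<eta>'"
  have R: "0 \<le> R" "1 / (1 + R) * schwartz_norm M \<theta> \<le> \<eta>'"
    using \<eta>' n\<theta> [of M] by (simp_all add: R_def field_simps)
  obtain r :: "'a \<Rightarrow> 'a" where r: "r \<in> borel_measurable borel" "finite (r ` cball 0 R)" "\<And>w. norm (r w - w) \<le> h"
    using grid_rounding [OF h(1), of R] by blast
  define F where "F = r ` cball 0 R"
  define v where "v k = measure lborel (cball 0 R \<inter> r -` {k})" for k
  have "schwartz_norm M (\<lambda>y. (\<integral>w. \<phi> w * \<theta> (y - w) \<partial>lborel) - (\<Sum>k\<in>F. of_real (v k) * \<phi> k * \<theta> (y - k)))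
      \<le> \<eta> * schwartz_norm (Suc ?N) \<phi>" if \<phi>: "\<phi> \<in> schwartz_space" for \<phi>
  proof -
    let ?S = "schwartz_norm (Suc ?N) \<phi>"
    have S: "0 \<le> ?S" by (rule schwartz_norm_nonneg [OF \<phi>])
    have "(1 + norm y) ^ M * cmod (partial_derivs bs (\<lambda>y. (\<integral>w. \<phi> w * \<theta> (y - w) \<partial>lborel) - (\<Sum>k\<in>F. of_real (v k) * \<phi> k * \<theta> (y - k))) y)
        \<le> \<eta>' * ?S * I" if bs: "bs \<in> lists Basis" "length bs \<le> M" for bs y
    proof -
      let ?T = "partial_derivs bs \<theta>" and ?w = "(1 + norm y) ^ M"
      have sm: "(\<lambda>y. \<theta> (y - k)) \<in> smooth_space" for k using smooth_translate [OF schwartz_smooth [OF \<theta>], of "- k"] by simp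
      have pd: "partial_derivs bs (\<lambda>y. \<theta> (y - k)) = (\<lambda>y. ?T (y - k))" for k
        using partial_derivs_translate [OF schwartz_smooth [OF \<theta>] bs(1), of "- k"] by simp
      have "partial_derivs bs (\<lambda>y. (\<integral>w. \<phi> w * \<theta> (y - w) \<partial>lborel) - (\<Sum>k\<in>F. of_real (v k) * \<phi> k * \<theta> (y - k))) y
          = (\<integral>w. \<phi> w * ?T (y - w) \<partial>lborel) - (\<Sum>k\<in>F. of_real (v k) * \<phi> k * ?T (y - k))"
        by (simp add: partial_derivs_diff partial_derivs_sum partial_derivs_cmult convolution_smooth [OF \<theta> \<phi>]
            convolution_derivs [OF \<theta> \<phi>] smooth_sum smooth_cmult sm bs pd)
      also have "(\<Sum>k\<in>F. of_real (v k) * \<phi> k * ?T (y - k)) = (\<integral>w. indicator (cball 0 R) w *\<^sub>R (\<phi> (r w) * ?T (y - r w)) \<partial>lborel)"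
        using has_bochner_integral_integral_eq [OF integral_grid [OF r(1,2), of "\<lambda>k. \<phi> k * ?T (y - k)"]]
        by (simp add: F_def v_def scaleR_conv_of_real mult.assoc)
      also have "(\<integral>w. \<phi> w * ?T (y - w) \<partial>lborel) - \<dots>
          = (\<integral>w. \<phi> w * ?T (y - w) - indicator (cball 0 R) w *\<^sub>R (\<phi> (r w) * ?T (y - r w)) \<partial>lborel)"
        using integral_grid [OF r(1,2), of "\<lambda>k. \<phi> k * ?T (y - k)"]
        by (intro Bochner_Integration.integral_diff [symmetric] convolution_integrable [OF \<theta> \<phi> bs(1)])
           (auto simp: has_bochner_integral_iff)
      finally have "?w * cmod (partial_derivs bs (\<lambda>y. (\<integral>w. \<phi> w * \<theta> (y - w) \<partial>lborel) - (\<Sum>k\<in>F. of_real (v k) * \<phi> k * \<theta> (y - k))) y)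
          = cmod (\<integral>w. of_real ?w * (\<phi> w * ?T (y - w) - indicator (cball 0 R) w *\<^sub>R (\<phi> (r w) * ?T (y - r w))) \<partial>lborel)"
        by (simp add: norm_mult norm_power del: of_real_power of_real_add)
      also have "\<dots> \<le> (\<integral>w. (\<eta>' * ?S) * (1 / (1 + norm (w :: 'a)) ^ ?d) \<partial>lborel)"
      proof (rule norm_integral_le)
        show "integrable lborel (\<lambda>w. (\<eta>' * ?S) * (1 / (1 + norm (w :: 'a)) ^ ?d))"
          by (intro integrable_mult_right integrable_weight)
        fix w :: 'a
        have P: "0 \<le> 1 / (1 + norm w) ^ ?d" by simp
        have "?w * cmod (\<phi> w * ?T (y - w) - indicator (cball 0 R) w *\<^sub>R (\<phi> (r w) * ?T (y - r w)))
            \<le> \<eta>' * ?S * (1 / (1 + norm w) ^ ?d)"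
        proof (cases "w \<in> cball 0 R")
          case True
          have "?w * cmod (\<phi> w * ?T (y - w) - \<phi> (w + (r w - w)) * ?T (y - (w + (r w - w)))) \<le> h * K * ?S * (1 / (1 + norm w) ^ ?d)"
            unfolding K_def by (rule kernel_oscillation [OF \<theta> \<phi> bs r(3) h(2)])
          also have "\<dots> \<le> \<eta>' * ?S * (1 / (1 + norm w) ^ ?d)" by (intro mult_right_mono h(3) S P)
          finally show ?thesis using True by simp
        next
          case False
          then have "?w * cmod (\<phi> w * ?T (y - w)) \<le> 1 / (1 + R) * schwartz_norm M \<theta> * ?S * (1 / (1 + norm w) ^ ?d)"
            using R(1) by (intro kernel_tail [OF \<theta> \<phi> bs]) auto
          also have "\<dots> \<le> \<eta>' * ?S * (1 / (1 + norm w) ^ ?d)" by (intro mult_right_mono R(2) S P)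
          finally show ?thesis using False by simp
        qed
        then show "cmod (of_real ?w * (\<phi> w * ?T (y - w) - indicator (cball 0 R) w *\<^sub>R (\<phi> (r w) * ?T (y - r w))))
            \<le> (\<eta>' * ?S) * (1 / (1 + norm w) ^ ?d)"
          by (simp add: norm_mult norm_power del: of_real_power of_real_add)
      qed
      also have "\<dots> = \<eta>' * ?S * I" unfolding I_def by (simp only: integral_mult_right_zero)
      finally show ?thesis .
    qed
    then have "schwartz_norm M (\<lambda>y. (\<integral>w. \<phi> w * \<theta> (y - w) \<partial>lborel) - (\<Sum>k\<in>F. of_real (v k) * \<phi> k * \<theta> (y - k)))
        \<le> ?card * (\<eta>' * ?S * I)" by (rule schwartz_norm_least)
    also have "\<dots> = ?card * (\<eta>' * I) * ?S" by simp
    also have "\<dots> \<le> \<eta> * ?S" by (rule mult_right_mono [OF \<eta>'(2) S])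
    finally show ?thesis .
  qed
  then show ?thesis using r(2) unfolding F_def by blast
qed

lemma small_parameter:
  fixes X \<epsilon> :: real
  assumes X: "0 \<le> X" and \<epsilon>: "0 < \<epsilon>"
  shows "\<exists>d. 0 < d \<and> d \<le> 1 \<and> X * d \<le> \<epsilon>"
proof -
  define d where "d = min 1 (\<epsilon> / (X + 1))"
  have "X * d \<le> (X + 1) * (\<epsilon> / (X + 1))" using X \<epsilon> by (intro mult_mono) (auto simp: d_def)
  then have "X * d \<le> \<epsilon>" using X by simp
  moreover have "0 < d" "d \<le> 1" using X \<epsilon> by (auto simp: d_def)
  ultimately show ?thesis by blast
qed

text \<open>Three errors of size \<open>\<epsilon> / 3\<close>: mollifying \<open>\<phi>\<close>,
  replacing the mollification by a Riemann sum, and replacing the point values of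
  \<open>\<phi>\<close> in \<open>u\<close> of that sum by narrow averages. The order
  \<open>M\<close> is fixed before \<epsilon>, which makes the approximation uniform on bounded
  sets.\<close>

lemma tempered_approximation:
  fixes u :: "('a::euclidean_space \<Rightarrow> complex) \<Rightarrow> complex"
  assumes u: "u \<in> tempered"
  shows "\<exists>M. \<forall>\<epsilon>>0. \<exists>f\<in>schwartz_space. \<forall>\<phi>\<in>schwartz_space. cmod (u \<phi> - distr_of f \<phi>) \<le> \<epsilon> * schwartz_norm M \<phi>"
proof -
  obtain M C where C: "0 \<le> C" "\<And>f. f \<in> schwartz_space \<Longrightarrow> cmod (u f) \<le> C * schwartz_norm M f"
    using tempered_bound [OF u] by blast
  define N where "N = Suc (M + 2 * DIM('a))"
  obtain K where K: "0 \<le> K" and K': "\<forall>\<delta>. 0 \<le> \<delta> \<longrightarrow> \<delta> \<le> 1 \<longrightarrow> (\<forall>\<phi>\<in>(schwartz_space :: ('a \<Rightarrow> complex) set).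
    mollify \<delta> \<phi> \<in> schwartz_space \<and> schwartz_norm M (\<lambda>y. \<phi> y - mollify \<delta> \<phi> y) \<le> \<delta> * K * schwartz_norm (Suc M) \<phi>)"
    using mollify_error [of M] by (elim exE conjE) (rule that)
  obtain L where L: "0 \<le> L" and L': "\<forall>\<delta>. 0 \<le> \<delta> \<longrightarrow> \<delta> \<le> 1 \<longrightarrow> (\<forall>\<phi>\<in>(schwartz_space :: ('a \<Rightarrow> complex) set).
    mollify \<delta> \<phi> \<in> schwartz_space \<and> schwartz_norm 0 (\<lambda>y. \<phi> y - mollify \<delta> \<phi> y) \<le> \<delta> * L * schwartz_norm (Suc 0) \<phi>)"
    using mollify_error [of 0] by (elim exE conjE) (rule that)
  have "\<exists>f\<in>schwartz_space. \<forall>\<phi>\<in>schwartz_space. cmod (u \<phi> - distr_of f \<phi>) \<le> \<epsilon> * schwartz_norm N \<phi>" if \<epsilon>: "0 < \<epsilon>" for \<epsilon>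
  proof -
    have e3: "0 < \<epsilon> / 3" using \<epsilon> by simp
    obtain \<delta> where \<delta>: "0 < \<delta>" "\<delta> \<le> 1" "C * K * \<delta> \<le> \<epsilon> / 3"
      using small_parameter [OF mult_nonneg_nonneg [OF C(1) K] e3] by blast
    obtain \<theta> :: "'a \<Rightarrow> complex" where \<theta>: "\<theta> \<in> schwartz_space"
      "\<And>\<phi> y. \<phi> \<in> schwartz_space \<Longrightarrow> mollify \<delta> \<phi> y = (\<integral>w. \<phi> w * \<theta> (y - w) \<partial>lborel)"
      using mollify_kernel [OF \<delta>(1)] by blast
    obtain \<eta> where \<eta>: "0 < \<eta>" "C * \<eta> \<le> \<epsilon> / 3" using small_parameter [OF C(1) e3] by blast
    obtain F :: "'a set" and v :: "'a \<Rightarrow> real" where F: "finite F"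
      and Fv: "\<And>\<phi>. \<phi> \<in> schwartz_space \<Longrightarrow> schwartz_norm M (\<lambda>y. (\<integral>w. \<phi> w * \<theta> (y - w) \<partial>lborel) - (\<Sum>k\<in>F. of_real (v k) * \<phi> k * \<theta> (y - k)))
        \<le> \<eta> * schwartz_norm N \<phi>"
      using convolution_riemann_sum [OF \<theta>(1) \<eta>(1), of M] unfolding N_def by blast
    \<comment> \<open>Applying \<open>u\<close> to the Riemann sum leaves a finite combination of
      the point values \<open>\<phi> k\<close> with these coefficients, samples of the regularized
      distribution times cell volumes.\<close>
    define c where "c k = of_real (v k) * u (\<lambda>y. \<theta> (y - k))" for k
    define A where "A = (\<Sum>k\<in>F. cmod (c k))"
    have A: "0 \<le> A" by (simp add: A_def sum_nonneg)
    \<comment> \<open>The width of the averages is chosen last, since it has to beat the total mass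
      \<open>A\<close> of the point values, which depends on the grid and on the first
      mollifier.\<close>
    obtain s where s: "0 < s" "s \<le> 1" "A * L * s \<le> \<epsilon> / 3"
      using small_parameter [OF mult_nonneg_nonneg [OF A L] e3] by blast
    obtain \<theta>' :: "'a \<Rightarrow> complex" where \<theta>': "\<theta>' \<in> schwartz_space" "\<And>x. \<theta>' (- x) = \<theta>' x"
      "\<And>\<phi> y. \<phi> \<in> schwartz_space \<Longrightarrow> mollify s \<phi> y = (\<integral>w. \<phi> w * \<theta>' (y - w) \<partial>lborel)"
      using mollify_kernel [OF s(1)] by blast
    \<comment> \<open>The finite combination of point masses, each smeared out by the narrow
      kernel.\<close>
    define f where "f w = (\<Sum>k\<in>F. c k * \<theta>' (w - k))" for w
    have tr: "(\<lambda>y. g (y - k)) \<in> schwartz_space" if "g \<in> schwartz_space" for k and g :: "'a \<Rightarrow> complex"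
      using schwartz_translate [OF that, of "- k"] by simp
    have f: "f \<in> schwartz_space" unfolding f_def [abs_def] by (intro schwartz_sum schwartz_cmult(1) tr \<theta>'(1))
    have "cmod (u \<phi> - distr_of f \<phi>) \<le> \<epsilon> * schwartz_norm N \<phi>" if \<phi>: "\<phi> \<in> schwartz_space" for \<phi>
    proof -
      let ?S = "schwartz_norm N \<phi>"
      let ?m = "mollify \<delta> \<phi>" and ?R = "\<lambda>y. \<Sum>k\<in>F. of_real (v k) * \<phi> k * \<theta> (y - k)"
      have S: "0 \<le> ?S" by (rule schwartz_norm_nonneg [OF \<phi>])
      have m: "?m \<in> schwartz_space" "schwartz_norm M (\<lambda>y. \<phi> y - ?m y) \<le> \<delta> * K * schwartz_norm (Suc M) \<phi>"
        using K' \<delta> \<phi> by auto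
      have R: "?R \<in> schwartz_space" by (intro schwartz_sum schwartz_cmult(1) tr \<theta>(1))
      have uR: "u ?R = (\<Sum>k\<in>F. c k * \<phi> k)"
      proof -
        have "u (\<lambda>y. of_real (v k) * \<phi> k * \<theta> (y - k)) = c k * \<phi> k" for k
          unfolding tempered_cmult [OF u tr [OF \<theta>(1)]] c_def by (simp only: mult_ac)
        moreover have "(\<lambda>y. of_real (v k) * \<phi> k * \<theta> (y - k)) \<in> schwartz_space" for k
          by (rule schwartz_cmult(1) [OF tr [OF \<theta>(1)]])
        ultimately show ?thesis by (simp only: tempered_sum [OF u])
      qed
      have "distr_of f \<phi> = (\<integral>w. (\<Sum>k\<in>F. c k * (\<phi> w * \<theta>' (k - w))) \<partial>lborel)"
      proof -
        have "f w * \<phi> w = (\<Sum>k\<in>F. c k * (\<phi> w * \<theta>' (k - w)))" for w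
          unfolding f_def sum_distrib_right
        proof (rule sum.cong [OF refl])
          fix k
          have "\<theta>' (w - k) = \<theta>' (k - w)" using \<theta>'(2) [of "k - w"] by simp
          then show "c k * \<theta>' (w - k) * \<phi> w = c k * (\<phi> w * \<theta>' (k - w))" by simp
        qed
        then show ?thesis using \<phi> by (simp add: distr_of_def)
      qed
      also have "\<dots> = (\<Sum>k\<in>F. c k * mollify s \<phi> k)"
        using convolution_integrable [OF \<theta>'(1) \<phi> lists.Nil] by (simp add: \<theta>'(3) [OF \<phi>])
      finally have eq: "u \<phi> - distr_of f \<phi> = u (\<lambda>y. \<phi> y - ?m y) + u (\<lambda>y. ?m y - ?R y) + (\<Sum>k\<in>F. c k * (\<phi> k - mollify s \<phi> k))"
        by (simp add: tempered_diff [OF u \<phi> m(1)] tempered_diff [OF u m(1) R] uR right_diff_distrib sum_subtractf)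
      have "cmod (u \<phi> - distr_of f \<phi>) \<le> cmod (u (\<lambda>y. \<phi> y - ?m y)) + cmod (u (\<lambda>y. ?m y - ?R y)) + cmod (\<Sum>k\<in>F. c k * (\<phi> k - mollify s \<phi> k))"
        unfolding eq by (rule order_trans [OF norm_triangle_ineq], rule add_right_mono, rule norm_triangle_ineq)
      also have "\<dots> \<le> \<epsilon> / 3 * ?S + \<epsilon> / 3 * ?S + \<epsilon> / 3 * ?S"
      proof (intro add_mono)
        have "cmod (u (\<lambda>y. \<phi> y - ?m y)) \<le> C * schwartz_norm M (\<lambda>y. \<phi> y - ?m y)" by (rule C(2) [OF schwartz_diff(1) [OF \<phi> m(1)]])
        also have "\<dots> \<le> C * (\<delta> * K * schwartz_norm (Suc M) \<phi>)" by (rule mult_left_mono [OF m(2) C(1)])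
        also have "\<dots> \<le> C * (\<delta> * K * ?S)"
          using C K \<delta> by (intro mult_left_mono schwartz_norm_mono \<phi>) (auto simp: N_def)
        also have "\<dots> \<le> \<epsilon> / 3 * ?S" using mult_right_mono [OF \<delta>(3) S] by (simp add: mult_ac)
        finally show "cmod (u (\<lambda>y. \<phi> y - ?m y)) \<le> \<epsilon> / 3 * ?S" .
        have "cmod (u (\<lambda>y. ?m y - ?R y)) \<le> C * schwartz_norm M (\<lambda>y. ?m y - ?R y)" by (rule C(2) [OF schwartz_diff(1) [OF m(1) R]])
        also have "\<dots> \<le> C * (\<eta> * ?S)" using Fv [OF \<phi>] by (intro mult_left_mono C(1)) (simp add: \<theta>(2) [OF \<phi>])
        also have "\<dots> \<le> \<epsilon> / 3 * ?S" using mult_right_mono [OF \<eta>(2) S] by (simp add: mult.assoc)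
        finally show "cmod (u (\<lambda>y. ?m y - ?R y)) \<le> \<epsilon> / 3 * ?S" .
        have pt: "cmod (\<phi> k - mollify s \<phi> k) \<le> s * L * ?S" for k
        proof -
          have ms: "mollify s \<phi> \<in> schwartz_space" "schwartz_norm 0 (\<lambda>y. \<phi> y - mollify s \<phi> y) \<le> s * L * schwartz_norm (Suc 0) \<phi>"
            using L' s \<phi> by auto
          have "cmod (\<phi> k - mollify s \<phi> k) \<le> schwartz_norm 0 (\<lambda>y. \<phi> y - mollify s \<phi> y)"
            using schwartz_norm_upper [OF schwartz_diff(1) [OF \<phi> ms(1)] lists.Nil, of 0 0 k] by simp
          also note ms(2)
          also have "s * L * schwartz_norm (Suc 0) \<phi> \<le> s * L * ?S"
            using L s by (intro mult_left_mono schwartz_norm_mono \<phi>) (auto simp: N_def)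
          finally show ?thesis .
        qed
        have "cmod (\<Sum>k\<in>F. c k * (\<phi> k - mollify s \<phi> k)) \<le> (\<Sum>k\<in>F. cmod (c k) * (s * L * ?S))"
          by (rule sum_norm_le) (simp add: norm_mult pt mult_left_mono)
        also have "\<dots> = A * L * s * ?S" unfolding A_def sum_distrib_right [symmetric] by (simp only: mult_ac)
        also have "\<dots> \<le> \<epsilon> / 3 * ?S" by (rule mult_right_mono [OF s(3) S])
        finally show "cmod (\<Sum>k\<in>F. c k * (\<phi> k - mollify s \<phi> k)) \<le> \<epsilon> / 3 * ?S" .
      qed
      also have "\<dots> = \<epsilon> * ?S" by simp
      finally show ?thesis .
    qed
    with f show ?thesis by blast
  qed
  then show ?thesis by blast
qed

lemma distr_of_dense:
  fixes u :: "('a::euclidean_space \<Rightarrow> complex) \<Rightarrow> complex"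
  assumes u: "u \<in> tempered" and B: "schwartz_bounded B" and r: "0 < r"
  shows "\<exists>f\<in>schwartz_space. \<forall>\<phi>\<in>B. cmod ((distr_of f - u) \<phi>) \<le> r"
proof -
  obtain M where M: "\<And>\<epsilon>. 0 < \<epsilon> \<Longrightarrow> \<exists>f\<in>schwartz_space. \<forall>\<phi>\<in>schwartz_space. cmod (u \<phi> - distr_of f \<phi>) \<le> \<epsilon> * schwartz_norm M \<phi>"
    using tempered_approximation [OF u] by blast
  obtain C where C: "\<And>\<phi>. \<phi> \<in> B \<Longrightarrow> schwartz_norm M \<phi> \<le> C" using schwartz_bounded_norm [OF B] by blast
  obtain d where d: "0 < d" "\<bar>C\<bar> * d \<le> r" using small_parameter [OF abs_ge_zero r] by blast
  obtain f where f: "f \<in> schwartz_space" "\<And>\<phi>. \<phi> \<in> schwartz_space \<Longrightarrow> cmod (u \<phi> - distr_of f \<phi>) \<le> d * schwartz_norm M \<phi>"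
    using M [OF d(1)] by blast
  have "cmod ((distr_of f - u) \<phi>) \<le> r" if \<phi>: "\<phi> \<in> B" for \<phi>
  proof -
    have "cmod ((distr_of f - u) \<phi>) \<le> d * schwartz_norm M \<phi>"
      using f(2) [of \<phi>] \<phi> B by (auto simp: schwartz_bounded_def norm_minus_commute)
    also have "\<dots> \<le> d * \<bar>C\<bar>" using C [OF \<phi>] d(1) by (intro mult_left_mono) auto
    also have "\<dots> \<le> r" using d(2) by (simp add: mult.commute)
    finally show ?thesis .
  qed
  with f(1) show ?thesis by blast
qed

lemma schwartz_bounded_Un: "schwartz_bounded A \<Longrightarrow> schwartz_bounded B \<Longrightarrow> schwartz_bounded (A \<union> B)"
  unfolding schwartz_bounded_def by (intro conjI) (blast, metis Un_iff order_trans nle_le)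

lemma schwartz_bounded_UN:
  "finite I \<Longrightarrow> (\<And>i. i \<in> I \<Longrightarrow> schwartz_bounded (B i)) \<Longrightarrow> schwartz_bounded (\<Union>i\<in>I. B i)"
proof (induction I rule: finite_induct)
  case (insert i I)
  then show ?case by (auto intro: schwartz_bounded_Un)
qed (simp add: schwartz_bounded_def)

text \<open>Finitely many bounded sets have a bounded union, so one approximant serves all the
  seminorms at once. The weak topology is included because singletons are bounded.\<close>

lemma distr_of_dense_seminorms:
  fixes u :: "('a::euclidean_space \<Rightarrow> complex) \<Rightarrow> complex"
  assumes u: "u \<in> tempered" and Q: "finite Q" and r: "0 < r"
    and B: "\<And>p. p \<in> Q \<Longrightarrow> \<exists>B. schwartz_bounded B \<and> B \<noteq> {} \<and> p = (\<lambda>u. SUP \<phi>\<in>B. cmod (u \<phi>))"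
  shows "\<exists>g\<in>distr_of ` schwartz_space \<inter> tempered. \<forall>p\<in>Q. p (g - u) < r"
proof -
  obtain B where B: "\<And>p. p \<in> Q \<Longrightarrow> schwartz_bounded (B p) \<and> B p \<noteq> {} \<and> p = (\<lambda>u. SUP \<phi>\<in>B p. cmod (u \<phi>))"
    using B by metis
  have "schwartz_bounded (\<Union>p\<in>Q. B p)" using Q B by (intro schwartz_bounded_UN) auto
  \<comment> \<open>A supremum only inherits a weak inequality; the bound \<open>r / 2\<close>
    leaves room for the strict one.\<close>
  moreover have "0 < r / 2" using r by simp
  ultimately obtain f where f: "f \<in> schwartz_space" "\<And>\<phi>. \<phi> \<in> (\<Union>p\<in>Q. B p) \<Longrightarrow> cmod ((distr_of f - u) \<phi>) \<le> r / 2"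
    using distr_of_dense [OF u] by blast
  have "p (distr_of f - u) < r" if p: "p \<in> Q" for p
  proof -
    have "(SUP \<phi>\<in>B p. cmod ((distr_of f - u) \<phi>)) \<le> r / 2"
      using B [OF p] f(2) p by (intro cSUP_least) blast+
    moreover have "p (distr_of f - u) = (SUP \<phi>\<in>B p. cmod ((distr_of f - u) \<phi>))"
      using B [OF p] by metis
    ultimately show ?thesis using r by linarith
  qed
  then show ?thesis using f(1) distr_of_tempered by blast
qed

lemma dense_strong: "tempered \<subseteq> strong_topology closure_of (distr_of ` schwartz_space)"
  unfolding strong_topology_def
proof (intro subsetI closure_of_seminorm_topologyI [OF pseudometric_strong] distr_of_dense_seminorms)
  fix p :: "(('a \<Rightarrow> complex) \<Rightarrow> complex) \<Rightarrow> real" and Q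
  assume "Q \<subseteq> {\<lambda>u. SUP \<phi>\<in>B. cmod (u \<phi>) | B. schwartz_bounded B \<and> B \<noteq> {}}" "p \<in> Q"
  then show "\<exists>B. schwartz_bounded B \<and> B \<noteq> {} \<and> p = (\<lambda>u. SUP \<phi>\<in>B. cmod (u \<phi>))" by blast
qed

lemma dense_weak: "tempered \<subseteq> weak_topology closure_of (distr_of ` schwartz_space)"
  unfolding weak_topology_def
proof (intro subsetI closure_of_seminorm_topologyI [OF pseudometric_weak] distr_of_dense_seminorms)
  fix p :: "(('a \<Rightarrow> complex) \<Rightarrow> complex) \<Rightarrow> real" and Q
  assume "Q \<subseteq> {\<lambda>u. cmod (u \<phi>) | \<phi>. \<phi> \<in> schwartz_space}" "p \<in> Q"
  then obtain \<phi> where \<phi>: "\<phi> \<in> schwartz_space" "p = (\<lambda>u. cmod (u \<phi>))" by blast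
  then show "\<exists>B. schwartz_bounded B \<and> B \<noteq> {} \<and> p = (\<lambda>u. SUP \<phi>\<in>B. cmod (u \<phi>))"
    using schwartz_bounded_singleton [OF \<phi>(1)] by (intro exI [of _ "{\<phi>}"]) simp
qed

theorem theorem3p1:
  fixes e :: "'d::finite \<Rightarrow> real^'d"
  assumes "ordered_basis e"
  shows "homeomorphic_map schwartz_topology (subtopology smooth_topology (smooth_Z e)) (zak e) \<and>
         (\<exists>!T. T \<in> extensional tempered \<and>
           homeomorphic_map weak_topology (subtopology weak_topology (tempered_Z e)) T \<and>
           (\<forall>f\<in>schwartz_space. T (distr_of f) = distr_of (zak e f))) \<and>
         (\<exists>!T. T \<in> extensional tempered \<and>
           homeomorphic_map strong_topology (subtopology strong_topology (tempered_Z e)) T \<and>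
           (\<forall>f\<in>schwartz_space. T (distr_of f) = distr_of (zak e f)))"
proof -
  interpret lattice_basis e by standard (rule assms)
  show ?thesis
    by (intro conjI homeomorphic_map_zak
        zak_extension [OF topspace_weak_topology topspace_weak_topology Hausdorff_weak_topology
          continuous_map_transpose_weak continuous_map_transpose_weak dense_weak]
        zak_extension [OF topspace_strong_topology topspace_strong_topology Hausdorff_strong_topology
          continuous_map_transpose_strong continuous_map_transpose_strong dense_strong])
qed

end
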